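(* Let $S$ be a finite quantum stop time and let $V$ be a strongly continuous isometric $p$-adapted cocycle. Then $$V_{S+t} = \widehat{V}_S\, \sigma_S(V_t) \qquad \text{for all } t \in \mathbb{R}_+.$$
   Context: Fock space. Fix a complex Hilbert space $\mathsf{k}$. Inner products are linear in the second variable. $B(H)$ denotes the bounded operators on a Hilbert space $H$. For a subinterval $A$ of $\mathbb{R}_+ = [0,\infty)$, $\mathcal{F}_A$ is the Boson (symmetric) Fock space over $L^2(A;\mathsf{k})$, with exponential vectors $\varepsilon(f)$, $f \in L^2(A;\mathsf{k})$, which are total and satisfy $\langle \varepsilon(f), \varepsilon(g)\rangle = \exp\langle f,g\rangle$. Write $\mathcal{F} = \mathcal{F}_{\mathbb{R}_+}$, $\mathcal{F}_{t)} = \mathcal{F}_{[0,t)}$, $\mathcal{F}_{[t} = \mathcal{F}_{[t,\infty)}$, with identity operators $I$, $I_{t)}$, $I_{[t}$ (so $\mathcal{F}_{0)} = \mathbb{C}$), and identify $\mathcal{F} \cong \mathcal{F}_{s)} \otimes \mathcal{F}_{[s}$ via $\varepsilon(f) \leftrightarrow \varepsilon(f|_{[0,s)}) \otimes \varepsilon(f|_{[s,\infty)})$. Stop times. A finite quantum stop time is a map $S$ from the Borel $\sigma$-algebra of $[0,\infty]$ to $B(\mathcal{F})$ such that: each $S(A)$ is an orthogonal projection; $A \mapsto \langle x, S(A) y\rangle$ is a complex measure for all $x,y \in \mathcal{F}$; $S([0,\infty]) = I$; $S([0,t]) \in B(\mathcal{F}_{t)}) \otimes I_{[t}$ for all $t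 \in (0,\infty)$; $S(\{0\}) = 0$; and $S(\{\infty\}) = 0$ (finiteness). For $t \in \mathbb{R}_+$, $S+t$ is the finite quantum stop time with $(S+t)([0,u]) = 0$ if $u \in [0,t)$ and $(S+t)([0,u]) = S([0,u-t])$ if $u \in [t,\infty]$. Let $\mathsf{h}$ be a complex Hilbert space; stop times are extended by ampliation to $\mathsf{h} \otimes \mathcal{F}$, i.e., $S(A)$ also denotes $I_{\mathsf{h}} \otimes S(A)$. CCR flow and its stopped version. For $t \in \mathbb{R}_+$, $\Gamma_t : \mathcal{F} \to \mathcal{F}$ is the isometry with $\Gamma_t\varepsilon(f) = \varepsilon(\theta_t f)$, where $(\theta_t f)(s) = f(s-t)$ if $s \ge t$ and $0$ if $s<t$; it is regarded as an isometric isomorphism of $\mathcal{F}$ onto $\mathcal{F}_{[t} \cong \varepsilon(0|_{[0,t)}) \otimes \mathcal{F}_{[t}$. Put $\sigma_t(X) = I_{t)} \otimes \Gamma_t X \Gamma_t^*$ for $X \in B(\mathcal{F})$ and $\sigma_\infty(X) := I$. For $X \in B(\mathcal{F})$, $\sigma_S(X)$ is the strong operator limit of $\sum_{j=1}^{n+1} \sigma_{\pi_j}(X) S((\pi_{j-1},\pi_j])$ over finite partitions $\pi = \{0 = \pi_0 < \cdots < \pi_{n+1} = \infty\}$ of $[0,\infty]$ ordered by refinement (it exists); $\sigma_S$ is a normal unital $*$-endomorphism of $B(\mathcal{F})$. Both $\sigma_t$ ($t \in \mathbb{R}_+$) and $\sigma_S$ are extended by ampliation to normal unital $*$-endomorphisms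 of $B(\mathsf{h} \otimes \mathcal{F})$ acting trivially on $B(\mathsf{h})$. Cocycles. Let $\mathcal{M} \subseteq B(\mathsf{h})$ be a von Neumann algebra and $\overline{\otimes}$ the ultraweak tensor product. Let $p \in B(\mathsf{k})$ be an orthogonal projection, acting pointwise on $L^2([t,\infty);\mathsf{k})$, and let $P_{[t} \in B(\mathcal{F}_{[t})$ be its second quantisation: $P_{[t}\varepsilon(f) = \varepsilon(pf)$. A family $V = (V_t)_{t \in \mathbb{R}_+} \subseteq \mathcal{M} \,\overline{\otimes}\, B(\mathcal{F})$ is a $p$-adapted process if $V_t = V_{t)} \otimes P_{[t}$ for all $t \in \mathbb{R}_+$, with $V_{t)} \in \mathcal{M} \,\overline{\otimes}\, B(\mathcal{F}_{t)})$; its identity-adapted projection is the process $\widehat{V}$ with $\widehat{V}_t := V_{t)} \otimes I_{[t}$. A $p$-adapted process $V$ is a cocycle if $V_{s+t} = \widehat{V}_s\, \sigma_s(V_t)$ for all $s,t \in \mathbb{R}_+$. It is isometric if $V_{t)}^* V_{t)} = I_{\mathsf{h}} \otimes I_{t)}$ for all $t \in \mathbb{R}_+$, and strongly continuous if $t \mapsto V_t$ is strongly continuous on $\mathbb{R}_+$. If $V$ is a strongly continuous isometric $p$-adapted cocycle then $\widehat{V}$ is a strongly continuous isometric identity-adapted (i.e., $I_{\mathsf{k}}$-adapted) cocycle. Stopped cocycles. For a strongly continuous isometric $p$-adapted cocycle $V$, a finite quantum stop time $S$ and $t \in (0,\infty)$, $V_{S,t}$ is the strong operator limit of $\sum_{j=1}^{n+1}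 V_{\pi_j} S((\pi_{j-1},\pi_j])$ over finite partitions $\pi = \{0 = \pi_0 < \cdots < \pi_{n+1} = t\}$ of $[0,t]$ ordered by refinement, and $V_S$ is the strong operator limit of $V_{S,t}$ as $t \to \infty$; these limits exist. $\widehat{V}_S$ is obtained by applying this to the cocycle $\widehat{V}$, and $V_{S+t}$ by applying it to the stop time $S+t$. *)

theory Defs
  imports "HOL-Analysis.Analysis"
begin

section \<open>Complex Hilbert spaces\<close>

text \<open>The inner product is linear in the second variable.  No separability is assumed.\<close>

class complex_hilbert = banach +
  fixes scaleC :: "complex \<Rightarrow> 'a \<Rightarrow> 'a" (infixr "*\<^sub>C" 75)
    and cinner :: "'a \<Rightarrow> 'a \<Rightarrow> complex"
  assumes scaleC_add_right: "c *\<^sub>C (x + y) = c *\<^sub>C x + c *\<^sub>C y"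
    and scaleC_add_left: "(c + d) *\<^sub>C x = c *\<^sub>C x + d *\<^sub>C x"
    and scaleC_scaleC: "c *\<^sub>C d *\<^sub>C x = (c * d) *\<^sub>C x"
    and scaleC_of_real: "complex_of_real r *\<^sub>C x = r *\<^sub>R x"
    and cinner_commute: "cinner x y = cnj (cinner y x)"
    and cinner_add_right: "cinner x (y + z) = cinner x y + cinner x z"
    and cinner_scaleC_right: "cinner x (c *\<^sub>C y) = c * cinner x y"
    and cinner_same: "cinner x x = complex_of_real ((norm x)\<^sup>2)"

global_interpretation complex_hilbert: vector_space
  "scaleC :: complex \<Rightarrow> 'a \<Rightarrow> 'a::complex_hilbert"
  defines cspan = complex_hilbert.span
proof
  show "(1::complex) *\<^sub>C x = x" for x :: 'a
    using scaleC_of_real[of 1 x] by simp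
qed (auto simp: scaleC_add_right scaleC_add_left scaleC_scaleC)

definition bounded_clinear :: "('a::complex_hilbert \<Rightarrow> 'b::complex_hilbert) \<Rightarrow> bool" where
  "bounded_clinear T \<longleftrightarrow> bounded_linear T \<and> (\<forall>c x. T (c *\<^sub>C x) = c *\<^sub>C T x)"

definition bops :: "('a::complex_hilbert \<Rightarrow> 'a) set" where
  "bops = {T. bounded_clinear T}"

text \<open>For a closed subspace \<open>K\<close>, an operator in \<open>B(K)\<close> is represented by its extension to the
  whole space which vanishes on the orthogonal complement of \<open>K\<close>; thus \<open>ident_on K\<close>, the
  identity operator of \<open>K\<close>, is represented by the orthogonal projection onto \<open>K\<close>.\<close>

definition bops_on :: "'a::complex_hilbert set \<Rightarrow> ('a \<Rightarrow> 'a) set" where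
  "bops_on K = {T \<in> bops. range T \<subseteq> K \<and> (\<forall>x. (\<forall>u\<in>K. cinner u x = 0) \<longrightarrow> T x = 0)}"

definition ident_on :: "'a::complex_hilbert set \<Rightarrow> 'a \<Rightarrow> 'a" where
  "ident_on K = (THE T. T \<in> bops_on K \<and> (\<forall>u\<in>K. T u = u))"

definition cadj :: "('a::complex_hilbert \<Rightarrow> 'b::complex_hilbert) \<Rightarrow> 'b \<Rightarrow> 'a" where
  "cadj T = (THE T'. \<forall>x y. cinner (T' x) y = cinner x (T y))"

definition orth_projection :: "('a::complex_hilbert \<Rightarrow> 'a) \<Rightarrow> bool" where
  "orth_projection T \<longleftrightarrow> T \<in> bops \<and> T \<circ> T = T \<and> cadj T = T"

text \<open>Limit of a net of operators in the strong operator topology.\<close>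

definition sot_Lim :: "'i filter \<Rightarrow> ('i \<Rightarrow> 'a \<Rightarrow> 'b::t2_space) \<Rightarrow> 'a \<Rightarrow> 'b" where
  "sot_Lim F T = (\<lambda>x. Lim F (\<lambda>i. T i x))"

section \<open>Von Neumann algebras and the ultraweak topology\<close>

definition commutant :: "('a::complex_hilbert \<Rightarrow> 'a) set \<Rightarrow> ('a \<Rightarrow> 'a) set" where
  "commutant M = {T \<in> bops. \<forall>A\<in>M. T \<circ> A = A \<circ> T}"

definition von_neumann_algebra :: "('a::complex_hilbert \<Rightarrow> 'a) set \<Rightarrow> bool" where
  "von_neumann_algebra M \<longleftrightarrow>
     M \<subseteq> bops \<and> (\<forall>A\<in>M. cadj A \<in> M) \<and> commutant (commutant M) = M"

text \<open>The ultraweakly continuous functionals on the bounded operators.\<close>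

definition normal_functionals :: "(('a::complex_hilbert \<Rightarrow> 'a) \<Rightarrow> complex) set" where
  "normal_functionals =
     {(\<lambda>T. \<Sum>n. cinner (x n) (T (y n))) | x y :: nat \<Rightarrow> 'a.
        summable (\<lambda>n. (norm (x n))\<^sup>2) \<and> summable (\<lambda>n. (norm (y n))\<^sup>2)}"

definition ultraweak_closure :: "('a::complex_hilbert \<Rightarrow> 'a) set \<Rightarrow> ('a \<Rightarrow> 'a) set" where
  "ultraweak_closure \<A> =
     {T \<in> bops. \<forall>\<Omega> e. finite \<Omega> \<and> \<Omega> \<subseteq> normal_functionals \<and> e > 0 \<longrightarrow>
        (\<exists>A\<in>\<A>. \<forall>\<omega>\<in>\<Omega>. cmod (\<omega> T - \<omega> A) < e)}"

text \<open>Normality is ultraweak continuity: normal functionals pull back to normal functionals.\<close>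

definition normal_unital_star_endo ::
  "(('a::complex_hilbert \<Rightarrow> 'a) \<Rightarrow> ('a \<Rightarrow> 'a)) \<Rightarrow> bool" where
  "normal_unital_star_endo \<Phi> \<longleftrightarrow>
     (\<forall>T\<in>bops. \<Phi> T \<in> bops) \<and>
     (\<forall>T\<in>bops. \<forall>U\<in>bops. \<Phi> (\<lambda>x. T x + U x) = (\<lambda>x. \<Phi> T x + \<Phi> U x)) \<and>
     (\<forall>c. \<forall>T\<in>bops. \<Phi> (\<lambda>x. c *\<^sub>C T x) = (\<lambda>x. c *\<^sub>C \<Phi> T x)) \<and>
     (\<forall>T\<in>bops. \<forall>U\<in>bops. \<Phi> (T \<circ> U) = \<Phi> T \<circ> \<Phi> U) \<and>
     (\<forall>T\<in>bops. \<Phi> (cadj T) = cadj (\<Phi> T)) \<and>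
     \<Phi> id = id \<and>
     (\<forall>\<omega>\<in>normal_functionals. \<exists>\<omega>'\<in>normal_functionals. \<forall>T\<in>bops. \<omega> (\<Phi> T) = \<omega>' T)"

section \<open>Hilbert space tensor products\<close>

text \<open>\<open>(H\<^sub>3, tn)\<close> is a Hilbert space tensor product of \<open>H\<^sub>1\<close> and \<open>H\<^sub>2\<close>, with simple
  tensors \<open>tn x u\<close>.  Bilinearity of \<open>tn\<close> follows from the formula for the inner product.\<close>

definition hilbert_tensor ::
  "('a::complex_hilbert \<Rightarrow> 'b::complex_hilbert \<Rightarrow> 'c::complex_hilbert) \<Rightarrow> bool" where
  "hilbert_tensor tn \<longleftrightarrow>
     (\<forall>x u y v. cinner (tn x u) (tn y v) = cinner x y * cinner u v) \<and>
     closure (cspan {tn x u | x u. True}) = UNIV"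

definition optensor ::
  "('a::complex_hilbert \<Rightarrow> 'b::complex_hilbert \<Rightarrow> 'c::complex_hilbert) \<Rightarrow>
   ('a \<Rightarrow> 'a) \<Rightarrow> ('b \<Rightarrow> 'b) \<Rightarrow> 'c \<Rightarrow> 'c" where
  "optensor tn A X = (THE T. T \<in> bops \<and> (\<forall>x u. T (tn x u) = tn (A x) (X u)))"

definition ultraweak_tensor ::
  "('a::complex_hilbert \<Rightarrow> 'b::complex_hilbert \<Rightarrow> 'c::complex_hilbert) \<Rightarrow>
   ('a \<Rightarrow> 'a) set \<Rightarrow> ('b \<Rightarrow> 'b) set \<Rightarrow> ('c \<Rightarrow> 'c) set" where
  "ultraweak_tensor tn M N = ultraweak_closure
     {(\<lambda>z. \<Sum>i<n. optensor tn (A i) (X i) z) | (n::nat) A X. \<forall>i<n. A i \<in> M \<and> X i \<in> N}"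

text \<open>The ampliation of \<open>\<phi>\<close>.  It is determined only on bounded operators, which is all that is
  used.\<close>

definition ampliation ::
  "('a::complex_hilbert \<Rightarrow> 'b::complex_hilbert \<Rightarrow> 'c::complex_hilbert) \<Rightarrow>
   (('b \<Rightarrow> 'b) \<Rightarrow> ('b \<Rightarrow> 'b)) \<Rightarrow> ('c \<Rightarrow> 'c) \<Rightarrow> ('c \<Rightarrow> 'c)" where
  "ampliation tn \<phi> = (SOME \<Phi>. normal_unital_star_endo \<Phi> \<and>
     (\<forall>A\<in>bops. \<forall>X\<in>bops. \<Phi> (optensor tn A X) = optensor tn A (\<phi> X)))"

section \<open>Boson Fock space\<close>

text \<open>Elements of \<open>L\<^sup>2(A;k)\<close> are represented by functions on the line vanishing off \<open>A\<close>.
  The library's Bochner integral needs a second countable codomain, so strong measurability (being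
  a pointwise limit of simple functions) is spelled out here.\<close>

definition L2 :: "real set \<Rightarrow> (real \<Rightarrow> 'k::complex_hilbert) set" where
  "L2 A = {f. (\<exists>s. (\<forall>i::nat. simple_function lborel (s i)) \<and> (\<forall>r. (\<lambda>i. s i r) \<longlonglongrightarrow> f r)) \<and>
              integrable lborel (\<lambda>r. (norm (f r))\<^sup>2) \<and> (\<forall>r. r \<notin> A \<longrightarrow> f r = 0)}"

definition L2_inner :: "(real \<Rightarrow> 'k::complex_hilbert) \<Rightarrow> (real \<Rightarrow> 'k) \<Rightarrow> complex" where
  "L2_inner f g = (LINT r|lborel. cinner (f r) (g r))"

definition restr :: "real set \<Rightarrow> (real \<Rightarrow> 'k::complex_hilbert) \<Rightarrow> real \<Rightarrow> 'k" where
  "restr A f = (\<lambda>r. if r \<in> A then f r else 0)"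

text \<open>\<open>ex f\<close> is the exponential vector of \<open>f\<close>.  The two properties below determine the Boson
  Fock space over \<open>L\<^sup>2([0,\<infinity>);k)\<close>, together with its exponential vectors, up to a unique
  isometric isomorphism.\<close>

definition boson_fock :: "((real \<Rightarrow> 'k::complex_hilbert) \<Rightarrow> 'f::complex_hilbert) \<Rightarrow> bool" where
  "boson_fock ex \<longleftrightarrow>
     (\<forall>f\<in>L2 {0..}. \<forall>g\<in>L2 {0..}. cinner (ex f) (ex g) = exp (L2_inner f g)) \<and>
     closure (cspan (ex ` L2 {0..})) = UNIV"

text \<open>The Fock space over \<open>L\<^sup>2(A;k)\<close>, realised as a closed subspace of the full Fock space
  by tensoring with the vacuum vector of the complementary factor.\<close>

definition fock_on ::
  "((real \<Rightarrow> 'k::complex_hilbert) \<Rightarrow> 'f::complex_hilbert) \<Rightarrow> real set \<Rightarrow> 'f set" where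
  "fock_on ex A = closure (cspan (ex ` L2 A))"

text \<open>The operator \<open>X \<otimes> Y\<close> on Fock space, for \<open>X\<close> an operator on the factor for \<open>[0,t)\<close> and
  \<open>Y\<close> one on the factor for \<open>[t,\<infinity>)\<close>, under the identification of \<open>ex f\<close> with
  \<open>ex (restr {0..<t} f) \<otimes> ex (restr {t..} f)\<close>.\<close>

definition fock_optensor ::
  "((real \<Rightarrow> 'k::complex_hilbert) \<Rightarrow> 'f::complex_hilbert) \<Rightarrow> real \<Rightarrow>
   ('f \<Rightarrow> 'f) \<Rightarrow> ('f \<Rightarrow> 'f) \<Rightarrow> 'f \<Rightarrow> 'f" where
  "fock_optensor ex t X Y = (THE T. T \<in> bops \<and>
     (\<forall>f\<in>L2 {0..}. \<forall>g\<in>L2 {0..}. cinner (ex f) (T (ex g)) =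
        cinner (ex (restr {0..<t} f)) (X (ex (restr {0..<t} g))) *
        cinner (ex (restr {t..} f)) (Y (ex (restr {t..} g)))))"

text \<open>The same with the initial space \<open>h\<close> included in the first factor.\<close>

definition init_fock_optensor ::
  "('h::complex_hilbert \<Rightarrow> 'f::complex_hilbert \<Rightarrow> 'g::complex_hilbert) \<Rightarrow>
   ((real \<Rightarrow> 'k::complex_hilbert) \<Rightarrow> 'f) \<Rightarrow> real \<Rightarrow>
   ('g \<Rightarrow> 'g) \<Rightarrow> ('f \<Rightarrow> 'f) \<Rightarrow> 'g \<Rightarrow> 'g" where
  "init_fock_optensor tn ex t W Y = (THE T. T \<in> bops \<and>
     (\<forall>x y. \<forall>f\<in>L2 {0..}. \<forall>g\<in>L2 {0..}. cinner (tn x (ex f)) (T (tn y (ex g))) =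
        cinner (tn x (ex (restr {0..<t} f))) (W (tn y (ex (restr {0..<t} g)))) *
        cinner (ex (restr {t..} f)) (Y (ex (restr {t..} g)))))"

definition init_fock_before ::
  "('h::complex_hilbert \<Rightarrow> 'f::complex_hilbert \<Rightarrow> 'g::complex_hilbert) \<Rightarrow>
   ((real \<Rightarrow> 'k::complex_hilbert) \<Rightarrow> 'f) \<Rightarrow> real \<Rightarrow> 'g set" where
  "init_fock_before tn ex t = closure (cspan {tn x u | x u. u \<in> fock_on ex {0..<t}})"

text \<open>The second quantisation of the projection \<open>p\<close> on the Fock space over \<open>[t,\<infinity>)\<close>.\<close>

definition second_quant ::
  "((real \<Rightarrow> 'k::complex_hilbert) \<Rightarrow> 'f::complex_hilbert) \<Rightarrow> ('k \<Rightarrow> 'k) \<Rightarrow> real \<Rightarrow> 'f \<Rightarrow> 'f" where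
  "second_quant ex p t = (THE T. T \<in> bops_on (fock_on ex {t..}) \<and>
     (\<forall>f\<in>L2 {t..}. T (ex f) = ex (p \<circ> f)))"

section \<open>The CCR flow\<close>

definition right_shift :: "real \<Rightarrow> (real \<Rightarrow> 'k::complex_hilbert) \<Rightarrow> real \<Rightarrow> 'k" where
  "right_shift t f = (\<lambda>s. if s \<ge> t then f (s - t) else 0)"

definition fock_shift ::
  "((real \<Rightarrow> 'k::complex_hilbert) \<Rightarrow> 'f::complex_hilbert) \<Rightarrow> real \<Rightarrow> 'f \<Rightarrow> 'f" where
  "fock_shift ex t = (THE T. T \<in> bops \<and> (\<forall>f\<in>L2 {0..}. T (ex f) = ex (right_shift t f)))"

definition ccr_flow ::
  "((real \<Rightarrow> 'k::complex_hilbert) \<Rightarrow> 'f::complex_hilbert) \<Rightarrow> real \<Rightarrow> ('f \<Rightarrow> 'f) \<Rightarrow> 'f \<Rightarrow> 'f" where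
  "ccr_flow ex t X = fock_optensor ex t (ident_on (fock_on ex {0..<t}))
     (fock_shift ex t \<circ> X \<circ> cadj (fock_shift ex t))"

section \<open>Quantum stop times\<close>

text \<open>The type \<open>ennreal\<close> is the extended half-line \<open>[0,\<infinity>]\<close>; the values of a stop time on sets which
  are not Borel are irrelevant.\<close>

definition finite_quantum_stop_time ::
  "((real \<Rightarrow> 'k::complex_hilbert) \<Rightarrow> 'f::complex_hilbert) \<Rightarrow>
   (ennreal set \<Rightarrow> 'f \<Rightarrow> 'f) \<Rightarrow> bool" where
  "finite_quantum_stop_time ex S \<longleftrightarrow>
     (\<forall>A\<in>sets borel. orth_projection (S A)) \<and>
     (\<forall>x y. \<forall>A :: nat \<Rightarrow> ennreal set. range A \<subseteq> sets borel \<and> disjoint_family A \<longrightarrow>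
        (\<lambda>n. cinner x (S (A n) y)) sums cinner x (S (\<Union>n. A n) y)) \<and>
     S UNIV = id \<and>
     (\<forall>t>0. \<exists>X\<in>bops_on (fock_on ex {0..<t}).
        S {..ennreal t} = fock_optensor ex t X (ident_on (fock_on ex {t..}))) \<and>
     S {0} = (\<lambda>_. 0) \<and>
     S {\<infinity>} = (\<lambda>_. 0)"

text \<open>The stop time \<open>S + t\<close>; it is determined on Borel sets by its values on initial intervals.\<close>

definition stop_time_plus ::
  "((real \<Rightarrow> 'k::complex_hilbert) \<Rightarrow> 'f::complex_hilbert) \<Rightarrow>
   (ennreal set \<Rightarrow> 'f \<Rightarrow> 'f) \<Rightarrow> real \<Rightarrow> ennreal set \<Rightarrow> 'f \<Rightarrow> 'f" where
  "stop_time_plus ex S t = (SOME S'. finite_quantum_stop_time ex S' \<and>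
     (\<forall>u<ennreal t. S' {..u} = (\<lambda>_. 0)) \<and>
     (\<forall>u\<ge>ennreal t. S' {..u} = S {..u - ennreal t}))"

text \<open>A partition \<open>0 = \<pi>\<^sub>0 < \<dots> < \<pi>\<^sub>n\<^sub>+\<^sub>1 = b\<close> is represented by the finite set \<open>Q\<close> of its
  interior points, so that refinement is inclusion; the summand for \<open>q = \<pi>\<^sub>j\<close> involves the
  interval from \<open>\<pi>\<^sub>j\<^sub>-\<^sub>1 = Max {r \<in> insert 0 Q. r < q}\<close> to \<open>q\<close>.\<close>

definition stop_sum ::
  "(ennreal \<Rightarrow> 'a \<Rightarrow> 'a::comm_monoid_add) \<Rightarrow> (ennreal set \<Rightarrow> 'a \<Rightarrow> 'a) \<Rightarrow> ennreal \<Rightarrow>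
   ennreal set \<Rightarrow> 'a \<Rightarrow> 'a" where
  "stop_sum Z S b Q =
     (\<lambda>x. \<Sum>q\<in>insert b Q. Z q (S {Max {r \<in> insert 0 Q. r < q}<..q} x))"

definition stop_limit ::
  "(ennreal \<Rightarrow> 'a \<Rightarrow> 'a::complex_hilbert) \<Rightarrow> (ennreal set \<Rightarrow> 'a \<Rightarrow> 'a) \<Rightarrow> ennreal \<Rightarrow> 'a \<Rightarrow> 'a" where
  "stop_limit Z S b = sot_Lim (finite_subsets_at_top {0<..<b}) (stop_sum Z S b)"

definition stopped_ccr_flow ::
  "((real \<Rightarrow> 'k::complex_hilbert) \<Rightarrow> 'f::complex_hilbert) \<Rightarrow>
   (ennreal set \<Rightarrow> 'f \<Rightarrow> 'f) \<Rightarrow> ('f \<Rightarrow> 'f) \<Rightarrow> 'f \<Rightarrow> 'f" where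
  "stopped_ccr_flow ex S X =
     stop_limit (\<lambda>q. if q = \<infinity> then id else ccr_flow ex (enn2real q) X) S \<infinity>"

section \<open>Cocycles\<close>

text \<open>Processes are families indexed by \<open>[0,\<infinity>)\<close>; their values at negative times are irrelevant.\<close>

definition adapted_process ::
  "('h::complex_hilbert \<Rightarrow> 'f::complex_hilbert \<Rightarrow> 'g::complex_hilbert) \<Rightarrow>
   ((real \<Rightarrow> 'k::complex_hilbert) \<Rightarrow> 'f) \<Rightarrow> ('h \<Rightarrow> 'h) set \<Rightarrow> ('k \<Rightarrow> 'k) \<Rightarrow>
   (real \<Rightarrow> 'g \<Rightarrow> 'g) \<Rightarrow> bool" where
  "adapted_process tn ex M p V \<longleftrightarrow> (\<forall>t\<ge>0. V t \<in> ultraweak_tensor tn M bops \<and>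
     (\<exists>W\<in>ultraweak_tensor tn M (bops_on (fock_on ex {0..<t})).
        V t = init_fock_optensor tn ex t W (second_quant ex p t)))"

text \<open>The operator on the tensor product of \<open>h\<close> with the Fock space over \<open>[0,t)\<close> from which a
  \<open>p\<close>-adapted process at time \<open>t\<close> is built.\<close>

definition before_part ::
  "('h::complex_hilbert \<Rightarrow> 'f::complex_hilbert \<Rightarrow> 'g::complex_hilbert) \<Rightarrow>
   ((real \<Rightarrow> 'k::complex_hilbert) \<Rightarrow> 'f) \<Rightarrow> ('k \<Rightarrow> 'k) \<Rightarrow> (real \<Rightarrow> 'g \<Rightarrow> 'g) \<Rightarrow> real \<Rightarrow> 'g \<Rightarrow> 'g" where
  "before_part tn ex p V t = (THE W. W \<in> bops_on (init_fock_before tn ex t) \<and>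
     V t = init_fock_optensor tn ex t W (second_quant ex p t))"

definition identity_adapted ::
  "('h::complex_hilbert \<Rightarrow> 'f::complex_hilbert \<Rightarrow> 'g::complex_hilbert) \<Rightarrow>
   ((real \<Rightarrow> 'k::complex_hilbert) \<Rightarrow> 'f) \<Rightarrow> ('k \<Rightarrow> 'k) \<Rightarrow> (real \<Rightarrow> 'g \<Rightarrow> 'g) \<Rightarrow> real \<Rightarrow> 'g \<Rightarrow> 'g" where
  "identity_adapted tn ex p V t =
     init_fock_optensor tn ex t (before_part tn ex p V t) (ident_on (fock_on ex {t..}))"

definition adapted_cocycle ::
  "('h::complex_hilbert \<Rightarrow> 'f::complex_hilbert \<Rightarrow> 'g::complex_hilbert) \<Rightarrow>
   ((real \<Rightarrow> 'k::complex_hilbert) \<Rightarrow> 'f) \<Rightarrow> ('h \<Rightarrow> 'h) set \<Rightarrow> ('k \<Rightarrow> 'k) \<Rightarrow>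
   (real \<Rightarrow> 'g \<Rightarrow> 'g) \<Rightarrow> bool" where
  "adapted_cocycle tn ex M p V \<longleftrightarrow> adapted_process tn ex M p V \<and>
     (\<forall>s\<ge>0. \<forall>t\<ge>0. V (s + t) =
        identity_adapted tn ex p V s \<circ> ampliation tn (ccr_flow ex s) (V t))"

definition isometric_process ::
  "('h::complex_hilbert \<Rightarrow> 'f::complex_hilbert \<Rightarrow> 'g::complex_hilbert) \<Rightarrow>
   ((real \<Rightarrow> 'k::complex_hilbert) \<Rightarrow> 'f) \<Rightarrow> ('k \<Rightarrow> 'k) \<Rightarrow> (real \<Rightarrow> 'g \<Rightarrow> 'g) \<Rightarrow> bool" where
  "isometric_process tn ex p V \<longleftrightarrow> (\<forall>t\<ge>0.
     cadj (before_part tn ex p V t) \<circ> before_part tn ex p V t =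
     optensor tn id (ident_on (fock_on ex {0..<t})))"

definition strongly_continuous_process :: "(real \<Rightarrow> 'g \<Rightarrow> 'g::complex_hilbert) \<Rightarrow> bool" where
  "strongly_continuous_process V \<longleftrightarrow> (\<forall>x. continuous_on {0..} (\<lambda>t. V t x))"

definition stopped_upto ::
  "('h::complex_hilbert \<Rightarrow> 'f::complex_hilbert \<Rightarrow> 'g::complex_hilbert) \<Rightarrow>
   (real \<Rightarrow> 'g \<Rightarrow> 'g) \<Rightarrow> (ennreal set \<Rightarrow> 'f \<Rightarrow> 'f) \<Rightarrow> real \<Rightarrow> 'g \<Rightarrow> 'g" where
  "stopped_upto tn V S t =
     stop_limit (\<lambda>q. V (enn2real q)) (\<lambda>A. optensor tn id (S A)) (ennreal t)"

definition stopped_process ::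
  "('h::complex_hilbert \<Rightarrow> 'f::complex_hilbert \<Rightarrow> 'g::complex_hilbert) \<Rightarrow>
   (real \<Rightarrow> 'g \<Rightarrow> 'g) \<Rightarrow> (ennreal set \<Rightarrow> 'f \<Rightarrow> 'f) \<Rightarrow> 'g \<Rightarrow> 'g" where
  "stopped_process tn V S = sot_Lim at_top (stopped_upto tn V S)"

end

theory Submission
  imports Defs
begin

text \<open>For \<open>f \<in> L2 {0..}\<close> let \<open>j t f\<close> be the operator \<open>u \<mapsto> \<epsilon>(f|[0,t)) \<otimes> \<Gamma>\<^sub>t u\<close>.  The operators
  \<open>(j t f)\<^sup>* (j t g)\<close> are scalars and the ranges of the \<open>j t f\<close> are jointly total, so \<open>\<sigma>\<^sub>t(X)\<close> is the only
  bounded operator with \<open>\<sigma>\<^sub>t(X) (j t f) = (j t f) X\<close> for all \<open>f\<close>.  The limits \<open>jS g b\<close> of the sums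
  \<open>\<Sum> S((q',q]) (j q g)\<close> over partitions of \<open>[0,b]\<close> have the same two properties, because \<open>S((q',q])\<close>
  belongs to \<open>B(F_{q)}) \<otimes> I\<close> and because \<open>j q g\<close> maps \<open>\<epsilon>(g(\<cdot> + q))\<close> to \<open>\<epsilon>(g)\<close>.  As \<open>\<sigma>\<^sub>q(X)\<close> commutes
  with \<open>S((q',q])\<close>, the partition sums for \<open>\<sigma>\<^sub>S(X)\<close> are bounded and converge on the ranges of the
  \<open>jS g b\<close>, and \<open>\<sigma>\<^sub>S(X) (jS g b) = (jS g b) X\<close> determines \<open>\<sigma>\<^sub>S\<close> as well as its ampliation.

  For a partition of \<open>[0,b+t]\<close> containing \<open>t\<close>, the cocycle identity turns the partition sum of
  \<open>V_{S+t}\<close> into the partition sum of the stopped identity-adapted cocycle, applied to the partition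
  sum of \<open>\<sigma>\<^sub>S(V\<^sub>t)\<close>: the cells are mutually orthogonal, so that no cross terms occur.  The outer sums
  are contractions, hence the limits may be taken in both factors simultaneously.\<close>

section \<open>Complex Hilbert spaces\<close>

text \<open>Ampliations are chosen by \<open>SOME\<close>, so existence and uniqueness are both at
  stake. A normal functional is determined by rank-one operators, and those between product vectors
  are elementary tensors; this gives uniqueness on bounded operators. Existence needs the
  intertwined endomorphism to be normal, which follows from Gram factorisations with explicit bounds
  of trace-norm type. The projection \<open>p\<close> is an obstacle, because \<open>V t\<close>
  does not act as the identity on the future. It equals \<open>Vh t\<close> composed with a flow
  image of one operator \<open>P0\<close> that fixes the vacuum. Hence \<open>V\<close> and
  \<open>Vh\<close> agree on vectors with vacuum future, and adapted operators are determined there;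
  the cocycle law and strong continuity pass from \<open>V\<close> to \<open>Vh\<close> in this way.
  Partition sums are compared on fixed vectors. Orthogonality of the cells turns the error into a
  sum weighted by the additive content \<open>(norm (S A (ex g)))\<^sup>2\<close>, which requires
  moduli of continuity uniform in the position of the cell. For the embeddings these come from
  absolute continuity of the integral, for the cocycle from total boundedness of the orbit of
  \<open>ex g\<close> under left shifts.\<close>

lemma cinner_zero_right [simp]: "cinner x 0 = 0"
  using cinner_add_right[of x 0 0] by simp

lemma cinner_zero_left [simp]: "cinner 0 x = 0"
  by (subst cinner_commute) simp

lemma cinner_add_left: "cinner (x + y) z = cinner x z + cinner y z"
  by (subst cinner_commute, subst (2) cinner_commute, subst (3) cinner_commute)
    (simp add: cinner_add_right)

lemma cinner_scaleC_left: "cinner (c *\<^sub>C x) y = cnj c * cinner x y"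
  by (subst cinner_commute, subst (2) cinner_commute) (simp add: cinner_scaleC_right)

lemma cinner_minus_right: "cinner x (- y) = - cinner x y"
  using cinner_add_right[of x y "- y"] by (simp add: eq_neg_iff_add_eq_0 add.commute)

lemma cinner_minus_left: "cinner (- x) y = - cinner x y"
  using cinner_add_left[of x "- x" y] by (simp add: eq_neg_iff_add_eq_0 add.commute)

lemma cinner_diff_right: "cinner x (y - z) = cinner x y - cinner x z"
  using cinner_add_right[of x y "- z"] by (simp add: cinner_minus_right)

lemma cinner_diff_left: "cinner (x - y) z = cinner x z - cinner y z"
  using cinner_add_left[of x "- y" z] by (simp add: cinner_minus_left)

lemma cinner_sum_right: "cinner x (\<Sum>i\<in>A. f i) = (\<Sum>i\<in>A. cinner x (f i))"
  by (induction A rule: infinite_finite_induct) (auto simp: cinner_add_right)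

lemma cinner_sum_left: "cinner (\<Sum>i\<in>A. f i) x = (\<Sum>i\<in>A. cinner (f i) x)"
  by (induction A rule: infinite_finite_induct) (auto simp: cinner_add_left)

lemma scaleC_diff_right: "c *\<^sub>C (x - y) = c *\<^sub>C x - c *\<^sub>C (y::'a::complex_hilbert)"
  using scaleC_add_right[of c x "- y"] by simp

lemma scaleC_sum_right: "c *\<^sub>C (\<Sum>i\<in>A. f i) = (\<Sum>i\<in>A. c *\<^sub>C (f i :: 'a::complex_hilbert))"
  by (induction A rule: infinite_finite_induct) (auto simp: scaleC_add_right)

lemma norm_sq_cinner: "(norm x)\<^sup>2 = Re (cinner x x)"
  by (simp add: cinner_same)

lemma cinner_self_eq_0_iff [simp]: "cinner x x = 0 \<longleftrightarrow> x = 0"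
  by (simp add: cinner_same)

lemma norm_scaleC [simp]: "norm (c *\<^sub>C x) = cmod c * norm (x::'a::complex_hilbert)"
proof -
  have "complex_of_real ((norm (c *\<^sub>C x))\<^sup>2) = complex_of_real ((cmod c * norm x)\<^sup>2)"
    unfolding power_mult_distrib of_real_mult complex_norm_square cinner_same[symmetric]
    by (simp add: cinner_scaleC_left cinner_scaleC_right)
  then have "(norm (c *\<^sub>C x))\<^sup>2 = (cmod c * norm x)\<^sup>2"
    by (metis of_real_eq_iff)
  then show ?thesis by (simp add: power2_eq_iff_nonneg)
qed

lemma norm_diff_sq: "(norm (x - y))\<^sup>2 = (norm x)\<^sup>2 + (norm y)\<^sup>2 - 2 * Re (cinner x (y::'a::complex_hilbert))"
proof -
  have "Re (cinner y x) = Re (cinner x y)" by (subst cinner_commute) simp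
  then show ?thesis
    by (simp add: norm_sq_cinner cinner_diff_left cinner_diff_right)
qed

lemma norm_add_sq: "(norm (x + y))\<^sup>2 = (norm x)\<^sup>2 + (norm y)\<^sup>2 + 2 * Re (cinner x (y::'a::complex_hilbert))"
  using norm_diff_sq[of x "- y"] by (simp add: cinner_minus_right)

lemma parallelogram: "(norm (x + y))\<^sup>2 + (norm (x - y))\<^sup>2 = 2 * (norm x)\<^sup>2 + 2 * (norm (y::'a::complex_hilbert))\<^sup>2"
  by (simp add: norm_add_sq norm_diff_sq)

lemma cinner_Cauchy_Schwarz: "cmod (cinner x y) \<le> norm x * norm (y::'a::complex_hilbert)"
proof (cases "y = 0")
  case False
  define c where "c = cinner y x / complex_of_real ((norm y)\<^sup>2)"
  have "cinner y (x - c *\<^sub>C y) = 0"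
    using False by (simp add: cinner_diff_right cinner_scaleC_right c_def cinner_same)
  then have "cinner (c *\<^sub>C y) (x - c *\<^sub>C y) = 0" by (simp add: cinner_scaleC_left)
  then have "(norm (c *\<^sub>C y + (x - c *\<^sub>C y)))\<^sup>2 = (norm (c *\<^sub>C y))\<^sup>2 + (norm (x - c *\<^sub>C y))\<^sup>2"
    by (simp only: norm_add_sq) simp
  then have "(norm (c *\<^sub>C y))\<^sup>2 \<le> (norm x)\<^sup>2" by simp
  then have "cmod c * norm y \<le> norm x" by (simp add: power2_le_iff_abs_le)
  moreover have "cmod c = cmod (cinner y x) / (norm y)\<^sup>2" by (simp add: c_def norm_divide norm_power)
  ultimately have "cmod (cinner y x) \<le> norm x * norm y"
    using False by (simp add: field_simps power2_eq_square)
  moreover have "cmod (cinner x y) = cmod (cinner y x)" by (subst cinner_commute) simp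
  ultimately show ?thesis by simp
qed simp

lemma bounded_bilinear_cinner: "bounded_bilinear (cinner :: 'a::complex_hilbert \<Rightarrow> 'a \<Rightarrow> complex)"
proof
  fix r and x y :: 'a
  show "cinner (r *\<^sub>R x) y = r *\<^sub>R cinner x y"
    by (simp add: scaleC_of_real[symmetric] cinner_scaleC_left scaleR_conv_of_real)
  show "cinner x (r *\<^sub>R y) = r *\<^sub>R cinner x y"
    by (simp add: scaleC_of_real[symmetric] cinner_scaleC_right scaleR_conv_of_real)
next
  show "\<exists>K. \<forall>x y :: 'a. cmod (cinner x y) \<le> norm x * norm y * K"
    by (rule exI[of _ 1]) (simp add: cinner_Cauchy_Schwarz)
qed (auto simp: cinner_add_left cinner_add_right)

lemma bounded_bilinear_scaleC: "bounded_bilinear (scaleC :: complex \<Rightarrow> 'a::complex_hilbert \<Rightarrow> 'a)"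
proof
  fix r c and x :: 'a
  show "(r *\<^sub>R c) *\<^sub>C x = r *\<^sub>R c *\<^sub>C x"
    by (simp add: scaleC_of_real[symmetric] scaleC_scaleC scaleR_conv_of_real)
  show "c *\<^sub>C r *\<^sub>R x = r *\<^sub>R c *\<^sub>C x"
    by (simp add: scaleC_of_real[symmetric] scaleC_scaleC mult.commute)
next
  show "\<exists>K. \<forall>c. \<forall>x :: 'a. norm (c *\<^sub>C x) \<le> cmod c * norm x * K"
    by (rule exI[of _ 1]) simp
qed (auto simp: scaleC_add_left scaleC_add_right)

lemmas tendsto_cinner [tendsto_intros] = bounded_bilinear.tendsto[OF bounded_bilinear_cinner]
lemmas tendsto_scaleC [tendsto_intros] = bounded_bilinear.tendsto[OF bounded_bilinear_scaleC]
lemmas sums_cinner_right = bounded_linear.sums[OF bounded_bilinear.bounded_linear_right[OF bounded_bilinear_cinner]]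

lemma norm_sum_sq_orthogonal:
  fixes v :: "'i \<Rightarrow> 'a::complex_hilbert"
  assumes "finite A" "\<And>i j. i \<in> A \<Longrightarrow> j \<in> A \<Longrightarrow> i \<noteq> j \<Longrightarrow> cinner (v i) (v j) = 0"
  shows "(norm (\<Sum>i\<in>A. v i))\<^sup>2 = (\<Sum>i\<in>A. (norm (v i))\<^sup>2)"
  using assms
proof (induction A rule: finite_induct)
  case (insert a A)
  have "cinner (v a) (\<Sum>i\<in>A. v i) = 0"
    using insert.hyps insert.prems by (auto simp: cinner_sum_right intro!: sum.neutral)
  then show ?case using insert by (simp add: norm_add_sq)
qed simp

lemma eq_0_if_cinner_eq_0: "(\<And>y. cinner y x = 0) \<Longrightarrow> x = (0::'a::complex_hilbert)"
  using cinner_self_eq_0_iff by blast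

lemma eq_if_cinner_eq: "(\<And>z. cinner z x = cinner z y) \<Longrightarrow> x = (y::'a::complex_hilbert)"
  using eq_0_if_cinner_eq_0[of "x - y"] by (simp add: cinner_diff_right)

lemma eq_if_cinner_eq_left: "(\<And>z. cinner x z = cinner y z) \<Longrightarrow> x = (y::'a::complex_hilbert)"
  by (rule eq_if_cinner_eq) (metis cinner_commute)

subsection \<open>Closed subspaces\<close>

abbreviation csubspace :: "'a::complex_hilbert set \<Rightarrow> bool" where
  "csubspace \<equiv> complex_hilbert.subspace"

lemma csubspace_cspan [simp]: "csubspace (cspan B)"
  by (rule complex_hilbert.subspace_span)

lemma csubspace_closure [simp]:
  assumes "csubspace K" shows "csubspace (closure K)"
proof (rule complex_hilbert.subspaceI)
  show "0 \<in> closure K" using assms closure_subset complex_hilbert.subspace_0 by blast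
next
  fix x y assume "x \<in> closure K" "y \<in> closure K"
  then obtain u v where "\<And>n. u n \<in> K" "u \<longlonglongrightarrow> x" "\<And>n. v n \<in> K" "v \<longlonglongrightarrow> y"
    unfolding closure_sequential by blast
  then show "x + y \<in> closure K"
    unfolding closure_sequential
    by (intro exI[of _ "\<lambda>n. u n + v n"])
      (auto intro: tendsto_add complex_hilbert.subspace_add[OF assms])
next
  fix c x assume "x \<in> closure K"
  then obtain u where "\<And>n. u n \<in> K" "u \<longlonglongrightarrow> x"
    unfolding closure_sequential by blast
  then show "c *\<^sub>C x \<in> closure K"
    unfolding closure_sequential
    by (intro exI[of _ "\<lambda>n. c *\<^sub>C u n"])
      (auto intro!: tendsto_intros complex_hilbert.subspace_scale[OF assms])
qed

lemma csubspace_orthogonal: "csubspace {x. cinner y x = (0::complex)}"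
  by (rule complex_hilbert.subspaceI) (auto simp: cinner_add_right cinner_scaleC_right)

lemma closed_orthogonal: "closed {x. cinner y x = (0::complex)}"
  by (intro closed_Collect_eq continuous_intros
      bounded_linear.continuous_on[OF bounded_bilinear.bounded_linear_right[OF bounded_bilinear_cinner]])

lemma closure_cspan_induct [consumes 1, case_names base closed subspace]:
  assumes "x \<in> closure (cspan B)" "\<And>b. b \<in> B \<Longrightarrow> P b" "closed {x. P x}" "csubspace {x. P x}"
  shows "P x"
proof -
  have "cspan B \<subseteq> {x. P x}"
    using assms(2,4) by (intro complex_hilbert.span_minimal) auto
  then have "closure (cspan B) \<subseteq> {x. P x}" by (intro closure_minimal assms(3))
  then show ?thesis using assms(1) by blast
qed

lemma cinner_closure_cspan_eq_0:
  assumes "x \<in> closure (cspan B)" "\<And>b. b \<in> B \<Longrightarrow> cinner y b = 0"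
  shows "cinner y x = 0"
  using assms(1)
  by (rule closure_cspan_induct) (auto simp: assms(2) closed_orthogonal csubspace_orthogonal)

lemma eq_0_if_orthogonal_total:
  assumes "closure (cspan B) = UNIV" "\<And>b. b \<in> B \<Longrightarrow> cinner b x = 0"
  shows "x = 0"
proof -
  have "cinner x x = 0"
    by (rule cinner_closure_cspan_eq_0[of x B])
      (use assms in \<open>auto, metis cinner_commute complex_cnj_zero\<close>)
  then show ?thesis by simp
qed

lemma eq_if_cinner_eq_total:
  assumes "closure (cspan B) = UNIV" "\<And>b. b \<in> B \<Longrightarrow> cinner b x = cinner b y"
  shows "x = y"
  using eq_0_if_orthogonal_total[of B "x - y"] assms by (simp add: cinner_diff_right)

text \<open>A minimising sequence for the distance is Cauchy: midpoints stay in \<open>K\<close>, so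
  the parallelogram law bounds the distance between two members by how far they are from being
  minimal. Completeness of the space and closedness of \<open>K\<close> supply the limit.\<close>

lemma closest_point_exists:
  fixes K :: "'a::complex_hilbert set"
  assumes K: "closed K" "csubspace K"
  shows "\<exists>y\<in>K. \<forall>u\<in>K. norm (x - y) \<le> norm (x - u)"
proof -
  define d where "d = (INF u\<in>K. norm (x - u))"
  have K0: "0 \<in> K" using K complex_hilbert.subspace_0 by blast
  have bdd: "bdd_below ((\<lambda>u. norm (x - u)) ` K)" by (rule bdd_belowI[of _ 0]) auto
  have dle: "d \<le> norm (x - u)" if "u \<in> K" for u
    unfolding d_def by (rule cINF_lower[OF bdd that])
  have d0: "0 \<le> d" unfolding d_def using K0 by (intro cINF_greatest) auto
  have "\<exists>u\<in>K. norm (x - u) < d + 1 / Suc n" for n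
    using cINF_less_iff[of K "\<lambda>u. norm (x - u)" "d + 1 / Suc n"] bdd K0
    unfolding d_def by (metis divide_pos_pos empty_iff less_add_same_cancel1 of_nat_0_less_iff zero_less_Suc zero_less_one)
  then obtain u where u: "\<And>n. u n \<in> K" "\<And>n. norm (x - u n) < d + 1 / Suc n" by metis
  have lim: "(\<lambda>n. norm (x - u n)) \<longlonglongrightarrow> d"
  proof (rule tendsto_sandwich[of "\<lambda>_. d" _ _ "\<lambda>n. d + 1 / Suc n"])
    show "(\<lambda>n. d + 1 / Suc n) \<longlonglongrightarrow> d"
      using tendsto_add[OF tendsto_const[of d] LIMSEQ_inverse_real_of_nat] by (simp add: inverse_eq_divide)
    show "\<forall>\<^sub>F n in sequentially. norm (x - u n) \<le> d + 1 / Suc n"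
      by (intro always_eventually allI less_imp_le u)
  qed (auto simp: dle u)
  have key: "(norm (u m - u n))\<^sup>2 \<le> 2 * (norm (x - u m))\<^sup>2 + 2 * (norm (x - u n))\<^sup>2 - 4 * d\<^sup>2" for m n
  proof -
    have "(1/2) *\<^sub>C (u m + u n) \<in> K"
      using u K by (intro complex_hilbert.subspace_scale complex_hilbert.subspace_add) auto
    then have "d \<le> norm (x - (1/2) *\<^sub>C (u m + u n))" by (rule dle)
    moreover have "norm ((x - u m) + (x - u n)) = 2 * norm (x - (1/2) *\<^sub>C (u m + u n))"
    proof -
      have "(x - u m) + (x - u n) = 2 *\<^sub>C (x - (1/2) *\<^sub>C (u m + u n))"
        using scaleC_add_left[of 1 1 x] by (simp add: scaleC_diff_right scaleC_scaleC)
      then show ?thesis by simp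
    qed
    ultimately have "2 * d \<le> norm ((x - u m) + (x - u n))" by simp
    then have "(2 * d)\<^sup>2 \<le> (norm ((x - u m) + (x - u n)))\<^sup>2" using d0 by (intro power_mono) auto
    moreover have "norm (u m - u n) = norm ((x - u m) - (x - u n))"
      by (simp add: norm_minus_commute)
    ultimately show ?thesis using parallelogram[of "x - u m" "x - u n"] by simp
  qed
  have "Cauchy u"
  proof (rule metric_CauchyI)
    fix e :: real assume e: "0 < e"
    have "(\<lambda>n. (norm (x - u n))\<^sup>2) \<longlonglongrightarrow> d\<^sup>2" by (intro tendsto_intros lim)
    moreover have "d\<^sup>2 < d\<^sup>2 + e\<^sup>2 / 4" using e by simp
    ultimately have "\<forall>\<^sub>F n in sequentially. (norm (x - u n))\<^sup>2 < d\<^sup>2 + e\<^sup>2 / 4"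
      by (rule order_tendstoD)
    then obtain N where N: "\<And>n. n \<ge> N \<Longrightarrow> (norm (x - u n))\<^sup>2 < d\<^sup>2 + e\<^sup>2 / 4"
      unfolding eventually_sequentially by blast
    have "dist (u m) (u n) < e" if "m \<ge> N" "n \<ge> N" for m n
    proof -
      have "(norm (u m - u n))\<^sup>2 < e\<^sup>2" using key[of m n] N[OF that(1)] N[OF that(2)] by simp
      then show ?thesis using e by (simp add: dist_norm power2_less_imp_less)
    qed
    then show "\<exists>M. \<forall>m\<ge>M. \<forall>n\<ge>M. dist (u m) (u n) < e" by blast
  qed
  then obtain y where y: "u \<longlonglongrightarrow> y" using Cauchy_convergent convergentD by blast
  then have "y \<in> K" using closed_sequentially[OF K(1)] u by blast
  moreover have "norm (x - y) = d"
    by (rule LIMSEQ_unique[OF tendsto_norm lim]) (intro tendsto_intros y)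
  ultimately show ?thesis using dle by blast
qed

lemma orthogonal_decomposition:
  fixes K :: "'a::complex_hilbert set"
  assumes K: "closed K" "csubspace K"
  shows "\<exists>y\<in>K. \<forall>u\<in>K. cinner u (x - y) = 0"
proof -
  obtain y where y: "y \<in> K" "\<And>u. u \<in> K \<Longrightarrow> norm (x - y) \<le> norm (x - u)"
    using closest_point_exists[OF K] by blast
  have "cinner u (x - y) = 0" if u: "u \<in> K" for u
  proof (cases "u = 0")
    case False
    \<comment> \<open>With this coefficient, moving \<open>y\<close> to
      \<open>y + c *\<^sub>C u\<close> lowers the squared distance by exactly
      \<open>(cmod c)\<^sup>2 * (norm u)\<^sup>2\<close>, which minimality forces to vanish.\<close>
    define c where "c = cinner u (x - y) / complex_of_real ((norm u)\<^sup>2)"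
    have "y + c *\<^sub>C u \<in> K" using y u K
      by (intro complex_hilbert.subspace_add complex_hilbert.subspace_scale) auto
    then have "norm (x - y) \<le> norm ((x - y) - c *\<^sub>C u)" using y(2) by (simp add: diff_diff_eq)
    then have "(norm (x - y))\<^sup>2 \<le> (norm ((x - y) - c *\<^sub>C u))\<^sup>2" by simp
    moreover have "cinner (x - y) (c *\<^sub>C u) = complex_of_real ((cmod c)\<^sup>2 * (norm u)\<^sup>2)"
    proof -
      have "cinner (x - y) u = cnj (c * complex_of_real ((norm u)\<^sup>2))"
        using False by (subst cinner_commute) (simp add: c_def)
      then show ?thesis
        by (simp add: cinner_scaleC_right complex_norm_square[symmetric] mult.assoc[symmetric])
    qed
    ultimately have "(cmod c)\<^sup>2 * (norm u)\<^sup>2 \<le> 0"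
      by (simp add: norm_diff_sq power_mult_distrib mult.commute)
    then have "cmod c * norm u = 0"
      by (metis power_mult_distrib power2_less_eq_zero_iff)
    then show ?thesis using False by (simp add: c_def)
  qed simp
  then show ?thesis using y by blast
qed

text \<open>A closed subspace is its own double orthogonal complement; membership is thereby reduced
  to testing against vectors orthogonal to \<open>K\<close>.\<close>

lemma mem_closed_csubspace_if:
  fixes K :: "'a::complex_hilbert set"
  assumes K: "closed K" "csubspace K" and x: "\<And>z. (\<And>u. u \<in> K \<Longrightarrow> cinner u z = 0) \<Longrightarrow> cinner z x = 0"
  shows "x \<in> K"
proof -
  obtain y where y: "y \<in> K" "\<And>u. u \<in> K \<Longrightarrow> cinner u (x - y) = 0"
    using orthogonal_decomposition[OF K] by blast
  have "cinner (x - y) x = 0" by (rule x) (rule y)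
  moreover have "cinner (x - y) y = 0" using y by (metis cinner_commute complex_cnj_zero)
  ultimately have "cinner (x - y) (x - y) = 0" by (simp add: cinner_diff_right)
  then show ?thesis using y by simp
qed

subsection \<open>Bounded operators\<close>

lemma bounded_clinearI:
  assumes "\<And>x y. T (x + y) = T x + T y" "\<And>c x. T (c *\<^sub>C x) = c *\<^sub>C T x" "\<And>x. norm (T x) \<le> K * norm x"
  shows "bounded_clinear T"
  unfolding bounded_clinear_def
proof (intro conjI allI)
  show "bounded_linear T"
    by (rule bounded_linear_intro[of T K])
      (use assms in \<open>auto simp: scaleC_of_real[symmetric] mult.commute\<close>)
qed (use assms in auto)

lemma bounded_clinear_add: "bounded_clinear T \<Longrightarrow> T (x + y) = T x + T y"
  by (simp add: bounded_clinear_def linear_simps)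

lemma bounded_clinear_diff: "bounded_clinear T \<Longrightarrow> T (x - y) = T x - T y"
  by (simp add: bounded_clinear_def linear_simps)

lemma bounded_clinear_zero [simp]: "bounded_clinear T \<Longrightarrow> T 0 = 0"
  by (simp add: bounded_clinear_def linear_simps)

lemma bounded_clinear_scaleC: "bounded_clinear T \<Longrightarrow> T (c *\<^sub>C x) = c *\<^sub>C T x"
  by (simp add: bounded_clinear_def)

lemma bounded_clinear_sum: "bounded_clinear T \<Longrightarrow> T (\<Sum>i\<in>A. f i) = (\<Sum>i\<in>A. T (f i))"
  by (simp add: bounded_clinear_def linear_sum bounded_linear.linear)

lemma bounded_clinear_bounded_linear: "bounded_clinear T \<Longrightarrow> bounded_linear T"
  by (simp add: bounded_clinear_def)

lemma bounded_clinear_bound: "bounded_clinear T \<Longrightarrow> norm (T x) \<le> onorm T * norm x"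
  by (simp add: bounded_clinear_def onorm)

lemma bounded_clinear_tendsto:
  "bounded_clinear T \<Longrightarrow> (f \<longlongrightarrow> l) F \<Longrightarrow> ((\<lambda>i. T (f i)) \<longlongrightarrow> T l) F"
  by (simp add: bounded_clinear_def bounded_linear.tendsto)

lemma bounded_clinear_continuous_on: "bounded_clinear T \<Longrightarrow> continuous_on A T"
  by (simp add: bounded_clinear_def linear_continuous_on)

lemma bounded_clinear_sums: "bounded_clinear T \<Longrightarrow> f sums l \<Longrightarrow> (\<lambda>i. T (f i)) sums T l"
  by (simp add: bounded_clinear_def bounded_linear.sums)

lemma bounded_clinear_comp:
  assumes "bounded_clinear T" "bounded_clinear U" shows "bounded_clinear (T \<circ> U)"
  using assms by (auto simp: bounded_clinear_def o_def intro: bounded_linear_compose)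

lemma bopsI: "bounded_clinear T \<Longrightarrow> T \<in> bops" by (simp add: bops_def)
lemma bopsD: "T \<in> bops \<Longrightarrow> bounded_clinear T" by (simp add: bops_def)

lemma bops_comp [intro]: "T \<in> bops \<Longrightarrow> U \<in> bops \<Longrightarrow> T \<circ> U \<in> bops"
  by (simp add: bops_def bounded_clinear_comp)

lemma bounded_clinear_id [intro, simp]: "bounded_clinear id"
  by (rule bounded_clinearI[of _ 1]) auto

lemma bops_id [intro, simp]: "id \<in> bops"
  by (simp add: bops_def)

lemma bops_zero [intro, simp]: "(\<lambda>_. 0) \<in> bops"
  by (intro bopsI bounded_clinearI[of _ 0]) auto

lemma bops_add [intro]: "T \<in> bops \<Longrightarrow> U \<in> bops \<Longrightarrow> (\<lambda>x. T x + U x) \<in> bops"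
  by (auto simp: bops_def bounded_clinear_def bounded_linear_add scaleC_add_right)

lemma bops_diff [intro]: "T \<in> bops \<Longrightarrow> U \<in> bops \<Longrightarrow> (\<lambda>x. T x - U x) \<in> bops"
  by (auto simp: bops_def bounded_clinear_def bounded_linear_sub scaleC_diff_right)

lemma bops_sum [intro]: "(\<And>i. i \<in> A \<Longrightarrow> T i \<in> bops) \<Longrightarrow> (\<lambda>x. \<Sum>i\<in>A. T i x) \<in> bops"
  by (induction A rule: infinite_finite_induct) auto

lemma bops_scaleC [intro]: "T \<in> bops \<Longrightarrow> (\<lambda>x. c *\<^sub>C T x) \<in> bops"
  by (auto simp: bops_def bounded_clinear_def scaleC_scaleC mult.commute
      intro: bounded_linear_compose[OF bounded_bilinear.bounded_linear_right[OF bounded_bilinear_scaleC]])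

lemma bounded_clinear_eq_on_total:
  assumes "bounded_clinear T" "bounded_clinear U" "closure (cspan B) = UNIV" "\<And>b. b \<in> B \<Longrightarrow> T b = U b"
  shows "T = U"
proof
  fix x
  have "x \<in> closure (cspan B)" using assms(3) by simp
  then show "T x = U x"
    by (induction rule: closure_cspan_induct)
      (use assms in \<open>auto intro!: closed_Collect_eq bounded_clinear_continuous_on complex_hilbert.subspaceI
        simp: bounded_clinear_add bounded_clinear_scaleC\<close>)
qed

lemma bounded_clinear_eq_if_cinner_eq:
  assumes "bounded_clinear T" "bounded_clinear U" "closure (cspan B) = UNIV" "closure (cspan C) = UNIV"
    "\<And>b c. b \<in> B \<Longrightarrow> c \<in> C \<Longrightarrow> cinner c (T b) = cinner c (U b)"
  shows "T = U"
  using assms by (intro bounded_clinear_eq_on_total[OF assms(1,2,3)] eq_if_cinner_eq_total[OF assms(4)])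

text \<open>For each \<open>x\<close> this is the Riesz representation of
  \<open>y \<mapsto> cinner x (T y)\<close>: unless that functional is zero, there is a nonzero
  vector \<open>w\<close> orthogonal to its kernel, and the representing vector is the multiple of
  \<open>w\<close> with the right value at \<open>w\<close>.\<close>

lemma cadj_exists:
  fixes T :: "'a::complex_hilbert \<Rightarrow> 'b::complex_hilbert"
  assumes T: "bounded_clinear T"
  shows "\<exists>T'. \<forall>x y. cinner (T' x) y = cinner x (T y)"
proof -
  have "\<exists>z. \<forall>y. cinner z y = cinner x (T y)" for x
  proof (cases "\<forall>y. cinner x (T y) = 0")
    case True
    then show ?thesis by (intro exI[of _ 0]) simp
  next
    case False
    then obtain y0 where y0: "cinner x (T y0) \<noteq> 0" by blast
    define K where "K = {y. cinner x (T y) = 0}"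
    have cl: "closed K" unfolding K_def
      by (intro closed_Collect_eq continuous_on_const
          bounded_linear.continuous_on[OF bounded_bilinear.bounded_linear_right[OF bounded_bilinear_cinner]]
          bounded_clinear_continuous_on T)
    have sub: "csubspace K" unfolding K_def
      by (rule complex_hilbert.subspaceI)
        (auto simp: T bounded_clinear_add bounded_clinear_scaleC cinner_add_right cinner_scaleC_right)
    obtain k where k: "k \<in> K" "\<And>u. u \<in> K \<Longrightarrow> cinner u (y0 - k) = 0"
      using orthogonal_decomposition[OF cl sub] by blast
    define w where "w = y0 - k"
    have xw: "cinner x (T w) = cinner x (T y0)"
      using k(1) by (simp add: w_def K_def bounded_clinear_diff[OF T] cinner_diff_right)
    have w0: "w \<noteq> 0" using xw y0 T by auto
    define z where "z = cnj (cinner x (T w) / cinner w w) *\<^sub>C w"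
    have "cinner z y = cinner x (T y)" for y
    proof -
      define u where "u = y - (cinner x (T y) / cinner x (T w)) *\<^sub>C w"
      have "u \<in> K" using xw y0
        by (simp add: u_def K_def bounded_clinear_diff[OF T] bounded_clinear_scaleC[OF T]
            cinner_diff_right cinner_scaleC_right)
      then have "cinner u w = 0" using k(2) w_def by simp
      then have "cinner w u = 0" by (metis cinner_commute complex_cnj_zero)
      then have "cinner w y = (cinner x (T y) / cinner x (T w)) * cinner w w"
        by (simp add: u_def cinner_diff_right cinner_scaleC_right)
      then show ?thesis
        using w0 xw y0 by (simp add: z_def cinner_scaleC_left)
    qed
    then show ?thesis by blast
  qed
  then show ?thesis by metis
qed

lemma cadj_eqI:
  assumes "\<And>x y. cinner (T' x) y = cinner x (T y)"
  shows "cadj T = T'"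
  unfolding cadj_def
proof (rule the_equality)
  show "\<forall>x y. cinner (T' x) y = cinner x (T y)" using assms by blast
  show "U = T'" if "\<forall>x y. cinner (U x) y = cinner x (T y)" for U
    using that assms by (intro ext eq_if_cinner_eq_left) simp
qed

lemma cinner_cadj_left:
  assumes "bounded_clinear T"
  shows "cinner (cadj T x) y = cinner x (T y)"
  using cadj_exists[OF assms] cadj_eqI[of _ T] by metis

lemma cinner_cadj_right:
  assumes "bounded_clinear T"
  shows "cinner x (cadj T y) = cinner (T x) y"
  by (metis assms cinner_cadj_left cinner_commute)

lemma bounded_clinear_cadj:
  fixes T :: "'a::complex_hilbert \<Rightarrow> 'b::complex_hilbert"
  assumes T: "bounded_clinear T" shows "bounded_clinear (cadj T)"
proof (rule bounded_clinearI[of _ "onorm T"])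
  show "cadj T (x + y) = cadj T x + cadj T y" for x y
    by (rule eq_if_cinner_eq_left) (simp add: cinner_add_left cinner_cadj_left[OF T])
  show "cadj T (c *\<^sub>C x) = c *\<^sub>C cadj T x" for c x
    by (rule eq_if_cinner_eq_left) (simp add: cinner_scaleC_left cinner_cadj_left[OF T])
  show "norm (cadj T x) \<le> onorm T * norm x" for x
  proof (cases "cadj T x = 0")
    case True
    then show ?thesis by (simp add: T bounded_clinear_bounded_linear onorm_pos_le)
  next
    case False
    have "(norm (cadj T x))\<^sup>2 = Re (cinner x (T (cadj T x)))"
      by (simp add: norm_sq_cinner cinner_cadj_left[OF T])
    also have "\<dots> \<le> norm x * norm (T (cadj T x))"
      by (meson cinner_Cauchy_Schwarz complex_Re_le_cmod order_trans)
    also have "\<dots> \<le> norm x * (onorm T * norm (cadj T x))"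
      by (intro mult_left_mono bounded_clinear_bound T) auto
    finally show ?thesis using False by (simp add: power2_eq_square mult_ac)
  qed
qed

lemma bops_cadj [intro]: "T \<in> bops \<Longrightarrow> cadj T \<in> bops"
  by (simp add: bops_def bounded_clinear_cadj)

lemma closure_cspan_subset:
  "csubspace K \<Longrightarrow> closed K \<Longrightarrow> B \<subseteq> K \<Longrightarrow> closure (cspan B) \<subseteq> K"
  by (intro closure_minimal complex_hilbert.span_minimal)

lemma subset_closure_cspan: "B \<subseteq> closure (cspan B)"
  by (meson closure_subset complex_hilbert.span_superset order_trans)

subsection \<open>Orthogonal projections onto closed subspaces\<close>

lemma ident_on_unique:
  assumes K: "closed K" "csubspace K"
    and T: "T \<in> bops_on K" "\<forall>u\<in>K. T u = u" and U: "U \<in> bops_on K" "\<forall>u\<in>K. U u = u"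
  shows "T = U"
proof
  fix x
  obtain y where y: "y \<in> K" "\<And>u. u \<in> K \<Longrightarrow> cinner u (x - y) = 0"
    using orthogonal_decomposition[OF K] by blast
  have "T (x - y) = 0" "U (x - y) = 0" using y T U by (auto simp: bops_on_def)
  moreover have "bounded_clinear T" "bounded_clinear U" using T U by (auto simp: bops_on_def bops_def)
  ultimately have "T x = T y" "U x = U y" by (auto simp: bounded_clinear_diff)
  then show "T x = U x" using y T U by simp
qed

text \<open>Linearity of the projection comes from uniqueness of the orthogonal decomposition: sums
  and multiples of decompositions are again decompositions.\<close>

lemma ident_on_exists:
  fixes K :: "'a::complex_hilbert set"
  assumes K: "closed K" "csubspace K"
  shows "\<exists>T. T \<in> bops_on K \<and> (\<forall>u\<in>K. T u = u)"
proof -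
  obtain T where T: "\<And>x. T x \<in> K" "\<And>x u. u \<in> K \<Longrightarrow> cinner u (x - T x) = 0"
    using orthogonal_decomposition[OF K] by metis
  have uniq: "T x = y" if "y \<in> K" "\<And>u. u \<in> K \<Longrightarrow> cinner u (x - y) = 0" for x y
  proof -
    have d: "T x - y \<in> K" using K T that by (intro complex_hilbert.subspace_diff) auto
    have "cinner (T x - y) ((x - y) - (x - T x)) = 0"
      using that(2)[OF d] T(2)[OF d] by (subst cinner_diff_right) simp
    then show ?thesis by simp
  qed
  have bdd: "bounded_clinear T"
  proof (rule bounded_clinearI[of _ 1])
    fix x y show "T (x + y) = T x + T y"
    proof (rule uniq)
      show "T x + T y \<in> K" using T K by (intro complex_hilbert.subspace_add) auto
      show "cinner u (x + y - (T x + T y)) = 0" if "u \<in> K" for u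
        using T(2)[OF that, of x] T(2)[OF that, of y] by (simp add: cinner_diff_right cinner_add_right)
    qed
  next
    fix c x show "T (c *\<^sub>C x) = c *\<^sub>C T x"
    proof (rule uniq)
      show "c *\<^sub>C T x \<in> K" using T K by (intro complex_hilbert.subspace_scale) auto
      show "cinner u (c *\<^sub>C x - c *\<^sub>C T x) = 0" if "u \<in> K" for u
        using T(2)[OF that, of x] by (simp add: scaleC_diff_right[symmetric] cinner_scaleC_right)
    qed
  next
    fix x
    have "(norm (T x + (x - T x)))\<^sup>2 = (norm (T x))\<^sup>2 + (norm (x - T x))\<^sup>2"
      by (simp only: norm_add_sq T(2)[OF T(1)]) simp
    then have "(norm (T x))\<^sup>2 \<le> (norm x)\<^sup>2" by simp
    then show "norm (T x) \<le> 1 * norm x" by simp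
  qed
  have "T u = u" if "u \<in> K" for u using that by (intro uniq) auto
  moreover have "T x = 0" if "\<forall>u\<in>K. cinner u x = 0" for x
    using that K by (intro uniq) (auto intro: complex_hilbert.subspace_0)
  ultimately show ?thesis using bdd T(1) by (intro exI[of _ T]) (auto simp: bops_on_def bops_def)
qed

lemma
  assumes K: "closed K" "csubspace K"
  shows ident_on_bops_on: "ident_on K \<in> bops_on K"
    and ident_on_apply: "u \<in> K \<Longrightarrow> ident_on K u = u"
proof -
  have "\<exists>!T. T \<in> bops_on K \<and> (\<forall>u\<in>K. T u = u)"
    using ident_on_exists[OF K] ident_on_unique[OF K] by blast
  then have "ident_on K \<in> bops_on K \<and> (\<forall>u\<in>K. ident_on K u = u)"
    unfolding ident_on_def by (rule theI')
  then show "ident_on K \<in> bops_on K" "u \<in> K \<Longrightarrow> ident_on K u = u" by auto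
qed

lemma bops_onD:
  assumes "T \<in> bops_on K"
  shows "T \<in> bops" "T x \<in> K" "(\<And>u. u \<in> K \<Longrightarrow> cinner u y = 0) \<Longrightarrow> T y = 0"
  using assms by (auto simp: bops_on_def)

lemma ident_on_eqI:
  assumes K: "closed K" "csubspace K" and y: "y \<in> K" "\<And>u. u \<in> K \<Longrightarrow> cinner u (x - y) = 0"
  shows "ident_on K x = y"
proof -
  have "ident_on K (x - y) = 0"
    using y by (intro bops_onD(3)[OF ident_on_bops_on[OF K]]) auto
  then show ?thesis
    using ident_on_apply[OF K y(1)] bounded_clinear_diff[OF bopsD[OF bops_onD(1)[OF ident_on_bops_on[OF K]]], of x y]
    by simp
qed

lemma cinner_ident_on:
  assumes K: "closed K" "csubspace K" and "u \<in> K"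
  shows "cinner u (ident_on K x) = cinner u x"
proof -
  obtain y where y: "y \<in> K" "\<And>u. u \<in> K \<Longrightarrow> cinner u (x - y) = 0"
    using orthogonal_decomposition[OF K] by blast
  have "ident_on K x = y" by (rule ident_on_eqI[OF K y])
  then show ?thesis using y(2)[OF assms(3)] by (simp add: cinner_diff_right)
qed

lemma norm_ident_on:
  assumes K: "closed K" "csubspace K"
  shows "norm (ident_on K x) \<le> norm x"
proof -
  have "cinner (ident_on K x) (ident_on K x) = cinner (ident_on K x) x"
    by (rule cinner_ident_on[OF K bops_onD(2)[OF ident_on_bops_on[OF K]]])
  then have "(norm (ident_on K x))\<^sup>2 \<le> norm (ident_on K x) * norm x"
    using cinner_Cauchy_Schwarz[of "ident_on K x" x] complex_Re_le_cmod[of "cinner (ident_on K x) x"]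
    by (simp add: norm_sq_cinner)
  then show ?thesis by (cases "ident_on K x = 0") (auto simp: power2_eq_square)
qed

lemma bops_on_apply_ident_on:
  assumes K: "closed K" "csubspace K" and T: "T \<in> bops_on K"
  shows "T (ident_on K x) = T x"
proof -
  have "T (x - ident_on K x) = 0"
    using cinner_ident_on[OF K] by (intro bops_onD(3)[OF T]) (simp add: cinner_diff_right)
  then show ?thesis using bounded_clinear_diff[OF bopsD[OF bops_onD(1)[OF T]]] by simp
qed

lemma bops_on_cadj:
  assumes K: "closed K" "csubspace K" and T: "T \<in> bops_on K"
  shows "cadj T \<in> bops_on K"
proof -
  have bT: "bounded_clinear T" using bopsD[OF bops_onD(1)[OF T]] .
  have "cadj T x \<in> K" for x
  proof (rule mem_closed_csubspace_if[OF K])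
    fix z assume "\<And>u. u \<in> K \<Longrightarrow> cinner u z = 0"
    then have "T z = 0" by (rule bops_onD(3)[OF T])
    then show "cinner z (cadj T x) = 0" by (simp add: cinner_cadj_right[OF bT])
  qed
  moreover have "cadj T x = 0" if "\<forall>u\<in>K. cinner u x = 0" for x
  proof (rule eq_0_if_cinner_eq_0)
    fix y
    have "cinner (T y) x = 0" using that bops_onD(2)[OF T] by blast
    then show "cinner y (cadj T x) = 0" by (simp add: cinner_cadj_right[OF bT])
  qed
  ultimately show ?thesis using bops_onD(1)[OF T] by (auto simp: bops_on_def)
qed

lemma orth_projectionD:
  assumes "orth_projection P"
  shows "P \<in> bops" "P (P x) = P x" "cinner (P x) y = cinner x (P y)" "cinner (P x) (P y) = cinner x (P y)"
    "norm (P x) \<le> norm x"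
proof -
  have b: "bounded_clinear P" using assms by (auto simp: orth_projection_def bops_def)
  show "P \<in> bops" using assms by (simp add: orth_projection_def)
  show p: "P (P x) = P x" for x using assms by (auto simp: orth_projection_def fun_eq_iff)
  show a: "cinner (P x) y = cinner x (P y)" for x y
    using cinner_cadj_left[OF b] assms by (simp add: orth_projection_def)
  show pp: "cinner (P x) (P y) = cinner x (P y)" for x y by (simp add: a p)
  have "(norm (P x))\<^sup>2 \<le> norm x * norm (P x)"
    using pp[of x x] cinner_Cauchy_Schwarz[of x "P x"] complex_Re_le_cmod[of "cinner x (P x)"]
    by (simp add: norm_sq_cinner)
  then show "norm (P x) \<le> norm x"
    by (cases "P x = 0") (auto simp: power2_eq_square)
qed

subsection \<open>Extension of operators from a family of vectors\<close>

text \<open>The bound makes the closure of the relation between corresponding finite combinations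
  the graph of a bounded operator on the closed span of the \<open>b i\<close>. The absolute value
  in the conclusion is there because \<open>K\<close> may be negative when all combinations
  vanish.\<close>

lemma clinear_extension:
  fixes b :: "'i \<Rightarrow> 'a::complex_hilbert" and d :: "'i \<Rightarrow> 'b::complex_hilbert"
  assumes bd: "\<And>F c. finite F \<Longrightarrow> F \<subseteq> I \<Longrightarrow>
      norm (\<Sum>i\<in>F. c i *\<^sub>C d i) \<le> K * norm (\<Sum>i\<in>F. c i *\<^sub>C b i)"
  shows "\<exists>T. bounded_clinear T \<and> (\<forall>x. norm (T x) \<le> \<bar>K\<bar> * norm x) \<and> (\<forall>i\<in>I. T (b i) = d i)"
proof -
  \<comment> \<open>A relation rather than a map, since a vector may be a finite combination of the
    \<open>b i\<close> in several ways; the hypothesis is what makes the second component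
    unique.\<close>
  define R where "R = {(\<Sum>i\<in>F. c i *\<^sub>C b i, \<Sum>i\<in>F. c i *\<^sub>C d i) | F c. finite F \<and> F \<subseteq> I}"
  have R_add: "(x + x', y + y') \<in> R" if xy: "(x, y) \<in> R" "(x', y') \<in> R" for x y x' y'
  proof -
    obtain F c F' c' where F: "finite F" "F \<subseteq> I" "x = (\<Sum>i\<in>F. c i *\<^sub>C b i)" "y = (\<Sum>i\<in>F. c i *\<^sub>C d i)"
      and F': "finite F'" "F' \<subseteq> I" "x' = (\<Sum>i\<in>F'. c' i *\<^sub>C b i)" "y' = (\<Sum>i\<in>F'. c' i *\<^sub>C d i)"
      using xy unfolding R_def by auto
    have ext: "(\<Sum>i\<in>G. g i *\<^sub>C v i) = (\<Sum>i\<in>F \<union> F'. (if i \<in> G then g i else 0) *\<^sub>C v i)"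
      if "G \<subseteq> F \<union> F'" for G and g :: "'i \<Rightarrow> complex" and v :: "'i \<Rightarrow> 'v::complex_hilbert"
      using F(1) F'(1) that by (intro sum.mono_neutral_cong_left) auto
    have "x + x' = (\<Sum>i\<in>F \<union> F'. ((if i \<in> F then c i else 0) + (if i \<in> F' then c' i else 0)) *\<^sub>C b i)"
      "y + y' = (\<Sum>i\<in>F \<union> F'. ((if i \<in> F then c i else 0) + (if i \<in> F' then c' i else 0)) *\<^sub>C d i)"
      unfolding F F' by (simp_all add: ext[of F] ext[of F'] scaleC_add_left sum.distrib)
    then show ?thesis unfolding R_def using F F' 
      by (intro CollectI exI[of _ "F \<union> F'"] exI[of _ "\<lambda>i. (if i \<in> F then c i else 0) + (if i \<in> F' then c' i else 0)"]) auto
  qed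
  have R_scale: "(a *\<^sub>C x, a *\<^sub>C y) \<in> R" if xy: "(x, y) \<in> R" for a x y
  proof -
    obtain F c where F: "finite F" "F \<subseteq> I" "x = (\<Sum>i\<in>F. c i *\<^sub>C b i)" "y = (\<Sum>i\<in>F. c i *\<^sub>C d i)"
      using xy unfolding R_def by auto
    then show ?thesis unfolding R_def
      by (intro CollectI exI[of _ F] exI[of _ "\<lambda>i. a * c i"]) (auto simp: scaleC_sum_right scaleC_scaleC)
  qed
  have R_bd: "norm y \<le> \<bar>K\<bar> * norm x" if "(x, y) \<in> R" for x y
  proof -
    have "norm y \<le> K * norm x" using that bd unfolding R_def by auto
    also have "\<dots> \<le> \<bar>K\<bar> * norm x" by (intro mult_right_mono) auto
    finally show ?thesis .
  qed
  have R_b: "(b i, d i) \<in> R" if "i \<in> I" for i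
    unfolding R_def using that by (intro CollectI exI[of _ "{i}"] exI[of _ "\<lambda>_. 1"]) auto
  define Cl where "Cl = closure R"
  have Cl_seq: "(x, y) \<in> Cl \<longleftrightarrow> (\<exists>u v. (\<forall>n. (u n, v n) \<in> R) \<and> u \<longlonglongrightarrow> x \<and> v \<longlonglongrightarrow> y)" for x y
  proof
    assume "(x, y) \<in> Cl"
    then obtain w where w: "\<And>n. w n \<in> R" "w \<longlonglongrightarrow> (x, y)" unfolding Cl_def closure_sequential by blast
    then show "\<exists>u v. (\<forall>n. (u n, v n) \<in> R) \<and> u \<longlonglongrightarrow> x \<and> v \<longlonglongrightarrow> y"
      by (intro exI[of _ "\<lambda>n. fst (w n)"] exI[of _ "\<lambda>n. snd (w n)"])
        (auto dest: tendsto_fst tendsto_snd)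
  next
    assume "\<exists>u v. (\<forall>n. (u n, v n) \<in> R) \<and> u \<longlonglongrightarrow> x \<and> v \<longlonglongrightarrow> y"
    then show "(x, y) \<in> Cl" unfolding Cl_def closure_sequential by (auto intro: tendsto_Pair)
  qed
  have Cl_add: "(x + x', y + y') \<in> Cl" if xy: "(x, y) \<in> Cl" "(x', y') \<in> Cl" for x y x' y'
  proof -
    obtain u v where 1: "\<forall>n. (u n, v n) \<in> R" "u \<longlonglongrightarrow> x" "v \<longlonglongrightarrow> y"
      using xy(1)[unfolded Cl_seq] by blast
    obtain u' v' where 2: "\<forall>n. (u' n, v' n) \<in> R" "u' \<longlonglongrightarrow> x'" "v' \<longlonglongrightarrow> y'"
      using xy(2)[unfolded Cl_seq] by blast
    from 1 2 show ?thesis unfolding Cl_seq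
      by (intro exI[of _ "\<lambda>n. u n + u' n"] exI[of _ "\<lambda>n. v n + v' n"]) (simp add: R_add tendsto_add)
  qed
  have Cl_scale: "(a *\<^sub>C x, a *\<^sub>C y) \<in> Cl" if xy: "(x, y) \<in> Cl" for a x y
  proof -
    obtain u v where "\<forall>n. (u n, v n) \<in> R" "u \<longlonglongrightarrow> x" "v \<longlonglongrightarrow> y"
      using xy[unfolded Cl_seq] by blast
    then show ?thesis unfolding Cl_seq
      by (intro exI[of _ "\<lambda>n. a *\<^sub>C u n"] exI[of _ "\<lambda>n. a *\<^sub>C v n"]) (simp add: R_scale tendsto_scaleC)
  qed
  have Cl_bd: "norm y \<le> \<bar>K\<bar> * norm x" if xy: "(x, y) \<in> Cl" for x y
  proof -
    obtain u v where uv: "\<forall>n. (u n, v n) \<in> R" "u \<longlonglongrightarrow> x" "v \<longlonglongrightarrow> y" using xy[unfolded Cl_seq] by blast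
    show ?thesis
      by (rule LIMSEQ_le[of "\<lambda>n. norm (v n)" _ "\<lambda>n. \<bar>K\<bar> * norm (u n)"])
        (use uv R_bd in \<open>auto intro!: tendsto_intros\<close>)
  qed
  define D where "D = fst ` R"
  have D_sub: "csubspace D"
  proof (rule complex_hilbert.subspaceI)
    have "(0, 0) \<in> R" unfolding R_def by (intro CollectI exI[of _ "{}"]) auto
    then show "0 \<in> D" unfolding D_def by force
  next
    fix x y assume "x \<in> D" "y \<in> D"
    then obtain x' y' where "(x, x') \<in> R" "(y, y') \<in> R" unfolding D_def by auto
    from R_add[OF this] show "x + y \<in> D" unfolding D_def by force
  next
    fix c x assume "x \<in> D"
    then obtain x' where "(x, x') \<in> R" unfolding D_def by auto
    from R_scale[OF this] show "c *\<^sub>C x \<in> D" unfolding D_def by force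
  qed
  have dom: "\<exists>y. (x, y) \<in> Cl" if x: "x \<in> closure D" for x
  proof -
    obtain u where u: "\<And>n. u n \<in> D" "u \<longlonglongrightarrow> x" using x unfolding closure_sequential by blast
    have "\<exists>y. (u n, y) \<in> R" for n using u(1)[of n] unfolding D_def by auto
    then obtain v where v: "\<And>n. (u n, v n) \<in> R" by metis
    have diff: "norm (v m - v n) \<le> \<bar>K\<bar> * norm (u m - u n)" for m n
      using R_bd[OF R_add[OF v[of m] R_scale[OF v[of n], of "-1"]]] by simp
    have "Cauchy v"
    proof (rule metric_CauchyI)
      fix e :: real assume e: "0 < e"
      have "Cauchy u" using u(2) LIMSEQ_imp_Cauchy by blast
      moreover have "0 < e / (\<bar>K\<bar> + 1)" using e by (simp add: add_pos_pos add_nonneg_pos)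
      ultimately obtain M where M: "\<forall>m\<ge>M. \<forall>n\<ge>M. dist (u m) (u n) < e / (\<bar>K\<bar> + 1)"
        using metric_CauchyD by blast
      have "dist (v m) (v n) < e" if "m \<ge> M" "n \<ge> M" for m n
      proof -
        have "(\<bar>K\<bar> + 1) * norm (u m - u n) < e"
          using M that by (simp add: dist_norm pos_less_divide_eq add_nonneg_pos mult.commute)
        moreover have "\<bar>K\<bar> * norm (u m - u n) \<le> (\<bar>K\<bar> + 1) * norm (u m - u n)"
          by (simp add: mult_right_mono)
        ultimately show ?thesis using diff[of m n] by (simp add: dist_norm)
      qed
      then show "\<exists>M. \<forall>m\<ge>M. \<forall>n\<ge>M. dist (v m) (v n) < e" by blast
    qed
    then obtain y where "v \<longlonglongrightarrow> y" using Cauchy_convergent convergentD by blast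
    then show ?thesis using u v unfolding Cl_seq by blast
  qed
  have uniq: "y = y'" if "(x, y) \<in> Cl" "(x, y') \<in> Cl" for x y y'
    using Cl_bd[OF Cl_add[OF that(1) Cl_scale[OF that(2), of "-1"]]] by simp
  have DK: "closed (closure D)" "csubspace (closure D)" using D_sub by auto
  \<comment> \<open>Vectors orthogonal to the domain will be sent to zero, which makes the operator
    total without enlarging its bound.\<close>
  define P where "P = ident_on (closure D)"
  have P: "P \<in> bops_on (closure D)" "\<forall>u\<in>closure D. P u = u"
    using ident_on_bops_on[OF DK] ident_on_apply[OF DK] by (auto simp: P_def)
  have bP: "bounded_clinear P" using bopsD[OF bops_onD(1)[OF P(1)]] .
  have "\<exists>y. (P x, y) \<in> Cl" for x using dom bops_onD(2)[OF P(1)] by blast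
  then obtain T where T: "\<And>x. (P x, T x) \<in> Cl" by metis
  have bd: "norm (T x) \<le> \<bar>K\<bar> * norm x" for x
  proof -
    have "norm (T x) \<le> \<bar>K\<bar> * norm (P x)" by (rule Cl_bd[OF T])
    also have "\<dots> \<le> \<bar>K\<bar> * norm x" unfolding P_def by (intro mult_left_mono norm_ident_on DK) auto
    finally show ?thesis .
  qed
  have "bounded_clinear T"
  proof (rule bounded_clinearI[OF _ _ bd])
    show "T (x + y) = T x + T y" for x y
      using uniq T[of "x + y"] Cl_add[OF T[of x] T[of y]] by (simp add: bounded_clinear_add[OF bP])
    show "T (c *\<^sub>C x) = c *\<^sub>C T x" for c x
      using uniq T[of "c *\<^sub>C x"] Cl_scale[OF T[of x], of c] by (simp add: bounded_clinear_scaleC[OF bP])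
  qed
  moreover have "T (b i) = d i" if "i \<in> I" for i
  proof -
    have "b i \<in> closure D" using R_b[OF that] closure_subset unfolding D_def by force
    then have "P (b i) = b i" using P by blast
    moreover have "(b i, d i) \<in> Cl" unfolding Cl_def using R_b[OF that] closure_subset by blast
    ultimately show ?thesis using uniq T[of "b i"] by simp
  qed
  ultimately show ?thesis using bd by blast
qed

subsection \<open>Finite orthonormal systems\<close>

text \<open>Gram-Schmidt, one vector at a time: the residual \<open>r\<close> of the new vector is
  normalised and appended unless it is zero, so the system may be shorter than the cardinality of
  \<open>A\<close>.\<close>

lemma finite_orthonormal:
  fixes A :: "'a::complex_hilbert set"
  assumes "finite A"
  shows "\<exists>m (e :: nat \<Rightarrow> 'a). (\<forall>k<m. \<forall>l<m. cinner (e k) (e l) = (if k = l then 1 else 0)) \<and>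
    (\<forall>a\<in>A. a = (\<Sum>k<m. cinner (e k) a *\<^sub>C e k))"
  using assms
proof (induction A rule: finite_induct)
  case empty
  show ?case by (rule exI[of _ 0]) auto
next
  case (insert a A)
  then obtain m and e :: "nat \<Rightarrow> 'a" where on: "\<And>k l. k < m \<Longrightarrow> l < m \<Longrightarrow> cinner (e k) (e l) = (if k = l then 1 else 0)"
    and A: "\<And>b. b \<in> A \<Longrightarrow> b = (\<Sum>k<m. cinner (e k) b *\<^sub>C e k)" by metis
  define r where "r = a - (\<Sum>k<m. cinner (e k) a *\<^sub>C e k)"
  have er: "cinner (e k) r = 0" if "k < m" for k
    using that by (simp add: r_def cinner_diff_right cinner_sum_right cinner_scaleC_right on if_distrib cong: if_cong)
  show ?case
  proof (cases "r = 0")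
    case True
    then show ?thesis using on A r_def by (intro exI[of _ m] exI[of _ e]) auto
  next
    case False
    define e' where "e' = e(m := (1 / complex_of_real (norm r)) *\<^sub>C r)"
    have e'm: "e' m = (1 / complex_of_real (norm r)) *\<^sub>C r" and e'l: "\<And>k. k < m \<Longrightarrow> e' k = e k"
      by (auto simp: e'_def)
    have re: "cinner r (e k) = 0" if "k < m" for k
      using er[OF that] by (metis cinner_commute complex_cnj_zero)
    have mm: "cinner (e' m) (e' m) = 1"
      using False by (simp add: e'm cinner_same norm_divide power2_eq_square)
    have "cinner (e' k) (e' l) = (if k = l then 1 else 0)" if "k < Suc m" "l < Suc m" for k l
    proof (cases "k = m")
      case True
      then show ?thesis using that mm e'l re by (cases "l = m") (auto simp: e'm cinner_scaleC_left)
    next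
      case False
      then show ?thesis using that e'l er on by (cases "l = m") (auto simp: e'm cinner_scaleC_right)
    qed
    moreover have "b = (\<Sum>k<Suc m. cinner (e' k) b *\<^sub>C e' k)" if "b \<in> insert a A" for b
    proof (cases "b \<in> A")
      case True
      have "cinner r b = 0"
        by (subst A[OF True]) (auto simp: cinner_sum_right cinner_scaleC_right re intro!: sum.neutral)
      then have "cinner (e' m) b = 0" by (simp add: e'm cinner_scaleC_left)
      moreover have "(\<Sum>k<m. cinner (e' k) b *\<^sub>C e' k) = b"
        using A[OF True] e'l by simp
      ultimately show ?thesis by simp
    next
      case ne: False
      then have b: "b = a" using that by simp
      have "cinner r a = cinner r r + cinner r (\<Sum>k<m. cinner (e k) a *\<^sub>C e k)"
        by (simp add: r_def cinner_diff_right[symmetric] cinner_add_right[symmetric])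
      also have "cinner r (\<Sum>k<m. cinner (e k) a *\<^sub>C e k) = 0"
        by (auto simp: cinner_sum_right cinner_scaleC_right re intro!: sum.neutral)
      finally have "cinner (e' m) a = complex_of_real (norm r)"
        using False by (simp add: e'm cinner_scaleC_left cinner_same power2_eq_square)
      then have "cinner (e' m) a *\<^sub>C e' m = r" using False by (simp add: e'm scaleC_scaleC)
      then show ?thesis using e'l by (simp add: b r_def)
    qed
    ultimately show ?thesis by (intro exI[of _ "Suc m"] exI[of _ e']) blast
  qed
qed

text \<open>Coordinates with respect to a finite orthonormal system spanning the vectors
  \<open>a p\<close> provide the factors. This is positivity of a Gram matrix in explicit form,
  obtained without any diagonalisation.\<close>

lemma gram_factorization:
  fixes a :: "'i \<Rightarrow> 'a::complex_hilbert"
  assumes "finite F"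
  shows "\<exists>m (c :: 'i \<Rightarrow> nat \<Rightarrow> complex). \<forall>p\<in>F. \<forall>q\<in>F. cinner (a p) (a q) = (\<Sum>k<m. cnj (c p k) * c q k)"
proof -
  have fin: "finite (a ` F)" using assms by (rule finite_imageI)
  obtain m and e :: "nat \<Rightarrow> 'a" where "\<forall>b\<in>a ` F. b = (\<Sum>k<m. cinner (e k) b *\<^sub>C e k)"
    using finite_orthonormal[OF fin] by blast
  then have e: "\<And>p. p \<in> F \<Longrightarrow> a p = (\<Sum>k<m. cinner (e k) (a p) *\<^sub>C e k)" by blast
  have "cinner (a p) (a q) = (\<Sum>k<m. cnj (cinner (e k) (a p)) * cinner (e k) (a q))" if "p \<in> F" "q \<in> F" for p q
    by (subst e[OF that(2)]) (simp add: cinner_sum_right cinner_scaleC_right mult.commute cinner_commute[of "a p"])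
  then show ?thesis by (intro exI[of _ m] exI[of _ "\<lambda>p k. cinner (e k) (a p)"]) auto
qed

text \<open>A factorised kernel replaces a double sum weighted by its entries by finitely many inner
  products in the space of the \<open>y p\<close> and \<open>z q\<close>, where operators can be
  applied termwise.\<close>

lemma gram_sum:
  assumes "\<And>p q. p \<in> F \<Longrightarrow> q \<in> F \<Longrightarrow> K p q = (\<Sum>k<m. cnj (c p k) * c q k)"
  shows "(\<Sum>p\<in>F. \<Sum>q\<in>F. K p q * cinner (y p) (z q)) =
    (\<Sum>k<(m::nat). cinner (\<Sum>p\<in>F. c p k *\<^sub>C y p) (\<Sum>q\<in>F. c q k *\<^sub>C z q))"
proof -
  have "(\<Sum>k<m. cinner (\<Sum>p\<in>F. c p k *\<^sub>C y p) (\<Sum>q\<in>F. c q k *\<^sub>C z q)) =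
      (\<Sum>k<m. \<Sum>p\<in>F. \<Sum>q\<in>F. cnj (c p k) * c q k * cinner (y p) (z q))"
    unfolding cinner_sum_left unfolding cinner_sum_right
    by (intro sum.cong refl) (simp add: cinner_scaleC_left cinner_scaleC_right mult_ac)
  also have "\<dots> = (\<Sum>p\<in>F. \<Sum>k<m. \<Sum>q\<in>F. cnj (c p k) * c q k * cinner (y p) (z q))"
    by (rule sum.swap)
  also have "\<dots> = (\<Sum>p\<in>F. \<Sum>q\<in>F. \<Sum>k<m. cnj (c p k) * c q k * cinner (y p) (z q))"
    by (intro sum.cong refl sum.swap)
  also have "\<dots> = (\<Sum>p\<in>F. \<Sum>q\<in>F. K p q * cinner (y p) (z q))"
    by (intro sum.cong refl) (simp add: assms sum_distrib_right)
  finally show ?thesis by simp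
qed

section \<open>Operators intertwined by a family with scalar Gram matrix\<close>

text \<open>Boundedness: factorising the Gram matrix reduces the norm of a finite sum of vectors
  \<open>J i x\<close> to a finite sum of squared norms in \<open>D\<close>, where \<open>X\<close> acts termwise.\<close>

lemma kernel_operator_exists:
  fixes J :: "'i \<Rightarrow> 'b::complex_hilbert \<Rightarrow> 'c::complex_hilbert" and a :: "'i \<Rightarrow> 'd::complex_hilbert"
  assumes D: "csubspace D"
    and inner: "\<And>i j x y. i \<in> I \<Longrightarrow> j \<in> I \<Longrightarrow> x \<in> D \<Longrightarrow> y \<in> D \<Longrightarrow>
      cinner (J i x) (J j y) = cinner (a i) (a j) * cinner x y"
    and X: "bounded_clinear X" "\<And>x. x \<in> D \<Longrightarrow> X x \<in> D"
  shows "\<exists>T. bounded_clinear T \<and> (\<forall>x. norm (T x) \<le> onorm X * norm x) \<and> (\<forall>i\<in>I. \<forall>x\<in>D. T (J i x) = J i (X x))"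
proof -
  have "\<exists>T. bounded_clinear T \<and> (\<forall>x. norm (T x) \<le> \<bar>onorm X\<bar> * norm x) \<and> (\<forall>p\<in>I \<times> D. T (J (fst p) (snd p)) = J (fst p) (X (snd p)))"
  proof (rule clinear_extension)
    fix F and r :: "'i \<times> 'b \<Rightarrow> complex" assume F: "finite F" "F \<subseteq> I \<times> D"
    obtain m c where c: "\<And>p q. p \<in> F \<Longrightarrow> q \<in> F \<Longrightarrow> cinner (a (fst p)) (a (fst q)) = (\<Sum>k<(m::nat). cnj (c p k) * c q k)"
      using gram_factorization[OF F(1), of "\<lambda>p. a (fst p)"] by blast
    have FD: "fst p \<in> I" "snd p \<in> D" if "p \<in> F" for p using that F(2) by auto
    \<comment> \<open>One formula serves twice: with \<open>Y\<close> the identity for the given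
      combination, and with \<open>Y = X\<close> for its image.\<close>
    have n: "(norm (\<Sum>p\<in>F. r p *\<^sub>C J (fst p) (Y (snd p))))\<^sup>2 = (\<Sum>k<m. (norm (\<Sum>p\<in>F. c p k *\<^sub>C r p *\<^sub>C Y (snd p)))\<^sup>2)"
      if Y: "\<And>x. x \<in> D \<Longrightarrow> Y x \<in> D" for Y
    proof -
      have "cinner (\<Sum>p\<in>F. r p *\<^sub>C J (fst p) (Y (snd p))) (\<Sum>p\<in>F. r p *\<^sub>C J (fst p) (Y (snd p))) =
         (\<Sum>p\<in>F. \<Sum>q\<in>F. cinner (a (fst p)) (a (fst q)) * cinner (r p *\<^sub>C Y (snd p)) (r q *\<^sub>C Y (snd q)))"
        unfolding cinner_sum_left unfolding cinner_sum_right
        by (intro sum.cong refl)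
          (simp add: cinner_scaleC_left cinner_scaleC_right inner FD Y mult_ac)
      also have "\<dots> = (\<Sum>k<m. cinner (\<Sum>p\<in>F. c p k *\<^sub>C r p *\<^sub>C Y (snd p)) (\<Sum>p\<in>F. c p k *\<^sub>C r p *\<^sub>C Y (snd p)))"
        by (rule gram_sum) (rule c)
      finally show ?thesis by (simp add: norm_sq_cinner)
    qed
    have "(norm (\<Sum>p\<in>F. r p *\<^sub>C J (fst p) (X (snd p))))\<^sup>2 = (\<Sum>k<m. (norm (\<Sum>p\<in>F. c p k *\<^sub>C r p *\<^sub>C X (snd p)))\<^sup>2)"
      by (rule n) (rule X)
    also have "\<dots> = (\<Sum>k<m. (norm (X (\<Sum>p\<in>F. c p k *\<^sub>C r p *\<^sub>C snd p)))\<^sup>2)"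
      by (simp add: bounded_clinear_sum[OF X(1)] bounded_clinear_scaleC[OF X(1)])
    also have "\<dots> \<le> (\<Sum>k<m. (onorm X * norm (\<Sum>p\<in>F. c p k *\<^sub>C r p *\<^sub>C snd p))\<^sup>2)"
      by (intro sum_mono power_mono bounded_clinear_bound X) auto
    also have "\<dots> = (onorm X * norm (\<Sum>p\<in>F. r p *\<^sub>C J (fst p) (snd p)))\<^sup>2"
      using n[of "\<lambda>x. x"] by (simp add: power_mult_distrib sum_distrib_left)
    finally show "norm (\<Sum>p\<in>F. r p *\<^sub>C J (fst p) (X (snd p))) \<le> onorm X * norm (\<Sum>p\<in>F. r p *\<^sub>C J (fst p) (snd p))"
      by (rule power2_le_imp_le) (simp add: onorm_pos_le X bounded_clinear_bounded_linear)
  qed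
  moreover have "onorm X \<ge> 0" using X(1) by (simp add: bounded_clinear_bounded_linear onorm_pos_le)
  ultimately show ?thesis by (auto simp: split_paired_all)
qed

text \<open>\<open>J i\<close> is the abstract form of \<open>u \<mapsto> a i \<otimes> u\<close>, and \<open>endo_of I J X\<close> below is then \<open>I \<otimes> X\<close>.\<close>

definition intertwiners ::
  "'i set \<Rightarrow> ('i \<Rightarrow> 'd::complex_hilbert) \<Rightarrow> ('i \<Rightarrow> 'a::complex_hilbert \<Rightarrow> 'a) \<Rightarrow> bool" where
  "intertwiners I a J \<longleftrightarrow> (\<forall>i\<in>I. J i \<in> bops) \<and>
     (\<forall>i\<in>I. \<forall>j\<in>I. \<forall>x y. cinner (J i x) (J j y) = cinner (a i) (a j) * cinner x y) \<and>
     closure (cspan {J i x | i x. i \<in> I}) = UNIV"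

lemma intertwinersD:
  assumes "intertwiners I a J"
  shows "i \<in> I \<Longrightarrow> J i \<in> bops" "i \<in> I \<Longrightarrow> j \<in> I \<Longrightarrow> cinner (J i x) (J j y) = cinner (a i) (a j) * cinner x y"
    "closure (cspan {J i x | i x. i \<in> I}) = UNIV"
  using assms by (auto simp: intertwiners_def)

definition endo_of :: "'i set \<Rightarrow> ('i \<Rightarrow> 'a::complex_hilbert \<Rightarrow> 'a) \<Rightarrow> ('a \<Rightarrow> 'a) \<Rightarrow> 'a \<Rightarrow> 'a" where
  "endo_of I J X = (THE T. T \<in> bops \<and> (\<forall>i\<in>I. \<forall>x. T (J i x) = J i (X x)))"

lemma endo_of_eqI:
  assumes "intertwiners I a J" "T \<in> bops" "\<And>i x. i \<in> I \<Longrightarrow> T (J i x) = J i (X x)"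
  shows "endo_of I J X = T"
  unfolding endo_of_def
proof (rule the_equality)
  fix U assume U: "U \<in> bops \<and> (\<forall>i\<in>I. \<forall>x. U (J i x) = J i (X x))"
  show "U = T"
    by (rule bounded_clinear_eq_on_total[OF _ _ intertwinersD(3)[OF assms(1)]])
      (use U assms bopsD in auto)
qed (use assms in auto)

lemma
  assumes "intertwiners I a J" "X \<in> bops"
  shows endo_of_bops: "endo_of I J X \<in> bops"
    and endo_of_apply: "i \<in> I \<Longrightarrow> endo_of I J X (J i x) = J i (X x)"
    and norm_endo_of: "norm (endo_of I J X x) \<le> onorm X * norm x"
proof -
  have "\<exists>T. bounded_clinear T \<and> (\<forall>x. norm (T x) \<le> onorm X * norm x) \<and> (\<forall>i\<in>I. \<forall>x\<in>UNIV. T (J i x) = J i (X x))"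
    using assms by (intro kernel_operator_exists[of UNIV I J a]) (auto simp: intertwinersD bops_def)
  then obtain T where T: "T \<in> bops" "\<And>i x. i \<in> I \<Longrightarrow> T (J i x) = J i (X x)" "\<And>x. norm (T x) \<le> onorm X * norm x"
    by (auto simp: bops_def)
  have "endo_of I J X = T" by (rule endo_of_eqI[OF assms(1) T(1,2)])
  with T show "endo_of I J X \<in> bops" "i \<in> I \<Longrightarrow> endo_of I J X (J i x) = J i (X x)"
    "norm (endo_of I J X x) \<le> onorm X * norm x" by auto
qed

lemma endo_of_cadj:
  assumes J: "intertwiners I a J" and X: "X \<in> bops"
  shows "endo_of I J (cadj X) = cadj (endo_of I J X)"
proof (rule endo_of_eqI[OF J])
  have b: "bounded_clinear (endo_of I J X)" using endo_of_bops[OF J X] by (rule bopsD)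
  show "cadj (endo_of I J X) \<in> bops" using endo_of_bops[OF J X] by (rule bops_cadj)
  fix i x assume i: "i \<in> I"
  show "cadj (endo_of I J X) (J i x) = J i (cadj X x)"
  proof (rule eq_if_cinner_eq_total[OF intertwinersD(3)[OF J]])
    fix v assume "v \<in> {J i x | i x. i \<in> I}"
    then obtain j y where v: "v = J j y" "j \<in> I" by blast
    show "cinner v (cadj (endo_of I J X) (J i x)) = cinner v (J i (cadj X x))"
      using v i by (simp add: cinner_cadj_right[OF b] cinner_cadj_right[OF bopsD[OF X]]
          endo_of_apply[OF J X] intertwinersD[OF J])
  qed
qed

subsection \<open>Normality\<close>

text \<open>The constant \<open>c\<close> plays the role of a bound on the trace norm: it bounds
  both square sums, so that countably many representations with summable constants can be
  concatenated. Unordered sums are used to permit reindexing by pairs.\<close>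

definition nuclear_rep :: "real \<Rightarrow> (('a::complex_hilbert \<Rightarrow> 'a) \<Rightarrow> complex) \<Rightarrow> bool" where
  "nuclear_rep c \<omega> \<longleftrightarrow> (\<exists>(X :: nat \<Rightarrow> 'a) Y A B. ((\<lambda>k. (norm (X k))\<^sup>2) has_sum A) UNIV \<and> A \<le> c \<and>
     ((\<lambda>k. (norm (Y k))\<^sup>2) has_sum B) UNIV \<and> B \<le> c \<and>
     (\<forall>T\<in>bops. ((\<lambda>k. cinner (X k) (T (Y k))) has_sum \<omega> T) UNIV))"

lemma norm_mult_le_sum_sq: "norm x * norm y \<le> (norm x)\<^sup>2 + (norm y)\<^sup>2"
proof -
  have "0 \<le> norm x * norm y" by simp
  then show ?thesis using sum_squares_bound[of "norm x" "norm y"] by linarith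
qed

lemma summable_norm_mult:
  assumes "summable (\<lambda>n. (norm (x n))\<^sup>2)" "summable (\<lambda>n. (norm (y n))\<^sup>2)"
  shows "summable (\<lambda>n. norm (x n) * norm (y n))"
proof (rule summable_comparison_test'[OF summable_add[OF assms], of 0])
  show "norm (norm (x n) * norm (y n)) \<le> (norm (x n))\<^sup>2 + (norm (y n))\<^sup>2" for n
    using norm_mult_le_sum_sq[of "x n" "y n"] by simp
qed

lemma abs_summable_cinner:
  fixes X Y :: "'i \<Rightarrow> 'a::complex_hilbert"
  assumes "(\<lambda>k. (norm (X k))\<^sup>2) summable_on UNIV" "(\<lambda>k. (norm (Y k))\<^sup>2) summable_on UNIV" "T \<in> bops"
  shows "(\<lambda>k. norm (cinner (X k) (T (Y k)))) summable_on UNIV"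
proof (rule Infinite_Sum.abs_summable_on_comparison_test')
  show "(\<lambda>k. onorm T * ((norm (X k))\<^sup>2 + (norm (Y k))\<^sup>2)) summable_on UNIV"
    by (intro summable_on_cmult_right summable_on_add assms)
  fix k
  have o: "onorm T \<ge> 0" using assms(3) by (simp add: bops_def bounded_clinear_bounded_linear onorm_pos_le)
  have "cmod (cinner (X k) (T (Y k))) \<le> norm (X k) * norm (T (Y k))" by (rule cinner_Cauchy_Schwarz)
  also have "\<dots> \<le> norm (X k) * (onorm T * norm (Y k))"
    by (intro mult_left_mono bounded_clinear_bound bopsD assms) auto
  also have "\<dots> = onorm T * (norm (X k) * norm (Y k))" by simp
  also have "\<dots> \<le> onorm T * ((norm (X k))\<^sup>2 + (norm (Y k))\<^sup>2)"
  proof (intro mult_left_mono o)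
    show "norm (X k) * norm (Y k) \<le> (norm (X k))\<^sup>2 + (norm (Y k))\<^sup>2"
      by (rule norm_mult_le_sum_sq)
  qed
  finally show "cmod (cinner (X k) (T (Y k))) \<le> onorm T * ((norm (X k))\<^sup>2 + (norm (Y k))\<^sup>2)" .
qed

lemma nuclear_rep_mono: "nuclear_rep c \<omega> \<Longrightarrow> c \<le> d \<Longrightarrow> nuclear_rep d \<omega>"
  unfolding nuclear_rep_def by (meson order_trans)

text \<open>The double family of vectors is again square summable, because its row sums are
  dominated by the \<open>c m\<close>; enumerating pairs by \<open>prod_decode\<close> turns it back
  into sequences. Absolute summability of the double series identifies its value with the given
  iterated sum.\<close>

lemma nuclear_rep_sums:
  fixes \<omega> :: "nat \<Rightarrow> ('a::complex_hilbert \<Rightarrow> 'a) \<Rightarrow> complex"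
  assumes rep: "\<And>m. nuclear_rep (c m) (\<omega> m)" and c: "c sums s"
    and sums: "\<And>T. T \<in> bops \<Longrightarrow> (\<lambda>m. \<omega> m T) sums \<omega>' T"
  shows "nuclear_rep s \<omega>'"
proof -
  let ?P = "\<lambda>m X Y A B. ((\<lambda>k. (norm (X k))\<^sup>2) has_sum A) UNIV \<and> A \<le> c m \<and>
     ((\<lambda>k. (norm (Y k))\<^sup>2) has_sum B) UNIV \<and> B \<le> c m \<and>
     (\<forall>T\<in>bops. ((\<lambda>k :: nat. cinner (X k :: 'a) (T (Y k))) has_sum \<omega> m T) UNIV)"
  have "\<forall>m. \<exists>X Y A B. ?P m X Y A B" using rep unfolding nuclear_rep_def by blast
  from choice[OF this] obtain X where "\<forall>m. \<exists>Y A B. ?P m (X m) Y A B" ..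
  from choice[OF this] obtain Y where "\<forall>m. \<exists>A B. ?P m (X m) (Y m) A B" ..
  from choice[OF this] obtain A where "\<forall>m. \<exists>B. ?P m (X m) (Y m) (A m) B" ..
  from choice[OF this] obtain B where P: "\<forall>m. ?P m (X m) (Y m) (A m) (B m)" ..
  have X: "\<And>m. ((\<lambda>k. (norm (X m k))\<^sup>2) has_sum A m) UNIV" "\<And>m. A m \<le> c m"
    and Y: "\<And>m. ((\<lambda>k. (norm (Y m k))\<^sup>2) has_sum B m) UNIV" "\<And>m. B m \<le> c m"
    and XY: "\<And>m T. T \<in> bops \<Longrightarrow> ((\<lambda>k. cinner (X m k) (T (Y m k))) has_sum \<omega> m T) UNIV"
    using P by blast+
  have tot: "\<exists>S. ((\<lambda>p. (norm (Z (fst p) (snd p)))\<^sup>2) has_sum S) (UNIV :: (nat \<times> nat) set) \<and> S \<le> s"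
    if Z: "\<And>m. ((\<lambda>k. (norm (Z m k))\<^sup>2) has_sum C m) UNIV" "\<And>m. C m \<le> c m" for Z :: "nat \<Rightarrow> nat \<Rightarrow> 'a" and C
  proof -
    have C0: "C m \<ge> 0" for m by (rule has_sum_nonneg[OF Z(1)]) auto
    have cs: "(c has_sum s) UNIV" using c C0 Z(2) by (intro sums_nonneg_imp_has_sum) (auto intro: order_trans)
    have Cs: "C summable_on UNIV"
      by (rule summable_on_comparison_test[of c]) (use cs C0 Z(2) in \<open>auto simp: summable_on_def\<close>)
    have 1: "(\<lambda>p. (norm (Z (fst p) (snd p)))\<^sup>2) summable_on (Sigma UNIV (\<lambda>_. UNIV))"
      by (rule summable_on_SigmaI[where g = C]) (use Z Cs in auto)
    have "((\<lambda>p. (norm (Z (fst p) (snd p)))\<^sup>2) has_sum infsum C UNIV) (Sigma UNIV (\<lambda>_. UNIV))"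
      by (rule has_sum_SigmaI[where g = C]) (use Z Cs 1 in auto)
    moreover have "infsum C UNIV \<le> s"
      using has_sum_mono[OF has_sum_infsum[OF Cs] cs] Z(2) by auto
    ultimately show ?thesis by auto
  qed
  obtain SX where SX: "((\<lambda>p. (norm (X (fst p) (snd p)))\<^sup>2) has_sum SX) UNIV" "SX \<le> s"
    using tot[OF X] by blast
  obtain SY where SY: "((\<lambda>p. (norm (Y (fst p) (snd p)))\<^sup>2) has_sum SY) UNIV" "SY \<le> s"
    using tot[OF Y] by blast
  have XYs: "((\<lambda>p. cinner (X (fst p) (snd p)) (T (Y (fst p) (snd p)))) has_sum \<omega>' T) UNIV" if T: "T \<in> bops" for T
  proof -
    have "(\<lambda>p. cinner (X (fst p) (snd p)) (T (Y (fst p) (snd p)))) summable_on UNIV"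
      by (rule Infinite_Sum.abs_summable_summable[OF abs_summable_cinner[of "\<lambda>p. X (fst p) (snd p)" "\<lambda>p. Y (fst p) (snd p)" T]])
        (use SX SY T in \<open>auto simp: summable_on_def\<close>)
    then obtain S where S: "((\<lambda>p. cinner (X (fst p) (snd p)) (T (Y (fst p) (snd p)))) has_sum S) (Sigma UNIV (\<lambda>_. UNIV))"
      by (auto simp: summable_on_def)
    have "((\<lambda>m. \<omega> m T) has_sum S) UNIV" by (rule has_sum_SigmaD[OF S]) (use XY T in auto)
    then have "(\<lambda>m. \<omega> m T) sums S" by (rule has_sum_imp_sums)
    then have "S = \<omega>' T" using sums[OF T] sums_unique2 by blast
    then show ?thesis using S by simp
  qed
  have bij: "bij_betw prod_decode UNIV (UNIV :: (nat \<times> nat) set)" by (rule bij_prod_decode)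
  define X' Y' where "X' n = X (fst (prod_decode n)) (snd (prod_decode n))"
    and "Y' n = Y (fst (prod_decode n)) (snd (prod_decode n))" for n
  have "((\<lambda>n. (norm (X' n))\<^sup>2) has_sum SX) UNIV" "((\<lambda>n. (norm (Y' n))\<^sup>2) has_sum SY) UNIV"
    "\<And>T. T \<in> bops \<Longrightarrow> ((\<lambda>n. cinner (X' n) (T (Y' n))) has_sum \<omega>' T) UNIV"
    unfolding X'_def Y'_def
    using has_sum_reindex_bij_betw[OF bij, THEN iffD2, OF SX(1)] has_sum_reindex_bij_betw[OF bij, THEN iffD2, OF SY(1)]
      has_sum_reindex_bij_betw[OF bij, THEN iffD2, OF XYs] by auto
  then show ?thesis unfolding nuclear_rep_def using SX(2) SY(2) by blast
qed

text \<open>Scaling \<open>X\<close> by \<open>r\<close> and \<open>Y\<close> by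
  \<open>1 / r\<close> does not affect \<open>\<omega>\<close>, so the two square sums can be
  balanced. The product form of the constant matters later: a small vector on one side alone must
  already give a small constant.\<close>

lemma nuclear_rep_finite:
  fixes X Y :: "nat \<Rightarrow> 'a::complex_hilbert"
  assumes X: "(\<Sum>k<m. (norm (X k))\<^sup>2) \<le> \<alpha>\<^sup>2" and Y: "(\<Sum>k<m. (norm (Y k))\<^sup>2) \<le> \<beta>\<^sup>2" and nn: "0 \<le> \<alpha>" "0 \<le> \<beta>"
    and \<omega>: "\<And>T. T \<in> bops \<Longrightarrow> \<omega> T = (\<Sum>k<m. cinner (X k) (T (Y k)))"
  shows "nuclear_rep (\<alpha> * \<beta>) \<omega>"
proof -
  have fin: "nuclear_rep c \<omega>" if le: "(\<Sum>k<m. (norm (X' k))\<^sup>2) \<le> c" "(\<Sum>k<m. (norm (Y' k))\<^sup>2) \<le> c"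
    and \<omega>': "\<And>T. T \<in> bops \<Longrightarrow> \<omega> T = (\<Sum>k<m. cinner (X' k) (T (Y' k)))" for X' Y' :: "nat \<Rightarrow> 'a" and c
  proof -
    define X2 Y2 where "X2 k = (if k < m then X' k else 0)" and "Y2 k = (if k < m then Y' k else 0)" for k
    have hs: "(f has_sum (\<Sum>k<m. f k)) UNIV" if "\<And>k. k \<ge> m \<Longrightarrow> f k = 0" for f :: "nat \<Rightarrow> 'z::real_normed_vector"
      by (rule has_sum_finite_neutralI[of "{..<m}"]) (use that in auto)
    have 1: "((\<lambda>k. (norm (X2 k))\<^sup>2) has_sum (\<Sum>k<m. (norm (X' k))\<^sup>2)) UNIV"
      using hs[of "\<lambda>k. (norm (X2 k))\<^sup>2"] by (simp add: X2_def)
    have 2: "((\<lambda>k. (norm (Y2 k))\<^sup>2) has_sum (\<Sum>k<m. (norm (Y' k))\<^sup>2)) UNIV"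
      using hs[of "\<lambda>k. (norm (Y2 k))\<^sup>2"] by (simp add: Y2_def)
    have 3: "((\<lambda>k. cinner (X2 k) (T (Y2 k))) has_sum \<omega> T) UNIV" if "T \<in> bops" for T
      using hs[of "\<lambda>k. cinner (X2 k) (T (Y2 k))"] \<omega>'[OF that]
      by (simp add: X2_def Y2_def)
    show ?thesis unfolding nuclear_rep_def using 1 2 3 le by blast
  qed
  show ?thesis
  proof (cases "\<alpha> = 0 \<or> \<beta> = 0")
    case True
    have z: "\<omega> T = 0" if T: "T \<in> bops" for T
    proof -
      have "cinner (X k) (T (Y k)) = 0" if k: "k < m" for k
      proof (cases "\<alpha> = 0")
        case True
        then have "(\<Sum>k<m. (norm (X k))\<^sup>2) = 0" using X by (simp add: antisym sum_nonneg)
        then have "X k = 0" using k by (simp add: sum_nonneg_eq_0_iff)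
        then show ?thesis by simp
      next
        case False
        then have "(\<Sum>k<m. (norm (Y k))\<^sup>2) = 0" using Y True by (simp add: antisym sum_nonneg)
        then have "Y k = 0" using k by (simp add: sum_nonneg_eq_0_iff)
        then show ?thesis using bopsD[OF T] by simp
      qed
      then show ?thesis using \<omega>[OF T] by simp
    qed
    show ?thesis
      by (rule fin[of "\<lambda>_. 0" _ "\<lambda>_. 0"]) (use True z in auto)
  next
    case False
    then have pos: "\<alpha> > 0" "\<beta> > 0" using nn by auto
    \<comment> \<open>The value at which \<open>r\<^sup>2 * \<alpha>\<^sup>2\<close> and
      \<open>(1 / r)\<^sup>2 * \<beta>\<^sup>2\<close> are both equal to
      \<open>\<alpha> * \<beta>\<close>.\<close>
    define r where "r = sqrt (\<beta> / \<alpha>)"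
    have r: "r > 0" "r\<^sup>2 = \<beta> / \<alpha>" using pos by (auto simp: r_def)
    show ?thesis
    proof (rule fin[of "\<lambda>k. r *\<^sub>R X k" _ "\<lambda>k. (1 / r) *\<^sub>R Y k"])
      have "(\<Sum>k<m. (norm (r *\<^sub>R X k))\<^sup>2) = r\<^sup>2 * (\<Sum>k<m. (norm (X k))\<^sup>2)"
        by (simp add: power_mult_distrib sum_distrib_left)
      also have "\<dots> \<le> r\<^sup>2 * \<alpha>\<^sup>2" by (intro mult_left_mono X) auto
      also have "\<dots> = \<alpha> * \<beta>" unfolding r(2) using pos by (simp add: power2_eq_square)
      finally show "(\<Sum>k<m. (norm (r *\<^sub>R X k))\<^sup>2) \<le> \<alpha> * \<beta>" .
      have "(\<Sum>k<m. (norm ((1 / r) *\<^sub>R Y k))\<^sup>2) = (1 / r)\<^sup>2 * (\<Sum>k<m. (norm (Y k))\<^sup>2)"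
        by (simp add: power_mult_distrib power_divide sum_divide_distrib)
      also have "\<dots> \<le> (1 / r)\<^sup>2 * \<beta>\<^sup>2" by (intro mult_left_mono Y) auto
      also have "\<dots> = \<alpha> * \<beta>" unfolding power_divide r(2) using pos by (simp add: power2_eq_square)
      finally show "(\<Sum>k<m. (norm ((1 / r) *\<^sub>R Y k))\<^sup>2) \<le> \<alpha> * \<beta>" .
      fix T :: "'a \<Rightarrow> 'a" assume T: "T \<in> bops"
      have "cinner (r *\<^sub>R X k) (T ((1 / r) *\<^sub>R Y k)) = cinner (X k) (T (Y k))" for k
        using r(1) by (simp add: scaleC_of_real[symmetric] bounded_clinear_scaleC[OF bopsD[OF T]]
            cinner_scaleC_left cinner_scaleC_right)
      then show "\<omega> T = (\<Sum>k<m. cinner (r *\<^sub>R X k) (T ((1 / r) *\<^sub>R Y k)))" using \<omega>[OF T] by simp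
    qed
  qed
qed

lemma nuclear_rep_imp_normal:
  assumes "nuclear_rep c \<omega>"
  shows "\<exists>\<omega>'\<in>normal_functionals. \<forall>T\<in>bops. \<omega> T = \<omega>' T"
proof -
  obtain X Y A B where 1: "((\<lambda>k. (norm (X k))\<^sup>2) has_sum A) UNIV" "((\<lambda>k. (norm (Y k))\<^sup>2) has_sum B) UNIV"
    "\<And>T. T \<in> bops \<Longrightarrow> ((\<lambda>k. cinner (X k) (T (Y k))) has_sum \<omega> T) (UNIV :: nat set)"
    using assms unfolding nuclear_rep_def by blast
  have "summable (\<lambda>n. (norm (X n))\<^sup>2)" "summable (\<lambda>n. (norm (Y n))\<^sup>2)"
    by (rule sums_summable[OF has_sum_imp_sums[OF 1(1)]], rule sums_summable[OF has_sum_imp_sums[OF 1(2)]])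
  then have 2: "(\<lambda>T. \<Sum>n. cinner (X n) (T (Y n))) \<in> normal_functionals"
    unfolding normal_functionals_def by blast
  have "\<omega> T = (\<Sum>n. cinner (X n) (T (Y n)))" if "T \<in> bops" for T
    using has_sum_imp_sums[OF 1(3)[OF that]] by (simp add: sums_iff)
  then show ?thesis by (intro bexI[OF _ 2] ballI)
qed

text \<open>A sequence approaching \<open>x\<close> at geometric speed is telescoped. The terms lie
  in \<open>K\<close> itself, not merely in its closure, and the bounds on their norms add up to
  \<open>4 * norm x\<close>, the origin of the factors 4 in the bounds on functionals below.\<close>

lemma closure_series:
  fixes x :: "'a::complex_hilbert"
  assumes K: "csubspace K" and x: "x \<in> closure K"
  shows "\<exists>u. (\<forall>n. u n \<in> K \<and> norm (u n) \<le> 2 * (1/2) ^ n * norm x) \<and> u sums x"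
proof (cases "x = 0")
  case True
  then show ?thesis using complex_hilbert.subspace_0[OF K] by (intro exI[of _ "\<lambda>_. 0"]) auto
next
  case False
  have "\<exists>v\<in>K. norm (v - x) < (1/2) ^ n * norm x" for n
    using x False unfolding closure_approachable dist_norm by simp
  then obtain w where w: "\<And>n. w n \<in> K" "\<And>n. norm (w n - x) < (1/2) ^ n * norm x" by metis
  \<comment> \<open>Starting from 0 makes the telescoping series sum to \<open>x\<close> itself; the
    error bound at index 0 still holds, with equality.\<close>
  define v where "v n = (if n = 0 then 0 else w n)" for n
  have v: "v n \<in> K" "norm (v n - x) \<le> (1/2) ^ n * norm x" for n
    using w[of n] complex_hilbert.subspace_0[OF K] by (auto simp: v_def less_imp_le)
  have lim: "v \<longlonglongrightarrow> x"
  proof (rule Lim_transform_bound[of "\<lambda>n. v n - x" "\<lambda>n. (1/2) ^ n * norm x" sequentially, THEN Lim_null[THEN iffD2]])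
    show "\<forall>\<^sub>F n in sequentially. norm (v n - x) \<le> norm ((1/2) ^ n * norm x)" using v by simp
    show "(\<lambda>n. (1/2) ^ n * norm x) \<longlonglongrightarrow> 0"
      by (intro tendsto_mult_left_zero LIMSEQ_realpow_zero) auto
  qed
  have "(\<lambda>n. v (Suc n) - v n) sums x" using telescope_sums[OF lim] by (simp add: v_def)
  moreover have "v (Suc n) - v n \<in> K" for n using v K complex_hilbert.subspace_diff by blast
  moreover have "norm (v (Suc n) - v n) \<le> 2 * (1/2) ^ n * norm x" for n
  proof -
    have "norm (v (Suc n) - v n) \<le> norm (v (Suc n) - x) + norm (v n - x)"
      using norm_triangle_ineq4[of "v (Suc n) - x" "v n - x"] by simp
    also have "\<dots> \<le> (1/2) ^ Suc n * norm x + (1/2) ^ n * norm x" by (intro add_mono v)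
    also have "\<dots> \<le> 2 * (1/2) ^ n * norm x" by simp
    finally show ?thesis .
  qed
  ultimately show ?thesis by (intro exI[of _ "\<lambda>n. v (Suc n) - v n"]) auto
qed

lemma sums_cinner_left:
  assumes "u sums x" shows "(\<lambda>n. cinner (u n) y) sums cinner x y"
  using assms unfolding sums_def
  by (simp only: cinner_sum_left[symmetric]) (intro tendsto_intros)

text \<open>For vectors in the algebraic span the Gram factorisation writes the functional as a
  finite sum of matrix elements. The same factorisation without \<open>T\<close> shows that the two
  square sums are exactly the squared norms of \<open>u\<close> and \<open>u'\<close>.\<close>

lemma nuclear_rep_endo_of_span:
  fixes J :: "'i \<Rightarrow> 'a::complex_hilbert \<Rightarrow> 'a"
  assumes J: "intertwiners I a J" and u: "u \<in> cspan {J i x | i x. i \<in> I}" "u' \<in> cspan {J i x | i x. i \<in> I}"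
  shows "nuclear_rep (norm u * norm u') (\<lambda>T. cinner u (endo_of I J T u'))"
proof -
  let ?B = "{J i x | i x. i \<in> I}"
  obtain ind arg where ia: "\<And>b. b \<in> ?B \<Longrightarrow> ind b \<in> I \<and> b = J (ind b) (arg b)"
  proof -
    have "\<forall>b\<in>?B. \<exists>i. \<exists>x. i \<in> I \<and> b = J i x" by blast
    from bchoice[OF this] obtain ind where "\<forall>b\<in>?B. \<exists>x. ind b \<in> I \<and> b = J (ind b) x" by blast
    from bchoice[OF this] show ?thesis using that by blast
  qed
  \<comment> \<open>The representation is claimed for every larger finite index set, with zero
    arguments at the new indices, so that \<open>u\<close> and \<open>u'\<close> can afterwards
    share a common set.\<close>
  have rep: "\<exists>F y. finite F \<and> F \<subseteq> ?B \<and> (\<forall>G. F \<subseteq> G \<longrightarrow> finite G \<longrightarrow> G \<subseteq> ?B \<longrightarrow> w = (\<Sum>b\<in>G. J (ind b) (y b)))"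
    if w: "w \<in> cspan ?B" for w
  proof -
    obtain F r where F: "finite F" "F \<subseteq> ?B" "w = (\<Sum>b\<in>F. r b *\<^sub>C b)"
      using w unfolding complex_hilbert.span_explicit by blast
    have "w = (\<Sum>b\<in>G. J (ind b) (if b \<in> F then r b *\<^sub>C arg b else 0))" if G: "F \<subseteq> G" "finite G" "G \<subseteq> ?B" for G
    proof -
      have b: "bounded_clinear (J (ind b))" if "b \<in> ?B" for b
        using ia[OF that] intertwinersD(1)[OF J] bopsD by blast
      have "r b *\<^sub>C b = J (ind b) (if b \<in> F then r b *\<^sub>C arg b else 0)" if "b \<in> F" for b
      proof -
        have "b \<in> ?B" using that F by blast
        then show ?thesis using that ia[of b] b[of b] by (simp add: bounded_clinear_scaleC)
      qed
      then have "w = (\<Sum>b\<in>F. J (ind b) (if b \<in> F then r b *\<^sub>C arg b else 0))"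
        unfolding F(3) by (intro sum.cong refl)
      also have "\<dots> = (\<Sum>b\<in>G. J (ind b) (if b \<in> F then r b *\<^sub>C arg b else 0))"
      proof (rule sum.mono_neutral_left)
        show "\<forall>i\<in>G - F. J (ind i) (if i \<in> F then r i *\<^sub>C arg i else 0) = 0"
        proof
          fix i assume "i \<in> G - F"
          then have "i \<in> ?B" "i \<notin> F" using G by auto
          then show "J (ind i) (if i \<in> F then r i *\<^sub>C arg i else 0) = 0" using b[of i] by simp
        qed
      qed (use G in auto)
      finally show ?thesis .
    qed
    then show ?thesis using F by (intro exI[of _ F] exI[of _ "\<lambda>b. if b \<in> F then r b *\<^sub>C arg b else 0"]) blast
  qed
  obtain F1 y where F1: "finite F1" "F1 \<subseteq> ?B"
    "\<And>G. F1 \<subseteq> G \<Longrightarrow> finite G \<Longrightarrow> G \<subseteq> ?B \<Longrightarrow> u = (\<Sum>b\<in>G. J (ind b) (y b))" using rep[OF u(1)] by blast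
  obtain F2 z where F2: "finite F2" "F2 \<subseteq> ?B"
    "\<And>G. F2 \<subseteq> G \<Longrightarrow> finite G \<Longrightarrow> G \<subseteq> ?B \<Longrightarrow> u' = (\<Sum>b\<in>G. J (ind b) (z b))" using rep[OF u(2)] by blast
  define F where "F = F1 \<union> F2"
  have F: "finite F" "F \<subseteq> ?B" using F1 F2 by (auto simp: F_def)
  have uF: "u = (\<Sum>b\<in>F. J (ind b) (y b))" "u' = (\<Sum>b\<in>F. J (ind b) (z b))"
    using F1(3)[of F] F2(3)[of F] F by (auto simp: F_def)
  have indI: "ind b \<in> I" if "b \<in> F" for b using ia F that by blast
  obtain m c where c: "\<And>p q. p \<in> F \<Longrightarrow> q \<in> F \<Longrightarrow> cinner (a (ind p)) (a (ind q)) = (\<Sum>k<(m::nat). cnj (c p k) * c q k)"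
    using gram_factorization[OF F(1), of "\<lambda>p. a (ind p)"] by blast
  have inner: "cinner (\<Sum>b\<in>F. J (ind b) (p b)) (\<Sum>b\<in>F. J (ind b) (q b)) =
     (\<Sum>k<m. cinner (\<Sum>b\<in>F. c b k *\<^sub>C p b) (\<Sum>b\<in>F. c b k *\<^sub>C q b))" for p q
  proof -
    have "cinner (\<Sum>b\<in>F. J (ind b) (p b)) (\<Sum>b\<in>F. J (ind b) (q b)) =
        (\<Sum>b\<in>F. \<Sum>d\<in>F. cinner (a (ind b)) (a (ind d)) * cinner (p b) (q d))"
      unfolding cinner_sum_left unfolding cinner_sum_right
      by (intro sum.cong refl intertwinersD(2)[OF J] indI)
    also have "\<dots> = (\<Sum>k<m. cinner (\<Sum>b\<in>F. c b k *\<^sub>C p b) (\<Sum>b\<in>F. c b k *\<^sub>C q b))"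
      by (rule gram_sum) (rule c)
    finally show ?thesis .
  qed
  show ?thesis
  proof (rule nuclear_rep_finite[of "\<lambda>k. \<Sum>b\<in>F. c b k *\<^sub>C y b" m _ "\<lambda>k. \<Sum>b\<in>F. c b k *\<^sub>C z b"])
    show "(\<Sum>k<m. (norm (\<Sum>b\<in>F. c b k *\<^sub>C y b))\<^sup>2) \<le> (norm u)\<^sup>2"
      using inner[of y y] by (simp add: norm_sq_cinner uF)
    show "(\<Sum>k<m. (norm (\<Sum>b\<in>F. c b k *\<^sub>C z b))\<^sup>2) \<le> (norm u')\<^sup>2"
      using inner[of z z] by (simp add: norm_sq_cinner uF)
    fix T :: "'a \<Rightarrow> 'a" assume T: "T \<in> bops"
    have "endo_of I J T u' = (\<Sum>b\<in>F. J (ind b) (T (z b)))"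
      using indI unfolding uF(2) bounded_clinear_sum[OF bopsD[OF endo_of_bops[OF J T]]]
      by (intro sum.cong refl endo_of_apply[OF J T])
    then show "cinner u (endo_of I J T u') =
      (\<Sum>k<m. cinner (\<Sum>b\<in>F. c b k *\<^sub>C y b) (T (\<Sum>b\<in>F. c b k *\<^sub>C z b)))"
      using inner[of y "\<lambda>b. T (z b)"]
      by (simp add: uF bounded_clinear_sum[OF bopsD[OF T]] bounded_clinear_scaleC[OF bopsD[OF T]])
  qed auto
qed

text \<open>Both vectors are expanded in turn into geometric series from the algebraic span; each
  expansion costs a factor 4, whence 16.\<close>

lemma nuclear_rep_endo_of:
  fixes J :: "'i \<Rightarrow> 'a::complex_hilbert \<Rightarrow> 'a"
  assumes J: "intertwiners I a J"
  shows "nuclear_rep (16 * norm x * norm y) (\<lambda>T. cinner x (endo_of I J T y))"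
proof -
  let ?K = "cspan {J i x | i x. i \<in> I}"
  have cl: "z \<in> closure ?K" for z using intertwinersD(3)[OF J] by simp
  have geo: "(\<lambda>n. 2 * (1/2) ^ n * r) sums (4 * r)" for r :: real
    using sums_mult2[OF sums_mult[OF geometric_sums[of "1/2::real"], of 2], of r] by simp
  have 1: "nuclear_rep (4 * norm y * norm u) (\<lambda>T. cinner u (endo_of I J T y))" if u: "u \<in> ?K" for u
  proof -
    obtain w where w: "\<And>n. w n \<in> ?K" "\<And>n. norm (w n) \<le> 2 * (1/2) ^ n * norm y" "w sums y"
      using closure_series[OF csubspace_cspan cl[of y]] by blast
    show ?thesis
    proof (rule nuclear_rep_sums[where \<omega> = "\<lambda>m T. cinner u (endo_of I J T (w m))"])
      show "nuclear_rep (2 * (1/2) ^ m * (norm y * norm u)) (\<lambda>T. cinner u (endo_of I J T (w m)))" for m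
      proof (rule nuclear_rep_mono[OF nuclear_rep_endo_of_span[OF J u w(1)]])
        have "norm u * norm (w m) \<le> norm u * (2 * (1/2) ^ m * norm y)" by (intro mult_left_mono w) auto
        then show "norm u * norm (w m) \<le> 2 * (1/2) ^ m * (norm y * norm u)" by (simp add: mult_ac)
      qed
      show "(\<lambda>m. 2 * (1/2) ^ m * (norm y * norm u)) sums (4 * norm y * norm u)"
        using geo[of "norm y * norm u"] by (simp add: mult.assoc)
      show "(\<lambda>m. cinner u (endo_of I J T (w m))) sums cinner u (endo_of I J T y)" if "T \<in> bops" for T
        by (rule sums_cinner_right[OF bounded_clinear_sums[OF bopsD[OF endo_of_bops[OF J that]] w(3)]])
    qed
  qed
  obtain w where w: "\<And>n. w n \<in> ?K" "\<And>n. norm (w n) \<le> 2 * (1/2) ^ n * norm x" "w sums x"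
    using closure_series[OF csubspace_cspan cl[of x]] by blast
  show ?thesis
  proof (rule nuclear_rep_sums[where \<omega> = "\<lambda>m T. cinner (w m) (endo_of I J T y)"])
    show "nuclear_rep (2 * (1/2) ^ m * (4 * norm x * norm y)) (\<lambda>T. cinner (w m) (endo_of I J T y))" for m
    proof (rule nuclear_rep_mono[OF 1[OF w(1)]])
      have "4 * norm y * norm (w m) \<le> 4 * norm y * (2 * (1/2) ^ m * norm x)" by (intro mult_left_mono w) auto
      then show "4 * norm y * norm (w m) \<le> 2 * (1/2) ^ m * (4 * norm x * norm y)" by (simp add: mult_ac)
    qed
    show "(\<lambda>m. 2 * (1/2) ^ m * (4 * norm x * norm y)) sums (16 * norm x * norm y)"
      using geo[of "4 * norm x * norm y"] by (simp add: mult.assoc)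
    show "(\<lambda>m. cinner (w m) (endo_of I J T y)) sums cinner x (endo_of I J T y)" for T
      by (rule sums_cinner_left[OF w(3)])
  qed
qed

text \<open>The bounds for the single terms are proportional to
  \<open>norm (x n) * norm (y n)\<close>, hence summable for square-summable families. This is the
  purpose of keeping an explicit constant in \<open>nuclear_rep\<close>.\<close>

lemma normal_endo_of:
  fixes J :: "'i \<Rightarrow> 'a::complex_hilbert \<Rightarrow> 'a"
  assumes J: "intertwiners I a J" and \<omega>: "\<omega> \<in> normal_functionals"
  shows "\<exists>\<omega>'\<in>normal_functionals. \<forall>T\<in>bops. \<omega> (endo_of I J T) = \<omega>' T"
proof -
  obtain x y where \<omega>_eq: "\<omega> = (\<lambda>T. \<Sum>n. cinner (x n) (T (y n)))"
    and s: "summable (\<lambda>n. (norm (x n))\<^sup>2)" "summable (\<lambda>n. (norm (y n))\<^sup>2)"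
    using \<omega> unfolding normal_functionals_def by blast
  note sxy = summable_norm_mult[OF s]
  have "nuclear_rep (\<Sum>n. 16 * norm (x n) * norm (y n)) (\<lambda>T. \<omega> (endo_of I J T))"
  proof (rule nuclear_rep_sums[where \<omega> = "\<lambda>n T. cinner (x n) (endo_of I J T (y n))"])
    show "nuclear_rep (16 * norm (x n) * norm (y n)) (\<lambda>T. cinner (x n) (endo_of I J T (y n)))" for n
      by (rule nuclear_rep_endo_of[OF J])
    show "(\<lambda>n. 16 * norm (x n) * norm (y n)) sums (\<Sum>n. 16 * norm (x n) * norm (y n))"
      using summable_mult[OF sxy, of 16] by (simp add: mult.assoc summable_sums)
    fix T :: "'a \<Rightarrow> 'a" assume T: "T \<in> bops"
    have "(\<lambda>n. (norm (x n))\<^sup>2) summable_on UNIV" "(\<lambda>n. (norm (y n))\<^sup>2) summable_on UNIV"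
      using s by (simp_all add: summable_on_UNIV_nonneg_real_iff)
    from Infinite_Sum.abs_summable_summable[OF abs_summable_cinner[OF this endo_of_bops[OF J T]]]
    show "(\<lambda>n. cinner (x n) (endo_of I J T (y n))) sums \<omega> (endo_of I J T)"
      unfolding \<omega>_eq by (rule summable_sums[OF summable_on_imp_summable])
  qed
  then show ?thesis by (rule nuclear_rep_imp_normal)
qed

lemma normal_unital_star_endo_endo_of:
  fixes J :: "'i \<Rightarrow> 'a::complex_hilbert \<Rightarrow> 'a"
  assumes J: "intertwiners I a J"
  shows "normal_unital_star_endo (endo_of I J)"
  unfolding normal_unital_star_endo_def
proof (intro conjI ballI allI)
  fix T :: "'a \<Rightarrow> 'a" assume T: "T \<in> bops"
  note bJ = bopsD[OF intertwinersD(1)[OF J]]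
  show "endo_of I J T \<in> bops" by (rule endo_of_bops[OF J T])
  show "endo_of I J (\<lambda>x. c *\<^sub>C T x) = (\<lambda>x. c *\<^sub>C endo_of I J T x)" for c
    by (rule endo_of_eqI[OF J])
      (use endo_of_bops[OF J T] in \<open>auto simp: endo_of_apply[OF J T] bounded_clinear_scaleC[OF bJ]\<close>)
  show "endo_of I J (cadj T) = cadj (endo_of I J T)" by (rule endo_of_cadj[OF J T])
  fix U :: "'a \<Rightarrow> 'a" assume U: "U \<in> bops"
  show "endo_of I J (\<lambda>x. T x + U x) = (\<lambda>x. endo_of I J T x + endo_of I J U x)"
    by (rule endo_of_eqI[OF J])
      (use endo_of_bops[OF J T] endo_of_bops[OF J U] in
        \<open>auto simp: endo_of_apply[OF J T] endo_of_apply[OF J U] bounded_clinear_add[OF bJ]\<close>)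
  show "endo_of I J (T \<circ> U) = endo_of I J T \<circ> endo_of I J U"
    by (rule endo_of_eqI[OF J])
      (use endo_of_bops[OF J T] endo_of_bops[OF J U] in
        \<open>auto simp: endo_of_apply[OF J T] endo_of_apply[OF J U]\<close>)
next
  show "endo_of I J id = id" by (rule endo_of_eqI[OF J]) auto
qed (rule normal_endo_of[OF J])

text \<open>On rank-one operators a normal functional is a bounded sesquilinear form in
  \<open>w\<close> and \<open>z\<close>. Representing it by a vector in each variable separately
  lets an equality on a total set extend to all vectors, one variable at a time.\<close>

lemma normal_functional_rank_one:
  fixes x y :: "nat \<Rightarrow> 'a::complex_hilbert"
  assumes "summable (\<lambda>n. (norm (x n))\<^sup>2)" "summable (\<lambda>n. (norm (y n))\<^sup>2)"
  shows "\<exists>v. \<forall>z. (\<lambda>n. cinner (x n) (cinner w (y n) *\<^sub>C z)) sums cinner v z"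
    and "\<exists>v. \<forall>w. (\<lambda>n. cinner (x n) (cinner w (y n) *\<^sub>C z)) sums cinner w v"
proof -
  have sxy: "summable (\<lambda>n. r * (norm (x n) * norm (y n)))" for r
    by (rule summable_mult[OF summable_norm_mult[OF assms]])
  have "summable (\<lambda>n. cnj (cinner w (y n)) *\<^sub>C x n)"
  proof (rule summable_comparison_test'[OF sxy[of "norm w"], of 0])
    show "norm (cnj (cinner w (y n)) *\<^sub>C x n) \<le> norm w * (norm (x n) * norm (y n))" for n
      using mult_right_mono[OF cinner_Cauchy_Schwarz[of w "y n"], of "norm (x n)"] by (simp add: mult_ac)
  qed
  from sums_cinner_left[OF summable_sums[OF this]]
  show "\<exists>v. \<forall>z. (\<lambda>n. cinner (x n) (cinner w (y n) *\<^sub>C z)) sums cinner v z"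
    by (auto simp: cinner_scaleC_left cinner_scaleC_right)
  have "summable (\<lambda>n. cinner (x n) z *\<^sub>C y n)"
  proof (rule summable_comparison_test'[OF sxy[of "norm z"], of 0])
    show "norm (cinner (x n) z *\<^sub>C y n) \<le> norm z * (norm (x n) * norm (y n))" for n
      using mult_right_mono[OF cinner_Cauchy_Schwarz[of "x n" z], of "norm (y n)"] by (simp add: mult_ac)
  qed
  from sums_cinner_right[OF summable_sums[OF this]]
  show "\<exists>v. \<forall>w. (\<lambda>n. cinner (x n) (cinner w (y n) *\<^sub>C z)) sums cinner w v"
    by (auto simp: cinner_scaleC_right mult.commute)
qed

lemma bops_rank_one [intro, simp]: "(\<lambda>x. cinner w x *\<^sub>C z) \<in> bops"
proof (intro bopsI bounded_clinearI)
  show "norm (cinner w x *\<^sub>C z) \<le> norm w * norm z * norm x" for x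
    using mult_right_mono[OF cinner_Cauchy_Schwarz[of w x], of "norm z"] by (simp add: mult_ac)
qed (auto simp: cinner_add_right cinner_scaleC_right scaleC_add_left scaleC_scaleC)

text \<open>Composing \<open>T\<close> with the projection onto the span of finitely many of the vectors defining a
  normal functional changes its value only by a tail of an absolutely convergent series.\<close>

lemma normal_functional_finite_rank_approx:
  fixes x y :: "nat \<Rightarrow> 'a::complex_hilbert" and e :: "nat \<Rightarrow> 'a"
  assumes s: "summable (\<lambda>n. (norm (x n))\<^sup>2)" "summable (\<lambda>n. (norm (y n))\<^sup>2)" and T: "T \<in> bops"
    and on: "\<And>k l. k < M \<Longrightarrow> l < M \<Longrightarrow> cinner (e k) (e l) = (if k = l then 1 else 0)"
    and y: "\<And>n. n < N \<Longrightarrow> y n = (\<Sum>k<M. cinner (e k) (y n) *\<^sub>C e k)"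
  shows "cmod ((\<Sum>n. cinner (x n) (T (y n))) - (\<Sum>k<M. \<Sum>n. cinner (x n) (cinner (e k) (y n) *\<^sub>C T (e k)))) \<le>
    (\<Sum>n. 2 * onorm T * (norm (x (n + N)) * norm (y (n + N))))"
proof -
  define R where "R v = (\<Sum>k<M. cinner (e k) v *\<^sub>C e k)" for v
  have Rb: "norm (R v) \<le> norm v" for v
  proof -
    have "cinner (R v) (R v) = cinner (R v) v"
      unfolding R_def cinner_sum_left cinner_sum_right
      by (intro sum.cong refl)
        (simp add: cinner_scaleC_left cinner_scaleC_right on if_distrib cong: if_cong)
    then have "(norm (R v))\<^sup>2 \<le> norm (R v) * norm v"
      using cinner_Cauchy_Schwarz[of "R v" v] complex_Re_le_cmod[of "cinner (R v) v"] by (simp add: norm_sq_cinner)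
    then show ?thesis by (cases "R v = 0") (auto simp: power2_eq_square)
  qed
  note sxy = summable_norm_mult[OF s]
  have sn: "(\<lambda>n. (norm (x n))\<^sup>2) summable_on UNIV" "(\<lambda>n. (norm (y n))\<^sup>2) summable_on UNIV"
    using s by (simp_all add: summable_on_UNIV_nonneg_real_iff)
  have sm: "summable (\<lambda>n. cinner (x n) (U (y n)))" if "U \<in> bops" for U
    by (rule summable_on_imp_summable[OF Infinite_Sum.abs_summable_summable[OF abs_summable_cinner[OF sn that]]])
  have TR: "(\<Sum>k<M. cinner (e k) v *\<^sub>C T (e k)) = T (R v)" for v
    by (simp add: R_def bounded_clinear_sum[OF bopsD[OF T]] bounded_clinear_scaleC[OF bopsD[OF T]])
  have "(\<Sum>k<M. \<Sum>n. cinner (x n) (cinner (e k) (y n) *\<^sub>C T (e k))) = (\<Sum>n. \<Sum>k<M. cinner (x n) (cinner (e k) (y n) *\<^sub>C T (e k)))"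
    by (rule suminf_sum[symmetric]) (rule sm, simp)
  also have "\<dots> = (\<Sum>n. cinner (x n) (T (R (y n))))" by (simp add: cinner_sum_right[symmetric] TR)
  finally have eq1: "(\<Sum>k<M. \<Sum>n. cinner (x n) (cinner (e k) (y n) *\<^sub>C T (e k))) = (\<Sum>n. cinner (x n) (T (R (y n))))" .
  have TRb: "(\<lambda>v. T (R v)) \<in> bops"
    unfolding TR[symmetric] by (intro bops_sum bops_rank_one)
  define g where "g n = cinner (x n) (T (y n)) - cinner (x n) (T (R (y n)))" for n
  have g0: "g n = 0" if "n < N" for n using y[OF that] by (simp add: g_def R_def[symmetric])
  have sg: "summable g" unfolding g_def by (intro summable_diff sm T TRb)
  have "(\<Sum>n. cinner (x n) (T (y n))) - (\<Sum>n. cinner (x n) (T (R (y n)))) = suminf g"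
    unfolding g_def by (rule suminf_diff[OF sm[OF T] sm[OF TRb]])
  also have "\<dots> = (\<Sum>n. g (n + N)) + (\<Sum>n<N. g n)" by (rule suminf_split_initial_segment[OF sg])
  also have "\<dots> = (\<Sum>n. g (n + N))" using g0 by simp
  finally have eq2: "(\<Sum>n. cinner (x n) (T (y n))) - (\<Sum>n. cinner (x n) (T (R (y n)))) = (\<Sum>n. g (n + N))" .
  have o: "onorm T \<ge> 0" using T by (simp add: bops_def bounded_clinear_bounded_linear onorm_pos_le)
  have gb: "cmod (g n) \<le> 2 * onorm T * (norm (x n) * norm (y n))" for n
  proof -
    have "g n = cinner (x n) (T (y n - R (y n)))"
      by (simp add: g_def cinner_diff_right bounded_clinear_diff[OF bopsD[OF T]])
    then have "cmod (g n) \<le> norm (x n) * norm (T (y n - R (y n)))" by (simp add: cinner_Cauchy_Schwarz)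
    also have "\<dots> \<le> norm (x n) * (onorm T * norm (y n - R (y n)))"
      by (intro mult_left_mono bounded_clinear_bound bopsD T) auto
    \<comment> \<open>The triangle inequality suffices here and accounts for the factor 2 in the
      tail.\<close>
    also have "\<dots> \<le> norm (x n) * (onorm T * (2 * norm (y n)))"
      using norm_triangle_ineq4[of "y n" "R (y n)"] Rb[of "y n"] o
      by (intro mult_left_mono) auto
    finally show ?thesis by (simp add: mult_ac)
  qed
  have s2: "summable (\<lambda>n. 2 * onorm T * (norm (x (n + N)) * norm (y (n + N))))"
    by (intro summable_mult) (use summable_ignore_initial_segment[OF sxy, of N] in simp)
  have s3: "summable (\<lambda>n. cmod (g (n + N)))"
    by (rule summable_comparison_test'[OF s2, of 0]) (simp add: gb)
  have "cmod (\<Sum>n. g (n + N)) \<le> (\<Sum>n. cmod (g (n + N)))" by (rule summable_norm[OF s3])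
  also have "\<dots> \<le> (\<Sum>n. 2 * onorm T * (norm (x (n + N)) * norm (y (n + N))))"
    by (rule suminf_le[OF gb s3 s2])
  finally show ?thesis unfolding eq1 eq2 .
qed

text \<open>Equality spreads from rank-one operators over \<open>W\<close> to all rank-one operators
  and hence to finite sums of them; the tails \<open>r N\<close> of the two defining series control
  what a finite-rank truncation of \<open>T\<close> misses.\<close>

lemma normal_functionals_eqI:
  fixes \<omega> \<omega>' :: "('a::complex_hilbert \<Rightarrow> 'a) \<Rightarrow> complex"
  assumes \<omega>: "\<omega> \<in> normal_functionals" "\<omega>' \<in> normal_functionals"
    and W: "closure (cspan W) = UNIV"
    and eq: "\<And>z w. z \<in> W \<Longrightarrow> w \<in> W \<Longrightarrow> \<omega> (\<lambda>x. cinner w x *\<^sub>C z) = \<omega>' (\<lambda>x. cinner w x *\<^sub>C z)"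
    and T: "T \<in> bops"
  shows "\<omega> T = \<omega>' T"
proof -
  obtain x y where \<omega>_eq: "\<omega> = (\<lambda>T. \<Sum>n. cinner (x n) (T (y n)))"
    and s: "summable (\<lambda>n. (norm (x n))\<^sup>2)" "summable (\<lambda>n. (norm (y n))\<^sup>2)"
    using \<omega>(1) unfolding normal_functionals_def by blast
  obtain x' y' where \<omega>'_eq: "\<omega>' = (\<lambda>T. \<Sum>n. cinner (x' n) (T (y' n)))"
    and s': "summable (\<lambda>n. (norm (x' n))\<^sup>2)" "summable (\<lambda>n. (norm (y' n))\<^sup>2)"
    using \<omega>(2) unfolding normal_functionals_def by blast
  have eq1: "\<omega> (\<lambda>x. cinner w x *\<^sub>C z) = \<omega>' (\<lambda>x. cinner w x *\<^sub>C z)" if w: "w \<in> W" for w z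
  proof -
    obtain v where v: "\<And>z. \<omega> (\<lambda>x. cinner w x *\<^sub>C z) = cinner v z"
      using normal_functional_rank_one(1)[OF s] sums_unique unfolding \<omega>_eq by metis
    obtain v' where v': "\<And>z. \<omega>' (\<lambda>x. cinner w x *\<^sub>C z) = cinner v' z"
      using normal_functional_rank_one(1)[OF s'] sums_unique unfolding \<omega>'_eq by metis
    have "v = v'"
    proof (rule eq_if_cinner_eq_total[OF W])
      fix b assume "b \<in> W"
      then have "cinner v b = cinner v' b" using eq[OF _ w] v v' by metis
      then show "cinner b v = cinner b v'" by (metis cinner_commute)
    qed
    then show ?thesis using v v' by simp
  qed
  have eq2: "\<omega> (\<lambda>x. cinner w x *\<^sub>C z) = \<omega>' (\<lambda>x. cinner w x *\<^sub>C z)" for w z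
  proof -
    obtain v where v: "\<And>w. \<omega> (\<lambda>x. cinner w x *\<^sub>C z) = cinner w v"
      using normal_functional_rank_one(2)[OF s] sums_unique unfolding \<omega>_eq by metis
    obtain v' where v': "\<And>w. \<omega>' (\<lambda>x. cinner w x *\<^sub>C z) = cinner w v'"
      using normal_functional_rank_one(2)[OF s'] sums_unique unfolding \<omega>'_eq by metis
    have "v = v'" by (rule eq_if_cinner_eq_total[OF W]) (use eq1 v v' in metis)
    then show ?thesis using v v' by simp
  qed
  define r where "r N = (\<Sum>n. 2 * onorm T * (norm (x (n + N)) * norm (y (n + N)))) +
      (\<Sum>n. 2 * onorm T * (norm (x' (n + N)) * norm (y' (n + N))))" for N
  have le: "cmod (\<omega> T - \<omega>' T) \<le> r N" for N
  proof -
    \<comment> \<open>The orthonormal system is to span initial vectors of both functionals, so that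
      one finite-rank operator approximates both values and its contribution \<open>\<rho>\<close>
      cancels.\<close>
    have fin: "finite (y ` {..<N} \<union> y' ` {..<N})" by simp
    from finite_orthonormal[OF fin] obtain M and e :: "nat \<Rightarrow> 'a" where
      Me: "(\<forall>k<M. \<forall>l<M. cinner (e k) (e l) = (if k = l then 1 else 0)) \<and>
        (\<forall>a\<in>y ` {..<N} \<union> y' ` {..<N}. a = (\<Sum>k<M. cinner (e k) a *\<^sub>C e k))" by (elim exE) (erule that)
    have on: "\<And>k l. k < M \<Longrightarrow> l < M \<Longrightarrow> cinner (e k) (e l) = (if k = l then 1 else 0)"
      using Me[THEN conjunct1] by blast
    have A: "\<And>a. a \<in> y ` {..<N} \<union> y' ` {..<N} \<Longrightarrow> a = (\<Sum>k<M. cinner (e k) a *\<^sub>C e k)"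
      by (rule bspec[OF Me[THEN conjunct2]])
    define \<rho> where "\<rho> = (\<Sum>k<M. \<omega> (\<lambda>x. cinner (e k) x *\<^sub>C T (e k)))"
    have \<rho>': "\<rho> = (\<Sum>k<M. \<omega>' (\<lambda>x. cinner (e k) x *\<^sub>C T (e k)))" unfolding \<rho>_def by (simp add: eq2)
    have "cmod (\<omega> T - \<rho>) \<le> (\<Sum>n. 2 * onorm T * (norm (x (n + N)) * norm (y (n + N))))"
      unfolding \<rho>_def unfolding \<omega>_eq
      by (rule normal_functional_finite_rank_approx[OF s T on], assumption, assumption, rule A, simp)
    moreover have "cmod (\<omega>' T - \<rho>) \<le> (\<Sum>n. 2 * onorm T * (norm (x' (n + N)) * norm (y' (n + N))))"
      unfolding \<rho>' unfolding \<omega>'_eq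
      by (rule normal_functional_finite_rank_approx[OF s' T on], assumption, assumption, rule A, simp)
    moreover have "cmod (\<omega> T - \<omega>' T) \<le> cmod (\<omega> T - \<rho>) + cmod (\<omega>' T - \<rho>)"
      using norm_triangle_ineq4[of "\<omega> T - \<rho>" "\<omega>' T - \<rho>"] by simp
    ultimately show ?thesis unfolding r_def by linarith
  qed
  have tail: "(\<lambda>N. \<Sum>n. 2 * onorm T * (norm (x (n + N)) * norm (y (n + N)))) \<longlonglongrightarrow> 0"
    if "summable (\<lambda>n. (norm (x n))\<^sup>2)" "summable (\<lambda>n. (norm (y n))\<^sup>2)" for x y :: "nat \<Rightarrow> 'a"
    by (rule suminf_exist_split2[OF summable_mult[OF summable_norm_mult[OF that]]])
  have "r \<longlonglongrightarrow> 0 + 0" unfolding r_def by (intro tendsto_add tail s s')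
  then have "cmod (\<omega> T - \<omega>' T) \<le> 0"
    by (intro LIMSEQ_le_const[of r]) (use le in auto)
  then show ?thesis by simp
qed

section \<open>Tensor products and ampliations\<close>

instantiation complex :: complex_hilbert
begin

definition scaleC_complex :: "complex \<Rightarrow> complex \<Rightarrow> complex" where "scaleC_complex c z = c * z"
definition cinner_complex :: "complex \<Rightarrow> complex \<Rightarrow> complex" where "cinner_complex x y = cnj x * y"

instance
proof
  fix x :: complex
  show "cinner x x = complex_of_real ((norm x)\<^sup>2)"
    by (simp add: cinner_complex_def complex_norm_square mult.commute del: of_real_power)
qed (auto simp: scaleC_complex_def cinner_complex_def algebra_simps scaleR_conv_of_real)

end

lemma cinner_eq_on_closure:
  assumes b: "bounded_clinear S" "bounded_clinear T" "bounded_clinear S'" "bounded_clinear T'"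
    and x: "x \<in> closure (cspan B)" and y: "y \<in> closure (cspan B)"
    and eq: "\<And>b c. b \<in> B \<Longrightarrow> c \<in> B \<Longrightarrow> cinner (S b) (T c) = k * cinner (S' b) (T' c)"
  shows "cinner (S x) (T y) = k * cinner (S' x) (T' y)"
proof -
  have 1: "cinner (S b) (T y) = k * cinner (S' b) (T' y)" if b': "b \<in> B" for b
  proof -
    show ?thesis
      using y
    proof (induction rule: closure_cspan_induct)
      case closed
      show ?case
        by (intro closed_Collect_eq continuous_on_mult_left
            bounded_linear.continuous_on[OF bounded_bilinear.bounded_linear_right[OF bounded_bilinear_cinner]]
            bounded_clinear_continuous_on b)
    next
      case subspace
      show ?case
        by (rule complex_hilbert.subspaceI)
          (auto simp: b bounded_clinear_add bounded_clinear_scaleC cinner_add_right cinner_scaleC_right algebra_simps)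
    qed (use eq b' in auto)
  qed
  show ?thesis
    using x
  proof (induction rule: closure_cspan_induct)
    case closed
    show ?case
      by (intro closed_Collect_eq continuous_on_mult_left
          bounded_linear.continuous_on[OF bounded_bilinear.bounded_linear_left[OF bounded_bilinear_cinner]]
          bounded_clinear_continuous_on b)
  next
    case subspace
    show ?case
      by (rule complex_hilbert.subspaceI)
        (auto simp: b bounded_clinear_add bounded_clinear_scaleC cinner_add_left cinner_scaleC_left algebra_simps)
  qed (rule 1)
qed

lemma cinner_eq_on_total:
  assumes b: "bounded_clinear S" "bounded_clinear T" "bounded_clinear S'" "bounded_clinear T'"
    and B: "closure (cspan B) = UNIV"
    and eq: "\<And>b c. b \<in> B \<Longrightarrow> c \<in> B \<Longrightarrow> cinner (S b) (T c) = k * cinner (S' b) (T' c)"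
  shows "cinner (S x) (T y) = k * cinner (S' x) (T' y)"
  by (rule cinner_eq_on_closure[OF b]) (use B eq in auto)

lemma cadj_id: "cadj id = id"
  by (rule cadj_eqI) simp

locale hilbert_tensor_product =
  fixes tn :: "'h::complex_hilbert \<Rightarrow> 'f::complex_hilbert \<Rightarrow> 'g::complex_hilbert"
  assumes ht: "hilbert_tensor tn"
begin

lemma tn_inner: "cinner (tn x u) (tn y v) = cinner x y * cinner u v"
  using ht by (simp add: hilbert_tensor_def)

lemma tn_total: "closure (cspan {tn x u | x u. True}) = UNIV"
  using ht by (simp add: hilbert_tensor_def)

lemma norm_tn: "norm (tn x u) = norm x * norm u"
proof -
  have "complex_of_real ((norm (tn x u))\<^sup>2) = complex_of_real ((norm x * norm u)\<^sup>2)"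
    unfolding power_mult_distrib of_real_mult cinner_same[symmetric] by (rule tn_inner)
  then have "(norm (tn x u))\<^sup>2 = (norm x * norm u)\<^sup>2" by (simp only: of_real_eq_iff)
  then show ?thesis by (simp add: power2_eq_iff_nonneg)
qed

lemma tn_add_right: "tn x (u + v) = tn x u + tn x v"
  by (rule eq_if_cinner_eq_total[OF tn_total]) (auto simp: tn_inner cinner_add_right algebra_simps)

lemma tn_scaleC_left: "tn (c *\<^sub>C x) u = c *\<^sub>C tn x u"
  by (rule eq_if_cinner_eq_total[OF tn_total]) (auto simp: tn_inner cinner_scaleC_right)

lemma tn_scaleC_right: "tn x (c *\<^sub>C u) = c *\<^sub>C tn x u"
  by (rule eq_if_cinner_eq_total[OF tn_total]) (auto simp: tn_inner cinner_scaleC_right)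

lemma bounded_clinear_tn_right: "bounded_clinear (tn x)"
  by (rule bounded_clinearI[of _ "norm x"]) (auto simp: tn_add_right tn_scaleC_right norm_tn)

lemma tn_closure_right:
  assumes "u \<in> closure (cspan B)"
  shows "tn x u \<in> closure (cspan {tn x u | x u. u \<in> B})"
  using assms
proof (induction rule: closure_cspan_induct)
  case (base b)
  then have "tn x b \<in> {tn x u | x u. u \<in> B}" by blast
  then show ?case by (rule subsetD[OF subset_closure_cspan])
next
  case closed
  have "closed (tn x -` closure (cspan {tn x u | x u. u \<in> B}))"
    by (intro closed_vimage bounded_clinear_continuous_on bounded_clinear_tn_right) auto
  then show ?case by (simp add: vimage_def)
next
  case subspace
  have K: "csubspace (closure (cspan {tn x u | x u. u \<in> B}))" by simp
  show ?case
    by (rule complex_hilbert.subspaceI)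
      (auto simp: tn_add_right tn_scaleC_right bounded_clinear_zero[OF bounded_clinear_tn_right]
        complex_hilbert.subspace_0[OF K] complex_hilbert.subspace_add[OF K] complex_hilbert.subspace_scale[OF K])
qed

lemma tn_total_right:
  assumes "closure (cspan B) = UNIV"
  shows "closure (cspan {tn x u | x u. u \<in> B}) = UNIV"
proof -
  have "{tn x u | x u. True} \<subseteq> closure (cspan {tn x u | x u. u \<in> B})"
    using tn_closure_right[of _ B] assms by auto
  then have "closure (cspan {tn x u | x u. True}) \<subseteq> closure (cspan {tn x u | x u. u \<in> B})"
    by (intro closure_cspan_subset) auto
  then show ?thesis using tn_total by auto
qed

lemma optensor_eqI:
  assumes "T \<in> bops" "\<And>x u. T (tn x u) = tn (A x) (X u)"
  shows "optensor tn A X = T"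
  unfolding optensor_def
proof (rule the_equality)
  fix U assume U: "U \<in> bops \<and> (\<forall>x u. U (tn x u) = tn (A x) (X u))"
  show "U = T"
    by (rule bounded_clinear_eq_on_total[OF _ _ tn_total]) (use U assms bopsD in auto)
qed (use assms in auto)

text \<open>The operator is a product of one acting as \<open>A\<close> on the left factor and one
  acting as \<open>X\<close> on the right factor. Each of these is intertwined by embeddings with
  scalar Gram matrix, namely \<open>x \<mapsto> tn x u\<close> for the first and
  \<open>u \<mapsto> tn x u\<close> for the second.\<close>

lemma
  assumes A: "A \<in> bops" and X: "X \<in> bops"
  shows optensor_bops: "optensor tn A X \<in> bops"
    and optensor_tn: "optensor tn A X (tn x u) = tn (A x) (X u)"
proof -
  have "\<exists>T. bounded_clinear T \<and> (\<forall>x. norm (T x) \<le> onorm A * norm x) \<and> (\<forall>u\<in>UNIV. \<forall>x\<in>UNIV. T (tn x u) = tn (A x) u)"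
    using bopsD[OF A] by (intro kernel_operator_exists[of UNIV UNIV "\<lambda>u x. tn x u" "\<lambda>u. u"]) (auto simp: tn_inner)
  then obtain T1 where T1: "T1 \<in> bops" "\<And>x u. T1 (tn x u) = tn (A x) u" by (auto simp: bops_def)
  have "\<exists>T. bounded_clinear T \<and> (\<forall>x. norm (T x) \<le> onorm X * norm x) \<and> (\<forall>x\<in>UNIV. \<forall>u\<in>UNIV. T (tn x u) = tn x (X u))"
    using bopsD[OF X] by (intro kernel_operator_exists[of UNIV UNIV "\<lambda>x u. tn x u" "\<lambda>x. x"]) (auto simp: tn_inner)
  then obtain T2 where T2: "T2 \<in> bops" "\<And>x u. T2 (tn x u) = tn x (X u)" by (auto simp: bops_def)
  have T: "T1 \<circ> T2 \<in> bops" "\<And>x u. (T1 \<circ> T2) (tn x u) = tn (A x) (X u)" using T1 T2 by auto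
  have "optensor tn A X = T1 \<circ> T2" by (rule optensor_eqI[OF T])
  with T show "optensor tn A X \<in> bops" "optensor tn A X (tn x u) = tn (A x) (X u)" by auto
qed

abbreviation amp :: "('f \<Rightarrow> 'f) \<Rightarrow> 'g \<Rightarrow> 'g" where
  "amp \<equiv> optensor tn id"

lemma amp_bops [intro]: "X \<in> bops \<Longrightarrow> amp X \<in> bops"
  by (rule optensor_bops) auto

lemma amp_tn: "X \<in> bops \<Longrightarrow> amp X (tn x u) = tn x (X u)"
  by (simp add: optensor_tn)

lemma amp_comp:
  assumes "X \<in> bops" "Y \<in> bops" shows "amp (X \<circ> Y) = amp X \<circ> amp Y"
  by (rule optensor_eqI) (use assms in \<open>auto simp: amp_tn amp_bops\<close>)

lemma amp_id: "amp id = id"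
  by (rule optensor_eqI) auto

lemma amp_add:
  assumes "X \<in> bops" "Y \<in> bops" shows "amp (\<lambda>x. X x + Y x) = (\<lambda>z. amp X z + amp Y z)"
  by (rule optensor_eqI) (use assms in \<open>auto simp: amp_tn amp_bops tn_add_right\<close>)

lemma amp_zero: "amp (\<lambda>_. 0) = (\<lambda>_. 0)"
  by (rule optensor_eqI) (auto simp: bounded_clinear_zero[OF bounded_clinear_tn_right])

lemma amp_sum:
  assumes "\<And>i. i \<in> A \<Longrightarrow> X i \<in> bops" shows "amp (\<lambda>x. \<Sum>i\<in>A. X i x) = (\<lambda>z. \<Sum>i\<in>A. amp (X i) z)"
  by (rule optensor_eqI)
    (use assms in \<open>auto simp: amp_tn bounded_clinear_sum[OF bounded_clinear_tn_right] intro!: bops_sum\<close>)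

lemma cadj_optensor:
  assumes "A \<in> bops" "X \<in> bops" shows "cadj (optensor tn A X) = optensor tn (cadj A) (cadj X)"
proof (rule cadj_eqI)
  fix z w
  have b: "bounded_clinear (optensor tn (cadj A) (cadj X))" "bounded_clinear (optensor tn A X)"
    using assms by (auto intro: bopsD optensor_bops)
  have "cinner (optensor tn (cadj A) (cadj X) z) (id w) = 1 * cinner (id z) (optensor tn A X w)"
    by (rule cinner_eq_on_total[OF b(1) bounded_clinear_id bounded_clinear_id b(2) tn_total])
      (use assms in \<open>auto simp: optensor_tn tn_inner cinner_cadj_left bopsD bops_cadj\<close>)
  then show "cinner (optensor tn (cadj A) (cadj X) z) w = cinner z (optensor tn A X w)" by simp
qed

lemma amp_inner:
  assumes "X \<in> bops" "Y \<in> bops" "\<And>u v. cinner (X u) (Y v) = k * cinner u v"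
  shows "cinner (amp X z) (amp Y w) = k * cinner z w"
proof -
  have b: "bounded_clinear (amp X)" "bounded_clinear (amp Y)" using assms by (auto intro: bopsD)
  have "cinner (amp X z) (amp Y w) = k * cinner (id z) (id w)"
    by (rule cinner_eq_on_total[OF b bounded_clinear_id bounded_clinear_id tn_total]) (auto simp: assms amp_tn tn_inner)
  then show ?thesis by simp
qed

lemma amp_orth_projection:
  assumes P: "orth_projection P" shows "orth_projection (amp P)"
proof -
  have P': "P \<in> bops" "P \<circ> P = P" "cadj P = P" using P by (auto simp: orth_projection_def)
  have "amp P \<circ> amp P = amp P" using amp_comp[OF P'(1) P'(1)] P'(2) by simp
  moreover have "cadj (amp P) = amp P"
    using cadj_optensor[OF bops_id P'(1)] P'(3) by (simp add: cadj_id)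
  ultimately show ?thesis using P' by (auto simp: orth_projection_def)
qed

text \<open>An identity \<open>cinner (X u) (Y v) = k * cinner u v\<close> survives ampliation with
  the same scalar \<open>k\<close>, so the Gram matrix is unchanged; totality is checked on simple
  tensors.\<close>

lemma amp_intertwiners:
  assumes j: "intertwiners I a j"
  shows "intertwiners I a (\<lambda>i. amp (j i))"
  unfolding intertwiners_def
proof (intro conjI ballI allI)
  show "amp (j i) \<in> bops" if "i \<in> I" for i using intertwinersD(1)[OF j that] by auto
  show "cinner (amp (j i) x) (amp (j i') y) = cinner (a i) (a i') * cinner x y" if "i \<in> I" "i' \<in> I" for i i' x y
    by (intro amp_inner intertwinersD[OF j] that)
  let ?K = "closure (cspan {amp (j i) z | i z. i \<in> I})"
  have "tn x (j i u) \<in> ?K" if "i \<in> I" for x i u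
  proof -
    have "tn x (j i u) = amp (j i) (tn x u)" using intertwinersD(1)[OF j that] by (simp add: amp_tn)
    then show ?thesis using subset_closure_cspan[of "{amp (j i) z | i z. i \<in> I}"] that by blast
  qed
  then have "{tn x u | x u. u \<in> {j i x | i x. i \<in> I}} \<subseteq> ?K" by blast
  then have "closure (cspan {tn x u | x u. u \<in> {j i x | i x. i \<in> I}}) \<subseteq> ?K"
    by (intro closure_cspan_subset) auto
  then show "?K = UNIV" using tn_total_right[OF intertwinersD(3)[OF j]] by auto
qed

lemma rank_one_tn:
  "(\<lambda>z. cinner (tn y v) z *\<^sub>C tn x u) = optensor tn (\<lambda>z. cinner y z *\<^sub>C x) (\<lambda>w. cinner v w *\<^sub>C u)"
  by (rule optensor_eqI[symmetric]) (auto simp: tn_inner tn_scaleC_left tn_scaleC_right scaleC_scaleC)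

text \<open>The endomorphism intertwined by the amplified family is one admissible choice for
  \<open>ampliation\<close>. Any other choice agrees with it on elementary tensors, which include
  the rank-one operators between product vectors, and normality then forces agreement on every
  bounded operator.\<close>

lemma ampliation_eq_endo_of:
  assumes j: "intertwiners I a j"
    and \<phi>: "\<And>X. X \<in> bops \<Longrightarrow> \<phi> X \<in> bops" "\<And>X i u. X \<in> bops \<Longrightarrow> i \<in> I \<Longrightarrow> \<phi> X (j i u) = j i (X u)"
  shows "normal_unital_star_endo (ampliation tn \<phi>)"
    and "T \<in> bops \<Longrightarrow> ampliation tn \<phi> T = endo_of I (\<lambda>i. amp (j i)) T"
proof -
  define \<Psi> where "\<Psi> = endo_of I (\<lambda>i. amp (j i))"
  note J = amp_intertwiners[OF j]
  have \<Psi>1: "normal_unital_star_endo \<Psi>" unfolding \<Psi>_def by (rule normal_unital_star_endo_endo_of[OF J])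
  have \<Psi>2: "\<Psi> (optensor tn A X) = optensor tn A (\<phi> X)" if A: "A \<in> bops" and X: "X \<in> bops" for A X
    unfolding \<Psi>_def
  proof (rule endo_of_eqI[OF J])
    show "optensor tn A (\<phi> X) \<in> bops" using A \<phi>(1)[OF X] by (rule optensor_bops)
    fix i z assume i: "i \<in> I"
    note ji = intertwinersD(1)[OF j i]
    have "optensor tn A (\<phi> X) \<circ> amp (j i) = amp (j i) \<circ> optensor tn A X"
      by (rule bounded_clinear_eq_on_total[OF _ _ tn_total])
        (use A X \<phi> i ji in \<open>auto simp: amp_tn optensor_tn intro!: bopsD bops_comp optensor_bops amp_bops\<close>)
    then show "optensor tn A (\<phi> X) (amp (j i) z) = amp (j i) (optensor tn A X z)"
      by (simp add: fun_eq_iff)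
  qed
  have ex: "\<exists>\<Phi>. normal_unital_star_endo \<Phi> \<and> (\<forall>A\<in>bops. \<forall>X\<in>bops. \<Phi> (optensor tn A X) = optensor tn A (\<phi> X))"
    by (rule exI[of _ \<Psi>]) (use \<Psi>1 \<Psi>2 in auto)
  note some = someI_ex[OF ex, folded ampliation_def]
  show N: "normal_unital_star_endo (ampliation tn \<phi>)" using some by (rule conjunct1)
  have eq: "ampliation tn \<phi> (optensor tn A X) = optensor tn A (\<phi> X)" if "A \<in> bops" "X \<in> bops" for A X
    using conjunct2[OF some] that by simp
  show "ampliation tn \<phi> T = endo_of I (\<lambda>i. amp (j i)) T" if T: "T \<in> bops"
  proof (rule ext, rule eq_if_cinner_eq)
    fix w z
    \<comment> \<open>A matrix element is a normal functional, given by sequences with a single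
      nonzero term; normality of \<open>\<Phi>\<close> therefore makes its pullback normal.\<close>
    have \<omega>: "\<exists>\<omega>'\<in>normal_functionals. \<forall>T\<in>bops. cinner z (\<Phi> T w) = \<omega>' T" if "normal_unital_star_endo \<Phi>" for \<Phi> :: "('g \<Rightarrow> 'g) \<Rightarrow> 'g \<Rightarrow> 'g"
    proof -
      define x y where "x n = (if n = (0::nat) then z else 0)" and "y n = (if n = (0::nat) then w else 0)" for n
      have s: "(\<lambda>n. (norm (x n))\<^sup>2) sums (norm z)\<^sup>2" "(\<lambda>n. (norm (y n))\<^sup>2) sums (norm w)\<^sup>2"
        using sums_single[of 0 "\<lambda>_. (norm z)\<^sup>2"] sums_single[of 0 "\<lambda>_. (norm w)\<^sup>2"]
        by (auto simp: x_def y_def if_distrib[of norm] if_distrib[of "\<lambda>x. x\<^sup>2"] cong: if_cong)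
      have N: "(\<lambda>T. \<Sum>n. cinner (x n) (T (y n))) \<in> normal_functionals"
        unfolding normal_functionals_def
        by (rule CollectI, rule exI[of _ x], rule exI[of _ y]) (use s in \<open>auto simp: sums_iff\<close>)
      have v: "(\<Sum>n. cinner (x n) (U (y n))) = cinner z (U w)" for U
      proof -
        have "(\<lambda>n. cinner (x n) (U (y n))) = (\<lambda>n. if n = 0 then cinner z (U w) else 0)"
          by (auto simp: x_def y_def)
        then show ?thesis using sums_single[of 0 "\<lambda>_. cinner z (U w)"] by (simp add: sums_iff)
      qed
      have "\<forall>\<omega>\<in>normal_functionals. \<exists>\<omega>'\<in>normal_functionals. \<forall>T\<in>bops. \<omega> (\<Phi> T) = \<omega>' T"
        using that unfolding normal_unital_star_endo_def by simp
      from bspec[OF this N] show ?thesis unfolding v .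
    qed
    obtain \<omega>1 where \<omega>1: "\<omega>1 \<in> normal_functionals" "\<And>T. T \<in> bops \<Longrightarrow> cinner z (ampliation tn \<phi> T w) = \<omega>1 T"
      using \<omega>[OF N] by blast
    obtain \<omega>2 where \<omega>2: "\<omega>2 \<in> normal_functionals" "\<And>T. T \<in> bops \<Longrightarrow> cinner z (\<Psi> T w) = \<omega>2 T"
      using \<omega>[OF \<Psi>1] by blast
    have "\<omega>1 T = \<omega>2 T"
    proof (rule normal_functionals_eqI[OF \<omega>1(1) \<omega>2(1) tn_total _ T])
      fix p q assume "p \<in> {tn x u | x u. True}" "q \<in> {tn x u | x u. True}"
      then obtain x u y v where pq: "p = tn x u" "q = tn y v" by blast
      show "\<omega>1 (\<lambda>x. cinner q x *\<^sub>C p) = \<omega>2 (\<lambda>x. cinner q x *\<^sub>C p)"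
        unfolding pq rank_one_tn
        by (simp add: optensor_bops \<omega>1(2)[symmetric] \<omega>2(2)[symmetric] eq \<Psi>2)
    qed
    then show "cinner z (ampliation tn \<phi> T w) = cinner z (endo_of I (\<lambda>i. amp (j i)) T w)"
      using \<omega>1(2)[OF T] \<omega>2(2)[OF T] by (simp add: \<Psi>_def)
  qed
qed

end

text \<open>Any Hilbert space is its own tensor product with the complex numbers. Results proved
  with an initial space thus specialise to Fock space alone, which is used for stop times and for
  the stopped flow before ampliation.\<close>

lemma hilbert_tensor_scaleC: "hilbert_tensor (scaleC :: complex \<Rightarrow> 'f::complex_hilbert \<Rightarrow> 'f)"
  unfolding hilbert_tensor_def
proof (intro conjI allI)
  show "cinner (x *\<^sub>C u) (y *\<^sub>C v) = cinner x y * cinner u v" for x y and u v :: 'f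
    by (simp add: cinner_scaleC_left cinner_scaleC_right cinner_complex_def)
  have "(x :: 'f) \<in> {c *\<^sub>C u | c u. True}" for x by (auto intro!: exI[of _ 1] exI[of _ x])
  then show "closure (cspan {c *\<^sub>C u | c (u :: 'f). True}) = UNIV"
    using subset_closure_cspan[of "{c *\<^sub>C u | c (u :: 'f). True}"] by blast
qed

section \<open>Square integrable functions\<close>

definition strongly_measurable :: "(real \<Rightarrow> 'k::complex_hilbert) \<Rightarrow> bool" where
  "strongly_measurable f \<longleftrightarrow> (\<exists>s. (\<forall>i::nat. simple_function lborel (s i)) \<and> (\<forall>r. (\<lambda>i. s i r) \<longlonglongrightarrow> f r))"

lemma mem_L2_iff: "f \<in> L2 A \<longleftrightarrow> strongly_measurable f \<and> integrable lborel (\<lambda>r. (norm (f r))\<^sup>2) \<and> (\<forall>r. r \<notin> A \<longrightarrow> f r = 0)"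
  by (simp add: L2_def strongly_measurable_def)

lemma strongly_measurableI:
  "(\<And>i. simple_function lborel (s i)) \<Longrightarrow> (\<And>r. (\<lambda>i. s i r) \<longlonglongrightarrow> f r) \<Longrightarrow> strongly_measurable f"
  by (auto simp: strongly_measurable_def)

lemma strongly_measurableE:
  assumes "strongly_measurable f"
  obtains s where "\<And>i. simple_function lborel (s i)" "\<And>r. (\<lambda>i. s i r) \<longlonglongrightarrow> f r"
  using assms by (auto simp: strongly_measurable_def)

lemma strongly_measurable_simple: "simple_function lborel f \<Longrightarrow> strongly_measurable f"
  by (rule strongly_measurableI[of "\<lambda>_. f"]) auto

lemma strongly_measurable_add:
  assumes "strongly_measurable f" "strongly_measurable g"
  shows "strongly_measurable (\<lambda>r. f r + g r)"
proof -
  obtain s where s: "\<And>i. simple_function lborel (s i)" "\<And>r. (\<lambda>i. s i r) \<longlonglongrightarrow> f r"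
    using assms(1) by (rule strongly_measurableE) blast
  obtain t where t: "\<And>i. simple_function lborel (t i)" "\<And>r. (\<lambda>i. t i r) \<longlonglongrightarrow> g r"
    using assms(2) by (rule strongly_measurableE) blast
  show ?thesis
    by (rule strongly_measurableI[of "\<lambda>i r. s i r + t i r"])
      (auto intro: simple_function_compose2[where h = "(+)"] tendsto_add s t)
qed

lemma strongly_measurable_If:
  assumes "strongly_measurable f" "B \<in> sets borel"
  shows "strongly_measurable (\<lambda>r. if r \<in> B then f r else 0)"
proof -
  obtain s where s: "\<And>i. simple_function lborel (s i)" "\<And>r. (\<lambda>i. s i r) \<longlonglongrightarrow> f r"
    using assms(1) by (rule strongly_measurableE) blast
  show ?thesis
    by (rule strongly_measurableI[of "\<lambda>i r. if r \<in> B then s i r else 0"])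
      (use s assms(2) in \<open>auto intro!: simple_function_If_set\<close>)
qed

lemma strongly_measurable_shift:
  assumes "strongly_measurable f"
  shows "strongly_measurable (\<lambda>r. f (t + r))"
proof -
  obtain s where s: "\<And>i. simple_function lborel (s i)" "\<And>r. (\<lambda>i. s i r) \<longlonglongrightarrow> f r"
    using assms(1) by (rule strongly_measurableE) blast
  have "simple_function lborel (\<lambda>r. s i (t + r))" for i
  proof -
    have fin: "finite (range (s i))" and meas: "\<And>x. s i -` {x} \<in> sets borel"
      using simple_functionD[OF s(1)[of i]] by simp_all
    have "finite (range (\<lambda>r. s i (t + r)))" by (rule finite_subset[OF _ fin]) auto
    moreover have "(\<lambda>r. s i (t + r)) -` {x} \<in> sets borel" for x
    proof -
      have "(\<lambda>r. t + r) -` (s i -` {x}) \<inter> space borel \<in> sets borel"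
        by (rule measurable_sets[OF _ meas]) simp
      then show ?thesis by (simp add: vimage_def)
    qed
    ultimately show ?thesis by (simp add: simple_function_def)
  qed
  then show ?thesis by (rule strongly_measurableI) (rule s)
qed

lemma strongly_measurable_comp:
  assumes "strongly_measurable f" "bounded_clinear p"
  shows "strongly_measurable (\<lambda>r. p (f r))"
proof -
  obtain s where s: "\<And>i. simple_function lborel (s i)" "\<And>r. (\<lambda>i. s i r) \<longlonglongrightarrow> f r"
    using assms(1) by (rule strongly_measurableE) blast
  show ?thesis
    by (rule strongly_measurableI[of "\<lambda>i r. p (s i r)"])
      (auto intro: simple_function_compose1 s bounded_clinear_tendsto[OF assms(2) s(2)])
qed

lemma borel_measurable_norm_strongly:
  assumes "strongly_measurable f"
  shows "(\<lambda>r. norm (f r)) \<in> borel_measurable lborel"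
proof -
  obtain s where s: "\<And>i. simple_function lborel (s i)" "\<And>r. (\<lambda>i. s i r) \<longlonglongrightarrow> f r"
    using assms(1) by (rule strongly_measurableE) blast
  show ?thesis
    by (rule borel_measurable_LIMSEQ_metric[of "\<lambda>i r. norm (s i r)"])
      (rule borel_measurable_simple_function[OF simple_function_compose1[OF s(1)]], rule tendsto_norm[OF s(2)])
qed

lemma borel_measurable_cinner_strongly:
  assumes "strongly_measurable f" "strongly_measurable g"
  shows "(\<lambda>r. cinner (f r) (g r)) \<in> borel_measurable lborel"
proof -
  obtain s where s: "\<And>i. simple_function lborel (s i)" "\<And>r. (\<lambda>i. s i r) \<longlonglongrightarrow> f r"
    using assms(1) by (rule strongly_measurableE) blast
  obtain t where t: "\<And>i. simple_function lborel (t i)" "\<And>r. (\<lambda>i. t i r) \<longlonglongrightarrow> g r"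
    using assms(2) by (rule strongly_measurableE) blast
  show ?thesis
    by (rule borel_measurable_LIMSEQ_metric[of "\<lambda>i r. cinner (s i r) (t i r)"])
      (rule borel_measurable_simple_function[OF simple_function_compose2[OF s(1) t(1), where h = cinner]],
        rule tendsto_cinner[OF s(2) t(2)])
qed

lemma L2D:
  assumes "f \<in> L2 A"
  shows "strongly_measurable f" "integrable lborel (\<lambda>r. (norm (f r))\<^sup>2)" "r \<notin> A \<Longrightarrow> f r = 0"
  using assms by (auto simp: mem_L2_iff)

lemma L2_boundI:
  assumes "strongly_measurable f" "integrable lborel h" "\<And>r. (norm (f r))\<^sup>2 \<le> h r" "\<And>r. r \<notin> A \<Longrightarrow> f r = 0"
  shows "f \<in> L2 A"
  unfolding mem_L2_iff
proof (intro conjI allI impI)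
  show "integrable lborel (\<lambda>r. (norm (f r))\<^sup>2)"
  proof (rule Bochner_Integration.integrable_bound[OF assms(2)])
    show "(\<lambda>r. (norm (f r))\<^sup>2) \<in> borel_measurable lborel"
      by (rule borel_measurable_power[OF borel_measurable_norm_strongly[OF assms(1)]])
    show "AE r in lborel. norm ((norm (f r))\<^sup>2) \<le> norm (h r)"
      using order_trans[OF assms(3) abs_ge_self] by simp
  qed
qed (use assms in auto)

lemma integrable_cinner:
  assumes "f \<in> L2 A" "g \<in> L2 B"
  shows "integrable lborel (\<lambda>r. cinner (f r) (g r))"
proof (rule Bochner_Integration.integrable_bound)
  show "integrable lborel (\<lambda>r. (norm (f r))\<^sup>2 + (norm (g r))\<^sup>2)"
    by (rule Bochner_Integration.integrable_add[OF L2D(2)[OF assms(1)] L2D(2)[OF assms(2)]])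
  show "(\<lambda>r. cinner (f r) (g r)) \<in> borel_measurable lborel"
    by (rule borel_measurable_cinner_strongly[OF L2D(1)[OF assms(1)] L2D(1)[OF assms(2)]])
  have "cmod (cinner (f r) (g r)) \<le> (norm (f r))\<^sup>2 + (norm (g r))\<^sup>2" for r
    by (rule order_trans[OF cinner_Cauchy_Schwarz norm_mult_le_sum_sq])
  then show "AE r in lborel. norm (cinner (f r) (g r)) \<le> norm ((norm (f r))\<^sup>2 + (norm (g r))\<^sup>2)" by simp
qed

lemma L2_zero: "(\<lambda>_. 0) \<in> L2 A"
  by (rule L2_boundI[where h = "\<lambda>_. 0"]) (auto intro: strongly_measurable_simple)

lemma L2_mono: "f \<in> L2 A \<Longrightarrow> A \<subseteq> B \<Longrightarrow> f \<in> L2 B"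
  by (auto simp: mem_L2_iff)

lemma L2_restr:
  assumes "f \<in> L2 A" "B \<in> sets borel"
  shows "restr B f \<in> L2 B"
  unfolding restr_def
  by (rule L2_boundI[OF strongly_measurable_If[OF L2D(1)[OF assms(1)] assms(2)] L2D(2)[OF assms(1)]]) auto

lemma norm_add_sq_le: "(norm (x + y))\<^sup>2 \<le> 2 * (norm x)\<^sup>2 + 2 * (norm (y::'a::complex_hilbert))\<^sup>2"
  using parallelogram[of x y] by (smt (verit) zero_le_power2)

lemma L2_add:
  assumes "f \<in> L2 A" "g \<in> L2 A"
  shows "(\<lambda>r. f r + g r) \<in> L2 A"
  by (rule L2_boundI[where h = "\<lambda>r. 2 * (norm (f r))\<^sup>2 + 2 * (norm (g r))\<^sup>2"])
    (use assms norm_add_sq_le in \<open>auto simp: mem_L2_iff intro: strongly_measurable_add\<close>)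

lemma L2_comp:
  assumes "f \<in> L2 A" "p \<in> bops"
  shows "p \<circ> f \<in> L2 A"
  unfolding o_def
proof (rule L2_boundI[where h = "\<lambda>r. (onorm p)\<^sup>2 * (norm (f r))\<^sup>2"])
  note p = bopsD[OF assms(2)]
  show "strongly_measurable (\<lambda>r. p (f r))" by (rule strongly_measurable_comp[OF L2D(1)[OF assms(1)] p])
  show "integrable lborel (\<lambda>r. (onorm p)\<^sup>2 * (norm (f r))\<^sup>2)" using L2D(2)[OF assms(1)] by simp
  show "(norm (p (f r)))\<^sup>2 \<le> (onorm p)\<^sup>2 * (norm (f r))\<^sup>2" for r
    using power_mono[OF bounded_clinear_bound[OF p, of "f r"], of 2] by (simp add: power_mult_distrib)
  show "p (f r) = 0" if "r \<notin> A" for r using L2D(3)[OF assms(1) that] p by simp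
qed

text \<open>The adjoint of \<open>right_shift t\<close> on square-integrable functions on the
  half-line; what \<open>f\<close> does before \<open>t\<close> is forgotten.\<close>

definition left_shift :: "real \<Rightarrow> (real \<Rightarrow> 'k::complex_hilbert) \<Rightarrow> real \<Rightarrow> 'k" where
  "left_shift t f = (\<lambda>s. if 0 \<le> s then f (s + t) else 0)"

lemma right_shift_eq:
  assumes "f \<in> L2 {0..}"
  shows "right_shift t f = (\<lambda>s. f (- t + s))"
  using L2D(3)[OF assms] by (auto simp: right_shift_def fun_eq_iff)

lemma right_shift_L2:
  assumes "f \<in> L2 {0..}"
  shows "right_shift t f \<in> L2 {t..}"
  unfolding mem_L2_iff
proof (intro conjI allI impI)
  show "strongly_measurable (right_shift t f)"
    unfolding right_shift_eq[OF assms] by (intro strongly_measurable_shift L2D[OF assms])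
  show "integrable lborel (\<lambda>r. (norm (right_shift t f r))\<^sup>2)"
    unfolding right_shift_eq[OF assms]
    using lborel_integrable_real_affine[OF L2D(2)[OF assms], of 1 "- t"] by simp
qed (auto simp: right_shift_def)

lemma left_shift_L2:
  assumes "f \<in> L2 {0..}"
  shows "left_shift t f \<in> L2 {0..}"
proof (rule L2_boundI[where h = "\<lambda>s. (norm (f (t + s)))\<^sup>2"])
  have "strongly_measurable (\<lambda>s. if s \<in> {0..} then f (t + s) else 0)"
    by (intro strongly_measurable_If strongly_measurable_shift L2D[OF assms]) simp
  moreover have "left_shift t f = (\<lambda>s. if s \<in> {0..} then f (t + s) else 0)"
    by (auto simp: left_shift_def add.commute)
  ultimately show "strongly_measurable (left_shift t f)" by simp
  show "integrable lborel (\<lambda>s. (norm (f (t + s)))\<^sup>2)"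
    using lborel_integrable_real_affine[OF L2D(2)[OF assms], of 1 t] by simp
qed (auto simp: left_shift_def add.commute)

lemma right_shift_left_shift:
  assumes "f \<in> L2 {0..}" "t \<ge> 0"
  shows "right_shift t (left_shift t f) = restr {t..} f"
  using assms(2) by (auto simp: right_shift_def left_shift_def restr_def fun_eq_iff)

lemma L2_inner_add_left:
  assumes "f \<in> L2 A" "g \<in> L2 B" "h \<in> L2 C"
  shows "L2_inner (\<lambda>r. f r + g r) h = L2_inner f h + L2_inner g h"
  unfolding L2_inner_def cinner_add_left
  by (rule Bochner_Integration.integral_add[OF integrable_cinner[OF assms(1,3)] integrable_cinner[OF assms(2,3)]])

lemma L2_inner_add_right:
  assumes "f \<in> L2 A" "g \<in> L2 B" "h \<in> L2 C"
  shows "L2_inner h (\<lambda>r. f r + g r) = L2_inner h f + L2_inner h g"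
  unfolding L2_inner_def cinner_add_right
  by (rule Bochner_Integration.integral_add[OF integrable_cinner[OF assms(3,1)] integrable_cinner[OF assms(3,2)]])

lemma L2_inner_disjoint:
  assumes "f \<in> L2 A" "g \<in> L2 B" "A \<inter> B = {}"
  shows "L2_inner f g = 0"
proof -
  have "(\<lambda>r. cinner (f r) (g r)) = (\<lambda>_. 0)"
  proof
    fix r show "cinner (f r) (g r) = 0"
    proof (cases "r \<in> A")
      case True
      then have "r \<notin> B" using assms(3) by blast
      then show ?thesis using L2D(3)[OF assms(2)] by simp
    qed (use L2D(3)[OF assms(1)] in simp)
  qed
  then show ?thesis by (simp add: L2_inner_def)
qed

lemma L2_inner_zero [simp]: "L2_inner (\<lambda>_. 0) f = 0" "L2_inner f (\<lambda>_. 0) = 0"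
  by (simp_all add: L2_inner_def)

lemma L2_inner_right_shift:
  assumes "f \<in> L2 {0..}" "g \<in> L2 {0..}"
  shows "L2_inner (right_shift t f) (right_shift t g) = L2_inner f g"
  unfolding L2_inner_def right_shift_eq[OF assms(1)] right_shift_eq[OF assms(2)]
  using lborel_integral_real_affine[of 1 "\<lambda>r. cinner (f r) (g r)" "- t"] by simp

lemma L2_inner_same: "L2_inner f f = complex_of_real (LINT r|lborel. (norm (f r))\<^sup>2)"
  unfolding L2_inner_def cinner_same by (rule integral_complex_of_real)

lemma restr_decompose:
  assumes "f \<in> L2 {0..}" "t \<ge> 0"
  shows "f = (\<lambda>r. restr {0..<t} f r + restr {t..} f r)"
  using assms(2) L2D(3)[OF assms(1)] by (auto simp: restr_def fun_eq_iff)

subsection \<open>Absolute continuity of the integral\<close>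

text \<open>The density \<open>h\<close> splits into \<open>min h n\<close> and a remainder: the
  remainder has small total integral once \<open>n\<close> is large, and the bounded part
  contributes at most \<open>n\<close> times the length of the interval.\<close>

lemma L2_absolutely_continuous:
  assumes g: "g \<in> L2 A" and e: "e > 0"
  shows "\<exists>d>0. \<forall>a b. b - a < d \<longrightarrow> (LINT r|lborel. (norm (restr {a..<b} g r))\<^sup>2) < e"
proof -
  define h where "h = (\<lambda>r. (norm (g r))\<^sup>2)"
  have h: "integrable lborel h" "h r \<ge> 0" for r using L2D(2)[OF g] by (auto simp: h_def)
  have hm [measurable]: "h \<in> borel_measurable borel" using borel_measurable_integrable[OF h(1)] by simp
  have "(\<lambda>n. LINT r|lborel. min (h r) (real n)) \<longlonglongrightarrow> (LINT r|lborel. h r)"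
  proof (rule integral_dominated_convergence[where w = h])
    show "AE r in lborel. (\<lambda>n. min (h r) (real n)) \<longlonglongrightarrow> h r"
    proof (rule AE_I2)
      fix r
      have "\<forall>\<^sub>F n in sequentially. min (h r) (real n) = h r"
        using eventually_ge_at_top[of "nat \<lceil>h r\<rceil>"]
      proof (rule eventually_mono)
        fix n assume "nat \<lceil>h r\<rceil> \<le> n"
        then have "h r \<le> real n" using order_trans[OF real_nat_ceiling_ge of_nat_mono] by blast
        then show "min (h r) (real n) = h r" by simp
      qed
      then show "(\<lambda>n. min (h r) (real n)) \<longlonglongrightarrow> h r" by (rule tendsto_eventually)
    qed
    show "AE r in lborel. norm (min (h r) (real n)) \<le> h r" for n using h(2) by (auto simp: min_def)
  qed (use h in auto)
  then have "\<forall>\<^sub>F n in sequentially. dist (LINT r|lborel. min (h r) (real n)) (LINT r|lborel. h r) < e / 2"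
    using e by (intro tendstoD) auto
  then obtain n where n: "dist (LINT r|lborel. min (h r) (real n)) (LINT r|lborel. h r) < e / 2"
    using eventually_happens by force
  have im: "integrable lborel (\<lambda>r. min (h r) (real n))"
    by (rule Bochner_Integration.integrable_bound[OF h(1)]) (use h(2) in \<open>auto simp: min_def\<close>)
  \<comment> \<open>The denominator \<open>2 * real n + 2\<close> stays positive at
    \<open>n = 0\<close> and leaves at most \<open>e / 2\<close> for the bounded part.\<close>
  have "(LINT r|lborel. (norm (restr {a..<b} g r))\<^sup>2) < e" if ab: "b - a < e / (2 * real n + 2)" for a b
  proof (cases "a \<le> b")
    case False
    then have "restr {a..<b} g = (\<lambda>_. 0)" by (auto simp: restr_def)
    then show ?thesis using e by simp
  next
    case True
    have ii: "integrable lborel (\<lambda>r. real n * indicator {a..<b} r)"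
      by (intro integrable_mult_right) (simp add: True)
    have "(LINT r|lborel. (norm (restr {a..<b} g r))\<^sup>2) \<le> (LINT r|lborel. (h r - min (h r) (real n)) + real n * indicator {a..<b} r)"
    proof (rule integral_mono)
      show "integrable lborel (\<lambda>r. (norm (restr {a..<b} g r))\<^sup>2)"
        using L2_restr[OF g, of "{a..<b}"] by (auto simp: mem_L2_iff)
      show "integrable lborel (\<lambda>r. (h r - min (h r) (real n)) + real n * indicator {a..<b} r)"
        by (intro Bochner_Integration.integrable_add Bochner_Integration.integrable_diff h im ii)
      show "(norm (restr {a..<b} g r))\<^sup>2 \<le> (h r - min (h r) (real n)) + real n * indicator {a..<b} r" for r
        using h(2)[of r] by (auto simp: restr_def h_def indicator_def)
    qed
    also have "\<dots> = (LINT r|lborel. h r) - (LINT r|lborel. min (h r) (real n)) + real n * (b - a)"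
    proof -
      have "(LINT r|lborel. real n * indicator {a..<b} r) = real n * (b - a)"
        using True by simp
      then show ?thesis
        using Bochner_Integration.integral_add[OF Bochner_Integration.integrable_diff[OF h(1) im] ii]
          Bochner_Integration.integral_diff[OF h(1) im] by simp
    qed
    also have "\<dots> < e / 2 + e / 2"
    proof (rule add_less_le_mono)
      show "(LINT r|lborel. h r) - (LINT r|lborel. min (h r) (real n)) < e / 2" using n unfolding dist_real_def by linarith
      have "real n * (b - a) \<le> real n * (e / (2 * real n + 2))" using ab by (intro mult_left_mono) auto
      also have "\<dots> \<le> e / 2" using e by (simp add: field_simps)
      finally show "real n * (b - a) \<le> e / 2" .
    qed
    finally show ?thesis by simp
  qed
  then show ?thesis using e by (intro exI[of _ "e / (2 * real n + 2)"]) auto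
qed

subsection \<open>Continuity of translations\<close>

lemma LINT_shift:
  fixes f :: "real \<Rightarrow> real"
  shows "(LINT r|lborel. f (r - h)) = (LINT r|lborel. f r)"
  using lborel_integral_real_affine[of 1 f "- h"] by simp

lemma integrable_shift:
  fixes f :: "real \<Rightarrow> real"
  shows "integrable lborel f \<Longrightarrow> integrable lborel (\<lambda>r. f (r - h))"
  using lborel_integrable_real_affine[of f 1 "- h"] by simp

text \<open>Translation invariance turns the measure of the symmetric difference into twice the mass
  of the points of \<open>U\<close> outside its translate. The corresponding integrand tends to 0
  pointwise because \<open>U\<close> is open, and it is dominated by the indicator of
  \<open>U\<close>.\<close>

lemma tendsto_translate_open:
  fixes U :: "real set"
  assumes U: "open U" "emeasure lborel U < \<infinity>"
  shows "((\<lambda>h. LINT r|lborel. \<bar>indicator U (r - h) - indicator U r\<bar>) \<longlongrightarrow> (0::real)) (at_right 0)"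
proof -
  let ?I = "indicator U :: real \<Rightarrow> real"
  have Um [measurable]: "U \<in> sets borel" using U by simp
  have iI: "integrable lborel ?I" using U by (simp add: integrable_indicator_iff)
  have Ih: "integrable lborel (\<lambda>r. ?I (r - h))" for h by (rule integrable_shift[OF iI])
  have iP: "integrable lborel (\<lambda>r. ?I r * (1 - ?I (r - h)))" for h
    by (rule Bochner_Integration.integrable_bound[OF iI]) (auto simp: indicator_def)
  have eq: "(LINT r|lborel. \<bar>?I (r - h) - ?I r\<bar>) = 2 * (LINT r|lborel. ?I r * (1 - ?I (r - h)))" for h
  proof -
    have "(LINT r|lborel. \<bar>?I (r - h) - ?I r\<bar>) = (LINT r|lborel. 2 * (?I r * (1 - ?I (r - h))) - ?I r + ?I (r - h))"
      by (intro Bochner_Integration.integral_cong) (auto simp: indicator_def)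
    also have "\<dots> = (LINT r|lborel. 2 * (?I r * (1 - ?I (r - h)))) - (LINT r|lborel. ?I r) + (LINT r|lborel. ?I (r - h))"
      using iP[of h] iI Ih[of h]
      by (subst Bochner_Integration.integral_add, simp, simp, subst Bochner_Integration.integral_diff) simp_all
    also have "\<dots> = 2 * (LINT r|lborel. ?I r * (1 - ?I (r - h)))"
      using LINT_shift[of ?I h] by simp
    finally show ?thesis .
  qed
  have "((\<lambda>h. LINT r|lborel. ?I r * (1 - ?I (r - h))) \<longlongrightarrow> 0) (at_right 0)"
  proof (rule tendsto_at_right_sequentially[of 0 1])
    fix S :: "nat \<Rightarrow> real" assume S: "S \<longlonglongrightarrow> 0"
    have "(\<lambda>n. LINT r|lborel. ?I r * (1 - ?I (r - S n))) \<longlonglongrightarrow> (LINT r|(lborel::real measure). 0)"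
    proof (rule integral_dominated_convergence[where w = ?I])
      show "AE r in lborel. (\<lambda>n. ?I r * (1 - ?I (r - S n))) \<longlonglongrightarrow> 0"
      proof (rule AE_I2)
        fix r
        show "(\<lambda>n. ?I r * (1 - ?I (r - S n))) \<longlonglongrightarrow> 0"
        proof (cases "r \<in> U")
          case True
          have "(\<lambda>n. r - S n) \<longlonglongrightarrow> r - 0" by (intro tendsto_intros S)
          then have "\<forall>\<^sub>F n in sequentially. r - S n \<in> U"
            using U(1) True by (intro topological_tendstoD) auto
          then have "\<forall>\<^sub>F n in sequentially. ?I r * (1 - ?I (r - S n)) = 0"
            by (rule eventually_mono) (simp add: True)
          then show ?thesis by (rule tendsto_eventually)
        qed simp
      qed
      show "AE r in lborel. norm (?I r * (1 - ?I (r - S n))) \<le> ?I r" for n by (auto simp: indicator_def)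
    qed (use iI in measurable)
    then show "(\<lambda>n. LINT r|lborel. ?I r * (1 - ?I (r - S n))) \<longlonglongrightarrow> 0" by simp
  qed simp
  from tendsto_mult_left[OF this, of 2] show ?thesis unfolding eq by simp
qed

lemma tendsto_translate_indicator:
  fixes A :: "real set"
  assumes A: "A \<in> sets borel" "emeasure lborel A < \<infinity>"
  shows "((\<lambda>h. LINT r|lborel. \<bar>indicator A (r - h) - indicator A r\<bar>) \<longlongrightarrow> (0::real)) (at_right 0)"
proof (rule tendstoI)
  fix e :: real assume e: "0 < e"
  \<comment> \<open>Passing to an open superset costs the excess twice, once for the set and once
    for its translate. Two quarters of \<open>e\<close> go there, the remaining half to the open
    set.\<close>
  obtain U where U: "open U" "A \<subseteq> U" "emeasure lborel (U - A) < ennreal (e / 4)"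
    using outer_regular_lborel[of A "e / 4"] A e by auto
  have Um [measurable]: "U \<in> sets borel" "A \<in> sets borel" using U A by auto
  have UA: "emeasure lborel (U - A) < \<infinity>" using U(3) by (auto intro: less_trans)
  have "emeasure lborel U \<le> emeasure lborel (A \<union> (U - A))" by (intro emeasure_mono) auto
  also have "\<dots> \<le> emeasure lborel A + emeasure lborel (U - A)" by (intro emeasure_subadditive) auto
  also have "\<dots> < \<infinity>" using A(2) UA by simp
  finally have Uf: "emeasure lborel U < \<infinity>" .
  let ?D = "indicator (U - A) :: real \<Rightarrow> real"
  have iD: "integrable lborel ?D" using UA by (simp add: integrable_indicator_iff)
  have iA: "integrable lborel (indicator A :: real \<Rightarrow> real)" using A by (simp add: integrable_indicator_iff)
  have iU: "integrable lborel (indicator U :: real \<Rightarrow> real)" using Uf by (simp add: integrable_indicator_iff)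
  have mD: "(LINT r|lborel. ?D r) < e / 4"
  proof -
    have "(LINT r|lborel. ?D r) = measure lborel (U - A)" by simp
    also have "\<dots> < e / 4"
    proof -
      have "ennreal (measure lborel (U - A)) < ennreal (e / 4)"
        using U(3) UA by (simp add: emeasure_eq_ennreal_measure)
      then show ?thesis using e by (simp add: ennreal_less_iff)
    qed
    finally show ?thesis .
  qed
  have "\<forall>\<^sub>F h in at_right 0. dist (LINT r|lborel. \<bar>indicator U (r - h) - indicator U r\<bar>) (0::real) < e / 2"
    using tendsto_translate_open[OF U(1) Uf] e by (intro tendstoD) auto
  then show "\<forall>\<^sub>F h in at_right 0. dist (LINT r|lborel. \<bar>indicator A (r - h) - indicator A r\<bar>) (0::real) < e"
  proof (rule eventually_mono)
    fix h assume h: "dist (LINT r|lborel. \<bar>indicator U (r - h) - indicator U r\<bar>) (0::real) < e / 2"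
    have i1: "integrable lborel (\<lambda>r. \<bar>indicator U (r - h) - indicator U r :: real\<bar>)"
      by (intro integrable_abs Bochner_Integration.integrable_diff integrable_shift iU)
    have "(LINT r|lborel. \<bar>indicator A (r - h) - indicator A r :: real\<bar>) \<le>
      (LINT r|lborel. \<bar>indicator U (r - h) - indicator U r\<bar> + (?D r + ?D (r - h)))"
    proof (rule integral_mono)
      show "integrable lborel (\<lambda>r. \<bar>indicator A (r - h) - indicator A r :: real\<bar>)"
        by (intro integrable_abs Bochner_Integration.integrable_diff integrable_shift iA)
      show "integrable lborel (\<lambda>r. \<bar>indicator U (r - h) - indicator U r :: real\<bar> + (?D r + ?D (r - h)))"
        by (intro Bochner_Integration.integrable_add i1 iD integrable_shift)
      show "\<bar>indicator A (r - h) - indicator A r :: real\<bar> \<le> \<bar>indicator U (r - h) - indicator U r\<bar> + (?D r + ?D (r - h))" for r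
        using U(2) by (auto simp: indicator_def)
    qed
    also have "\<dots> = (LINT r|lborel. \<bar>indicator U (r - h) - indicator U r\<bar>) + ((LINT r|lborel. ?D r) + (LINT r|lborel. ?D (r - h)))"
      using i1 iD integrable_shift[OF iD, of h]
      by (subst Bochner_Integration.integral_add, simp, simp, subst Bochner_Integration.integral_add) simp_all
    also have "\<dots> < e"
      using h mD LINT_shift[of ?D h] by (simp add: dist_real_def)
    finally have "(LINT r|lborel. \<bar>indicator A (r - h) - indicator A r :: real\<bar>) < e" .
    moreover have "(LINT r|lborel. \<bar>indicator A (r - h) - indicator A r :: real\<bar>) \<ge> 0"
      by (rule integral_nonneg_AE) simp
    ultimately show "dist (LINT r|lborel. \<bar>indicator A (r - h) - indicator A r\<bar>) (0::real) < e"
      by (simp add: dist_real_def)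
  qed
qed

lemma L2_simple_approx:
  assumes f: "f \<in> L2 A" and e: "e > 0"
  shows "\<exists>s. simple_function lborel s \<and> s \<in> L2 A \<and> (LINT r|lborel. (norm (f r - s r))\<^sup>2) < e"
proof -
  obtain s where s: "\<And>i. simple_function lborel (s i)" "\<And>r. (\<lambda>i. s i r) \<longlonglongrightarrow> f r"
    using L2D(1)[OF f] by (rule strongly_measurableE) blast
  \<comment> \<open>Cutting off where the simple function is more than twice as large as
    \<open>f\<close> keeps pointwise convergence, gives the integrable majorant
    \<open>9 * (norm (f r))\<^sup>2\<close>, and makes \<open>t i\<close> vanish wherever
    \<open>f\<close> does.\<close>
  define t where "t i r = (if norm (s i r) \<le> 2 * norm (f r) then s i r else 0)" for i r
  have fm [measurable]: "(\<lambda>r. norm (f r)) \<in> borel_measurable borel"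
    using borel_measurable_norm_strongly[OF L2D(1)[OF f]] by simp
  have sm [measurable]: "(\<lambda>r. norm (s i r)) \<in> borel_measurable borel" for i
    using borel_measurable_simple_function[OF simple_function_compose1[OF s(1)], of norm i] by simp
  have ts: "simple_function lborel (t i)" for i
    unfolding t_def by (rule simple_function_If[OF s(1)]) auto
  have tb: "norm (t i r) \<le> 2 * norm (f r)" for i r by (auto simp: t_def)
  have tL: "t i \<in> L2 A" for i
  proof (rule L2_boundI[where h = "\<lambda>r. 4 * (norm (f r))\<^sup>2"])
    show "strongly_measurable (t i)" by (rule strongly_measurable_simple[OF ts])
    show "integrable lborel (\<lambda>r. 4 * (norm (f r))\<^sup>2)" using L2D(2)[OF f] by simp
    show "(norm (t i r))\<^sup>2 \<le> 4 * (norm (f r))\<^sup>2" for r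
      using power_mono[OF tb[of i r], of 2] by (simp add: power_mult_distrib)
    show "t i r = 0" if "r \<notin> A" for r using tb[of i r] L2D(3)[OF f that] by simp
  qed
  have tlim: "(\<lambda>i. t i r) \<longlonglongrightarrow> f r" for r
  proof (cases "f r = 0")
    case True
    then show ?thesis using tb[of _ r] by simp
  next
    case False
    have "(\<lambda>i. norm (s i r)) \<longlonglongrightarrow> norm (f r)" by (intro tendsto_norm s)
    then have "\<forall>\<^sub>F i in sequentially. norm (s i r) < 2 * norm (f r)"
      using False by (intro order_tendstoD) auto
    then have "\<forall>\<^sub>F i in sequentially. s i r = t i r" by (rule eventually_mono) (simp add: t_def)
    then show ?thesis using s(2)[of r] by (rule Lim_transform_eventually[rotated])
  qed
  have "(\<lambda>i. LINT r|lborel. (norm (f r - t i r))\<^sup>2) \<longlonglongrightarrow> (LINT r|(lborel::real measure). 0)"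
  proof (rule integral_dominated_convergence[where w = "\<lambda>r. 9 * (norm (f r))\<^sup>2"])
    have "strongly_measurable (\<lambda>r. f r + (-1) *\<^sub>C t i r)" for i
    proof (intro strongly_measurable_add L2D(1)[OF f] strongly_measurable_comp[OF L2D(1)[OF tL]])
      show "bounded_clinear (\<lambda>x::'a. (-1) *\<^sub>C x)"
        by (rule bounded_clinearI[of _ 1]) (auto simp: scaleC_add_right scaleC_scaleC)
    qed
    from borel_measurable_norm_strongly[OF this]
    show "(\<lambda>r. (norm (f r - t i r))\<^sup>2) \<in> borel_measurable lborel" for i
      by (auto intro: borel_measurable_power)
    show "AE r in lborel. (\<lambda>i. (norm (f r - t i r))\<^sup>2) \<longlonglongrightarrow> 0"
    proof (rule AE_I2)
      fix r
      have "(\<lambda>i. (norm (f r - t i r))\<^sup>2) \<longlonglongrightarrow> (norm (f r - f r))\<^sup>2" by (intro tendsto_intros tlim)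
      then show "(\<lambda>i. (norm (f r - t i r))\<^sup>2) \<longlonglongrightarrow> 0" by simp
    qed
    show "AE r in lborel. norm ((norm (f r - t i r))\<^sup>2) \<le> 9 * (norm (f r))\<^sup>2" for i
    proof (rule AE_I2)
      fix r
      have "norm (f r - t i r) \<le> 3 * norm (f r)" using norm_triangle_ineq4[of "f r" "t i r"] tb[of i r] by simp
      from power_mono[OF this, of 2] show "norm ((norm (f r - t i r))\<^sup>2) \<le> 9 * (norm (f r))\<^sup>2"
        by (simp add: power_mult_distrib)
    qed
  qed (use L2D(2)[OF f] in auto)
  then have "\<forall>\<^sub>F i in sequentially. (LINT r|lborel. (norm (f r - t i r))\<^sup>2) < e"
    using e by (intro order_tendstoD(2)[of _ 0]) auto
  then obtain i where "(LINT r|lborel. (norm (f r - t i r))\<^sup>2) < e" using eventually_happens by force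
  then show ?thesis using ts tL by blast
qed

lemma L2_diff:
  assumes "f \<in> L2 A" "g \<in> L2 A"
  shows "(\<lambda>r. f r - g r) \<in> L2 A"
proof -
  have "(\<lambda>x. (-1) *\<^sub>C x) \<in> bops" using bops_scaleC[OF bops_id, of "-1"] by simp
  from L2_add[OF assms(1) L2_comp[OF assms(2) this]] show ?thesis by simp
qed

lemma L2_shift_UNIV:
  assumes "f \<in> L2 A" shows "(\<lambda>r. f (r - h)) \<in> L2 UNIV"
  using strongly_measurable_shift[OF L2D(1)[OF assms], of "- h"] integrable_shift[OF L2D(2)[OF assms], of h]
  by (simp add: mem_L2_iff)

text \<open>Where the translate differs from \<open>s\<close>, one of the two values is nonzero, and
  the point lies in the symmetric difference of the level set of that value and its translate.
  \<open>V\<close> omits the value 0, whose level set may have infinite measure.\<close>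

lemma tendsto_translate_simple:
  fixes s :: "real \<Rightarrow> 'k::complex_hilbert"
  assumes s: "simple_function lborel s" "s \<in> L2 A"
  shows "((\<lambda>h. LINT r|lborel. (norm (s (r - h) - s r))\<^sup>2) \<longlongrightarrow> 0) (at_right 0)"
proof -
  define V where "V = range s - {0}"
  have V: "finite V" "finite (range s)" using s(1) by (auto simp: V_def simple_function_def)
  have "\<exists>C. \<forall>v\<in>range s. norm v \<le> C" using V(2) by (meson bounded_iff finite_imp_bounded)
  then obtain C where C: "\<And>r. norm (s r) \<le> C" by auto
  define A' where "A' v = s -` {v}" for v
  have Am [measurable]: "A' v \<in> sets borel" for v
    using simple_functionD(2)[OF s(1), of "{v}"] by (simp add: A'_def)
  have Af: "emeasure lborel (A' v) < \<infinity>" if "v \<in> V" for v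
  proof -
    have v: "v \<noteq> 0" using that by (simp add: V_def)
    have "integrable lborel (\<lambda>r. indicator (A' v) r :: real)"
    proof (rule Bochner_Integration.integrable_bound[of lborel "\<lambda>r. (1 / (norm v)\<^sup>2) * (norm (s r))\<^sup>2"])
      show "AE r in lborel. norm (indicator (A' v) r :: real) \<le> norm (1 / (norm v)\<^sup>2 * (norm (s r))\<^sup>2)"
        using v by (auto simp: indicator_def A'_def)
    qed (use L2D(2)[OF s(2)] in auto)
    then show ?thesis by (simp add: integrable_indicator_iff)
  qed
  define D where "D v h = (LINT r|lborel. \<bar>indicator (A' v) (r - h) - indicator (A' v) r :: real\<bar>)" for v h
  have iA: "integrable lborel (\<lambda>r. \<bar>indicator (A' v) (r - h) - indicator (A' v) r :: real\<bar>)" if "v \<in> V" for v h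
    by (intro integrable_abs Bochner_Integration.integrable_diff integrable_shift)
      (use Af[OF that] in \<open>simp_all add: integrable_indicator_iff\<close>)
  have pt: "(norm (s (r - h) - s r))\<^sup>2 \<le> 4 * C\<^sup>2 * (\<Sum>v\<in>V. \<bar>indicator (A' v) (r - h) - indicator (A' v) r :: real\<bar>)" for r h
  proof (cases "s (r - h) = s r")
    case True
    then show ?thesis by (simp add: sum_nonneg)
  next
    case False
    have "norm (s (r - h) - s r) \<le> 2 * C"
      using norm_triangle_ineq4[of "s (r - h)" "s r"] C[of "r - h"] C[of r] by simp
    from power_mono[OF this, of 2] have "(norm (s (r - h) - s r))\<^sup>2 \<le> 4 * C\<^sup>2 * 1"
      by (simp add: power_mult_distrib)
    also have "\<dots> \<le> 4 * C\<^sup>2 * (\<Sum>v\<in>V. \<bar>indicator (A' v) (r - h) - indicator (A' v) r :: real\<bar>)"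
    proof (intro mult_left_mono)
      obtain v where v: "v \<in> V" "v = s (r - h) \<or> v = s r"
        using False unfolding V_def by (metis Diff_iff rangeI singletonD)
      have "1 = \<bar>indicator (A' v) (r - h) - indicator (A' v) r :: real\<bar>"
        using v(2) False by (auto simp: A'_def indicator_def)
      also have "\<dots> \<le> (\<Sum>v\<in>V. \<bar>indicator (A' v) (r - h) - indicator (A' v) r :: real\<bar>)"
        by (rule member_le_sum[OF v(1)]) (use V in auto)
      finally show "1 \<le> (\<Sum>v\<in>V. \<bar>indicator (A' v) (r - h) - indicator (A' v) r :: real\<bar>)" .
    qed auto
    finally show ?thesis .
  qed
  have le: "(LINT r|lborel. (norm (s (r - h) - s r))\<^sup>2) \<le> 4 * C\<^sup>2 * (\<Sum>v\<in>V. D v h)" for h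
  proof -
    have "(LINT r|lborel. (norm (s (r - h) - s r))\<^sup>2) \<le>
        (LINT r|lborel. 4 * C\<^sup>2 * (\<Sum>v\<in>V. \<bar>indicator (A' v) (r - h) - indicator (A' v) r :: real\<bar>))"
      by (rule integral_mono[OF L2D(2)[OF L2_diff[OF L2_shift_UNIV[OF s(2)] L2_mono[OF s(2) subset_UNIV]]] _ pt])
        (intro integrable_mult_right Bochner_Integration.integrable_sum iA)
    also have "\<dots> = 4 * C\<^sup>2 * (\<Sum>v\<in>V. D v h)"
      unfolding D_def
      by (subst Bochner_Integration.integral_mult_right_zero, subst Bochner_Integration.integral_sum) (auto intro: iA)
    finally show ?thesis .
  qed
  have "((\<lambda>h. 4 * C\<^sup>2 * (\<Sum>v\<in>V. D v h)) \<longlongrightarrow> 4 * C\<^sup>2 * (\<Sum>v\<in>V. 0)) (at_right 0)"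
    unfolding D_def
    by (rule tendsto_mult_left, rule tendsto_sum, rule tendsto_translate_indicator) (use Af in auto)
  then have "((\<lambda>h. 4 * C\<^sup>2 * (\<Sum>v\<in>V. D v h)) \<longlongrightarrow> 0) (at_right 0)" by simp
  then show ?thesis
    by (rule tendsto_sandwich[of "\<lambda>_. 0", rotated 3])
      (use le in \<open>auto intro!: always_eventually integral_nonneg_AE\<close>)
qed

lemma tendsto_translate_L2:
  assumes f: "f \<in> L2 A" shows "((\<lambda>h. LINT r|lborel. (norm (f (r - h) - f r))\<^sup>2) \<longlongrightarrow> 0) (at_right 0)"
proof (rule tendstoI)
  fix e :: real assume e: "0 < e"
  \<comment> \<open>The three errors enter the final estimate with weights 4, 4 and 2, hence a tenth
    of \<open>e\<close> for each.\<close>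
  obtain s where s: "simple_function lborel s" "s \<in> L2 A" "(LINT r|lborel. (norm (f r - s r))\<^sup>2) < e / 10"
    using L2_simple_approx[OF f, of "e / 10"] e by auto
  have "\<forall>\<^sub>F h in at_right 0. dist (LINT r|lborel. (norm (s (r - h) - s r))\<^sup>2) 0 < e / 10"
    using tendsto_translate_simple[OF s(1,2)] e by (intro tendstoD) auto
  then show "\<forall>\<^sub>F h in at_right 0. dist (LINT r|lborel. (norm (f (r - h) - f r))\<^sup>2) 0 < e"
  proof (rule eventually_mono)
    fix h assume h: "dist (LINT r|lborel. (norm (s (r - h) - s r))\<^sup>2) 0 < e / 10"
    let ?a = "\<lambda>r. (norm (f r - s r))\<^sup>2"
    have i1: "integrable lborel ?a" by (rule L2D(2)[OF L2_diff[OF f s(2)]])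
    have i2: "integrable lborel (\<lambda>r. ?a (r - h))" by (rule integrable_shift[OF i1])
    have i3: "integrable lborel (\<lambda>r. (norm (s (r - h) - s r))\<^sup>2)"
      by (rule L2D(2)[OF L2_diff[OF L2_shift_UNIV[OF s(2)] L2_mono[OF s(2) subset_UNIV]]])
    have i4: "integrable lborel (\<lambda>r. (norm (f (r - h) - f r))\<^sup>2)"
      by (rule L2D(2)[OF L2_diff[OF L2_shift_UNIV[OF f] L2_mono[OF f subset_UNIV]]])
    have "(LINT r|lborel. (norm (f (r - h) - f r))\<^sup>2) \<le>
        (LINT r|lborel. 4 * ?a (r - h) + (4 * ?a r + 2 * (norm (s (r - h) - s r))\<^sup>2))"
    proof (rule integral_mono[OF i4])
      show "integrable lborel (\<lambda>r. 4 * ?a (r - h) + (4 * ?a r + 2 * (norm (s (r - h) - s r))\<^sup>2))"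
        using i1 i2 i3 by simp
      fix r
      define x y z where "x = f (r - h) - s (r - h)" and "y = - (f r - s r)" and "z = s (r - h) - s r"
      have "f (r - h) - f r = (x + y) + z" by (simp add: x_def y_def z_def)
      then have "(norm (f (r - h) - f r))\<^sup>2 \<le> 2 * (norm (x + y))\<^sup>2 + 2 * (norm z)\<^sup>2"
        using norm_add_sq_le[of "x + y" z] by simp
      also have "\<dots> \<le> 2 * (2 * (norm x)\<^sup>2 + 2 * (norm y)\<^sup>2) + 2 * (norm z)\<^sup>2"
        using norm_add_sq_le[of x y] by simp
      finally show "(norm (f (r - h) - f r))\<^sup>2 \<le> 4 * ?a (r - h) + (4 * ?a r + 2 * (norm (s (r - h) - s r))\<^sup>2)"
        by (simp add: x_def y_def z_def norm_minus_commute)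
    qed
    also have "\<dots> = 4 * (LINT r|lborel. ?a (r - h)) + (4 * (LINT r|lborel. ?a r) + 2 * (LINT r|lborel. (norm (s (r - h) - s r))\<^sup>2))"
      using i1 i2 i3 by (subst Bochner_Integration.integral_add, simp, simp, subst Bochner_Integration.integral_add) simp_all
    also have "\<dots> < e" using h s(3) LINT_shift[of ?a h] e by (simp add: dist_real_def)
    finally have "(LINT r|lborel. (norm (f (r - h) - f r))\<^sup>2) < e" .
    moreover have "(LINT r|lborel. (norm (f (r - h) - f r))\<^sup>2) \<ge> 0"
      by (rule integral_nonneg_AE) simp
    ultimately show "dist (LINT r|lborel. (norm (f (r - h) - f r))\<^sup>2) 0 < e" by (simp add: dist_real_def)
  qed
qed

lemma tendsto_L2_inner_right_shift:
  assumes f: "f \<in> L2 {0..}"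
  shows "((\<lambda>h. L2_inner (right_shift h f) f) \<longlongrightarrow> L2_inner f f) (at_right 0)"
proof (rule tendstoI)
  fix e :: real assume e: "0 < e"
  define N where "N = (LINT r|lborel. (norm (f r))\<^sup>2)"
  define D where "D h = (LINT r|lborel. (norm (f (r - h) - f r))\<^sup>2)" for h
  have N: "N \<ge> 0" unfolding N_def by (rule integral_nonneg_AE) simp
  \<comment> \<open>The weight in \<open>2ab \<le> k a^2 + b^2 / k\<close>: it keeps the fixed term
    \<open>N / k\<close> below \<open>e\<close>, and the translation error then only has to be below
    \<open>e / k\<close>.\<close>
  define k where "k = (N + 1) / e"
  have k: "k > 0" "N / k < e" using N e by (auto simp: k_def field_simps)
  have "\<forall>\<^sub>F h in at_right 0. dist (D h) 0 < e / k"
    unfolding D_def using tendsto_translate_L2[OF f] e k by (intro tendstoD) auto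
  then show "\<forall>\<^sub>F h in at_right 0. dist (L2_inner (right_shift h f) f) (L2_inner f f) < e"
  proof (rule eventually_mono)
    fix h assume h: "dist (D h) 0 < e / k"
    note f' = L2_mono[OF f subset_UNIV]
    have d: "(\<lambda>r. f (r - h) - f r) \<in> L2 UNIV" by (rule L2_diff[OF L2_shift_UNIV[OF f] f'])
    have "L2_inner (right_shift h f) f - L2_inner f f = (LINT r|lborel. cinner (f (r - h)) (f r) - cinner (f r) (f r))"
      unfolding L2_inner_def right_shift_eq[OF f]
      using Bochner_Integration.integral_diff[OF integrable_cinner[OF L2_shift_UNIV[OF f, of h] f] integrable_cinner[OF f f]]
      by simp
    also have "\<dots> = (LINT r|lborel. cinner (f (r - h) - f r) (f r))" by (simp add: cinner_diff_left)
    finally have "cmod (L2_inner (right_shift h f) f - L2_inner f f) \<le> (LINT r|lborel. cmod (cinner (f (r - h) - f r) (f r)))"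
      by (metis integral_norm_bound)
    also have "\<dots> \<le> (LINT r|lborel. (k * (norm (f (r - h) - f r))\<^sup>2 + (1 / k) * (norm (f r))\<^sup>2) / 2)"
    proof (rule integral_mono)
      show "integrable lborel (\<lambda>r. cmod (cinner (f (r - h) - f r) (f r)))"
        by (rule integrable_norm[OF integrable_cinner[OF d f]])
      show "integrable lborel (\<lambda>r. (k * (norm (f (r - h) - f r))\<^sup>2 + (1 / k) * (norm (f r))\<^sup>2) / 2)"
        using L2D(2)[OF d] L2D(2)[OF f] by simp
      fix r
      define a b where "a = norm (f (r - h) - f r)" and "b = norm (f r)"
      have "0 \<le> (k * a - b)\<^sup>2" by simp
      then have "2 * (a * b) * k \<le> k\<^sup>2 * a\<^sup>2 + b\<^sup>2" by (simp add: power2_eq_square algebra_simps)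
      then have "a * b \<le> (k * a\<^sup>2 + (1 / k) * b\<^sup>2) / 2" using k(1) by (simp add: field_simps power2_eq_square)
      then show "cmod (cinner (f (r - h) - f r) (f r)) \<le> (k * (norm (f (r - h) - f r))\<^sup>2 + (1 / k) * (norm (f r))\<^sup>2) / 2"
        using cinner_Cauchy_Schwarz[of "f (r - h) - f r" "f r"] by (simp add: a_def b_def)
    qed
    also have "\<dots> = (k * D h + (1 / k) * N) / 2"
      unfolding D_def N_def using L2D(2)[OF d] L2D(2)[OF f] by simp
    also have "\<dots> < e"
    proof -
      have "D h < e / k" using h by (simp add: dist_real_def)
      then have "k * D h < e" using k(1) by (simp add: field_simps)
      then show ?thesis using k(2) by simp
    qed
    finally show "dist (L2_inner (right_shift h f) f) (L2_inner f f) < e" by (simp add: dist_norm)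
  qed
qed

section \<open>Fock space over the half-line\<close>

text \<open>Proportional Gram matrices give proportional norms of finite combinations, so the
  bounded extension applies with the constant \<open>sqrt (cmod k)\<close>.\<close>

lemma kernel_extension:
  fixes b :: "'i \<Rightarrow> 'a::complex_hilbert" and d :: "'i \<Rightarrow> 'b::complex_hilbert"
  assumes "\<And>i i'. i \<in> I \<Longrightarrow> i' \<in> I \<Longrightarrow> cinner (d i) (d i') = k * cinner (b i) (b i')"
  shows "\<exists>T. bounded_clinear T \<and> (\<forall>i\<in>I. T (b i) = d i)"
proof -
  have "\<exists>T. bounded_clinear T \<and> (\<forall>x. norm (T x) \<le> \<bar>sqrt (cmod k)\<bar> * norm x) \<and> (\<forall>i\<in>I. T (b i) = d i)"
  proof (rule clinear_extension)
    fix F and c :: "'i \<Rightarrow> complex" assume F: "finite F" "F \<subseteq> I"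
    have "cinner (\<Sum>i\<in>F. c i *\<^sub>C d i) (\<Sum>i\<in>F. c i *\<^sub>C d i) = k * cinner (\<Sum>i\<in>F. c i *\<^sub>C b i) (\<Sum>i\<in>F. c i *\<^sub>C b i)"
      unfolding cinner_sum_left unfolding cinner_sum_right sum_distrib_left
      by (intro sum.cong refl) (use F assms in \<open>auto simp: cinner_scaleC_left cinner_scaleC_right subset_iff\<close>)
    then have "cmod (cinner (\<Sum>i\<in>F. c i *\<^sub>C d i) (\<Sum>i\<in>F. c i *\<^sub>C d i)) = cmod k * (norm (\<Sum>i\<in>F. c i *\<^sub>C b i))\<^sup>2"
      by (simp add: norm_mult cinner_same norm_power)
    then have "(norm (\<Sum>i\<in>F. c i *\<^sub>C d i))\<^sup>2 = (sqrt (cmod k) * norm (\<Sum>i\<in>F. c i *\<^sub>C b i))\<^sup>2"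
      by (simp add: cinner_same norm_power power_mult_distrib)
    then show "norm (\<Sum>i\<in>F. c i *\<^sub>C d i) \<le> sqrt (cmod k) * norm (\<Sum>i\<in>F. c i *\<^sub>C b i)"
      by (rule power2_le_imp_le[OF eq_refl]) simp
  qed
  then show ?thesis by blast
qed

text \<open>Equiboundedness spreads strong convergence from a total set to all vectors. The bound is
  asked for only eventually, because partition sums are controlled only for sets \<open>Q\<close>
  that really are partitions of the interval.\<close>

lemma tendsto_on_total:
  fixes T :: "'i \<Rightarrow> 'a::complex_hilbert \<Rightarrow> 'b::complex_hilbert"
  assumes T: "\<And>i. bounded_clinear (T i)" "\<forall>\<^sub>F i in F. \<forall>x. norm (T i x) \<le> C * norm x"
    and U: "bounded_clinear U"
    and B: "closure (cspan B) = UNIV" "\<And>b. b \<in> B \<Longrightarrow> ((\<lambda>i. T i b) \<longlongrightarrow> U b) F"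
  shows "((\<lambda>i. T i x) \<longlongrightarrow> U x) F"
proof -
  let ?S = "{x. ((\<lambda>i. T i x) \<longlongrightarrow> U x) F}"
  have sub: "csubspace ?S"
    by (rule complex_hilbert.subspaceI)
      (auto simp: T(1) U bounded_clinear_add bounded_clinear_scaleC intro: tendsto_add tendsto_scaleC)
  have "closure ?S \<subseteq> ?S"
  proof
    fix x assume x: "x \<in> closure ?S"
    define K where "K = \<bar>C\<bar> + onorm U + 1"
    have oU: "onorm U \<ge> 0" using U by (simp add: bounded_clinear_bounded_linear onorm_pos_le)
    have K: "K > 0" using oU by (simp add: K_def)
    have "((\<lambda>i. T i x) \<longlongrightarrow> U x) F"
    proof (rule tendstoI)
      fix e :: real assume e: "0 < e"
      obtain y where y: "y \<in> ?S" "dist y x < e / (2 * K)"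
        using x e K unfolding closure_approachable by (metis divide_pos_pos zero_less_mult_iff zero_less_numeral)
      have "\<forall>\<^sub>F i in F. dist (T i y) (U y) < e / 2" using y(1) e by (intro tendstoD) auto
      then show "\<forall>\<^sub>F i in F. dist (T i x) (U x) < e"
        using T(2)
      proof (rule eventually_elim2)
        fix i assume i: "dist (T i y) (U y) < e / 2" "\<forall>x. norm (T i x) \<le> C * norm x"
        have eq: "T i x - U x = T i (x - y) + (T i y - U y) - U (x - y)"
          by (simp add: bounded_clinear_diff[OF T(1)] bounded_clinear_diff[OF U])
        have "norm (T i x - U x) \<le> norm (T i (x - y)) + norm (T i y - U y) + norm (U (x - y))"
          unfolding eq by (rule order_trans[OF norm_triangle_ineq4 add_right_mono[OF norm_triangle_ineq]])
        also have "\<dots> \<le> C * norm (x - y) + norm (T i y - U y) + onorm U * norm (x - y)"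
          using i(2) bounded_clinear_bound[OF U] by (intro add_mono) auto
        also have "\<dots> \<le> K * norm (x - y) + norm (T i y - U y)"
        proof -
          have "C * norm (x - y) \<le> \<bar>C\<bar> * norm (x - y)" by (intro mult_right_mono) auto
          then show ?thesis by (simp add: K_def algebra_simps) (smt (verit) norm_ge_zero)
        qed
        also have "\<dots> < K * (e / (2 * K)) + e / 2"
          using y(2) i(1) K by (intro add_strict_mono mult_strict_left_mono) (auto simp: dist_norm norm_minus_commute)
        also have "\<dots> = e" using K by simp
        finally show "dist (T i x) (U x) < e" by (simp add: dist_norm)
      qed
    qed
    then show "x \<in> ?S" by simp
  qed
  then have "closed ?S" using closure_subset_eq by blast
  then have "closure (cspan B) \<subseteq> ?S" using sub B(2) by (intro closure_cspan_subset) auto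
  then show ?thesis using B(1) by auto
qed

locale fock =
  fixes ex :: "(real \<Rightarrow> 'k::complex_hilbert) \<Rightarrow> 'f::complex_hilbert"
  assumes fock: "boson_fock ex"
begin

lemma ex_inner: "f \<in> L2 {0..} \<Longrightarrow> g \<in> L2 {0..} \<Longrightarrow> cinner (ex f) (ex g) = exp (L2_inner f g)"
  using fock by (simp add: boson_fock_def)

lemma ex_total: "closure (cspan (ex ` L2 {0..})) = UNIV"
  using fock by (simp add: boson_fock_def)

abbreviation vac :: 'f where "vac \<equiv> ex (\<lambda>_. 0)"

lemma vac_inner: "f \<in> L2 {0..} \<Longrightarrow> cinner vac (ex f) = 1" "f \<in> L2 {0..} \<Longrightarrow> cinner (ex f) vac = 1"
  by (simp_all add: ex_inner L2_zero)

section \<open>Concatenation of functions at a time \<open>t\<close> and the induced operators on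
  Fock space\<close>

definition conc :: "real \<Rightarrow> (real \<Rightarrow> 'k) \<Rightarrow> (real \<Rightarrow> 'k) \<Rightarrow> real \<Rightarrow> 'k" where
  "conc t f u = (\<lambda>r. restr {0..<t} f r + right_shift t u r)"

lemma restr_L2: "f \<in> L2 {0..} \<Longrightarrow> restr {0..<t} f \<in> L2 {0..<t}" "f \<in> L2 {0..} \<Longrightarrow> restr {t..} f \<in> L2 {t..}"
  by (auto intro: L2_restr)

lemma restr_L2': "f \<in> L2 {0..} \<Longrightarrow> restr {0..<t} f \<in> L2 {0..}"
  by (erule L2_mono[OF restr_L2(1)]) auto

lemma right_shift_L2': "f \<in> L2 {0..} \<Longrightarrow> t \<ge> 0 \<Longrightarrow> right_shift t f \<in> L2 {0..}"
  by (erule L2_mono[OF right_shift_L2]) auto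

lemma conc_L2: "f \<in> L2 {0..} \<Longrightarrow> u \<in> L2 {0..} \<Longrightarrow> t \<ge> 0 \<Longrightarrow> conc t f u \<in> L2 {0..}"
  unfolding conc_def by (intro L2_add restr_L2' right_shift_L2')

lemma restr_conc: "restr {0..<t} (conc t f u) = restr {0..<t} f" "t \<ge> 0 \<Longrightarrow> restr {t..} (conc t f u) = right_shift t u"
  by (auto simp: restr_def conc_def right_shift_def)

lemma conc_left_shift: "f \<in> L2 {0..} \<Longrightarrow> t \<ge> 0 \<Longrightarrow> conc t f (left_shift t f) = f"
  using restr_decompose[of f t] by (simp add: conc_def right_shift_left_shift)

lemma L2_inner_split:
  assumes "f \<in> L2 {0..}" "g \<in> L2 {0..}" "f' \<in> L2 {0..<t}" "g' \<in> L2 {0..<t}" "t \<ge> 0"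
  shows "L2_inner (\<lambda>r. f' r + right_shift t f r) (\<lambda>r. g' r + right_shift t g r) = L2_inner f' g' + L2_inner f g"
proof -
  have a: "right_shift t f \<in> L2 {t..}" "right_shift t g \<in> L2 {t..}" using assms by (auto intro: right_shift_L2)
  have z: "L2_inner f' (right_shift t g) = 0" by (rule L2_inner_disjoint[OF assms(3) a(2)]) auto
  have z': "L2_inner (right_shift t f) g' = 0" by (rule L2_inner_disjoint[OF a(1) assms(4)]) auto
  have g: "(\<lambda>r. g' r + right_shift t g r) \<in> L2 {0..}"
    by (intro L2_add L2_mono[OF assms(4)] L2_mono[OF a(2)]) (use assms(5) in auto)
  show ?thesis
    unfolding L2_inner_add_left[OF assms(3) a(1) g] L2_inner_add_right[OF assms(4) a(2) assms(3)]
      L2_inner_add_right[OF assms(4) a(2) a(1)] L2_inner_right_shift[OF assms(1,2)] z z' by simp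
qed

lemma L2_inner_conc:
  assumes "f \<in> L2 {0..}" "g \<in> L2 {0..}" "u \<in> L2 {0..}" "v \<in> L2 {0..}" "t \<ge> 0"
  shows "L2_inner (conc t f u) (conc t g v) = L2_inner (restr {0..<t} f) (restr {0..<t} g) + L2_inner u v"
  unfolding conc_def by (rule L2_inner_split) (use assms in \<open>auto intro: restr_L2\<close>)

definition j :: "real \<Rightarrow> (real \<Rightarrow> 'k) \<Rightarrow> 'f \<Rightarrow> 'f" where
  "j t f = (SOME T. bounded_clinear T \<and> (\<forall>u\<in>L2 {0..}. T (ex u) = ex (conc t f u)))"

definition \<kappa> :: "real \<Rightarrow> (real \<Rightarrow> 'k) \<Rightarrow> (real \<Rightarrow> 'k) \<Rightarrow> complex" where
  "\<kappa> t f g = exp (L2_inner (restr {0..<t} f) (restr {0..<t} g))"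

lemma
  assumes "f \<in> L2 {0..}" "t \<ge> 0"
  shows j_bops: "j t f \<in> bops" and j_ex: "u \<in> L2 {0..} \<Longrightarrow> j t f (ex u) = ex (conc t f u)"
proof -
  have "\<exists>T. bounded_clinear T \<and> (\<forall>u\<in>L2 {0..}. T (ex u) = ex (conc t f u))"
    by (rule kernel_extension[where k = "\<kappa> t f f"])
      (use assms in \<open>simp add: ex_inner conc_L2 L2_inner_conc exp_add \<kappa>_def\<close>)
  from someI_ex[OF this, folded j_def]
  show "j t f \<in> bops" "u \<in> L2 {0..} \<Longrightarrow> j t f (ex u) = ex (conc t f u)" by (auto simp: bops_def)
qed

lemma j_inner:
  assumes "f \<in> L2 {0..}" "g \<in> L2 {0..}" "t \<ge> 0"
  shows "cinner (j t f x) (j t g y) = \<kappa> t f g * cinner x y"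
proof -
  have "cinner (j t f x) (j t g y) = \<kappa> t f g * cinner (id x) (id y)"
    by (rule cinner_eq_on_total[OF bopsD[OF j_bops] bopsD[OF j_bops] bounded_clinear_id bounded_clinear_id ex_total])
      (use assms in \<open>auto simp: j_ex ex_inner conc_L2 L2_inner_conc exp_add \<kappa>_def\<close>)
  then show ?thesis by simp
qed

lemma j_left_shift: "f \<in> L2 {0..} \<Longrightarrow> t \<ge> 0 \<Longrightarrow> j t f (ex (left_shift t f)) = ex f"
  by (simp add: j_ex left_shift_L2 conc_left_shift)

lemma \<kappa>_eq: "f \<in> L2 {0..} \<Longrightarrow> g \<in> L2 {0..} \<Longrightarrow> \<kappa> t f g = cinner (ex (restr {0..<t} f)) (ex (restr {0..<t} g))"
  by (simp add: \<kappa>_def ex_inner restr_L2')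

lemma ex_mem_j_ranges:
  assumes "t \<ge> 0" shows "ex ` L2 {0..} \<subseteq> {j t f x | f x. f \<in> L2 {0..}}"
proof
  fix b assume "b \<in> ex ` L2 {0..}"
  then obtain u where u: "b = ex u" "u \<in> L2 {0..}" by blast
  have "b = j t u (ex (left_shift t u))" using j_left_shift[OF u(2) assms] u(1) by simp
  then show "b \<in> {j t f x | f x. f \<in> L2 {0..}}" using u(2) by blast
qed

lemma j_intertwiners:
  assumes "t \<ge> 0"
  shows "intertwiners (L2 {0..}) (\<lambda>f. ex (restr {0..<t} f)) (j t)"
  unfolding intertwiners_def
proof (intro conjI ballI allI)
  have "closure (cspan (ex ` L2 {0..})) \<subseteq> closure (cspan {j t f x | f x. f \<in> L2 {0..}})"
    by (intro closure_mono complex_hilbert.span_mono ex_mem_j_ranges assms)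
  then show "closure (cspan {j t f x | f x. f \<in> L2 {0..}}) = UNIV" using ex_total by auto
qed (use assms in \<open>auto simp: j_bops j_inner \<kappa>_eq\<close>)

text \<open>Concatenation is associative: following \<open>f\<close> up to \<open>s + t\<close> is
  following it up to \<open>s\<close> and then following its remainder up to \<open>t\<close>. The
  semigroup law of the flow and the comparison of neighbouring partition points both rest on
  this.\<close>

lemma j_comp:
  assumes "f \<in> L2 {0..}" "s \<ge> 0" "t \<ge> 0"
  shows "j (s + t) f = j s f \<circ> j t (left_shift s f)"
proof (rule bounded_clinear_eq_on_total[OF _ _ ex_total])
  show "bounded_clinear (j (s + t) f)" "bounded_clinear (j s f \<circ> j t (left_shift s f))"
    using assms by (auto intro!: bopsD[OF j_bops] bounded_clinear_comp left_shift_L2)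
  fix b assume "b \<in> ex ` L2 {0..}"
  then obtain u where u: "b = ex u" "u \<in> L2 {0..}" by blast
  have "conc s f (conc t (left_shift s f) u) = conc (s + t) f u"
    using assms(2,3) by (auto simp: conc_def restr_def left_shift_def right_shift_def fun_eq_iff algebra_simps)
  then show "j (s + t) f b = (j s f \<circ> j t (left_shift s f)) b"
    using assms u by (simp add: j_ex left_shift_L2 conc_L2)
qed

lemma j_0: "f \<in> L2 {0..} \<Longrightarrow> j 0 f = id"
proof (rule bounded_clinear_eq_on_total[OF bopsD[OF j_bops] bounded_clinear_id ex_total])
  fix b assume f: "f \<in> L2 {0..}" and "b \<in> ex ` L2 {0..}"
  then obtain u where u: "b = ex u" "u \<in> L2 {0..}" by blast
  have "conc 0 f u = u" using L2D(3)[OF u(2)] by (auto simp: conc_def restr_def right_shift_def fun_eq_iff)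
  then show "j 0 f b = id b" using f u by (simp add: j_ex)
qed auto

subsection \<open>The second quantised shift\<close>

abbreviation \<Gamma> :: "real \<Rightarrow> 'f \<Rightarrow> 'f" where "\<Gamma> t \<equiv> j t (\<lambda>_. 0)"

lemma conc_zero: "conc t (\<lambda>_. 0) u = right_shift t u"
  by (auto simp: conc_def restr_def)

lemma \<kappa>_zero [simp]: "\<kappa> t (\<lambda>_. 0) g = 1" "\<kappa> t g (\<lambda>_. 0) = 1"
  by (auto simp: \<kappa>_def restr_def)

lemma \<Gamma>_bops: "t \<ge> 0 \<Longrightarrow> \<Gamma> t \<in> bops"
  by (simp add: j_bops L2_zero)

lemma \<Gamma>_inner: "t \<ge> 0 \<Longrightarrow> cinner (\<Gamma> t x) (\<Gamma> t y) = cinner x y"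
  by (simp add: j_inner L2_zero)

lemma \<Gamma>_ex: "t \<ge> 0 \<Longrightarrow> u \<in> L2 {0..} \<Longrightarrow> \<Gamma> t (ex u) = ex (right_shift t u)"
  by (simp add: j_ex L2_zero conc_zero)

lemma norm_\<Gamma>:
  assumes "t \<ge> 0" shows "norm (\<Gamma> t x) = norm x"
proof -
  have "(norm (\<Gamma> t x))\<^sup>2 = (norm x)\<^sup>2" using assms by (simp add: norm_sq_cinner \<Gamma>_inner)
  then show ?thesis by (simp add: power2_eq_iff_nonneg)
qed

lemma cadj_\<Gamma>_\<Gamma>: "t \<ge> 0 \<Longrightarrow> cadj (\<Gamma> t) (\<Gamma> t x) = x"
  by (rule eq_if_cinner_eq) (simp add: cinner_cadj_right bopsD \<Gamma>_bops \<Gamma>_inner)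

lemma fock_shift_eq:
  assumes "t \<ge> 0" shows "fock_shift ex t = \<Gamma> t"
  unfolding fock_shift_def
proof (rule the_equality)
  show "\<Gamma> t \<in> bops \<and> (\<forall>f\<in>L2 {0..}. \<Gamma> t (ex f) = ex (right_shift t f))"
    using assms by (simp add: \<Gamma>_bops \<Gamma>_ex)
  fix T assume T: "T \<in> bops \<and> (\<forall>f\<in>L2 {0..}. T (ex f) = ex (right_shift t f))"
  show "T = \<Gamma> t"
    by (rule bounded_clinear_eq_on_total[OF _ _ ex_total]) (use T assms in \<open>auto simp: bopsD \<Gamma>_bops \<Gamma>_ex\<close>)
qed

lemma cadj_\<Gamma>_ex:
  assumes "t \<ge> 0" "f \<in> L2 {0..}"
  shows "cadj (\<Gamma> t) (ex f) = ex (left_shift t f)"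
proof (rule eq_if_cinner_eq_total[OF ex_total])
  fix b assume "b \<in> ex ` L2 {0..}"
  then obtain u where u: "b = ex u" "u \<in> L2 {0..}" by blast
  have "conc t (\<lambda>_. 0) u = conc t (\<lambda>_. 0) u" ..
  have "L2_inner (conc t (\<lambda>_. 0) u) (conc t f (left_shift t f)) = L2_inner u (left_shift t f)"
    using assms u by (subst L2_inner_conc) (auto simp: L2_zero left_shift_L2 restr_def)
  then have "L2_inner (right_shift t u) f = L2_inner u (left_shift t f)"
    using assms by (simp add: conc_left_shift conc_zero)
  then show "cinner b (cadj (\<Gamma> t) (ex f)) = cinner b (ex (left_shift t f))"
    using assms u by (simp add: cinner_cadj_right bopsD \<Gamma>_bops \<Gamma>_ex ex_inner right_shift_L2' left_shift_L2)
qed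

text \<open>Since \<open>\<Gamma> h\<close> is isometric, \<open>norm (\<Gamma> h b - b)\<close> is
  governed by \<open>cinner (\<Gamma> h b) b\<close>, which on exponential vectors is the
  exponential of an inner product with a translate.\<close>

lemma \<Gamma>_tendsto: "((\<lambda>h. \<Gamma> h y) \<longlongrightarrow> y) (at_right 0)"
proof -
  have pos: "\<forall>\<^sub>F h in at_right (0::real). h > 0" by (simp add: eventually_at_right_less)
  \<comment> \<open>The default value 0 at negative \<open>h\<close> makes the family consist of
    bounded operators for every index, as \<open>tendsto_on_total\<close> demands.\<close>
  have "((\<lambda>h. if h \<ge> 0 then \<Gamma> h y else 0) \<longlongrightarrow> id y) (at_right 0)"
  proof (rule tendsto_on_total[where T = "\<lambda>h y. if h \<ge> 0 then \<Gamma> h y else 0" and C = 1, OF _ _ bounded_clinear_id ex_total])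
    show "bounded_clinear (\<lambda>y. if h \<ge> 0 then \<Gamma> h y else 0)" for h
      using \<Gamma>_bops[of h] bops_zero by (cases "h \<ge> 0") (auto simp: bops_def)
    show "\<forall>\<^sub>F h in at_right 0. \<forall>x. norm (if h \<ge> 0 then \<Gamma> h x else 0) \<le> 1 * norm x"
      by (auto simp: norm_\<Gamma>)
    fix b assume "b \<in> ex ` L2 {0..}"
    then obtain u where u: "b = ex u" "u \<in> L2 {0..}" by blast
    have "((\<lambda>h. 2 * (norm b)\<^sup>2 - 2 * Re (exp (L2_inner (right_shift h u) u))) \<longlongrightarrow>
        2 * (norm b)\<^sup>2 - 2 * Re (exp (L2_inner u u))) (at_right 0)"
      by (intro tendsto_intros tendsto_L2_inner_right_shift u)
    moreover have "2 * (norm b)\<^sup>2 - 2 * Re (exp (L2_inner u u)) = 0"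
      using u by (simp add: norm_sq_cinner ex_inner)
    ultimately have lim: "((\<lambda>h. 2 * (norm b)\<^sup>2 - 2 * Re (exp (L2_inner (right_shift h u) u))) \<longlongrightarrow> 0) (at_right 0)"
      by simp
    have "\<forall>\<^sub>F h in at_right 0. 2 * (norm b)\<^sup>2 - 2 * Re (exp (L2_inner (right_shift h u) u)) = (norm (\<Gamma> h b - b))\<^sup>2"
      using pos
    proof (rule eventually_mono)
      fix h :: real assume h: "h > 0"
      then have "cinner (\<Gamma> h b) b = exp (L2_inner (right_shift h u) u)"
        using u by (simp add: \<Gamma>_ex ex_inner right_shift_L2')
      then show "2 * (norm b)\<^sup>2 - 2 * Re (exp (L2_inner (right_shift h u) u)) = (norm (\<Gamma> h b - b))\<^sup>2"
        using h by (simp add: norm_diff_sq norm_\<Gamma>)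
    qed
    from Lim_transform_eventually[OF lim this]
    have "((\<lambda>h. (norm (\<Gamma> h b - b))\<^sup>2) \<longlongrightarrow> 0) (at_right 0)" .
    then have "((\<lambda>h. norm (\<Gamma> h b - b)) \<longlongrightarrow> 0) (at_right 0)"
      using tendsto_real_sqrt[of _ 0] by fastforce
    then have "((\<lambda>h. \<Gamma> h b) \<longlongrightarrow> b) (at_right 0)"
      by (simp add: tendsto_norm_zero_iff LIM_zero_iff)
    moreover have "\<forall>\<^sub>F h in at_right 0. \<Gamma> h b = (if h \<ge> 0 then \<Gamma> h b else 0)"
      using pos by (rule eventually_mono) simp
    ultimately show "((\<lambda>h. if h \<ge> 0 then \<Gamma> h b else 0) \<longlongrightarrow> id b) (at_right 0)"
      by (simp add: Lim_transform_eventually)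
  qed
  moreover have "\<forall>\<^sub>F h in at_right 0. (if h \<ge> 0 then \<Gamma> h y else 0) = \<Gamma> h y"
    using pos by (rule eventually_mono) simp
  ultimately show ?thesis by (simp add: Lim_transform_eventually)
qed

text \<open>Both \<open>cinner (j h v y) (\<Gamma> h y)\<close> and
  \<open>cinner (\<Gamma> h y) (\<Gamma> h y)\<close> are the squared norm of \<open>y\<close>, so
  the distance depends on \<open>v\<close> only through \<open>\<kappa> h v v\<close>, that is,
  through the mass of \<open>v\<close> on \<open>[0,h)\<close>.\<close>

lemma norm_j_diff:
  assumes "v \<in> L2 {0..}" "h \<ge> 0"
  shows "norm (j h v y - \<Gamma> h y) = sqrt (Re (\<kappa> h v v) - 1) * norm y"
proof -
  have "\<kappa> h v v = complex_of_real (exp (LINT r|lborel. (norm (restr {0..<h} v r))\<^sup>2))"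
    by (simp add: \<kappa>_def L2_inner_same exp_of_real)
  then obtain x where x: "\<kappa> h v v = complex_of_real (exp x)" "x \<ge> 0"
    by (auto intro!: that integral_nonneg_AE)
  have "complex_of_real ((norm (j h v y))\<^sup>2) = complex_of_real (exp x * (norm y)\<^sup>2)"
    unfolding of_real_mult cinner_same[symmetric] x(1)[symmetric] by (rule j_inner[OF assms(1,1,2)])
  then have "(norm (j h v y))\<^sup>2 = exp x * (norm y)\<^sup>2" by (simp only: of_real_eq_iff)
  moreover have "cinner (j h v y) (\<Gamma> h y) = complex_of_real ((norm y)\<^sup>2)"
    using j_inner[OF assms(1) L2_zero assms(2), of y y] by (simp add: cinner_same)
  ultimately have "(norm (j h v y - \<Gamma> h y))\<^sup>2 = (exp x - 1) * (norm y)\<^sup>2"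
    using assms(2) by (simp add: norm_diff_sq norm_\<Gamma> algebra_simps)
  also have "\<dots> = (sqrt (Re (\<kappa> h v v) - 1) * norm y)\<^sup>2"
    using x by (simp add: power_mult_distrib)
  finally show ?thesis using x by (simp add: power2_eq_iff_nonneg)
qed

text \<open>Uniformity in \<open>s\<close> is the point: the mass of \<open>left_shift s g\<close>
  on \<open>[0,h)\<close> is that of \<open>g\<close> on \<open>[s,s+h)\<close>, which is small for
  short intervals wherever they lie. The remaining difference \<open>\<Gamma> h y - y\<close> does
  not involve \<open>s\<close>.\<close>

lemma j_left_shift_near_id:
  assumes g: "g \<in> L2 {0..}" and e: "e > 0"
  shows "\<exists>d>0. \<forall>s\<ge>0. \<forall>h\<ge>0. h < d \<longrightarrow> norm (j h (left_shift s g) y - y) < e"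
proof -
  define e1 where "e1 = e / (2 * (norm y + 1))"
  have n: "norm y + 1 > 0" by (simp add: add_nonneg_pos)
  have e1: "e1 > 0" "e1 * norm y < e / 2" using e n by (auto simp: e1_def field_simps add_pos_pos)
  have "isCont exp (0::real)" by simp
  moreover have "(1::real) < 1 + e1\<^sup>2" using e1 by simp
  ultimately have "\<forall>\<^sub>F x in at (0::real). exp x < 1 + e1\<^sup>2"
    unfolding isCont_def by (intro order_tendstoD(2)) auto
  then obtain d0 where d0: "d0 > 0" "\<And>x. x \<noteq> 0 \<Longrightarrow> dist x 0 < d0 \<Longrightarrow> exp x < 1 + e1\<^sup>2"
    unfolding eventually_at by auto
  obtain d1 where d1: "d1 > 0" "\<And>a b. b - a < d1 \<Longrightarrow> (LINT r|lborel. (norm (restr {a..<b} g r))\<^sup>2) < d0"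
    using L2_absolutely_continuous[OF g d0(1)] by blast
  have "\<forall>\<^sub>F h in at_right 0. dist (\<Gamma> h y) y < e / 2"
    using \<Gamma>_tendsto e by (intro tendstoD) auto
  then obtain d2 where d2: "d2 > 0" "\<And>h. h > 0 \<Longrightarrow> h < d2 \<Longrightarrow> dist (\<Gamma> h y) y < e / 2"
    unfolding eventually_at_right_field by auto
  have "norm (j h (left_shift s g) y - y) < e" if s: "s \<ge> 0" and h: "h \<ge> 0" "h < min d1 d2" for s h
  proof -
    let ?v = "left_shift s g"
    have v: "?v \<in> L2 {0..}" by (rule left_shift_L2[OF g])
    define x where "x = (LINT r|lborel. (norm (restr {s..<s + h} g r))\<^sup>2)"
    have "(\<lambda>r. (norm (restr {0..<h} ?v r))\<^sup>2) = (\<lambda>r. (norm (restr {s..<s + h} g (r - (- s))))\<^sup>2)"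
      using s by (auto simp: restr_def left_shift_def fun_eq_iff)
    then have "(LINT r|lborel. (norm (restr {0..<h} ?v r))\<^sup>2) = x"
      unfolding x_def using LINT_shift[of "\<lambda>r. (norm (restr {s..<s + h} g r))\<^sup>2" "- s"] by simp
    then have k: "\<kappa> h ?v ?v = complex_of_real (exp x)"
      by (simp add: \<kappa>_def L2_inner_same exp_of_real)
    have x: "x \<ge> 0" "x < d0" using d1(2)[of "s + h" s] h by (auto simp: x_def intro!: integral_nonneg_AE)
    have "exp x < 1 + e1\<^sup>2" using d0(2)[of x] x e1 by (cases "x = 0") (auto simp: dist_real_def)
    then have "sqrt (exp x - 1) < sqrt (e1\<^sup>2)" by (intro real_sqrt_less_mono) simp
    then have "sqrt (Re (\<kappa> h ?v ?v) - 1) \<le> e1" using e1 by (simp add: k)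
    then have "norm (j h ?v y - \<Gamma> h y) \<le> e1 * norm y"
      unfolding norm_j_diff[OF v h(1)] by (intro mult_right_mono) auto
    moreover have "norm (\<Gamma> h y - y) < e / 2"
      using d2(2)[of h] h e by (cases "h = 0") (auto simp: dist_norm j_0 L2_zero)
    moreover have "norm (j h ?v y - y) \<le> norm (j h ?v y - \<Gamma> h y) + norm (\<Gamma> h y - y)"
      using norm_triangle_ineq[of "j h ?v y - \<Gamma> h y" "\<Gamma> h y - y"] by simp
    ultimately show ?thesis using e1 by linarith
  qed
  then show ?thesis using d1 d2 by (intro exI[of _ "min d1 d2"]) auto
qed

lemma left_shift_0: "f \<in> L2 {0..} \<Longrightarrow> left_shift 0 f = f"
  using L2D(3) by (fastforce simp: left_shift_def fun_eq_iff)

lemma left_shift_add: "s \<ge> 0 \<Longrightarrow> h \<ge> 0 \<Longrightarrow> left_shift (s + h) g = left_shift s (left_shift h g)"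
  by (auto simp: left_shift_def fun_eq_iff algebra_simps)

lemma norm_cadj_\<Gamma>: "t \<ge> 0 \<Longrightarrow> norm (cadj (\<Gamma> t) x) \<le> norm x"
proof -
  assume t: "t \<ge> 0"
  have "(norm (cadj (\<Gamma> t) x))\<^sup>2 = Re (cinner x (\<Gamma> t (cadj (\<Gamma> t) x)))"
    using t by (simp add: norm_sq_cinner cinner_cadj_left bopsD \<Gamma>_bops)
  also have "\<dots> \<le> norm x * norm (\<Gamma> t (cadj (\<Gamma> t) x))"
    by (meson cinner_Cauchy_Schwarz complex_Re_le_cmod order_trans)
  finally have "(norm (cadj (\<Gamma> t) x))\<^sup>2 \<le> norm x * norm (cadj (\<Gamma> t) x)" using t by (simp add: norm_\<Gamma>)
  then show ?thesis by (cases "cadj (\<Gamma> t) x = 0") (auto simp: power2_eq_square)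
qed

text \<open>A further left shift by \<open>s\<close> is the contraction
  \<open>cadj (\<Gamma> s)\<close>, which reduces the estimate to \<open>s = 0\<close>. There the
  squared distance is bounded by an expression in
  \<open>cinner (\<Gamma> h (ex g)) (ex g)\<close>.\<close>

lemma ex_left_shift_uniform:
  assumes g: "g \<in> L2 {0..}" and e: "e > 0"
  shows "\<exists>d>0. \<forall>s\<ge>0. \<forall>h\<ge>0. h < d \<longrightarrow> norm (ex (left_shift (s + h) g) - ex (left_shift s g)) < e"
proof -
  let ?y = "ex g"
  have "((\<lambda>h. 2 * (norm ?y)\<^sup>2 - 2 * Re (cinner (\<Gamma> h ?y) ?y)) \<longlongrightarrow> 2 * (norm ?y)\<^sup>2 - 2 * Re (cinner ?y ?y)) (at_right 0)"
    by (intro tendsto_intros \<Gamma>_tendsto)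
  then have "\<forall>\<^sub>F h in at_right 0. 2 * (norm ?y)\<^sup>2 - 2 * Re (cinner (\<Gamma> h ?y) ?y) < e\<^sup>2"
    using e by (intro order_tendstoD(2)) (auto simp: norm_sq_cinner)
  then obtain d where d: "d > 0" "\<And>h. h > 0 \<Longrightarrow> h < d \<Longrightarrow> 2 * (norm ?y)\<^sup>2 - 2 * Re (cinner (\<Gamma> h ?y) ?y) < e\<^sup>2"
    unfolding eventually_at_right_field by auto
  have "norm (ex (left_shift (s + h) g) - ex (left_shift s g)) < e" if s: "s \<ge> 0" and h: "h \<ge> 0" "h < d" for s h
  proof -
    have "ex (left_shift (s + h) g) - ex (left_shift s g) = cadj (\<Gamma> s) (ex (left_shift h g) - ex g)"
      using s h g by (simp add: left_shift_add cadj_\<Gamma>_ex left_shift_L2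
          bounded_clinear_diff[OF bounded_clinear_cadj[OF bopsD[OF \<Gamma>_bops]]])
    then have le: "norm (ex (left_shift (s + h) g) - ex (left_shift s g)) \<le> norm (ex (left_shift h g) - ex g)"
      using norm_cadj_\<Gamma>[OF s] by simp
    have "norm (ex (left_shift h g) - ex g) < e"
    proof (cases "h = 0")
      case True
      then show ?thesis using e g by (simp add: left_shift_0)
    next
      case False
      have "(norm (ex (left_shift h g)))\<^sup>2 \<le> (norm ?y)\<^sup>2"
        using norm_cadj_\<Gamma>[OF h(1), of ?y] h g by (simp add: cadj_\<Gamma>_ex)
      moreover have "cinner (ex (left_shift h g)) ?y = cinner ?y (\<Gamma> h ?y)"
        using h g cinner_cadj_left[OF bopsD[OF \<Gamma>_bops[OF h(1)]], of ?y ?y] by (simp add: cadj_\<Gamma>_ex)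
      moreover have "Re (cinner ?y (\<Gamma> h ?y)) = Re (cinner (\<Gamma> h ?y) ?y)" by (subst cinner_commute) simp
      ultimately have "(norm (ex (left_shift h g) - ex g))\<^sup>2 \<le> 2 * (norm ?y)\<^sup>2 - 2 * Re (cinner (\<Gamma> h ?y) ?y)"
        by (simp add: norm_diff_sq)
      also have "\<dots> < e\<^sup>2" using d(2)[of h] h False by simp
      finally show ?thesis using e by (simp add: power2_less_imp_less)
    qed
    with le show ?thesis by simp
  qed
  then show ?thesis using d by blast
qed

text \<open>A finite net along the orbit of \<open>ex g\<close> under left shifts, taken on a grid
  of spacing \<open>d / 2\<close>. It will turn convergence of the cocycle to the identity at single
  vectors into convergence uniform over the orbit.\<close>

lemma ex_left_shift_totally_bounded:
  assumes g: "g \<in> L2 {0..}" and e: "e > 0"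
  shows "\<exists>N. finite N \<and> (\<forall>s\<in>{0..b}. \<exists>n\<in>N. norm (ex (left_shift s g) - n) < e)"
proof -
  obtain d where d: "d > 0" "\<And>s h. s \<ge> 0 \<Longrightarrow> h \<ge> 0 \<Longrightarrow> h < d \<Longrightarrow> norm (ex (left_shift (s + h) g) - ex (left_shift s g)) < e"
    using ex_left_shift_uniform[OF g e] by blast
  define N where "N = (\<lambda>k. ex (left_shift (real k * (d / 2)) g)) ` {..nat \<lceil>b / (d / 2)\<rceil>}"
  have "\<exists>n\<in>N. norm (ex (left_shift s g) - n) < e" if s: "s \<in> {0..b}" for s
  proof -
    define k where "k = nat \<lfloor>s / (d / 2)\<rfloor>"
    have "s / (d / 2) \<ge> 0" using s d by simp
    then have k: "real k \<le> s / (d / 2)" "s / (d / 2) < real k + 1" unfolding k_def by linarith+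
    have k': "real k * (d / 2) \<le> s" "s < real k * (d / 2) + d / 2"
      using k d by (simp_all add: field_simps)
    have "s / (d / 2) \<le> b / (d / 2)" using s d by (intro divide_right_mono) auto
    then have "real k \<le> b / (d / 2)" using k by linarith
    then have "k \<le> nat \<lceil>b / (d / 2)\<rceil>" by linarith
    moreover have "norm (ex (left_shift (real k * (d / 2) + (s - real k * (d / 2))) g) - ex (left_shift (real k * (d / 2)) g)) < e"
      using k' d by (intro d(2)) auto
    ultimately show ?thesis unfolding N_def by auto
  qed
  then show ?thesis unfolding N_def by (intro exI[of _ N]) (auto simp: N_def)
qed

subsection \<open>The CCR flow\<close>

lemma ex_mem_fock_on: "f \<in> L2 A \<Longrightarrow> ex f \<in> fock_on ex A"
  unfolding fock_on_def by (rule subsetD[OF subset_closure_cspan]) blast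

lemma fock_on_closed: "closed (fock_on ex A)" and fock_on_csubspace: "csubspace (fock_on ex A)"
  by (auto simp: fock_on_def)

lemma fock_optensor_eqI:
  assumes "T \<in> bops"
    "\<And>f g. f \<in> L2 {0..} \<Longrightarrow> g \<in> L2 {0..} \<Longrightarrow> cinner (ex f) (T (ex g)) =
        cinner (ex (restr {0..<t} f)) (X (ex (restr {0..<t} g))) *
        cinner (ex (restr {t..} f)) (Y (ex (restr {t..} g)))"
  shows "fock_optensor ex t X Y = T"
  unfolding fock_optensor_def
proof (rule the_equality)
  fix U assume U: "U \<in> bops \<and> (\<forall>f\<in>L2 {0..}. \<forall>g\<in>L2 {0..}. cinner (ex f) (U (ex g)) =
        cinner (ex (restr {0..<t} f)) (X (ex (restr {0..<t} g))) *
        cinner (ex (restr {t..} f)) (Y (ex (restr {t..} g))))"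
  show "U = T"
    by (rule bounded_clinear_eq_if_cinner_eq[OF _ _ ex_total ex_total]) (use U assms bopsD in auto)
qed (use assms in auto)

lemma cinner_ex_endo:
  assumes X: "X \<in> bops" and t: "t \<ge> 0" and fg: "f \<in> L2 {0..}" "g \<in> L2 {0..}"
  shows "cinner (ex f) (endo_of (L2 {0..}) (j t) X (ex g)) = \<kappa> t f g * cinner (ex (left_shift t f)) (X (ex (left_shift t g)))"
proof -
  have "cinner (ex f) (endo_of (L2 {0..}) (j t) X (ex g)) =
      cinner (j t f (ex (left_shift t f))) (endo_of (L2 {0..}) (j t) X (j t g (ex (left_shift t g))))"
    using fg t by (simp add: j_left_shift)
  also have "\<dots> = \<kappa> t f g * cinner (ex (left_shift t f)) (X (ex (left_shift t g)))"
    using fg t by (simp add: endo_of_apply[OF j_intertwiners X] j_inner)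
  finally show ?thesis .
qed

text \<open>On exponential vectors the kernel of the intertwined operator is the product of
  \<open>\<kappa> t f g\<close>, which belongs to the past, and a matrix element of \<open>X\<close>
  between left shifts. This is exactly the kernel by which the tensor product in
  \<open>ccr_flow\<close> is defined.\<close>

lemma ccr_flow_eq:
  assumes X: "X \<in> bops" and t: "t \<ge> 0"
  shows "ccr_flow ex t X = endo_of (L2 {0..}) (j t) X"
  unfolding ccr_flow_def
proof (rule fock_optensor_eqI)
  show "endo_of (L2 {0..}) (j t) X \<in> bops" by (rule endo_of_bops[OF j_intertwiners[OF t] X])
  fix f g :: "real \<Rightarrow> 'k" assume fg: "f \<in> L2 {0..}" "g \<in> L2 {0..}"
  have i: "ident_on (fock_on ex {0..<t}) (ex (restr {0..<t} g)) = ex (restr {0..<t} g)"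
    by (rule ident_on_apply[OF fock_on_closed fock_on_csubspace ex_mem_fock_on[OF restr_L2(1)[OF fg(2)]]])
  have r: "ex (restr {t..} u) = \<Gamma> t (ex (left_shift t u))" if "u \<in> L2 {0..}" for u
    using that t by (simp add: \<Gamma>_ex left_shift_L2 right_shift_left_shift)
  have "cinner (ex (restr {t..} f)) ((fock_shift ex t \<circ> X \<circ> cadj (fock_shift ex t)) (ex (restr {t..} g))) =
      cinner (ex (left_shift t f)) (X (ex (left_shift t g)))"
    using t by (simp add: fock_shift_eq r fg cadj_\<Gamma>_\<Gamma> \<Gamma>_inner)
  then show "cinner (ex f) (endo_of (L2 {0..}) (j t) X (ex g)) =
      cinner (ex (restr {0..<t} f)) (ident_on (fock_on ex {0..<t}) (ex (restr {0..<t} g))) *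
      cinner (ex (restr {t..} f)) ((fock_shift ex t \<circ> X \<circ> cadj (fock_shift ex t)) (ex (restr {t..} g)))"
    using fg by (simp add: i cinner_ex_endo[OF X t] \<kappa>_eq)
qed

subsection \<open>Operators acting on the Fock space of an initial interval\<close>

text \<open>\<open>scalar_at t A\<close> expresses that \<open>A\<close> belongs to \<open>B(F_{t)}) \<otimes> I\<close>.\<close>

definition scalar_at :: "real \<Rightarrow> ('f \<Rightarrow> 'f) \<Rightarrow> bool" where
  "scalar_at t A \<longleftrightarrow> A \<in> bops \<and> (\<forall>f\<in>L2 {0..}. \<forall>g\<in>L2 {0..}. \<exists>a. \<forall>u v. cinner (j t f u) (A (j t g v)) = a * cinner u v)"

lemma scalar_atD: "scalar_at t A \<Longrightarrow> A \<in> bops"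
  by (simp add: scalar_at_def)

lemma scalar_atE:
  assumes "scalar_at t A" "f \<in> L2 {0..}" "g \<in> L2 {0..}"
  obtains a where "\<And>u v. cinner (j t f u) (A (j t g v)) = a * cinner u v"
  using assms unfolding scalar_at_def by blast

text \<open>By \<open>j_comp\<close> the entries at time \<open>t\<close> are those at time
  \<open>s\<close> multiplied by a Gram factor of the left-shifted functions.\<close>

lemma scalar_at_mono:
  assumes A: "scalar_at s A" and s: "0 \<le> s" "s \<le> t"
  shows "scalar_at t A"
  unfolding scalar_at_def
proof (intro conjI ballI)
  show "A \<in> bops" by (rule scalar_atD[OF A])
  fix f g :: "real \<Rightarrow> 'k" assume fg: "f \<in> L2 {0..}" "g \<in> L2 {0..}"
  obtain a where a: "\<And>u v. cinner (j s f u) (A (j s g v)) = a * cinner u v" using scalar_atE[OF A fg] by blast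
  have c: "j t f = j s f \<circ> j (t - s) (left_shift s f)" "j t g = j s g \<circ> j (t - s) (left_shift s g)"
    using j_comp[OF fg(1) s(1), of "t - s"] j_comp[OF fg(2) s(1), of "t - s"] s by auto
  show "\<exists>a. \<forall>u v. cinner (j t f u) (A (j t g v)) = a * cinner u v"
    by (rule exI[of _ "a * \<kappa> (t - s) (left_shift s f) (left_shift s g)"])
      (use s fg in \<open>simp add: c a j_inner left_shift_L2\<close>)
qed

lemma scalar_at_diff:
  assumes "scalar_at t A" "scalar_at t B" "t \<ge> 0"
  shows "scalar_at t (\<lambda>x. A x - B x)"
  unfolding scalar_at_def
proof (intro conjI ballI)
  show "(\<lambda>x. A x - B x) \<in> bops" by (rule bops_diff[OF scalar_atD[OF assms(1)] scalar_atD[OF assms(2)]])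
  fix f g :: "real \<Rightarrow> 'k" assume fg: "f \<in> L2 {0..}" "g \<in> L2 {0..}"
  obtain a where a: "\<And>u v. cinner (j t f u) (A (j t g v)) = a * cinner u v" using scalar_atE[OF assms(1) fg] by blast
  obtain b where b: "\<And>u v. cinner (j t f u) (B (j t g v)) = b * cinner u v" using scalar_atE[OF assms(2) fg] by blast
  show "\<exists>a. \<forall>u v. cinner (j t f u) (A (j t g v) - B (j t g v)) = a * cinner u v"
    by (rule exI[of _ "a - b"]) (simp add: cinner_diff_right a b left_diff_distrib)
qed

end

section \<open>Fock space with an initial space\<close>

locale fock_tensor = fock ex + hilbert_tensor_product tn
  for ex :: "(real \<Rightarrow> 'k::complex_hilbert) \<Rightarrow> 'f::complex_hilbert"
    and tn :: "'h::complex_hilbert \<Rightarrow> 'f \<Rightarrow> 'g::complex_hilbert"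
begin

abbreviation J :: "real \<Rightarrow> (real \<Rightarrow> 'k) \<Rightarrow> 'g \<Rightarrow> 'g" where
  "J t f \<equiv> amp (j t f)"

abbreviation \<Phi> :: "real \<Rightarrow> ('g \<Rightarrow> 'g) \<Rightarrow> 'g \<Rightarrow> 'g" where
  "\<Phi> t \<equiv> endo_of (L2 {0..}) (J t)"

lemma J_bops: "f \<in> L2 {0..} \<Longrightarrow> t \<ge> 0 \<Longrightarrow> J t f \<in> bops"
  by (intro amp_bops j_bops)

lemma J_tn: "f \<in> L2 {0..} \<Longrightarrow> t \<ge> 0 \<Longrightarrow> J t f (tn x u) = tn x (j t f u)"
  by (simp add: amp_tn j_bops)

lemma J_inner:
  assumes "f \<in> L2 {0..}" "g \<in> L2 {0..}" "t \<ge> 0"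
  shows "cinner (J t f z) (J t g w) = \<kappa> t f g * cinner z w"
  by (rule amp_inner) (use assms in \<open>auto simp: j_inner j_bops\<close>)

lemma J_intertwiners: "t \<ge> 0 \<Longrightarrow> intertwiners (L2 {0..}) (\<lambda>f. ex (restr {0..<t} f)) (J t)"
  by (rule amp_intertwiners[OF j_intertwiners])

lemma J_total: "t \<ge> 0 \<Longrightarrow> closure (cspan {J t f z | f z. f \<in> L2 {0..}}) = UNIV"
  by (rule intertwinersD(3)[OF J_intertwiners])

lemma J_comp:
  assumes "f \<in> L2 {0..}" "s \<ge> 0" "t \<ge> 0"
  shows "J (s + t) f z = J s f (J t (left_shift s f) z)"
  using assms by (simp add: j_comp amp_comp j_bops left_shift_L2)

lemma J_0: "f \<in> L2 {0..} \<Longrightarrow> J 0 f = id"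
  by (simp add: j_0 amp_id)

lemma tn_ex_total: "closure (cspan {tn x (ex f) | x f. f \<in> L2 {0..}}) = UNIV"
proof -
  have "{tn x u | x u. u \<in> ex ` L2 {0..}} = {tn x (ex f) | x f. f \<in> L2 {0..}}" by blast
  then show ?thesis using tn_total_right[OF ex_total] by simp
qed

lemma \<Phi>_bops: "T \<in> bops \<Longrightarrow> t \<ge> 0 \<Longrightarrow> \<Phi> t T \<in> bops"
  by (rule endo_of_bops[OF J_intertwiners])

lemma \<Phi>_J: "T \<in> bops \<Longrightarrow> t \<ge> 0 \<Longrightarrow> f \<in> L2 {0..} \<Longrightarrow> \<Phi> t T (J t f z) = J t f (T z)"
  by (rule endo_of_apply[OF J_intertwiners])

lemma \<Phi>_eqI:
  assumes "t \<ge> 0" "U \<in> bops" "\<And>f z. f \<in> L2 {0..} \<Longrightarrow> U (J t f z) = J t f (T z)"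
  shows "\<Phi> t T = U"
  by (rule endo_of_eqI[OF J_intertwiners[OF assms(1)] assms(2,3)])

lemma norm_\<Phi>: "T \<in> bops \<Longrightarrow> t \<ge> 0 \<Longrightarrow> norm (\<Phi> t T z) \<le> onorm T * norm z"
  by (rule norm_endo_of[OF J_intertwiners])

lemma \<Phi>_comp: "T \<in> bops \<Longrightarrow> U \<in> bops \<Longrightarrow> t \<ge> 0 \<Longrightarrow> \<Phi> t (T \<circ> U) = \<Phi> t T \<circ> \<Phi> t U"
  by (rule \<Phi>_eqI) (auto simp: \<Phi>_J \<Phi>_bops)

lemma \<Phi>_add_time:
  assumes "T \<in> bops" "s \<ge> 0" "t \<ge> 0"
  shows "\<Phi> (s + t) T = \<Phi> s (\<Phi> t T)"
  by (rule \<Phi>_eqI) (use assms in \<open>auto simp: J_comp \<Phi>_J \<Phi>_bops left_shift_L2\<close>)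

lemma \<Phi>_0: "T \<in> bops \<Longrightarrow> \<Phi> 0 T = T"
  by (rule \<Phi>_eqI) (auto simp: J_0)

lemma \<Phi>_cadj: "T \<in> bops \<Longrightarrow> t \<ge> 0 \<Longrightarrow> cadj (\<Phi> t T) = \<Phi> t (cadj T)"
  by (rule endo_of_cadj[OF J_intertwiners, symmetric])

lemma cinner_\<Phi>_left: "T \<in> bops \<Longrightarrow> t \<ge> 0 \<Longrightarrow> cinner z (\<Phi> t T w) = cinner (\<Phi> t (cadj T) z) w"
  using cinner_cadj_left[OF bopsD[OF \<Phi>_bops], of T t z w] by (simp add: \<Phi>_cadj)

lemma \<Phi>_amp:
  assumes "X \<in> bops" "t \<ge> 0"
  shows "\<Phi> t (amp X) = amp (endo_of (L2 {0..}) (j t) X)"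
proof (rule \<Phi>_eqI)
  note b = endo_of_bops[OF j_intertwiners[OF assms(2)] assms(1)]
  show "amp (endo_of (L2 {0..}) (j t) X) \<in> bops" using b by blast
  fix f :: "real \<Rightarrow> 'k" and z assume f: "f \<in> L2 {0..}"
  have "endo_of (L2 {0..}) (j t) X \<circ> j t f = j t f \<circ> X"
    using endo_of_apply[OF j_intertwiners[OF assms(2)] assms(1) f] by (simp add: fun_eq_iff)
  from arg_cong[OF this, of amp]
  show "amp (endo_of (L2 {0..}) (j t) X) (J t f z) = J t f (amp X z)"
    using b f assms by (simp add: amp_comp j_bops fun_eq_iff)
qed (rule assms)

lemma ampliation_flow:
  assumes "T \<in> bops" "t \<ge> 0"
  shows "ampliation tn (ccr_flow ex t) T = \<Phi> t T"
proof (rule ampliation_eq_endo_of(2)[OF j_intertwiners[OF assms(2)] _ _ assms(1)])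
  show "ccr_flow ex t X \<in> bops" if "X \<in> bops" for X
    using endo_of_bops[OF j_intertwiners[OF assms(2)] that] by (simp add: ccr_flow_eq[OF that assms(2)])
  show "ccr_flow ex t X (j t i u) = j t i (X u)" if "X \<in> bops" "i \<in> L2 {0..}" for X i u
    using endo_of_apply[OF j_intertwiners[OF assms(2)] that] by (simp add: ccr_flow_eq[OF that(1) assms(2)])
qed

text \<open>\<open>\<Phi> h T\<close> carries the ampliated shift of \<open>z\<close> to the
  ampliated shift of \<open>T z\<close>. The shifts tend strongly to the identity, and
  \<open>\<Phi> h T\<close> is bounded by \<open>onorm T\<close> for all \<open>h\<close>.\<close>

lemma \<Phi>_tendsto:
  assumes T: "T \<in> bops"
  shows "((\<lambda>h. \<Phi> h T z) \<longlongrightarrow> T z) (at_right 0)"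
proof -
  have pos: "\<forall>\<^sub>F h in at_right (0::real). h > 0" by (simp add: eventually_at_right_less)
  have \<Gamma>: "((\<lambda>h. J h (\<lambda>_. 0) w) \<longlongrightarrow> w) (at_right 0)" for w
  proof -
    have "((\<lambda>h. if h \<ge> 0 then J h (\<lambda>_. 0) w else 0) \<longlongrightarrow> id w) (at_right 0)"
    proof (rule tendsto_on_total[where T = "\<lambda>h y. if h \<ge> 0 then J h (\<lambda>_. 0) y else 0" and C = 1, OF _ _ bounded_clinear_id tn_total])
      show "bounded_clinear (\<lambda>y. if h \<ge> 0 then J h (\<lambda>_. 0) y else 0)" for h
        using J_bops[OF L2_zero, of h] bops_zero by (cases "h \<ge> 0") (auto simp: bops_def)
      have "norm (J h (\<lambda>_. 0) x) = norm x" if "h \<ge> 0" for h x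
      proof -
        have "(norm (J h (\<lambda>_. 0) x))\<^sup>2 = (norm x)\<^sup>2" using that by (simp add: norm_sq_cinner J_inner L2_zero)
        then show ?thesis by (simp add: power2_eq_iff_nonneg)
      qed
      then show "\<forall>\<^sub>F h in at_right 0. \<forall>x. norm (if h \<ge> 0 then J h (\<lambda>_. 0) x else 0) \<le> 1 * norm x" by auto
      fix b assume "b \<in> {tn x u | x u. True}"
      then obtain x u where b: "b = tn x u" by blast
      have "((\<lambda>h. tn x (\<Gamma> h u)) \<longlongrightarrow> tn x u) (at_right 0)"
        by (rule bounded_clinear_tendsto[OF bounded_clinear_tn_right \<Gamma>_tendsto])
      moreover have "\<forall>\<^sub>F h in at_right 0. tn x (\<Gamma> h u) = (if h \<ge> 0 then J h (\<lambda>_. 0) b else 0)"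
        using pos by (rule eventually_mono) (simp add: b J_tn L2_zero)
      ultimately show "((\<lambda>h. if h \<ge> 0 then J h (\<lambda>_. 0) b else 0) \<longlongrightarrow> id b) (at_right 0)"
        by (simp add: Lim_transform_eventually b)
    qed
    moreover have "\<forall>\<^sub>F h in at_right 0. (if h \<ge> 0 then J h (\<lambda>_. 0) w else 0) = J h (\<lambda>_. 0) w"
      using pos by (rule eventually_mono) simp
    ultimately show ?thesis by (simp add: Lim_transform_eventually)
  qed
  have "((\<lambda>h. onorm T * norm (z - J h (\<lambda>_. 0) z) + norm (J h (\<lambda>_. 0) (T z) - T z)) \<longlongrightarrow>
      onorm T * norm (z - z) + norm (T z - T z)) (at_right 0)"
    by (intro tendsto_intros \<Gamma>)
  then have lim: "((\<lambda>h. onorm T * norm (z - J h (\<lambda>_. 0) z) + norm (J h (\<lambda>_. 0) (T z) - T z)) \<longlongrightarrow> 0) (at_right 0)"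
    by simp
  have "\<forall>\<^sub>F h in at_right 0. norm (\<Phi> h T z - T z) \<le> onorm T * norm (z - J h (\<lambda>_. 0) z) + norm (J h (\<lambda>_. 0) (T z) - T z)"
    using pos
  proof (rule eventually_mono)
    fix h :: real assume h: "h > 0"
    have eq: "\<Phi> h T z - T z = \<Phi> h T (z - J h (\<lambda>_. 0) z) + (J h (\<lambda>_. 0) (T z) - T z)"
      using h by (simp add: bounded_clinear_diff[OF bopsD[OF \<Phi>_bops[OF T]]] \<Phi>_J T L2_zero)
    show "norm (\<Phi> h T z - T z) \<le> onorm T * norm (z - J h (\<lambda>_. 0) z) + norm (J h (\<lambda>_. 0) (T z) - T z)"
      unfolding eq by (rule order_trans[OF norm_triangle_ineq add_right_mono[OF norm_\<Phi>[OF T less_imp_le[OF h]]]])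
  qed
  then have "((\<lambda>h. \<Phi> h T z - T z) \<longlongrightarrow> 0) (at_right 0)"
    by (rule Lim_null_comparison[OF _ lim])
  then show ?thesis by (rule LIM_zero_cancel)
qed

lemma amp_scalar:
  assumes A: "scalar_at t A" and t: "t \<ge> 0" and fg: "f \<in> L2 {0..}" "g \<in> L2 {0..}"
  shows "\<exists>a. \<forall>z w. cinner (J t f z) (amp A (J t g w)) = a * cinner z w"
proof -
  obtain a where a: "\<And>u v. cinner (j t f u) (A (j t g v)) = a * cinner u v" using scalar_atE[OF A fg] by blast
  have b: "A \<circ> j t g \<in> bops" using scalar_atD[OF A] fg t by (auto intro: j_bops)
  have "cinner (amp (j t f) z) (amp (A \<circ> j t g) w) = a * cinner z w" for z w
    by (rule amp_inner[OF j_bops[OF fg(1) t] b]) (simp add: a)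
  then show ?thesis using scalar_atD[OF A] fg t by (auto simp: amp_comp j_bops)
qed

text \<open>Between the ranges of the \<open>J t f\<close> the operator \<open>amp A\<close> has
  scalar entries, whereas \<open>\<Phi> t T\<close> acts as \<open>T\<close> along each of them;
  hence the two commute entry by entry.\<close>

lemma amp_scalar_commute:
  assumes A: "scalar_at t A" and t: "t \<ge> 0" and T: "T \<in> bops"
  shows "amp A (\<Phi> t T z) = \<Phi> t T (amp A z)"
proof -
  have "amp A \<circ> \<Phi> t T = \<Phi> t T \<circ> amp A"
  proof (rule bounded_clinear_eq_if_cinner_eq[OF _ _ J_total[OF t] J_total[OF t]])
    show "bounded_clinear (amp A \<circ> \<Phi> t T)" "bounded_clinear (\<Phi> t T \<circ> amp A)"
      using scalar_atD[OF A] \<Phi>_bops[OF T t] by (auto intro: bopsD)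
    fix b c assume "b \<in> {J t f z | f z. f \<in> L2 {0..}}" "c \<in> {J t f z | f z. f \<in> L2 {0..}}"
    then obtain f g z w where fg: "c = J t f z" "b = J t g w" "f \<in> L2 {0..}" "g \<in> L2 {0..}" by blast
    obtain a where a: "\<And>z w. cinner (J t f z) (amp A (J t g w)) = a * cinner z w"
      using amp_scalar[OF A t fg(3,4)] by blast
    show "cinner c ((amp A \<circ> \<Phi> t T) b) = cinner c ((\<Phi> t T \<circ> amp A) b)"
      using fg t T by (simp add: \<Phi>_J a cinner_\<Phi>_left bops_cadj cinner_cadj_left bopsD)
  qed
  then show ?thesis by (simp add: fun_eq_iff)
qed

subsection \<open>Extension by the identity\<close>

abbreviation Gb :: "real \<Rightarrow> 'g set" where "Gb t \<equiv> init_fock_before tn ex t"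

lemma Gb_closed: "closed (Gb t)" and Gb_csubspace: "csubspace (Gb t)"
  by (auto simp: init_fock_before_def)

lemma Gb_eq: "Gb t = closure (cspan {tn x (ex f) | x f. f \<in> L2 {0..<t}})"
proof
  have e: "{tn x u | x u. u \<in> ex ` L2 {0..<t}} = {tn x (ex f) | x f. f \<in> L2 {0..<t}}" by blast
  have "{tn x u | x u. u \<in> fock_on ex {0..<t}} \<subseteq> closure (cspan {tn x (ex f) | x f. f \<in> L2 {0..<t}})"
    using tn_closure_right[of _ "ex ` L2 {0..<t}"] unfolding fock_on_def e by blast
  then show "Gb t \<subseteq> closure (cspan {tn x (ex f) | x f. f \<in> L2 {0..<t}})"
    unfolding init_fock_before_def by (intro closure_cspan_subset) auto
  have "{tn x (ex f) | x f. f \<in> L2 {0..<t}} \<subseteq> {tn x u | x u. u \<in> fock_on ex {0..<t}}"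
    using ex_mem_fock_on by blast
  then show "closure (cspan {tn x (ex f) | x f. f \<in> L2 {0..<t}}) \<subseteq> Gb t"
    unfolding init_fock_before_def by (intro closure_mono complex_hilbert.span_mono)
qed

lemma tn_ex_mem_Gb: "f \<in> L2 {0..<t} \<Longrightarrow> tn x (ex f) \<in> Gb t"
  unfolding Gb_eq by (rule subsetD[OF subset_closure_cspan]) blast

text \<open>The counterpart of \<open>J\<close> with past and future exchanged: on
  \<open>Gb t\<close> it is \<open>z \<mapsto> z \<otimes> \<epsilon>(g)\<close> for a fixed
  function \<open>g\<close> living after \<open>t\<close>.\<close>

definition K :: "real \<Rightarrow> (real \<Rightarrow> 'k) \<Rightarrow> 'g \<Rightarrow> 'g" where
  "K t g = (SOME T. bounded_clinear T \<and> (\<forall>p\<in>UNIV \<times> L2 {0..<t}. T (tn (fst p) (ex (snd p))) = tn (fst p) (ex (\<lambda>r. snd p r + g r))))"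

lemma L2_inner_before_after:
  assumes "f \<in> L2 {0..<t}" "f' \<in> L2 {0..<t}" "g \<in> L2 {t..}" "g' \<in> L2 {t..}" "t \<ge> 0"
  shows "(\<lambda>r. f r + g r) \<in> L2 {0..}" 
    and "L2_inner (\<lambda>r. f r + g r) (\<lambda>r. f' r + g' r) = L2_inner f f' + L2_inner g g'"
proof -
  have z: "L2_inner f g' = 0" by (rule L2_inner_disjoint[OF assms(1,4)]) auto
  have z': "L2_inner g f' = 0" by (rule L2_inner_disjoint[OF assms(3,2)]) auto
  show "(\<lambda>r. f r + g r) \<in> L2 {0..}"
    by (intro L2_add L2_mono[OF assms(1)] L2_mono[OF assms(3)]) (use assms(5) in auto)
  have "(\<lambda>r. f' r + g' r) \<in> L2 {0..}"
    by (intro L2_add L2_mono[OF assms(2)] L2_mono[OF assms(4)]) (use assms(5) in auto)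
  then show "L2_inner (\<lambda>r. f r + g r) (\<lambda>r. f' r + g' r) = L2_inner f f' + L2_inner g g'"
    by (simp add: L2_inner_add_left[OF assms(1,3)] L2_inner_add_right[OF assms(2,4) assms(1)]
        L2_inner_add_right[OF assms(2,4) assms(3)] z z')
qed

lemma L2_before: "f \<in> L2 {0..<t} \<Longrightarrow> f \<in> L2 {0..}"
  by (erule L2_mono) auto

lemma L2_after: "f \<in> L2 {t..} \<Longrightarrow> t \<ge> 0 \<Longrightarrow> f \<in> L2 {0..}"
  by (erule L2_mono) auto

lemma
  assumes "g \<in> L2 {t..}" "t \<ge> 0"
  shows K_bops: "K t g \<in> bops"
    and K_tn: "f \<in> L2 {0..<t} \<Longrightarrow> K t g (tn x (ex f)) = tn x (ex (\<lambda>r. f r + g r))"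
proof -
  have "\<exists>T. bounded_clinear T \<and> (\<forall>p\<in>UNIV \<times> L2 {0..<t}. T (tn (fst p) (ex (snd p))) = tn (fst p) (ex (\<lambda>r. snd p r + g r)))"
    by (rule kernel_extension[where k = "exp (L2_inner g g)"])
      (use assms in \<open>auto simp: tn_inner ex_inner L2_before L2_inner_before_after exp_add\<close>)
  from someI_ex[OF this, folded K_def]
  show "K t g \<in> bops" "f \<in> L2 {0..<t} \<Longrightarrow> K t g (tn x (ex f)) = tn x (ex (\<lambda>r. f r + g r))"
    by (auto simp: bops_def)
qed

lemma K_inner:
  assumes g: "g \<in> L2 {t..}" "g' \<in> L2 {t..}" and t: "t \<ge> 0" and z: "z \<in> Gb t" "w \<in> Gb t"
  shows "cinner (K t g z) (K t g' w) = cinner (ex g) (ex g') * cinner z w"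
proof -
  have "cinner (K t g z) (K t g' w) = cinner (ex g) (ex g') * cinner (id z) (id w)"
    by (rule cinner_eq_on_closure[OF bopsD[OF K_bops[OF g(1) t]] bopsD[OF K_bops[OF g(2) t]] bounded_clinear_id bounded_clinear_id
          z[unfolded Gb_eq]])
      (use g t in \<open>auto simp: K_tn tn_inner ex_inner L2_before L2_after L2_inner_before_after exp_add\<close>)
  then show ?thesis by simp
qed

lemma restr_add: "f \<in> L2 {0..} \<Longrightarrow> t \<ge> 0 \<Longrightarrow> (\<lambda>r. restr {0..<t} f r + restr {t..} f r) = f"
  by (rule restr_decompose[symmetric])

lemma K_restr: "f \<in> L2 {0..} \<Longrightarrow> t \<ge> 0 \<Longrightarrow> K t (restr {t..} f) (tn x (ex (restr {0..<t} f))) = tn x (ex f)"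
  by (simp add: K_tn restr_L2 restr_add)

text \<open>This is \<open>W \<otimes> I\<close>, obtained as the operator intertwined by the maps
  \<open>K t g\<close>; \<open>kernel_operator_exists\<close> serves again, now with the domain
  \<open>Gb t\<close>.\<close>

definition lift :: "real \<Rightarrow> ('g \<Rightarrow> 'g) \<Rightarrow> 'g \<Rightarrow> 'g" where
  "lift t W = (SOME T. bounded_clinear T \<and> (\<forall>g\<in>L2 {t..}. \<forall>z\<in>Gb t. T (K t g z) = K t g (W z)))"

lemma
  assumes W: "W \<in> bops_on (Gb t)" and t: "t \<ge> 0"
  shows lift_bops: "lift t W \<in> bops"
    and lift_K: "g \<in> L2 {t..} \<Longrightarrow> z \<in> Gb t \<Longrightarrow> lift t W (K t g z) = K t g (W z)"
proof -
  have "\<exists>T. bounded_clinear T \<and> (\<forall>x. norm (T x) \<le> onorm W * norm x) \<and> (\<forall>g\<in>L2 {t..}. \<forall>z\<in>Gb t. T (K t g z) = K t g (W z))"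
    by (rule kernel_operator_exists[OF Gb_csubspace, where a = ex])
      (use t W in \<open>auto simp: K_inner bopsD[OF bops_onD(1)] bops_onD(2)\<close>)
  then have "\<exists>T. bounded_clinear T \<and> (\<forall>g\<in>L2 {t..}. \<forall>z\<in>Gb t. T (K t g z) = K t g (W z))" by blast
  from someI_ex[OF this, folded lift_def]
  show "lift t W \<in> bops" "g \<in> L2 {t..} \<Longrightarrow> z \<in> Gb t \<Longrightarrow> lift t W (K t g z) = K t g (W z)"
    by (auto simp: bops_def)
qed

lemma lift_kernel:
  assumes W: "W \<in> bops_on (Gb t)" and t: "t \<ge> 0" and fg: "f \<in> L2 {0..}" "g \<in> L2 {0..}"
  shows "cinner (tn x (ex f)) (lift t W (tn y (ex g))) =
    cinner (tn x (ex (restr {0..<t} f))) (W (tn y (ex (restr {0..<t} g)))) * cinner (ex (restr {t..} f)) (ex (restr {t..} g))"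
proof -
  have "cinner (tn x (ex f)) (lift t W (tn y (ex g))) =
      cinner (K t (restr {t..} f) (tn x (ex (restr {0..<t} f)))) (lift t W (K t (restr {t..} g) (tn y (ex (restr {0..<t} g)))))"
    using fg t by (simp add: K_restr)
  also have "\<dots> = cinner (ex (restr {t..} f)) (ex (restr {t..} g)) * cinner (tn x (ex (restr {0..<t} f))) (W (tn y (ex (restr {0..<t} g))))"
    using fg t by (simp add: lift_K[OF W t] K_inner restr_L2 tn_ex_mem_Gb bops_onD(2)[OF W])
  finally show ?thesis by simp
qed

text \<open>Along \<open>J\<close> the past enters only through one scalar, which does not depend on
  the future vectors; this is read off at exponential vectors and extended by density to all
  \<open>u\<close> and \<open>v\<close>.\<close>

lemma lift_J:
  assumes W: "W \<in> bops_on (Gb t)" and t: "t \<ge> 0" and fg: "f \<in> L2 {0..}" "g \<in> L2 {0..}"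
  shows "cinner (J t f (tn x u)) (lift t W (J t g (tn y v))) =
    cinner (tn x (ex (restr {0..<t} f))) (W (tn y (ex (restr {0..<t} g)))) * cinner u v"
proof -
  let ?k = "cinner (tn x (ex (restr {0..<t} f))) (W (tn y (ex (restr {0..<t} g))))"
  have "cinner ((J t f \<circ> tn x) u) ((lift t W \<circ> (J t g \<circ> tn y)) v) = ?k * cinner (id u) (id v)"
  proof (rule cinner_eq_on_total[OF _ _ bounded_clinear_id bounded_clinear_id ex_total])
    show "bounded_clinear (J t f \<circ> tn x)"
      by (intro bounded_clinear_comp bounded_clinear_tn_right bopsD[OF J_bops[OF fg(1) t]])
    show "bounded_clinear (lift t W \<circ> (J t g \<circ> tn y))"
      by (intro bounded_clinear_comp bounded_clinear_tn_right bopsD[OF J_bops[OF fg(2) t]] bopsD[OF lift_bops[OF W t]])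
    fix b c assume "b \<in> ex ` L2 {0..}" "c \<in> ex ` L2 {0..}"
    then obtain u v where uv: "b = ex u" "c = ex v" "u \<in> L2 {0..}" "v \<in> L2 {0..}" by blast
    show "cinner ((J t f \<circ> tn x) b) ((lift t W \<circ> (J t g \<circ> tn y)) c) = ?k * cinner (id b) (id c)"
      using uv fg t by (simp add: J_tn j_ex lift_kernel[OF W t] conc_L2 restr_conc ex_inner right_shift_L2' L2_inner_right_shift)
  qed
  then show ?thesis by simp
qed

text \<open>Adaptedness in commutant form: commuting with every \<open>I \<otimes> X\<close> acting
  on the future of \<open>t\<close>. In contrast to the form \<open>W \<otimes> I\<close>, it passes
  to products without exhibiting the factor \<open>W\<close>.\<close>

definition adapted_at :: "real \<Rightarrow> ('g \<Rightarrow> 'g) \<Rightarrow> bool" where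
  "adapted_at t A \<longleftrightarrow> A \<in> bops \<and> (\<forall>X\<in>bops. \<forall>z. A (\<Phi> t (amp X) z) = \<Phi> t (amp X) (A z))"

lemma J_tn_total: "t \<ge> 0 \<Longrightarrow> closure (cspan {J t f (tn x u) | f x u. f \<in> L2 {0..}}) = UNIV"
proof -
  assume t: "t \<ge> 0"
  have "{tn x (ex f) | x f. f \<in> L2 {0..}} \<subseteq> {J t f (tn x u) | f x u. f \<in> L2 {0..}}"
  proof
    fix b assume "b \<in> {tn x (ex f) | x f. f \<in> L2 {0..}}"
    then obtain x f where b: "b = tn x (ex f)" "f \<in> L2 {0..}" by blast
    have "b = J t f (tn x (ex (left_shift t f)))" using b t by (simp add: J_tn j_left_shift)
    then show "b \<in> {J t f (tn x u) | f x u. f \<in> L2 {0..}}" using b(2) by blast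
  qed
  then have "closure (cspan {tn x (ex f) | x f. f \<in> L2 {0..}}) \<subseteq> closure (cspan {J t f (tn x u) | f x u. f \<in> L2 {0..}})"
    by (intro closure_mono complex_hilbert.span_mono)
  then show ?thesis using tn_ex_total by auto
qed

lemma adapted_at_lift:
  assumes W: "W \<in> bops_on (Gb t)" and t: "t \<ge> 0"
  shows "adapted_at t (lift t W)"
  unfolding adapted_at_def
proof (intro conjI ballI allI)
  show b: "lift t W \<in> bops" by (rule lift_bops[OF W t])
  fix X :: "'f \<Rightarrow> 'f" and z assume X: "X \<in> bops"
  note aX = amp_bops[OF X]
  have "lift t W \<circ> \<Phi> t (amp X) = \<Phi> t (amp X) \<circ> lift t W"
  proof (rule bounded_clinear_eq_if_cinner_eq[OF _ _ J_tn_total[OF t] J_tn_total[OF t]])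
    show "bounded_clinear (lift t W \<circ> \<Phi> t (amp X))" "bounded_clinear (\<Phi> t (amp X) \<circ> lift t W)"
      using b \<Phi>_bops[OF aX t] by (auto intro: bopsD)
    fix b c assume "b \<in> {J t f (tn x u) | f x u. f \<in> L2 {0..}}" "c \<in> {J t f (tn x u) | f x u. f \<in> L2 {0..}}"
    then obtain f g x y u v where fg: "c = J t f (tn x u)" "b = J t g (tn y v)" "f \<in> L2 {0..}" "g \<in> L2 {0..}" by blast
    have "cadj (amp X) = amp (cadj X)" using cadj_optensor[OF bops_id X] by (simp add: cadj_id)
    then show "cinner c ((lift t W \<circ> \<Phi> t (amp X)) b) = cinner c ((\<Phi> t (amp X) \<circ> lift t W) b)"
      using fg t aX X by (simp add: \<Phi>_J cinner_\<Phi>_left amp_bops bops_cadj amp_tn lift_J[OF W t] cinner_cadj_left bopsD)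
  qed
  then show "lift t W (\<Phi> t (amp X) z) = \<Phi> t (amp X) (lift t W z)" by (simp add: fun_eq_iff)
qed

text \<open>Rank-one operators on the future factor move \<open>vac\<close> to an arbitrary vector.\<close>

lemma adapted_at_eqI:
  assumes A: "adapted_at t A" "adapted_at t B" and t: "t \<ge> 0"
    and eq: "\<And>f x. f \<in> L2 {0..} \<Longrightarrow> A (J t f (tn x vac)) = B (J t f (tn x vac))"
  shows "A = B"
proof (rule bounded_clinear_eq_on_total[OF _ _ J_tn_total[OF t]])
  show "bounded_clinear A" "bounded_clinear B" using A by (auto simp: adapted_at_def bops_def)
  fix b assume "b \<in> {J t f (tn x u) | f x u. f \<in> L2 {0..}}"
  then obtain f x u where b: "b = J t f (tn x u)" "f \<in> L2 {0..}" by blast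
  define X where "X = (\<lambda>v. cinner vac v *\<^sub>C u)"
  have X: "X \<in> bops" by (simp add: X_def)
  have "\<Phi> t (amp X) (J t f (tn x vac)) = b"
    using b t X by (simp add: \<Phi>_J amp_bops amp_tn) (simp add: X_def vac_inner L2_zero)
  then show "A b = B b" using A X eq[OF b(2)] unfolding adapted_at_def by metis
qed

lemma init_fock_optensor_eqI:
  assumes "T \<in> bops"
    "\<And>x y f g. f \<in> L2 {0..} \<Longrightarrow> g \<in> L2 {0..} \<Longrightarrow> cinner (tn x (ex f)) (T (tn y (ex g))) =
        cinner (tn x (ex (restr {0..<t} f))) (W (tn y (ex (restr {0..<t} g)))) *
        cinner (ex (restr {t..} f)) (Y (ex (restr {t..} g)))"
  shows "init_fock_optensor tn ex t W Y = T"
  unfolding init_fock_optensor_def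
proof (rule the_equality)
  fix U assume U: "U \<in> bops \<and> (\<forall>x y. \<forall>f\<in>L2 {0..}. \<forall>g\<in>L2 {0..}. cinner (tn x (ex f)) (U (tn y (ex g))) =
        cinner (tn x (ex (restr {0..<t} f))) (W (tn y (ex (restr {0..<t} g)))) *
        cinner (ex (restr {t..} f)) (Y (ex (restr {t..} g))))"
  show "U = T"
    by (rule bounded_clinear_eq_if_cinner_eq[OF _ _ tn_ex_total tn_ex_total]) (use U assms bopsD in auto)
qed (use assms in auto)

text \<open>\<open>Y'\<close> is \<open>Y\<close> carried back from \<open>[t,\<infinity>)\<close>
  to the half-line by the shift, so that \<open>W \<otimes> Y\<close> becomes the product of
  \<open>W \<otimes> I\<close> and the flow image of \<open>I \<otimes> Y'\<close>.\<close>

lemma init_fock_optensor_eq: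
  assumes W: "W \<in> bops_on (Gb t)" and t: "t \<ge> 0" and Y': "Y' \<in> bops"
    and Y: "\<And>f g. f \<in> L2 {0..} \<Longrightarrow> g \<in> L2 {0..} \<Longrightarrow>
      cinner (ex (right_shift t f)) (Y (ex (right_shift t g))) = cinner (ex f) (Y' (ex g))"
  shows "init_fock_optensor tn ex t W Y = lift t W \<circ> \<Phi> t (amp Y')"
proof (rule init_fock_optensor_eqI)
  show "lift t W \<circ> \<Phi> t (amp Y') \<in> bops" using lift_bops[OF W t] \<Phi>_bops[OF amp_bops[OF Y'] t] by blast
  fix x y and f g :: "real \<Rightarrow> 'k" assume fg: "f \<in> L2 {0..}" "g \<in> L2 {0..}"
  have e: "tn x (ex f) = J t f (tn x (ex (left_shift t f)))" if "f \<in> L2 {0..}" for x f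
    using that t by (simp add: J_tn j_left_shift)
  have "cinner (tn x (ex f)) ((lift t W \<circ> \<Phi> t (amp Y')) (tn y (ex g))) =
      cinner (tn x (ex (restr {0..<t} f))) (W (tn y (ex (restr {0..<t} g)))) * cinner (ex (left_shift t f)) (Y' (ex (left_shift t g)))"
    unfolding e[OF fg(1)] e[OF fg(2)] using fg t Y' by (simp add: \<Phi>_J amp_bops amp_tn lift_J[OF W t])
  also have "cinner (ex (left_shift t f)) (Y' (ex (left_shift t g))) = cinner (ex (restr {t..} f)) (Y (ex (restr {t..} g)))"
    using Y[of "left_shift t f" "left_shift t g"] fg t by (simp add: left_shift_L2 right_shift_left_shift)
  finally show "cinner (tn x (ex f)) ((lift t W \<circ> \<Phi> t (amp Y')) (tn y (ex g))) =
      cinner (tn x (ex (restr {0..<t} f))) (W (tn y (ex (restr {0..<t} g)))) * cinner (ex (restr {t..} f)) (Y (ex (restr {t..} g)))" .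
qed

lemma init_fock_optensor_ident:
  assumes W: "W \<in> bops_on (Gb t)" and t: "t \<ge> 0"
  shows "init_fock_optensor tn ex t W (ident_on (fock_on ex {t..})) = lift t W"
proof -
  have "ident_on (fock_on ex {t..}) (ex (right_shift t g)) = ex (right_shift t g)" if "g \<in> L2 {0..}" for g
    by (rule ident_on_apply[OF fock_on_closed fock_on_csubspace ex_mem_fock_on[OF right_shift_L2[OF that]]])
  then have "init_fock_optensor tn ex t W (ident_on (fock_on ex {t..})) = lift t W \<circ> \<Phi> t (amp id)"
    by (intro init_fock_optensor_eq[OF W t bops_id])
      (use t in \<open>simp add: ex_inner right_shift_L2' L2_inner_right_shift\<close>)
  moreover have "\<Phi> t (amp id) = id" using t by (intro \<Phi>_eqI) (auto simp: amp_id)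
  ultimately show ?thesis by simp
qed

end

subsection \<open>The case without initial space\<close>

context fock
begin

text \<open>With the complex numbers as initial space, \<open>X \<otimes> I\<close> is an instance
  of \<open>lift\<close>, whose entries along \<open>j\<close> are scalars by
  \<open>lift_J\<close>.\<close>

lemma scalar_at_fock_optensor:
  assumes X: "X \<in> bops_on (fock_on ex {0..<t})" and t: "t \<ge> 0"
  shows "scalar_at t (fock_optensor ex t X (ident_on (fock_on ex {t..})))"
proof -
  interpret F: fock_tensor ex "scaleC :: complex \<Rightarrow> 'f \<Rightarrow> 'f"
    by unfold_locales (rule hilbert_tensor_scaleC)
  have "{x *\<^sub>C u | x u. u \<in> fock_on ex {0..<t}} = fock_on ex {0..<t}"
    using complex_hilbert.subspace_scale[OF fock_on_csubspace, of _ "{0..<t}"]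
    by (auto intro!: exI[of _ 1])
  then have G: "F.Gb t = fock_on ex {0..<t}"
    by (simp add: init_fock_before_def complex_hilbert.span_eq_iff[THEN iffD2, OF fock_on_csubspace] fock_on_closed)
  have X': "X \<in> bops_on (F.Gb t)" using X by (simp add: G)
  have ampj: "F.amp A = A" if "A \<in> bops" for A
    by (rule F.optensor_eqI[OF that]) (simp add: bounded_clinear_scaleC bopsD that)
  have i: "ident_on (fock_on ex {t..}) (ex (restr {t..} g)) = ex (restr {t..} g)" if "g \<in> L2 {0..}" for g
    by (rule ident_on_apply[OF fock_on_closed fock_on_csubspace ex_mem_fock_on[OF restr_L2(2)[OF that]]])
  have "fock_optensor ex t X (ident_on (fock_on ex {t..})) = F.lift t X"
  proof (rule fock_optensor_eqI)
    show "F.lift t X \<in> bops" by (rule F.lift_bops[OF X' t])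
    fix f g :: "real \<Rightarrow> 'k" assume "f \<in> L2 {0..}" "g \<in> L2 {0..}"
    then show "cinner (ex f) (F.lift t X (ex g)) = cinner (ex (restr {0..<t} f)) (X (ex (restr {0..<t} g))) *
        cinner (ex (restr {t..} f)) (ident_on (fock_on ex {t..}) (ex (restr {t..} g)))"
      using F.lift_kernel[OF X' t, of f g 1 1] by (simp add: i)
  qed
  moreover have "scalar_at t (F.lift t X)"
    unfolding scalar_at_def
  proof (intro conjI ballI)
    show "F.lift t X \<in> bops" by (rule F.lift_bops[OF X' t])
    fix f g :: "real \<Rightarrow> 'k" assume fg: "f \<in> L2 {0..}" "g \<in> L2 {0..}"
    show "\<exists>a. \<forall>u v. cinner (j t f u) (F.lift t X (j t g v)) = a * cinner u v"
      using F.lift_J[OF X' t fg, of 1 _ 1] fg t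
      by (intro exI[of _ "cinner (ex (restr {0..<t} f)) (X (ex (restr {0..<t} g)))"] allI) (simp add: ampj j_bops)
  qed
  ultimately show ?thesis by simp
qed

text \<open>The converse direction, needed to recognise a shifted family of projections as a stop
  time. The factor \<open>X\<close> is the compression of \<open>A\<close> to the Fock space of
  \<open>[0,t)\<close>, and testing with vacuum futures identifies the scalar
  \<open>a\<close>.\<close>

lemma fock_optensor_scalar_at:
  assumes A: "scalar_at t A" and t: "t \<ge> 0"
  shows "\<exists>X\<in>bops_on (fock_on ex {0..<t}). A = fock_optensor ex t X (ident_on (fock_on ex {t..}))"
proof -
  let ?E = "ident_on (fock_on ex {0..<t})"
  note K = fock_on_closed[of "{0..<t}"] fock_on_csubspace[of "{0..<t}"]
  note E = bops_onD[OF ident_on_bops_on[OF K]]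
  have Ee: "?E (ex (restr {0..<t} g)) = ex (restr {0..<t} g)" if "g \<in> L2 {0..}" for g
    by (rule ident_on_apply[OF K ex_mem_fock_on[OF restr_L2(1)[OF that]]])
  have i: "ident_on (fock_on ex {t..}) (ex (restr {t..} g)) = ex (restr {t..} g)" if "g \<in> L2 {0..}" for g
    by (rule ident_on_apply[OF fock_on_closed fock_on_csubspace ex_mem_fock_on[OF restr_L2(2)[OF that]]])
  define X where "X = ?E \<circ> A \<circ> ?E"
  have X: "X \<in> bops_on (fock_on ex {0..<t})"
    using E scalar_atD[OF A] unfolding bops_on_def X_def
    by (auto simp: bounded_clinear_zero bopsD intro: bops_comp)
  have "fock_optensor ex t X (ident_on (fock_on ex {t..})) = A"
  proof (rule fock_optensor_eqI[OF scalar_atD[OF A]])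
    fix f g :: "real \<Rightarrow> 'k" assume fg: "f \<in> L2 {0..}" "g \<in> L2 {0..}"
    obtain a where a: "\<And>u v. cinner (j t f u) (A (j t g v)) = a * cinner u v" using scalar_atE[OF A fg] by blast
    have v: "j t h vac = ex (restr {0..<t} h)" if "h \<in> L2 {0..}" for h
    proof -
      have "conc t h (\<lambda>_. 0) = restr {0..<t} h" by (auto simp: conc_def right_shift_def)
      then show ?thesis using that t by (simp add: j_ex L2_zero)
    qed
    have "cinner (ex (restr {0..<t} f)) (X (ex (restr {0..<t} g))) = cinner (ex (restr {0..<t} f)) (A (ex (restr {0..<t} g)))"
      unfolding X_def using fg
      by (simp add: Ee cinner_ident_on[OF K ex_mem_fock_on[OF restr_L2(1)[OF fg(1)]]])
    also have "\<dots> = a" using a[of vac vac] fg by (simp add: v vac_inner L2_zero)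
    finally have 1: "cinner (ex (restr {0..<t} f)) (X (ex (restr {0..<t} g))) = a" .
    have "cinner (ex f) (A (ex g)) = a * cinner (ex (left_shift t f)) (ex (left_shift t g))"
      using a[of "ex (left_shift t f)" "ex (left_shift t g)"] fg t by (simp add: j_left_shift)
    also have "\<dots> = a * cinner (ex (restr {t..} f)) (ex (restr {t..} g))"
      using fg t by (simp add: right_shift_left_shift[symmetric] ex_inner left_shift_L2 right_shift_L2' L2_inner_right_shift)
    finally show "cinner (ex f) (A (ex g)) = cinner (ex (restr {0..<t} f)) (X (ex (restr {0..<t} g))) *
        cinner (ex (restr {t..} f)) (ident_on (fock_on ex {t..}) (ex (restr {t..} g)))"
      using fg by (simp add: 1 i)
  qed
  with X show ?thesis by metis
qed

end

section \<open>Adapted cocycles\<close>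

context fock
begin

text \<open>The second quantisation of a projection is itself a projection, onto the closed span of
  the vectors \<open>ex (p \<circ> f)\<close>. Recognising it as such gives existence with no
  separate norm estimate.\<close>

lemma
  assumes p: "orth_projection p" and t: "t \<ge> 0"
  shows second_quant_bops_on: "second_quant ex p t \<in> bops_on (fock_on ex {t..})"
    and second_quant_ex: "f \<in> L2 {t..} \<Longrightarrow> second_quant ex p t (ex f) = ex (p \<circ> f)"
proof -
  let ?F = "fock_on ex {t..}"
  note F = fock_on_closed[of "{t..}"] fock_on_csubspace[of "{t..}"]
  let ?B = "(\<lambda>f. ex (p \<circ> f)) ` L2 {t..}"
  define Kp where "Kp = closure (cspan ?B)"
  have Kp: "closed Kp" "csubspace Kp" by (auto simp: Kp_def)
  have L2_after: "f \<in> L2 {0..}" if "f \<in> L2 {t..}" for f :: "real \<Rightarrow> 'k"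
    by (rule L2_mono[OF that]) (use t in auto)
  have pL: "p \<circ> f \<in> L2 {t..}" if "f \<in> L2 {t..}" for f by (rule L2_comp[OF that orth_projectionD(1)[OF p]])
  have KpF: "Kp \<subseteq> ?F"
    unfolding Kp_def by (intro closure_cspan_subset F) (use pL ex_mem_fock_on in blast)
  have T: "ident_on Kp \<in> bops_on ?F"
    using ident_on_bops_on[OF Kp] KpF unfolding bops_on_def by blast
  have Te: "ident_on Kp (ex f) = ex (p \<circ> f)" if f: "f \<in> L2 {t..}" for f
  proof (rule ident_on_eqI[OF Kp])
    show "ex (p \<circ> f) \<in> Kp" unfolding Kp_def by (rule subsetD[OF subset_closure_cspan]) (use f in blast)
    fix u assume u: "u \<in> Kp"
    have o: "cinner (ex f - ex (p \<circ> f)) b = 0" if b: "b \<in> ?B" for b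
    proof -
      obtain g where g: "b = ex (p \<circ> g)" "g \<in> L2 {t..}" using b by blast
      have "L2_inner f (p \<circ> g) = L2_inner (p \<circ> f) (p \<circ> g)"
        unfolding L2_inner_def by (simp add: orth_projectionD[OF p])
      then show ?thesis
        using g f t by (simp add: cinner_diff_left ex_inner L2_after pL)
    qed
    have "cinner (ex f - ex (p \<circ> f)) u = 0"
      by (rule cinner_closure_cspan_eq_0[OF u[unfolded Kp_def] o])
    then show "cinner u (ex f - ex (p \<circ> f)) = 0" by (metis cinner_commute complex_cnj_zero)
  qed
  have eq: "second_quant ex p t = ident_on Kp"
    unfolding second_quant_def
  proof (rule the_equality)
    fix U assume U: "U \<in> bops_on ?F \<and> (\<forall>f\<in>L2 {t..}. U (ex f) = ex (p \<circ> f))"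
    have bU: "bounded_clinear U" "bounded_clinear (ident_on Kp)"
      using U T bops_onD(1) bopsD by blast+
    have "U u = ident_on Kp u" if "u \<in> ?F" for u
      using that unfolding fock_on_def
    proof (induction rule: closure_cspan_induct)
      case closed
      show ?case by (intro closed_Collect_eq bounded_clinear_continuous_on bU)
    next
      case subspace
      show ?case by (rule complex_hilbert.subspaceI) (auto simp: bU bounded_clinear_add bounded_clinear_scaleC)
    qed (use U Te in auto)
    then have "U (ident_on ?F z) = ident_on Kp (ident_on ?F z)" for z
      using bops_onD(2)[OF ident_on_bops_on[OF F]] by blast
    then show "U = ident_on Kp"
      using bops_on_apply_ident_on[OF F] U T by (metis ext)
  qed (use T Te in auto)
  show "second_quant ex p t \<in> bops_on ?F" using T eq by simp
  show "f \<in> L2 {t..} \<Longrightarrow> second_quant ex p t (ex f) = ex (p \<circ> f)" using Te eq by simp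
qed

end

lemma vector_functional_normal: "(\<lambda>T. cinner z (T w)) \<in> normal_functionals"
proof -
  define x y where "x n = (if n = (0::nat) then z else 0)" and "y n = (if n = (0::nat) then w else 0)" for n
  have s: "(\<lambda>n. (norm (x n))\<^sup>2) sums (norm z)\<^sup>2" "(\<lambda>n. (norm (y n))\<^sup>2) sums (norm w)\<^sup>2"
    using sums_single[of 0 "\<lambda>_. (norm z)\<^sup>2"] sums_single[of 0 "\<lambda>_. (norm w)\<^sup>2"]
    by (auto simp: x_def y_def if_distrib[of norm] if_distrib[of "\<lambda>x. x\<^sup>2"] cong: if_cong)
  have N: "(\<lambda>T. \<Sum>n. cinner (x n) (T (y n))) \<in> normal_functionals"
    unfolding normal_functionals_def
    by (rule CollectI, rule exI[of _ x], rule exI[of _ y]) (use s in \<open>auto simp: sums_iff\<close>)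
  have v: "(\<Sum>n. cinner (x n) (U (y n))) = cinner z (U w)" for U
  proof -
    have "(\<lambda>n. cinner (x n) (U (y n))) = (\<lambda>n. if n = 0 then cinner z (U w) else 0)"
      by (auto simp: x_def y_def)
    then show ?thesis using sums_single[of 0 "\<lambda>_. cinner z (U w)"] by (simp add: sums_iff)
  qed
  from N show ?thesis unfolding v .
qed

lemma ultraweak_closure_cinner_eq_0:
  assumes T: "T \<in> ultraweak_closure \<A>" and A: "\<And>A. A \<in> \<A> \<Longrightarrow> cinner z (A w) = 0"
  shows "cinner z (T w) = 0"
proof -
  have "cmod (cinner z (T w)) < e" if "e > 0" for e
  proof -
    have "\<exists>A\<in>\<A>. \<forall>\<omega>\<in>{\<lambda>T. cinner z (T w)}. cmod (\<omega> T - \<omega> A) < e"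
      using T vector_functional_normal[of z w] that unfolding ultraweak_closure_def by blast
    then show ?thesis using A by auto
  qed
  then show ?thesis using zero_less_norm_iff by blast
qed

context fock_tensor
begin

lemma optensor_mem_Gb:
  assumes A: "A \<in> bops" and X: "X \<in> bops_on (fock_on ex {0..<t})"
  shows "optensor tn A X z \<in> Gb t"
proof -
  note b = bopsD[OF optensor_bops[OF A bops_onD(1)[OF X]]]
  have "z \<in> closure (cspan {tn x u | x u. True})" using tn_total by simp
  then show ?thesis
  proof (induction rule: closure_cspan_induct)
    case (base c)
    then obtain x u where c: "c = tn x u" by blast
    have "optensor tn A X c \<in> {tn x u | x u. u \<in> fock_on ex {0..<t}}"
      using bops_onD(2)[OF X] by (auto simp: c optensor_tn[OF A bops_onD(1)[OF X]])
    then show ?case unfolding init_fock_before_def by (rule subsetD[OF subset_closure_cspan])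
  next
    case closed
    have "closed (optensor tn A X -` Gb t)"
      by (intro closed_vimage Gb_closed bounded_clinear_continuous_on b)
    then show ?case by (simp add: vimage_def)
  next
    case subspace
    show ?case
      by (rule complex_hilbert.subspaceI)
        (auto simp: bounded_clinear_add[OF b] bounded_clinear_scaleC[OF b] bounded_clinear_zero[OF b]
          complex_hilbert.subspace_0[OF Gb_csubspace] complex_hilbert.subspace_add[OF Gb_csubspace]
          complex_hilbert.subspace_scale[OF Gb_csubspace])
  qed
qed

text \<open>Both properties required by \<open>bops_on\<close> are vanishing conditions on matrix
  elements, and these survive ultraweak limits. They are checked on elementary tensors, the
  condition on the kernel by passing to adjoints.\<close>

lemma ultraweak_tensor_bops_on:
  assumes M: "M \<subseteq> bops" and W: "W \<in> ultraweak_tensor tn M (bops_on (fock_on ex {0..<t}))"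
  shows "W \<in> bops_on (Gb t)"
proof -
  let ?N = "bops_on (fock_on ex {0..<t})"
  let ?A = "{(\<lambda>z. \<Sum>i<n. optensor tn (A i) (X i) z) | (n::nat) A X. \<forall>i<n. A i \<in> M \<and> X i \<in> ?N}"
  have W': "W \<in> ultraweak_closure ?A" using W by (simp add: ultraweak_tensor_def)
  have Wb: "W \<in> bops" using W' by (simp add: ultraweak_closure_def)
  have 1: "cinner z (W w) = 0" if z: "\<And>u. u \<in> Gb t \<Longrightarrow> cinner u z = 0" for z w
  proof (rule ultraweak_closure_cinner_eq_0[OF W'])
    fix B assume "B \<in> ?A"
    then obtain n :: nat and A X where B: "B = (\<lambda>z. \<Sum>i<n. optensor tn (A i) (X i) z)" "\<And>i. i < n \<Longrightarrow> A i \<in> M \<and> X i \<in> ?N"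
      by blast
    have "cinner z (optensor tn (A i) (X i) w) = 0" if "i < n" for i
    proof -
      have "optensor tn (A i) (X i) w \<in> Gb t" using B(2)[OF that] M by (intro optensor_mem_Gb) auto
      then have "cinner (optensor tn (A i) (X i) w) z = 0" by (rule z)
      then show ?thesis by (metis cinner_commute complex_cnj_zero)
    qed
    then show "cinner z (B w) = 0" by (simp add: B(1) cinner_sum_right)
  qed
  have 2: "cinner z (W y) = 0" if y: "\<And>u. u \<in> Gb t \<Longrightarrow> cinner u y = 0" for z y
  proof (rule ultraweak_closure_cinner_eq_0[OF W'])
    fix B assume "B \<in> ?A"
    then obtain n :: nat and A X where B: "B = (\<lambda>z. \<Sum>i<n. optensor tn (A i) (X i) z)" "\<And>i. i < n \<Longrightarrow> A i \<in> M \<and> X i \<in> ?N"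
      by blast
    have "cinner z (optensor tn (A i) (X i) y) = 0" if "i < n" for i
    proof -
      have Ai: "A i \<in> bops" and Xi: "X i \<in> ?N" using B(2)[OF that] M by auto
      have "cadj (X i) \<in> ?N" by (rule bops_on_cadj[OF fock_on_closed fock_on_csubspace Xi])
      then have "optensor tn (cadj (A i)) (cadj (X i)) z \<in> Gb t" by (intro optensor_mem_Gb bops_cadj Ai)
      then have "cinner (optensor tn (cadj (A i)) (cadj (X i)) z) y = 0" by (rule y)
      moreover have "cinner (cadj (optensor tn (A i) (X i)) z) y = cinner z (optensor tn (A i) (X i) y)"
        by (rule cinner_cadj_left[OF bopsD[OF optensor_bops[OF Ai bops_onD(1)[OF Xi]]]])
      ultimately show ?thesis by (simp add: cadj_optensor[OF Ai bops_onD(1)[OF Xi]])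
    qed
    then show "cinner z (B y) = 0" by (simp add: B(1) cinner_sum_right)
  qed
  have "W w \<in> Gb t" for w
    by (rule mem_closed_csubspace_if[OF Gb_closed Gb_csubspace]) (rule 1)
  moreover have "W y = 0" if "\<forall>u\<in>Gb t. cinner u y = 0" for y
  proof (rule eq_0_if_cinner_eq_0)
    show "cinner z (W y) = 0" for z by (rule 2) (use that in blast)
  qed
  ultimately show ?thesis using Wb by (auto simp: bops_on_def)
qed

lemma bops_on_Gb_eqI:
  assumes W: "W \<in> bops_on (Gb t)" "W' \<in> bops_on (Gb t)"
    and eq: "\<And>f g x y. f \<in> L2 {0..<t} \<Longrightarrow> g \<in> L2 {0..<t} \<Longrightarrow>
      cinner (tn x (ex f)) (W (tn y (ex g))) = cinner (tn x (ex f)) (W' (tn y (ex g)))"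
  shows "W = W'"
proof
  fix z
  let ?B = "{tn x (ex f) | x f. f \<in> L2 {0..<t}}"
  note b = bopsD[OF bops_onD(1)[OF W(1)]] bopsD[OF bops_onD(1)[OF W(2)]]
  have 1: "W v = W' v" if "v \<in> ?B" for v
  proof -
    have d: "W v - W' v \<in> closure (cspan ?B)"
      using complex_hilbert.subspace_diff[OF Gb_csubspace bops_onD(2)[OF W(1)] bops_onD(2)[OF W(2)]] by (simp add: Gb_eq)
    have "cinner (W v - W' v) (W v - W' v) = 0"
    proof (rule cinner_closure_cspan_eq_0[OF d])
      fix c assume "c \<in> ?B"
      then have "cinner c (W v - W' v) = 0" using that eq by (auto simp: cinner_diff_right)
      then show "cinner (W v - W' v) c = 0" by (metis cinner_commute complex_cnj_zero)
    qed
    then show ?thesis by simp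
  qed
  have 2: "W v = W' v" if "v \<in> Gb t" for v
    using that unfolding Gb_eq
  proof (induction rule: closure_cspan_induct)
    case closed
    show ?case by (intro closed_Collect_eq bounded_clinear_continuous_on b)
  next
    case subspace
    show ?case by (rule complex_hilbert.subspaceI) (auto simp: b bounded_clinear_add bounded_clinear_scaleC)
  qed (rule 1)
  have "W (ident_on (Gb t) z) = W' (ident_on (Gb t) z)"
    by (rule 2[OF bops_onD(2)[OF ident_on_bops_on[OF Gb_closed Gb_csubspace]]])
  then show "W z = W' z"
    by (simp add: bops_on_apply_ident_on[OF Gb_closed Gb_csubspace] W)
qed

lemma J_vac:
  assumes "f \<in> L2 {0..<t}" "t \<ge> 0" shows "J t f (tn x vac) = tn x (ex f)"
proof -
  have "restr {0..<t} f = f" using L2D(3)[OF assms(1)] by (auto simp: restr_def fun_eq_iff)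
  then have "conc t f (\<lambda>_. 0) = f" by (auto simp: conc_def right_shift_def)
  then show ?thesis using assms by (simp add: J_tn j_ex L2_before L2_zero)
qed

end

section \<open>The identity-adapted projection of an isometric cocycle\<close>

locale isometric_cocycle = fock_tensor ex tn
  for ex :: "(real \<Rightarrow> 'k::complex_hilbert) \<Rightarrow> 'f::complex_hilbert"
    and tn :: "'h::complex_hilbert \<Rightarrow> 'f \<Rightarrow> 'g::complex_hilbert" +
  fixes M :: "('h \<Rightarrow> 'h) set" and p :: "'k \<Rightarrow> 'k" and V :: "real \<Rightarrow> 'g \<Rightarrow> 'g"
  assumes vN: "von_neumann_algebra M" and p: "orth_projection p"
    and cocycle: "adapted_cocycle tn ex M p V"
    and isometric: "isometric_process tn ex p V"
    and continuous: "strongly_continuous_process V"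
begin

text \<open>Up to the shift by \<open>t\<close>, every \<open>second_quant ex p t\<close> is this
  one operator, which gives the factorisation
  \<open>V t = Vh t \<circ> \<Phi> t (amp P0)\<close>.\<close>

definition P0 :: "'f \<Rightarrow> 'f" where "P0 = second_quant ex p 0"

definition W :: "real \<Rightarrow> 'g \<Rightarrow> 'g" where "W t = before_part tn ex p V t"

definition Vh :: "real \<Rightarrow> 'g \<Rightarrow> 'g" where "Vh t = identity_adapted tn ex p V t"

lemma P0_bops: "P0 \<in> bops"
  unfolding P0_def by (rule bops_onD(1)[OF second_quant_bops_on[OF p order_refl]])

lemma P0_ex: "f \<in> L2 {0..} \<Longrightarrow> P0 (ex f) = ex (p \<circ> f)"
  unfolding P0_def by (rule second_quant_ex[OF p order_refl])

lemma p_bounded: "bounded_clinear p"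
  using orth_projectionD(1)[OF p] by (rule bopsD)

lemma P0_vac: "P0 vac = vac"
  by (simp add: P0_ex L2_zero o_def p_bounded)

lemma p_comp_L2: "f \<in> L2 A \<Longrightarrow> p \<circ> f \<in> L2 A"
  by (rule L2_comp[OF _ orth_projectionD(1)[OF p]])

lemma init_fock_optensor_second_quant:
  assumes "B \<in> bops_on (Gb t)" "t \<ge> 0"
  shows "init_fock_optensor tn ex t B (second_quant ex p t) = lift t B \<circ> \<Phi> t (amp P0)"
proof (rule init_fock_optensor_eq[OF assms P0_bops])
  fix f g :: "real \<Rightarrow> 'k" assume fg: "f \<in> L2 {0..}" "g \<in> L2 {0..}"
  have "p \<circ> right_shift t g = right_shift t (p \<circ> g)"
    by (auto simp: right_shift_def fun_eq_iff p_bounded)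
  then show "cinner (ex (right_shift t f)) (second_quant ex p t (ex (right_shift t g))) = cinner (ex f) (P0 (ex g))"
    using fg assms(2)
    by (simp add: second_quant_ex[OF p assms(2)] right_shift_L2 P0_ex ex_inner right_shift_L2' p_comp_L2
        L2_inner_right_shift)
qed

text \<open>The vacuum is fixed by \<open>P0\<close>, so matrix elements between vectors with vacuum
  future recover the factor before \<open>t\<close>, whatever the projection \<open>p\<close>
  is.\<close>

lemma lift_second_quant_unique:
  assumes B: "B \<in> bops_on (Gb t)" "B' \<in> bops_on (Gb t)" and t: "t \<ge> 0"
    and eq: "lift t B \<circ> \<Phi> t (amp P0) = lift t B' \<circ> \<Phi> t (amp P0)"
  shows "B = B'"
proof (rule bops_on_Gb_eqI[OF B])
  fix f g :: "real \<Rightarrow> 'k" and x y assume fg: "f \<in> L2 {0..<t}" "g \<in> L2 {0..<t}"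
  have r: "restr {0..<t} h = h" if "h \<in> L2 {0..<t}" for h :: "real \<Rightarrow> 'k"
    using L2D(3)[OF that] by (auto simp: restr_def fun_eq_iff)
  have "cinner (tn x (ex f)) ((lift t C \<circ> \<Phi> t (amp P0)) (tn y (ex g))) = cinner (tn x (ex f)) (C (tn y (ex g)))"
    if C: "C \<in> bops_on (Gb t)" for C
  proof -
    have "cinner (tn x (ex f)) ((lift t C \<circ> \<Phi> t (amp P0)) (tn y (ex g))) =
        cinner (J t f (tn x vac)) (lift t C (J t g (tn y vac)))"
      using fg t by (simp add: J_vac[symmetric] \<Phi>_J amp_bops P0_bops L2_before amp_tn P0_vac)
    also have "\<dots> = cinner (tn x (ex f)) (C (tn y (ex g)))"
      using fg t by (simp add: lift_J[OF C t] L2_before r vac_inner L2_zero)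
    finally show ?thesis .
  qed
  from this[OF B(1)] this[OF B(2)] eq
  show "cinner (tn x (ex f)) (B (tn y (ex g))) = cinner (tn x (ex f)) (B' (tn y (ex g)))" by simp
qed

lemma
  assumes t: "t \<ge> 0"
  shows W_bops_on: "W t \<in> bops_on (Gb t)" and V_eq_lift: "V t = lift t (W t) \<circ> \<Phi> t (amp P0)"
proof -
  have "adapted_process tn ex M p V" using cocycle by (simp add: adapted_cocycle_def)
  then obtain B where B: "B \<in> ultraweak_tensor tn M (bops_on (fock_on ex {0..<t}))"
    "V t = init_fock_optensor tn ex t B (second_quant ex p t)"
    using t unfolding adapted_process_def by blast
  have "M \<subseteq> bops" using vN by (simp add: von_neumann_algebra_def)
  then have B1: "B \<in> bops_on (Gb t)" using B(1) by (rule ultraweak_tensor_bops_on)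
  have VB: "V t = lift t B \<circ> \<Phi> t (amp P0)" using B(2) init_fock_optensor_second_quant[OF B1 t] by simp
  have "W t = B"
    unfolding W_def before_part_def
  proof (rule the_equality)
    fix C assume C: "C \<in> bops_on (Gb t) \<and> V t = init_fock_optensor tn ex t C (second_quant ex p t)"
    then show "C = B"
      using VB init_fock_optensor_second_quant[of C t] t by (intro lift_second_quant_unique[OF _ B1 t]) auto
  qed (use B B1 in auto)
  with B1 VB show "W t \<in> bops_on (Gb t)" "V t = lift t (W t) \<circ> \<Phi> t (amp P0)" by auto
qed

lemma Vh_eq_lift: "t \<ge> 0 \<Longrightarrow> Vh t = lift t (W t)"
  unfolding Vh_def identity_adapted_def W_def[symmetric]
  by (rule init_fock_optensor_ident[OF W_bops_on])

lemma Vh_bops: "t \<ge> 0 \<Longrightarrow> Vh t \<in> bops"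
  by (simp add: Vh_eq_lift lift_bops W_bops_on)

lemma Vh_adapted: "t \<ge> 0 \<Longrightarrow> adapted_at t (Vh t)"
  by (simp add: Vh_eq_lift adapted_at_lift W_bops_on)

lemma Vh_commute: "t \<ge> 0 \<Longrightarrow> X \<in> bops \<Longrightarrow> Vh t (\<Phi> t (amp X) z) = \<Phi> t (amp X) (Vh t z)"
  using Vh_adapted unfolding adapted_at_def by blast

lemma V_eq: "t \<ge> 0 \<Longrightarrow> V t = Vh t \<circ> \<Phi> t (amp P0)"
  by (simp add: V_eq_lift Vh_eq_lift)

lemma V_bops: "t \<ge> 0 \<Longrightarrow> V t \<in> bops"
  unfolding V_eq by (intro bops_comp Vh_bops \<Phi>_bops amp_bops P0_bops)

lemma V_cocycle: "s \<ge> 0 \<Longrightarrow> t \<ge> 0 \<Longrightarrow> V (s + t) = Vh s \<circ> \<Phi> s (V t)"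
  using cocycle unfolding adapted_cocycle_def by (simp add: Vh_def ampliation_flow V_bops)

lemma W_inner:
  assumes t: "t \<ge> 0" and z: "z \<in> Gb t" "w \<in> Gb t"
  shows "cinner (W t z) (W t w) = cinner z w"
proof -
  note K = fock_on_closed[of "{0..<t}"] fock_on_csubspace[of "{0..<t}"]
  let ?E = "optensor tn id (ident_on (fock_on ex {0..<t}))"
  have eb: "ident_on (fock_on ex {0..<t}) \<in> bops" by (rule bops_onD(1)[OF ident_on_bops_on[OF K]])
  have "?E w = w"
    using z(2) unfolding init_fock_before_def
  proof (induction rule: closure_cspan_induct)
    case (base b)
    then obtain x u where b: "b = tn x u" "u \<in> fock_on ex {0..<t}" by blast
    show ?case unfolding b(1) amp_tn[OF eb] ident_on_apply[OF K b(2)] ..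
  next
    case closed
    show ?case
      by (rule closed_Collect_eq[OF bounded_clinear_continuous_on[OF bopsD[OF amp_bops[OF eb]]] continuous_on_id])
  next
    case subspace
    note b = bopsD[OF amp_bops[OF eb]]
    show ?case
      by (rule complex_hilbert.subspaceI)
        (simp_all only: mem_Collect_eq bounded_clinear_add[OF b] bounded_clinear_scaleC[OF b] bounded_clinear_zero[OF b])
  qed
  moreover have "cadj (W t) \<circ> W t = ?E"
    using isometric t unfolding isometric_process_def by (simp add: W_def)
  ultimately have "cadj (W t) (W t w) = w" by (metis comp_apply)
  then show ?thesis
    using cinner_cadj_right[OF bopsD[OF bops_onD(1)[OF W_bops_on[OF t]]], of z "W t w"] by simp
qed

lemma Vh_inner:
  assumes t: "t \<ge> 0" shows "cinner (Vh t z) (Vh t w) = cinner z w"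
proof -
  note b = bopsD[OF Vh_bops[OF t]]
  let ?B = "{tn x (ex f) | x f. f \<in> L2 {0..}}"
  have "cinner (Vh t z) (Vh t w) = 1 * cinner (id z) (id w)"
  proof (rule cinner_eq_on_total[OF b b bounded_clinear_id bounded_clinear_id tn_ex_total])
    fix b c assume "b \<in> ?B" "c \<in> ?B"
    then obtain x f y g where bc: "b = tn x (ex f)" "c = tn y (ex g)" "f \<in> L2 {0..}" "g \<in> L2 {0..}" by blast
    have "cinner (Vh t b) (Vh t c) =
        cinner (K t (restr {t..} f) (W t (tn x (ex (restr {0..<t} f))))) (K t (restr {t..} g) (W t (tn y (ex (restr {0..<t} g)))))"
      using bc t lift_K[OF W_bops_on[OF t], of "restr {t..} f" "tn x (ex (restr {0..<t} f))"]
        lift_K[OF W_bops_on[OF t], of "restr {t..} g" "tn y (ex (restr {0..<t} g))"]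
      by (simp add: Vh_eq_lift K_restr restr_L2 tn_ex_mem_Gb)
    also have "\<dots> = cinner (K t (restr {t..} f) (tn x (ex (restr {0..<t} f)))) (K t (restr {t..} g) (tn y (ex (restr {0..<t} g))))"
      using bc t by (simp add: K_inner restr_L2 bops_onD(2)[OF W_bops_on[OF t]] W_inner tn_ex_mem_Gb)
    also have "\<dots> = cinner b c" using bc t by (simp add: K_restr)
    finally show "cinner (Vh t b) (Vh t c) = 1 * cinner (id b) (id c)" by simp
  qed
  then show ?thesis by simp
qed

lemma norm_Vh: "t \<ge> 0 \<Longrightarrow> norm (Vh t z) = norm z"
proof -
  assume "t \<ge> 0"
  then have "(norm (Vh t z))\<^sup>2 = (norm z)\<^sup>2" by (simp add: norm_sq_cinner Vh_inner)
  then show ?thesis by (simp add: power2_eq_iff_nonneg)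
qed

text \<open>Both sides are adapted at \<open>s + t\<close>, so it suffices to compare them on
  vectors whose future after \<open>s + t\<close> is the vacuum. There the second quantised
  projection acts trivially, and the identity is the cocycle law of \<open>V\<close>.\<close>

lemma Vh_cocycle:
  assumes s: "s \<ge> 0" and t: "t \<ge> 0"
  shows "Vh (s + t) = Vh s \<circ> \<Phi> s (Vh t)"
proof (rule adapted_at_eqI)
  note b = Vh_bops[OF t] amp_bops
  show st: "s + t \<ge> 0" using s t by simp
  show "adapted_at (s + t) (Vh (s + t))" by (rule Vh_adapted[OF st])
  show "adapted_at (s + t) (Vh s \<circ> \<Phi> s (Vh t))"
    unfolding adapted_at_def
  proof (intro conjI ballI allI)
    show "Vh s \<circ> \<Phi> s (Vh t) \<in> bops" using Vh_bops[OF s] \<Phi>_bops[OF Vh_bops[OF t] s] by (rule bops_comp)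
    fix X :: "'f \<Rightarrow> 'f" and z assume X: "X \<in> bops"
    have Y: "endo_of (L2 {0..}) (j t) X \<in> bops" by (rule endo_of_bops[OF j_intertwiners[OF t] X])
    have c: "Vh t \<circ> \<Phi> t (amp X) = \<Phi> t (amp X) \<circ> Vh t" using Vh_commute[OF t X] by (simp add: fun_eq_iff)
    have "\<Phi> s (Vh t) (\<Phi> (s + t) (amp X) z) = (\<Phi> s (Vh t) \<circ> \<Phi> s (\<Phi> t (amp X))) z"
      using X s t by (simp add: \<Phi>_add_time amp_bops)
    also have "\<Phi> s (Vh t) \<circ> \<Phi> s (\<Phi> t (amp X)) = \<Phi> s (\<Phi> t (amp X)) \<circ> \<Phi> s (Vh t)"
      using X s t c by (simp add: \<Phi>_comp[symmetric] \<Phi>_bops amp_bops Vh_bops)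
    finally have "\<Phi> s (Vh t) (\<Phi> (s + t) (amp X) z) = \<Phi> s (amp (endo_of (L2 {0..}) (j t) X)) (\<Phi> s (Vh t) z)"
      by (simp only: \<Phi>_amp[OF X t] comp_apply)
    then show "(Vh s \<circ> \<Phi> s (Vh t)) (\<Phi> (s + t) (amp X) z) = \<Phi> (s + t) (amp X) ((Vh s \<circ> \<Phi> s (Vh t)) z)"
      using Vh_commute[OF s Y] X s t by (simp add: \<Phi>_add_time amp_bops \<Phi>_amp[OF X t])
  qed
  fix f :: "real \<Rightarrow> 'k" and x assume f: "f \<in> L2 {0..}"
  let ?v = "J (s + t) f (tn x vac)"
  have fixed: "\<Phi> (s + t) (amp P0) ?v = ?v"
    using f st by (simp add: \<Phi>_J amp_bops P0_bops amp_tn P0_vac)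
  have "V (s + t) ?v = Vh (s + t) ?v" using fixed st by (simp add: V_eq)
  moreover have "V (s + t) ?v = Vh s (\<Phi> s (V t) ?v)" using V_cocycle[OF s t] by simp
  \<comment> \<open>The factor \<open>P0\<close> inside \<open>V t\<close>, once moved by the flow,
    sits in the future of \<open>s + t\<close>, where it fixes \<open>?v\<close>.\<close>
  moreover have "\<Phi> s (V t) ?v = \<Phi> s (Vh t) (\<Phi> (s + t) (amp P0) ?v)"
    using s t by (simp add: V_eq \<Phi>_comp Vh_bops \<Phi>_bops amp_bops P0_bops \<Phi>_add_time)
  ultimately show "Vh (s + t) ?v = (Vh s \<circ> \<Phi> s (Vh t)) ?v" by (simp add: fixed)
qed

text \<open>By the cocycle law at time 0 this isometry is its own square, and an idempotent isometry
  is the identity.\<close>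

lemma Vh_0: "Vh 0 = id"
proof
  fix z
  have "Vh 0 = Vh 0 \<circ> Vh 0" using Vh_cocycle[of 0 0] by (simp add: \<Phi>_0 Vh_bops)
  then have "Vh 0 (Vh 0 z - z) = 0"
    by (metis bounded_clinear_diff[OF bopsD[OF Vh_bops[OF order_refl]]] comp_apply diff_self)
  then have "norm (Vh 0 z - z) = 0" using norm_Vh[of 0 "Vh 0 z - z"] by simp
  then show "Vh 0 z = id z" by simp
qed

lemma V_vac:
  assumes "h \<ge> 0" shows "V h (tn x vac) = Vh h (tn x vac)"
proof -
  have v: "tn x vac = J h (\<lambda>_. 0) (tn x vac)" using J_vac[OF L2_zero assms] by simp
  have "\<Phi> h (amp P0) (tn x vac) = tn x vac"
    by (subst (1 2) v) (use assms in \<open>simp add: \<Phi>_J amp_bops P0_bops L2_zero amp_tn P0_vac\<close>)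
  then show ?thesis using assms by (simp add: V_eq)
qed

text \<open>Strong continuity is assumed for \<open>V\<close>, which agrees with \<open>Vh\<close>
  on vectors with vacuum future. A rank-one \<open>X\<close> sending \<open>vac\<close> to
  \<open>u\<close> commutes with \<open>Vh h\<close> once it is shifted past \<open>h\<close>, and
  so carries the convergence from \<open>tn x vac\<close> to \<open>tn x u\<close>.\<close>

lemma Vh_tendsto: "((\<lambda>h. Vh h z) \<longlongrightarrow> z) (at_right 0)"
proof -
  have pos: "\<forall>\<^sub>F h in at_right (0::real). h > 0" by (simp add: eventually_at_right_less)
  have "((\<lambda>h. if h \<ge> 0 then Vh h z else 0) \<longlongrightarrow> id z) (at_right 0)"
  proof (rule tendsto_on_total[where T = "\<lambda>h y. if h \<ge> 0 then Vh h y else 0" and C = 1, OF _ _ bounded_clinear_id tn_total])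
    show "bounded_clinear (\<lambda>y. if h \<ge> 0 then Vh h y else 0)" for h
      using Vh_bops[of h] bops_zero by (cases "h \<ge> 0") (auto simp: bops_def)
    show "\<forall>\<^sub>F h in at_right 0. \<forall>x. norm (if h \<ge> 0 then Vh h x else 0) \<le> 1 * norm x" by (auto simp: norm_Vh)
    fix b assume "b \<in> {tn x u | x u. True}"
    then obtain x u where b: "b = tn x u" by blast
    define X where "X = (\<lambda>v. cinner vac v *\<^sub>C u)"
    have X: "X \<in> bops" by (simp add: X_def)
    have Xv: "amp X (tn x vac) = b" using X by (simp add: amp_tn b) (simp add: X_def vac_inner L2_zero)
    let ?v = "tn x vac"
    have "continuous_on {0..} (\<lambda>h. V h ?v)" using continuous by (simp add: strongly_continuous_process_def)
    then have "((\<lambda>h. V h ?v) \<longlongrightarrow> V 0 ?v) (at 0 within {0..})" by (simp add: continuous_on_def)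
    then have "((\<lambda>h. V h ?v) \<longlongrightarrow> V 0 ?v) (at_right 0)" by (rule tendsto_within_subset) auto
    then have Vlim: "((\<lambda>h. V h ?v) \<longlongrightarrow> ?v) (at_right 0)" by (simp add: V_vac Vh_0)
    have "((\<lambda>h. norm (b - tn x (\<Gamma> h u)) + onorm (amp X) * norm (V h ?v - ?v) + norm (\<Phi> h (amp X) ?v - amp X ?v)) \<longlongrightarrow>
        norm (b - tn x u) + onorm (amp X) * norm (?v - ?v) + norm (amp X ?v - amp X ?v)) (at_right 0)"
      by (intro tendsto_add tendsto_norm tendsto_diff tendsto_const tendsto_mult_left Vlim \<Phi>_tendsto[OF amp_bops[OF X]]
          bounded_clinear_tendsto[OF bounded_clinear_tn_right \<Gamma>_tendsto])
    then have lim: "((\<lambda>h. norm (b - tn x (\<Gamma> h u)) + onorm (amp X) * norm (V h ?v - ?v) + norm (\<Phi> h (amp X) ?v - amp X ?v)) \<longlongrightarrow> 0) (at_right 0)"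
      by (simp add: b)
    have "\<forall>\<^sub>F h in at_right 0. norm ((if h \<ge> 0 then Vh h b else 0) - b) \<le>
        norm (b - tn x (\<Gamma> h u)) + onorm (amp X) * norm (V h ?v - ?v) + norm (\<Phi> h (amp X) ?v - amp X ?v)"
      using pos
    proof (rule eventually_mono)
      fix h :: real assume h: "h > 0"
      have v: "J h (\<lambda>_. 0) ?v = ?v" using J_vac[OF L2_zero, of h x] h by simp
      have "\<Phi> h (amp X) ?v = J h (\<lambda>_. 0) (amp X ?v)"
        using h X by (subst v[symmetric]) (simp add: \<Phi>_J amp_bops L2_zero)
      then have gu: "tn x (\<Gamma> h u) = \<Phi> h (amp X) ?v"
        using h by (simp add: Xv b J_tn L2_zero)
      have "Vh h (tn x (\<Gamma> h u)) = \<Phi> h (amp X) (V h ?v)"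
        using h X by (simp add: gu Vh_commute V_vac)
      \<comment> \<open>Three errors: replacing \<open>b\<close> by its shift, the continuity of
        \<open>V\<close> at the vacuum vector, and undoing the shift.\<close>
      then have eq: "Vh h b - b = Vh h (b - tn x (\<Gamma> h u)) + \<Phi> h (amp X) (V h ?v - ?v) + (\<Phi> h (amp X) ?v - amp X ?v)"
        using h X by (simp add: bounded_clinear_diff[OF bopsD[OF Vh_bops]] bounded_clinear_diff[OF bopsD[OF \<Phi>_bops[OF amp_bops]]] Xv)
      have "norm (Vh h b - b) \<le> norm (Vh h (b - tn x (\<Gamma> h u))) + norm (\<Phi> h (amp X) (V h ?v - ?v)) + norm (\<Phi> h (amp X) ?v - amp X ?v)"
        unfolding eq by (rule order_trans[OF norm_triangle_ineq add_right_mono[OF norm_triangle_ineq]])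
      also have "\<dots> \<le> norm (b - tn x (\<Gamma> h u)) + onorm (amp X) * norm (V h ?v - ?v) + norm (\<Phi> h (amp X) ?v - amp X ?v)"
        using h norm_\<Phi>[OF amp_bops[OF X], of h "V h ?v - ?v"] by (simp add: norm_Vh)
      finally show "norm ((if h \<ge> 0 then Vh h b else 0) - b) \<le>
        norm (b - tn x (\<Gamma> h u)) + onorm (amp X) * norm (V h ?v - ?v) + norm (\<Phi> h (amp X) ?v - amp X ?v)"
        using h by simp
    qed
    then have "((\<lambda>h. (if h \<ge> 0 then Vh h b else 0) - b) \<longlongrightarrow> 0) (at_right 0)"
      by (rule Lim_null_comparison[OF _ lim])
    then show "((\<lambda>h. if h \<ge> 0 then Vh h b else 0) \<longlongrightarrow> id b) (at_right 0)"
      by (simp add: LIM_zero_cancel)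
  qed
  moreover have "\<forall>\<^sub>F h in at_right 0. (if h \<ge> 0 then Vh h z else 0) = Vh h z"
    using pos by (rule eventually_mono) simp
  ultimately show ?thesis by (simp add: Lim_transform_eventually)
qed

lemma Vh_near_id_uniform:
  assumes N: "finite N" and e: "e > 0"
  shows "\<exists>d>0. \<forall>h\<ge>0. h < d \<longrightarrow> (\<forall>n\<in>N. norm (Vh h n - n) < e)"
proof -
  have "\<forall>\<^sub>F h in at_right 0. \<forall>n\<in>N. norm (Vh h n - n) < e"
    unfolding eventually_ball_finite_distrib[OF N]
    using tendstoD[OF Vh_tendsto e] by (auto simp: dist_norm)
  then obtain d where d: "d > 0" "\<And>h. h > 0 \<Longrightarrow> h < d \<Longrightarrow> \<forall>n\<in>N. norm (Vh h n - n) < e"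
    unfolding eventually_at_right_field by auto
  have "\<forall>n\<in>N. norm (Vh h n - n) < e" if "h \<ge> 0" "h < d" for h
    using d(2)[of h] that e by (cases "h = 0") (auto simp: Vh_0)
  then show ?thesis using d(1) by blast
qed

end

section \<open>Sums over partitions\<close>

definition pred_point :: "ennreal set \<Rightarrow> ennreal \<Rightarrow> ennreal" where
  "pred_point Q q = Max {r \<in> insert 0 Q. r < q}"

lemma pred_point_eqI:
  assumes "finite Q" "r \<in> insert 0 Q" "r < q" "\<And>s. s \<in> Q \<Longrightarrow> s < q \<Longrightarrow> s \<le> r"
  shows "pred_point Q q = r"
  unfolding pred_point_def by (rule Max_eqI) (use assms in auto)

lemma pred_point:
  assumes "finite Q" "0 < q"
  shows "pred_point Q q \<in> insert 0 Q" "pred_point Q q < q" "\<And>s. s \<in> Q \<Longrightarrow> s < q \<Longrightarrow> s \<le> pred_point Q q"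
proof -
  have f: "finite {r \<in> insert 0 Q. r < q}" "{r \<in> insert 0 Q. r < q} \<noteq> {}" using assms by auto
  show "pred_point Q q \<in> insert 0 Q" "pred_point Q q < q" using Max_in[OF f] by (auto simp: pred_point_def)
  show "s \<le> pred_point Q q" if "s \<in> Q" "s < q" for s
    unfolding pred_point_def using f(1) that by (intro Max_ge) auto
qed

lemma partition_point:
  fixes Q :: "ennreal set"
  assumes "Q \<subseteq> {0<..<b}" "0 < b" "q \<in> insert b Q"
  shows "0 < q" "q \<le> b"
proof -
  have "0 < q \<and> q \<le> b"
  proof (cases "q = b")
    case False
    then have "q \<in> {0<..<b}" using assms by blast
    then show ?thesis by (simp add: less_imp_le)
  qed (use assms in simp)
  then show "0 < q" "q \<le> b" by auto
qed

lemma le_pred_point: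
  assumes "finite Q" "Q \<subseteq> {0<..<b}" "0 < b" "c \<in> insert b Q" "q \<in> insert b Q" "c < q"
  shows "c \<le> pred_point Q q"
proof -
  have "c \<in> Q" using assms(4,6) partition_point(2)[OF assms(2,3,5)] by auto
  then show ?thesis using pred_point(3)[OF assms(1) partition_point(1)[OF assms(2,3,5)]] assms(6) by blast
qed

lemma cell_subset:
  assumes "q \<le> b" shows "{pred_point Q q<..q} \<subseteq> {0<..b}"
proof
  fix x assume "x \<in> {pred_point Q q<..q}"
  then have x: "pred_point Q q < x" "x \<le> q" by auto
  have "0 < x" using x(1) by (rule le_less_trans[rotated]) simp
  then show "x \<in> {0<..b}" using x(2) assms by auto
qed

lemma cells_disjoint:
  assumes Q: "finite Q" "Q \<subseteq> {0<..<b}" "0 < b" and q: "q \<in> insert b Q" "q' \<in> insert b Q" "q \<noteq> q'"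
  shows "{pred_point Q q<..q} \<inter> {pred_point Q q'<..q'} = {}"
proof (cases "q < q'")
  case True
  then show ?thesis using le_pred_point[OF Q q(1,2)] by (auto dest: order_trans)
next
  case False
  then have "q' < q" using q(3) by simp
  then show ?thesis using le_pred_point[OF Q q(2,1)] by (auto dest: order_trans)
qed

definition part_sum :: "(ennreal \<Rightarrow> ennreal set \<Rightarrow> 'a::comm_monoid_add) \<Rightarrow> ennreal \<Rightarrow> ennreal set \<Rightarrow> 'a" where
  "part_sum \<tau> b Q = (\<Sum>q\<in>insert b Q. \<tau> q {pred_point Q q<..q})"

lemma stop_sum_eq: "stop_sum Z S b Q x = part_sum (\<lambda>q A. Z q (S A x)) b Q"
  by (simp add: stop_sum_def part_sum_def pred_point_def)

definition interval_additive :: "ennreal \<Rightarrow> (ennreal set \<Rightarrow> 'a::comm_monoid_add) \<Rightarrow> bool" where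
  "interval_additive b m \<longleftrightarrow> (\<forall>a c d. a \<le> c \<longrightarrow> c \<le> d \<longrightarrow> d \<le> b \<longrightarrow> m {a<..d} = m {a<..c} + m {c<..d})"

lemma interval_additive_sum:
  assumes "finite F" "interval_additive b m" "d \<le> b" "a < d" "\<And>f. f \<in> F \<Longrightarrow> a < f \<and> f < d"
  shows "m {a<..d} = (\<Sum>f\<in>insert d F. m {Max {r \<in> insert a F. r < f}<..f})"
  using assms
proof (induction F arbitrary: d rule: finite_linorder_max_induct)
  case empty
  have "{r. r = a \<and> r < d} = {a}" using empty by auto
  then show ?case by simp
next
  case (insert u F)
  have u: "a < u" "u < d" using insert.prems(4)[of u] by auto
  have ub: "u \<le> b" "a \<le> u" "u \<le> d"
    using less_imp_le[OF u(1)] less_imp_le[OF u(2)] insert.prems(2) by auto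
  have IH: "m {a<..u} = (\<Sum>f\<in>insert u F. m {Max {r \<in> insert a F. r < f}<..f})"
    by (rule insert.IH[OF insert.prems(1) ub(1) u(1)]) (use insert.prems(4) insert.hyps in auto)
  have d: "Max {r \<in> insert a (insert u F). r < d} = u"
    by (rule Max_eqI) (use insert u ub(2) in auto)
  have e: "{r \<in> insert a (insert u F). r < f} = {r \<in> insert a F. r < f}" if "f \<in> insert u F" for f
    using that insert.hyps by auto
  have "(\<Sum>f\<in>insert d (insert u F). m {Max {r \<in> insert a (insert u F). r < f}<..f}) =
      m {u<..d} + (\<Sum>f\<in>insert u F. m {Max {r \<in> insert a (insert u F). r < f}<..f})"
    using insert.hyps insert.prems u d by (subst sum.insert) auto
  also have "(\<Sum>f\<in>insert u F. m {Max {r \<in> insert a (insert u F). r < f}<..f}) = m {a<..u}"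
    unfolding IH by (intro sum.cong refl) (simp only: e)
  also have "m {u<..d} + m {a<..u} = m {a<..d}"
    using insert.prems(1)[unfolded interval_additive_def, rule_format, OF ub(2,3) insert.prems(2)]
    by (simp add: add.commute)
  finally show ?case by simp
qed

lemma interval_additive_sum_cell:
  assumes Q: "finite Q" and m: "interval_additive b m" and d: "d \<in> insert b Q" "d \<le> b" and a: "a \<in> insert 0 Q" "a < d"
  shows "m {a<..d} = (\<Sum>f\<in>{f \<in> insert b Q. a < f \<and> f \<le> d}. m {pred_point Q f<..f})"
proof -
  define F where "F = {f \<in> Q. a < f \<and> f < d}"
  have F: "finite F" using Q by (simp add: F_def)
  have set: "{f \<in> insert b Q. a < f \<and> f \<le> d} = insert d F" using d a by (auto simp: F_def)
  have p: "Max {r \<in> insert a F. r < f} = pred_point Q f" if "f \<in> insert d F" for f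
  proof (rule sym, rule pred_point_eqI[OF Q])
    have f: "a < f" "f \<le> d" using that a by (auto simp: F_def)
    have A: "finite {r \<in> insert a F. r < f}" "{r \<in> insert a F. r < f} \<noteq> {}" using F f by auto
    have M: "Max {r \<in> insert a F. r < f} \<in> insert a F" "Max {r \<in> insert a F. r < f} < f" using Max_in[OF A] by auto
    then show "Max {r \<in> insert a F. r < f} \<in> insert 0 Q" "Max {r \<in> insert a F. r < f} < f" using a by (auto simp: F_def)
    fix s assume s: "s \<in> Q" "s < f"
    show "s \<le> Max {r \<in> insert a F. r < f}"
    proof (cases "a < s")
      case True
      then have "s \<in> {r \<in> insert a F. r < f}" using s f by (auto simp: F_def)
      then show ?thesis by (rule Max_ge[OF A(1)])
    next
      case False
      have "a \<le> Max {r \<in> insert a F. r < f}" using f by (intro Max_ge[OF A(1)]) auto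
      then show ?thesis using False by simp
    qed
  qed
  have "m {a<..d} = (\<Sum>f\<in>insert d F. m {Max {r \<in> insert a F. r < f}<..f})"
    by (rule interval_additive_sum[OF F m d(2) a(2)]) (auto simp: F_def)
  also have "\<dots> = (\<Sum>f\<in>insert d F. m {pred_point Q f<..f})" by (intro sum.cong refl) (simp only: p)
  finally show ?thesis by (simp only: set)
qed

lemma interval_additive_part_sum:
  assumes Q: "finite Q" "Q \<subseteq> {0<..<b}" and b: "b > 0" and m: "interval_additive b m"
  shows "part_sum (\<lambda>_. m) b Q = m {0<..b}"
proof -
  have "{f \<in> insert b Q. 0 < f \<and> f \<le> b} = insert b Q" using partition_point[OF Q(2) b] by blast
  then show ?thesis using interval_additive_sum_cell[OF Q(1) m, of b 0] b by (simp add: part_sum_def)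
qed

text \<open>For \<open>f\<close> a point of a finer partition, this is the right end of the coarse
  cell that contains the fine cell ending at \<open>f\<close>.\<close>

definition next_point :: "ennreal \<Rightarrow> ennreal set \<Rightarrow> ennreal \<Rightarrow> ennreal" where
  "next_point b Q f = Min {q \<in> insert b Q. f \<le> q}"

lemma next_point:
  assumes "finite Q" "f \<le> b"
  shows "next_point b Q f \<in> insert b Q" "f \<le> next_point b Q f" "\<And>q. q \<in> insert b Q \<Longrightarrow> f \<le> q \<Longrightarrow> next_point b Q f \<le> q"
proof -
  have f: "finite {q \<in> insert b Q. f \<le> q}" "{q \<in> insert b Q. f \<le> q} \<noteq> {}" using assms by auto
  show "next_point b Q f \<in> insert b Q" "f \<le> next_point b Q f" using Min_in[OF f] by (auto simp: next_point_def)
  show "next_point b Q f \<le> q" if "q \<in> insert b Q" "f \<le> q" for q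
    unfolding next_point_def using f(1) that by (intro Min_le) auto
qed

text \<open>The coarse sum is rewritten over the cells of the finer partition: every fine cell keeps
  the value attached to the right end of the coarse cell that it lies in. Differences with the fine
  sum can then be taken cell by cell.\<close>

lemma part_sum_refine:
  assumes Q: "Q \<subseteq> R" "finite R" "R \<subseteq> {0<..<b}" and b: "b > 0"
    and add: "\<And>q. q \<in> insert b Q \<Longrightarrow> interval_additive q (\<tau> q)"
  shows "part_sum \<tau> b Q = (\<Sum>f\<in>insert b R. \<tau> (next_point b Q f) {pred_point R f<..f})"
proof -
  have fQ: "finite Q" using Q finite_subset by blast
  have le: "q \<le> b" "0 < q" if "q \<in> insert b R" for q
    using partition_point[OF Q(3) b that] by auto
  have fib: "{f \<in> insert b R. pred_point Q q < f \<and> f \<le> q} = {f \<in> insert b R. next_point b Q f = q}"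
    if q: "q \<in> insert b Q" for q
  proof -
    have q': "q \<le> b" "0 < q" using le[of q] q Q(1) by auto
    note pp = pred_point[OF fQ q'(2)]
    have "pred_point Q q < f \<and> f \<le> q \<longleftrightarrow> next_point b Q f = q" if f: "f \<in> insert b R" for f
    proof
      note np = next_point[OF fQ le(1)[OF f]]
      assume a: "pred_point Q q < f \<and> f \<le> q"
      have "next_point b Q f \<le> q" using np(3)[OF q] a by simp
      moreover have "\<not> next_point b Q f < q"
      proof
        assume l: "next_point b Q f < q"
        then have "next_point b Q f \<in> Q" using np(1) q' by auto
        then have "next_point b Q f \<le> pred_point Q q" using pp(3) l by blast
        then show False using a np(2) by auto
      qed
      ultimately show "next_point b Q f = q" by simp
    next
      note np = next_point[OF fQ le(1)[OF f]]
      assume a: "next_point b Q f = q"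
      have "\<not> f \<le> pred_point Q q"
      proof
        assume l: "f \<le> pred_point Q q"
        have "0 < f" using le[OF f] by simp
        then have "pred_point Q q \<in> Q" using l pp(1) by auto
        then have "q \<le> pred_point Q q" using np(3)[of "pred_point Q q"] l a by simp
        then show False using pp(2) by simp
      qed
      then show "pred_point Q q < f \<and> f \<le> q" using a np(2) by auto
    qed
    then show ?thesis by blast
  qed
  have "part_sum \<tau> b Q = (\<Sum>q\<in>insert b Q. \<Sum>f\<in>{f \<in> insert b R. next_point b Q f = q}. \<tau> q {pred_point R f<..f})"
    unfolding part_sum_def
  proof (intro sum.cong refl)
    fix q assume q: "q \<in> insert b Q"
    have q': "q \<le> b" "0 < q" using le[of q] q Q(1) by auto
    note pp = pred_point[OF fQ q'(2)]
    \<comment> \<open>Additivity of \<open>\<tau> q\<close> is available only up to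
      \<open>q\<close>, so the fine partition is cut at \<open>q\<close>; predecessors of points up
      to \<open>q\<close> are unaffected.\<close>
    define R' where "R' = {r \<in> R. r < q}"
    have R': "finite R'" using Q by (simp add: R'_def)
    have pr: "pred_point R' f = pred_point R f" if "f \<le> q" "0 < f" for f
    proof (rule pred_point_eqI[OF R'])
      note p2 = pred_point[OF Q(2) that(2)]
      show "pred_point R f \<in> insert 0 R'" "pred_point R f < f" using p2(1,2) that by (auto simp: R'_def)
      show "s \<le> pred_point R f" if "s \<in> R'" "s < f" for s using p2(3) that by (auto simp: R'_def)
    qed
    have "\<tau> q {pred_point Q q<..q} = (\<Sum>f\<in>{f \<in> insert q R'. pred_point Q q < f \<and> f \<le> q}. \<tau> q {pred_point R' f<..f})"
      by (rule interval_additive_sum_cell[OF R' add[OF q]]) (use pp Q in \<open>auto simp: R'_def\<close>)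
    also have "{f \<in> insert q R'. pred_point Q q < f \<and> f \<le> q} = {f \<in> insert b R. pred_point Q q < f \<and> f \<le> q}"
      using q q' Q pp by (auto simp: R'_def)
    also have "(\<Sum>f\<in>{f \<in> insert b R. pred_point Q q < f \<and> f \<le> q}. \<tau> q {pred_point R' f<..f}) =
        (\<Sum>f\<in>{f \<in> insert b R. pred_point Q q < f \<and> f \<le> q}. \<tau> q {pred_point R f<..f})"
      using le by (intro sum.cong refl) (auto simp: pr)
    finally show "\<tau> q {pred_point Q q<..q} = (\<Sum>f\<in>{f \<in> insert b R. next_point b Q f = q}. \<tau> q {pred_point R f<..f})"
      using fib[OF q] by simp
  qed
  also have "\<dots> = (\<Sum>q\<in>insert b Q. \<Sum>f\<in>{f \<in> insert b R. next_point b Q f = q}. \<tau> (next_point b Q f) {pred_point R f<..f})"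
    by (intro sum.cong refl) auto
  also have "\<dots> = (\<Sum>f\<in>insert b R. \<tau> (next_point b Q f) {pred_point R f<..f})"
    by (rule sum.group) (use fQ Q next_point(1)[OF fQ le(1)] in auto)
  finally show ?thesis .
qed

text \<open>The limit of the net is found through a sequence: centres \<open>x n\<close> to which
  the net eventually stays within \<open>1 / Suc n\<close> form a Cauchy sequence, because any two
  of them are eventually close to the same member of the net.\<close>

lemma complete_convergence_criterion:
  fixes f :: "'i \<Rightarrow> 'a::complete_space"
  assumes F: "F \<noteq> bot" and ev: "\<And>e. e > 0 \<Longrightarrow> \<exists>x. \<forall>\<^sub>F i in F. dist (f i) x \<le> e"
  shows "\<exists>l. (f \<longlongrightarrow> l) F"
proof -
  have "\<exists>x. \<forall>\<^sub>F i in F. dist (f i) x \<le> 1 / Suc n" for n by (rule ev) simp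
  then obtain x where x: "\<And>n. \<forall>\<^sub>F i in F. dist (f i) (x n) \<le> 1 / Suc n" by metis
  have d: "dist (x m) (x n) \<le> 1 / Suc m + 1 / Suc n" for m n
  proof -
    have "\<forall>\<^sub>F i in F. dist (f i) (x m) \<le> 1 / Suc m \<and> dist (f i) (x n) \<le> 1 / Suc n"
      using x[of m] x[of n] by (rule eventually_conj)
    then obtain i where i: "dist (f i) (x m) \<le> 1 / Suc m" "dist (f i) (x n) \<le> 1 / Suc n"
      using eventually_happens'[OF F] by blast
    have "dist (x m) (x n) \<le> dist (f i) (x m) + dist (f i) (x n)" by (rule dist_triangle3)
    then show ?thesis using i by linarith
  qed
  have inv: "\<exists>N. \<forall>n\<ge>N. 1 / Suc n < e" if e: "e > 0" for e :: real
  proof -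
    obtain N where N: "1 / Suc N < e" using reals_Archimedean[OF e] by (auto simp: inverse_eq_divide)
    have "1 / Suc n < e" if "n \<ge> N" for n
    proof -
      have "1 / real (Suc n) \<le> 1 / real (Suc N)" using that by (intro divide_left_mono) auto
      then show ?thesis using N by linarith
    qed
    then show ?thesis by blast
  qed
  have "Cauchy x"
  proof (rule metric_CauchyI)
    fix e :: real assume "0 < e"
    then obtain N where N: "\<And>n. n \<ge> N \<Longrightarrow> 1 / Suc n < e / 2" using inv[of "e / 2"] by auto
    have "dist (x m) (x n) < e" if "m \<ge> N" "n \<ge> N" for m n
      using d[of m n] N[OF that(1)] N[OF that(2)] by linarith
    then show "\<exists>M. \<forall>m\<ge>M. \<forall>n\<ge>M. dist (x m) (x n) < e" by blast
  qed
  then obtain l where l: "x \<longlonglongrightarrow> l" using Cauchy_convergent convergentD by blast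
  have "(f \<longlongrightarrow> l) F"
  proof (rule tendstoI)
    fix e :: real assume e: "0 < e"
    obtain N where N: "\<And>n. n \<ge> N \<Longrightarrow> 1 / Suc n < e / 2" using inv[of "e / 2"] e by auto
    obtain N' where N': "\<And>n. n \<ge> N' \<Longrightarrow> dist (x n) l < e / 2"
      using metric_LIMSEQ_D[OF l, of "e / 2"] e by auto
    define n where "n = max N N'"
    show "\<forall>\<^sub>F i in F. dist (f i) l < e"
      using x[of n]
    proof (rule eventually_mono)
      fix i assume "dist (f i) (x n) \<le> 1 / Suc n"
      then show "dist (f i) l < e"
        using N[of n] N'[of n] dist_triangle[of "f i" l "x n"] by (simp add: n_def)
    qed
  qed
  then show ?thesis by blast
qed

lemma part_sum_orthogonal:
  fixes \<tau> :: "ennreal \<Rightarrow> ennreal set \<Rightarrow> 'a::complex_hilbert"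
  assumes Q: "finite Q" "Q \<subseteq> {0<..<b}" and b: "b > 0"
    and orth: "\<And>f f' a a'. a \<le> f \<Longrightarrow> f \<le> a' \<Longrightarrow> a' \<le> f' \<Longrightarrow> f' \<le> b \<Longrightarrow> f \<in> insert b Q \<Longrightarrow> f' \<in> insert b Q \<Longrightarrow>
      cinner (v f {a<..f}) (v f' {a'<..f'}) = 0"
  shows "(norm (part_sum v b Q))\<^sup>2 = part_sum (\<lambda>q A. (norm (v q A))\<^sup>2) b Q"
  unfolding part_sum_def
proof (rule norm_sum_sq_orthogonal)
  show "finite (insert b Q)" using Q by simp
  have *: "cinner (v f {pred_point Q f<..f}) (v f' {pred_point Q f'<..f'}) = 0"
    if f: "f \<in> insert b Q" "f' \<in> insert b Q" "f < f'" for f f'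
  proof (rule orth[OF _ _ _ _ f(1,2)])
    have pos: "0 < f" "0 < f'" "f' \<le> b" using partition_point[OF Q(2) b] f by auto
    show "pred_point Q f \<le> f" "pred_point Q f' \<le> f'" using pred_point(2)[OF Q(1)] pos by (auto intro: less_imp_le)
    have "f \<in> Q" using f pos by auto
    then show "f \<le> pred_point Q f'" using pred_point(3)[OF Q(1) pos(2)] f(3) by blast
    show "f' \<le> b" by (rule pos)
  qed
  show "cinner (v f {pred_point Q f<..f}) (v f' {pred_point Q f'<..f'}) = 0"
    if f: "f \<in> insert b Q" "f' \<in> insert b Q" "f \<noteq> f'" for f f'
  proof (cases "f < f'")
    case True
    then show ?thesis using * f by blast
  next
    case False
    then have "cinner (v f' {pred_point Q f'<..f'}) (v f {pred_point Q f<..f}) = 0" using * f by simp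
    then show ?thesis by (metis cinner_commute complex_cnj_zero)
  qed
qed

text \<open>After a refinement the terms of the difference of two partition sums are still pairwise
  orthogonal, so the difference is controlled by an additive content of the cells.\<close>

lemma part_sum_converges:
  fixes \<tau> :: "ennreal \<Rightarrow> ennreal set \<Rightarrow> 'a::complex_hilbert"
  assumes b: "b > 0"
    and add: "\<And>q. q \<le> b \<Longrightarrow> interval_additive q (\<tau> q)"
    and orth: "\<And>q q' a c a' c'. a \<le> c \<Longrightarrow> c \<le> a' \<Longrightarrow> a' \<le> c' \<Longrightarrow> c \<le> q \<Longrightarrow> c' \<le> q' \<Longrightarrow> q \<le> b \<Longrightarrow> q' \<le> b \<Longrightarrow>
      cinner (\<tau> q {a<..c}) (\<tau> q' {a'<..c'}) = 0"
    and est: "\<And>e. e > 0 \<Longrightarrow> \<exists>Q0 n. finite Q0 \<and> Q0 \<subseteq> {0<..<b} \<and> interval_additive b n \<and> n {0<..b} \<le> (e::real) \<and>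
      (\<forall>a f c. a < f \<longrightarrow> f \<le> c \<longrightarrow> c \<le> b \<longrightarrow> (\<forall>u\<in>Q0. \<not> (f \<le> u \<and> u < c)) \<longrightarrow>
        (norm (\<tau> c {a<..f} - \<tau> f {a<..f}))\<^sup>2 \<le> n {a<..f})"
  shows "\<exists>l. (part_sum \<tau> b \<longlongrightarrow> l) (finite_subsets_at_top {0<..<b})"
proof (rule complete_convergence_criterion)
  show "finite_subsets_at_top {0<..<b} \<noteq> bot" by simp
  fix e :: real assume e: "e > 0"
  then have "e\<^sup>2 > 0" by simp
  from est[OF this] obtain Q0 n where Q0: "finite Q0" "Q0 \<subseteq> {0<..<b}" and n: "interval_additive b n" "n {0<..b} \<le> e\<^sup>2"
    and bd: "\<And>a f c. a < f \<Longrightarrow> f \<le> c \<Longrightarrow> c \<le> b \<Longrightarrow> (\<forall>u\<in>Q0. \<not> (f \<le> u \<and> u < c)) \<Longrightarrow>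
        (norm (\<tau> c {a<..f} - \<tau> f {a<..f}))\<^sup>2 \<le> n {a<..f}" by blast
  have "dist (part_sum \<tau> b Q) (part_sum \<tau> b Q0) \<le> e" if Q: "finite Q" "Q0 \<subseteq> Q" "Q \<subseteq> {0<..<b}" for Q
  proof -
    define v where "v f A = \<tau> (next_point b Q0 f) A - \<tau> f A" for f A
    have le: "f \<le> b" "0 < f" if "f \<in> insert b Q" for f
      using partition_point[OF Q(3) b that] by auto
    have np: "next_point b Q0 f \<le> b" "f \<le> next_point b Q0 f" if "f \<in> insert b Q" for f
      using next_point(1,2)[OF Q0(1) le(1)[OF that]] partition_point(2)[OF Q0(2) b] by auto
    have "part_sum \<tau> b Q0 = (\<Sum>f\<in>insert b Q. \<tau> (next_point b Q0 f) {pred_point Q f<..f})"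
      by (rule part_sum_refine[OF Q(2,1,3) b add]) (rule partition_point(2)[OF Q0(2) b])
    then have eq: "part_sum \<tau> b Q0 - part_sum \<tau> b Q = part_sum v b Q"
      by (simp add: part_sum_def v_def sum_subtractf)
    have "(norm (part_sum v b Q))\<^sup>2 = part_sum (\<lambda>q A. (norm (v q A))\<^sup>2) b Q"
    proof (rule part_sum_orthogonal[OF Q(1,3) b])
      fix f f' a a' assume f: "a \<le> f" "f \<le> a'" "a' \<le> f'" "f' \<le> b" "f \<in> insert b Q" "f' \<in> insert b Q"
      have fb: "f \<le> b" using f by simp
      note o = orth[OF f(1,2,3)]
      \<comment> \<open>Each difference involves a coarse and a fine right end, so orthogonality of
        the cells is used for all four combinations.\<close>
      show "cinner (v f {a<..f}) (v f' {a'<..f'}) = 0"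
        unfolding v_def cinner_diff_left cinner_diff_right
        using o[OF np(2)[OF f(5)] np(2)[OF f(6)] np(1)[OF f(5)] np(1)[OF f(6)]]
          o[OF np(2)[OF f(5)] order_refl np(1)[OF f(5)] f(4)]
          o[OF order_refl np(2)[OF f(6)] fb np(1)[OF f(6)]]
          o[OF order_refl order_refl fb f(4)] by simp
    qed
    also have "\<dots> \<le> part_sum (\<lambda>_. n) b Q"
      unfolding part_sum_def
    proof (intro sum_mono)
      fix f assume f: "f \<in> insert b Q"
      note f0 = le(2,1)[OF f]
      show "(norm (v f {pred_point Q f<..f}))\<^sup>2 \<le> n {pred_point Q f<..f}"
        unfolding v_def
      proof (rule bd[OF pred_point(2)[OF Q(1) f0(1)] np(2,1)[OF f]])
        show "\<forall>u\<in>Q0. \<not> (f \<le> u \<and> u < next_point b Q0 f)"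
        proof (intro ballI notI)
          fix u assume u: "u \<in> Q0" "f \<le> u \<and> u < next_point b Q0 f"
          then have "next_point b Q0 f \<le> u" using next_point(3)[OF Q0(1) f0(2), of u] by blast
          then show False using u by auto
        qed
      qed
    qed
    also have "\<dots> = n {0<..b}" by (rule interval_additive_part_sum[OF Q(1,3) b n(1)])
    also have "\<dots> \<le> e\<^sup>2" by (rule n)
    finally have "norm (part_sum v b Q) \<le> e" by (rule power2_le_imp_le) (use e in simp)
    then show ?thesis by (simp add: dist_norm norm_minus_commute[of "part_sum \<tau> b Q"] eq)
  qed
  then show "\<exists>x. \<forall>\<^sub>F Q in finite_subsets_at_top {0<..<b}. dist (part_sum \<tau> b Q) x \<le> e"
    unfolding eventually_finite_subsets_at_top using Q0 by blast
qed

section \<open>Finite quantum stop times\<close>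

text \<open>When the terms beyond a partition point \<open>b\<close> vanish, a partition of the
  longer interval may be replaced by its trace on the shorter one. This makes limits over different
  intervals comparable.\<close>

lemma part_sum_initial:
  assumes Q: "finite Q" "Q \<subseteq> {0<..<b'}" and b: "b \<in> insert b' Q" "0 < b'"
    and z: "\<And>q. q \<in> insert b' Q \<Longrightarrow> b < q \<Longrightarrow> v q {pred_point Q q<..q} = 0"
  shows "part_sum v b' Q = part_sum v b (Q \<inter> {0<..<b})"
proof -
  let ?R = "Q \<inter> {0<..<b}"
  have bb: "0 < b" "b \<le> b'" using partition_point[OF Q(2) b(2,1)] by auto
  have set: "insert b ?R = {q \<in> insert b' Q. q \<le> b}"
    using b Q bb by (auto simp: less_le)
  have p: "pred_point ?R q = pred_point Q q" if "q \<in> insert b ?R" for q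
  proof (rule pred_point_eqI)
    have q: "0 < q" "q \<le> b" using that bb by auto
    note pp = pred_point[OF Q(1) q(1)]
    show "finite ?R" using Q by simp
    have "pred_point Q q < b" using pp(2) q(2) by (rule less_le_trans)
    then show "pred_point Q q \<in> insert 0 ?R" using pp(1) Q(2) by auto
    show "pred_point Q q < q" by (rule pp)
    show "s \<le> pred_point Q q" if "s \<in> ?R" "s < q" for s using pp(3) that by auto
  qed
  have "part_sum v b ?R = (\<Sum>q\<in>insert b ?R. v q {pred_point Q q<..q})"
    unfolding part_sum_def by (intro sum.cong refl) (simp only: p)
  also have "\<dots> = (\<Sum>q\<in>insert b' Q. v q {pred_point Q q<..q})"
    unfolding set
  proof (rule sum.mono_neutral_left)
    show "\<forall>q\<in>insert b' Q - {q \<in> insert b' Q. q \<le> b}. v q {pred_point Q q<..q} = 0"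
    proof
      fix q assume "q \<in> insert b' Q - {q \<in> insert b' Q. q \<le> b}"
      then have "q \<in> insert b' Q" "b < q" by (auto simp: not_le)
      then show "v q {pred_point Q q<..q} = 0" by (rule z)
    qed
  qed (use Q in auto)
  finally show ?thesis by (simp add: part_sum_def)
qed

lemma filterlim_Int_partition:
  assumes "b \<le> b'"
  shows "filterlim (\<lambda>Q. Q \<inter> {0<..<b}) (finite_subsets_at_top {0<..<b}) (finite_subsets_at_top {0<..<b'::ennreal})"
  unfolding filterlim_def le_filter_def eventually_filtermap
proof (intro allI impI)
  fix P assume "eventually P (finite_subsets_at_top {0<..<b})"
  then obtain X where X: "finite X" "X \<subseteq> {0<..<b}" "\<forall>Y. finite Y \<and> X \<subseteq> Y \<and> Y \<subseteq> {0<..<b} \<longrightarrow> P Y"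
    unfolding eventually_finite_subsets_at_top by (elim exE conjE) (rule that, assumption+)
  have sub: "{0<..<b} \<subseteq> {0<..<b'}" using assms by auto
  show "\<forall>\<^sub>F Q in finite_subsets_at_top {0<..<b'}. P (Q \<inter> {0<..<b})"
    unfolding eventually_finite_subsets_at_top
  proof (intro exI[of _ X] conjI allI impI)
    fix Y assume Y: "finite Y \<and> X \<subseteq> Y \<and> Y \<subseteq> {0<..<b'}"
    show "P (Y \<inter> {0<..<b})" by (rule X(3)[rule_format]) (use Y X in auto)
  qed (use X sub in auto)
qed

lemma eventually_partition:
  "\<forall>\<^sub>F Q in finite_subsets_at_top {0<..<b}. finite Q \<and> Q \<subseteq> {0<..<b::ennreal}"
  unfolding eventually_finite_subsets_at_top by blast

lemma eventually_partition_mem: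
  assumes "0 < c" "c \<le> b"
  shows "\<forall>\<^sub>F Q in finite_subsets_at_top {0<..<b::ennreal}. finite Q \<and> Q \<subseteq> {0<..<b} \<and> c \<in> insert b Q"
proof (cases "c = b")
  case True
  then show ?thesis using eventually_partition[of b] by (auto elim: eventually_mono)
next
  case False
  then have "c < b" using assms by simp
  then show ?thesis
    unfolding eventually_finite_subsets_at_top using assms by (intro exI[of _ "{c}"]) auto
qed

lemma bounded_clinear_limit:
  fixes T :: "'i \<Rightarrow> 'a::complex_hilbert \<Rightarrow> 'b::complex_hilbert"
  assumes F: "F \<noteq> bot" and T: "\<And>i. bounded_clinear (T i)" "\<forall>\<^sub>F i in F. \<forall>x. norm (T i x) \<le> C * norm x"
    and U: "\<And>x. ((\<lambda>i. T i x) \<longlongrightarrow> U x) F"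
  shows "bounded_clinear U" "norm (U x) \<le> C * norm x"
proof -
  show bd: "norm (U x) \<le> C * norm x" for x
    by (rule tendsto_upperbound[OF tendsto_norm[OF U]]) (use T(2) F in \<open>auto elim: eventually_mono\<close>)
  show "bounded_clinear U"
  proof (rule bounded_clinearI[OF _ _ bd])
    show "U (x + y) = U x + U y" for x y
      using tendsto_unique[OF F U[of "x + y"]] tendsto_add[OF U[of x] U[of y]]
      by (simp add: bounded_clinear_add[OF T(1)])
    show "U (c *\<^sub>C x) = c *\<^sub>C U x" for c x
      using tendsto_unique[OF F U[of "c *\<^sub>C x"]] tendsto_scaleC[OF tendsto_const[of c] U[of x]]
      by (simp add: bounded_clinear_scaleC[OF T(1)])
  qed
qed

lemma limit_exists_on_total:
  fixes T :: "'i \<Rightarrow> 'a::complex_hilbert \<Rightarrow> 'b::complex_hilbert"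
  assumes F: "F \<noteq> bot" and T: "\<And>i. bounded_clinear (T i)" "\<forall>\<^sub>F i in F. \<forall>x. norm (T i x) \<le> C * norm x"
    and B: "closure (cspan B) = UNIV" "\<And>b. b \<in> B \<Longrightarrow> \<exists>l. ((\<lambda>i. T i b) \<longlongrightarrow> l) F"
  shows "\<exists>l. ((\<lambda>i. T i x) \<longlongrightarrow> l) F"
proof -
  let ?S = "{x. \<exists>l. ((\<lambda>i. T i x) \<longlongrightarrow> l) F}"
  have sub: "csubspace ?S"
  proof (rule complex_hilbert.subspaceI)
    show "0 \<in> ?S" using T(1) by (auto intro!: exI[of _ 0])
    show "x + y \<in> ?S" if "x \<in> ?S" "y \<in> ?S" for x y
    proof -
      from that obtain l l' where "((\<lambda>i. T i x) \<longlongrightarrow> l) F" "((\<lambda>i. T i y) \<longlongrightarrow> l') F" by blast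
      from tendsto_add[OF this] show ?thesis by (auto simp: bounded_clinear_add[OF T(1)])
    qed
    show "c *\<^sub>C x \<in> ?S" if "x \<in> ?S" for c x
    proof -
      from that obtain l where "((\<lambda>i. T i x) \<longlongrightarrow> l) F" by blast
      from tendsto_scaleC[OF tendsto_const[of c] this] show ?thesis by (auto simp: bounded_clinear_scaleC[OF T(1)])
    qed
  qed
  have "closure ?S \<subseteq> ?S"
  proof
    fix x assume x: "x \<in> closure ?S"
    have "\<exists>l. ((\<lambda>i. T i x) \<longlongrightarrow> l) F"
    proof (rule complete_convergence_criterion[OF F])
      fix e :: real assume e: "e > 0"
      define r where "r = e / (2 * (\<bar>C\<bar> + 1))"
      have r: "r > 0" "(\<bar>C\<bar> + 1) * r = e / 2" using e by (auto simp: r_def field_simps add_nonneg_pos)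
      obtain y where y: "y \<in> ?S" "dist y x < r" using x r(1) unfolding closure_approachable by blast
      then obtain l where l: "((\<lambda>i. T i y) \<longlongrightarrow> l) F" by blast
      have "\<forall>\<^sub>F i in F. dist (T i y) l < e / 2" using l e by (intro tendstoD) auto
      then have "\<forall>\<^sub>F i in F. dist (T i x) l \<le> e"
        using T(2)
      proof (rule eventually_elim2)
        fix i assume i: "dist (T i y) l < e / 2" "\<forall>x. norm (T i x) \<le> C * norm x"
        have "dist (T i x) (T i y) = norm (T i (x - y))" by (simp add: dist_norm bounded_clinear_diff[OF T(1)])
        also have "\<dots> \<le> C * norm (x - y)" using i(2) by blast
        also have "\<dots> \<le> (\<bar>C\<bar> + 1) * norm (x - y)" by (intro mult_right_mono) auto
        also have "\<dots> \<le> (\<bar>C\<bar> + 1) * r" using y(2) by (intro mult_left_mono) (auto simp: dist_norm norm_minus_commute)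
        finally have "dist (T i x) (T i y) \<le> e / 2" using r by simp
        then show "dist (T i x) l \<le> e" using i(1) dist_triangle[of "T i x" l "T i y"] by linarith
      qed
      then show "\<exists>l. \<forall>\<^sub>F i in F. dist (T i x) l \<le> e" by blast
    qed
    then show "x \<in> ?S" by simp
  qed
  then have "closed ?S" using closure_subset_eq by blast
  then have "closure (cspan B) \<subseteq> ?S" using sub B(2) by (intro closure_cspan_subset) auto
  then show ?thesis using B(1) by auto
qed

lemma ennreal_cases_lt_top:
  assumes "q < (\<infinity>::ennreal)" shows "ennreal (enn2real q) = q" "enn2real q \<ge> 0"
  using assms by (auto simp: ennreal_enn2real)

text \<open>That no mesh point lies in \<open>[f,c)\<close> is the situation of a fine point
  \<open>f\<close> and the end \<open>c\<close> of its coarse cell. A grid of spacing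
  \<open>d / 2\<close> meets every such interval of length at least \<open>d\<close>, so only
  shorter ones remain.\<close>

lemma mesh_exists:
  assumes d: "d > 0" and b: "0 < b" "b < \<infinity>"
  obtains Q0 where "finite Q0" "Q0 \<subseteq> {0<..<b}"
    "\<forall>f c. 0 < f \<longrightarrow> f \<le> c \<longrightarrow> c \<le> b \<longrightarrow> (\<forall>u\<in>Q0. \<not> (f \<le> u \<and> u < c)) \<longrightarrow> enn2real c - enn2real f < d"
proof -
  define T where "T = enn2real b"
  have T: "b = ennreal T" "T > 0" using b by (auto simp: T_def ennreal_enn2real enn2real_positive_iff)
  define Q0 where "Q0 = (\<lambda>k. ennreal (real k * (d / 2))) ` {..nat \<lceil>T / (d / 2)\<rceil>} \<inter> {0<..<b}"
  have "enn2real c - enn2real f < d"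
    if f: "0 < f" "f \<le> c" "c \<le> b" and no: "\<forall>u\<in>Q0. \<not> (f \<le> u \<and> u < c)" for f c
  proof (rule ccontr)
    assume "\<not> enn2real c - enn2real f < d"
    then have cf: "enn2real f + d \<le> enn2real c" by simp
    have fin: "c < \<infinity>" "f < \<infinity>" using f b by (auto intro: le_less_trans)
    define r r' where "r = enn2real f" and "r' = enn2real c"
    have fr: "f = ennreal r" "c = ennreal r'" using fin by (auto simp: r_def r'_def ennreal_enn2real)
    have r: "r > 0" using f(1) fin by (simp add: r_def enn2real_positive_iff less_top)
    have r': "r' \<le> T" unfolding r'_def T_def by (rule enn2real_mono) (use f(3) b in auto)
    \<comment> \<open>The first grid point not before \<open>r\<close>; it lies less than
      \<open>d / 2\<close> beyond \<open>r\<close> and therefore before \<open>r'\<close>.\<close>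
    define k where "k = nat \<lceil>r / (d / 2)\<rceil>"
    have "r / (d / 2) > 0" using r d by simp
    then have k: "r / (d / 2) \<le> real k" "real k < r / (d / 2) + 1" unfolding k_def by linarith+
    have k': "r \<le> real k * (d / 2)" "real k * (d / 2) < r + d / 2"
      using k d by (simp_all add: field_simps)
    have kT: "real k * (d / 2) < r'" using k'(2) cf d by (simp add: r_def r'_def)
    then have "real k * (d / 2) < T" using r' by linarith
    then have "real k < T / (d / 2)" using d by (simp add: field_simps)
    then have "k \<le> nat \<lceil>T / (d / 2)\<rceil>" by linarith
    moreover have "ennreal (real k * (d / 2)) \<in> {0<..<b}"
      using k'(1) r \<open>real k * (d / 2) < T\<close> T by (auto simp: ennreal_less_iff)
    ultimately have "ennreal (real k * (d / 2)) \<in> Q0" unfolding Q0_def by blast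
    moreover have "f \<le> ennreal (real k * (d / 2))" "ennreal (real k * (d / 2)) < c"
      using k'(1) kT r by (auto simp: fr ennreal_less_iff intro: ennreal_leI)
    ultimately show False using no by blast
  qed
  then show ?thesis by (intro that[of Q0]) (auto simp: Q0_def)
qed

locale stop_time = fock ex
  for ex :: "(real \<Rightarrow> 'k::complex_hilbert) \<Rightarrow> 'f::complex_hilbert" +
  fixes S :: "ennreal set \<Rightarrow> 'f \<Rightarrow> 'f"
  assumes stop: "finite_quantum_stop_time ex S"
begin

lemma S_proj: "A \<in> sets borel \<Longrightarrow> orth_projection (S A)"
  using stop by (simp add: finite_quantum_stop_time_def)

lemma S_bops: "A \<in> sets borel \<Longrightarrow> S A \<in> bops"
  by (rule orth_projectionD(1)[OF S_proj])

lemma S_sums: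
  "range A \<subseteq> sets borel \<Longrightarrow> disjoint_family A \<Longrightarrow> (\<lambda>n. cinner x (S (A n) y)) sums cinner x (S (\<Union>n. A n) y)"
  using stop by (simp add: finite_quantum_stop_time_def)

lemma S_UNIV: "S UNIV = id" and S_0: "S {0} = (\<lambda>_. 0)" and S_inf: "S {\<infinity>} = (\<lambda>_. 0)"
  using stop by (simp_all add: finite_quantum_stop_time_def)

text \<open>Countable additivity applied to empty sets yields a convergent series with constant
  terms, which must be zero.\<close>

lemma S_empty: "S {} x = 0"
proof (rule eq_0_if_cinner_eq_0)
  fix y
  have "(\<lambda>n::nat. cinner y (S {} x)) sums cinner y (S (\<Union>n::nat. {}) x)"
    by (rule S_sums) (auto simp: disjoint_family_on_def)
  then have "(\<lambda>n::nat. cinner y (S {} x)) \<longlonglongrightarrow> 0" by (intro summable_LIMSEQ_zero sums_summable)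
  then show "cinner y (S {} x) = 0" by (simp add: LIMSEQ_const_iff)
qed

lemma S_Un:
  assumes "A \<in> sets borel" "B \<in> sets borel" "A \<inter> B = {}"
  shows "S (A \<union> B) x = S A x + S B x"
proof (rule eq_if_cinner_eq)
  fix y
  define C where "C n = (if n = (0::nat) then A else if n = 1 then B else {})" for n
  have U: "(\<Union>n. C n) = A \<union> B" by (auto simp: C_def split: if_splits)
  have "(\<lambda>n. cinner y (S (C n) x)) sums cinner y (S (\<Union>n. C n) x)"
    by (rule S_sums) (use assms in \<open>auto simp: C_def disjoint_family_on_def\<close>)
  moreover have "(\<lambda>n. cinner y (S (C n) x)) sums (\<Sum>n\<in>{0,1}. cinner y (S (C n) x))"
    by (rule sums_finite) (auto simp: C_def S_empty)
  ultimately have "cinner y (S (A \<union> B) x) = (\<Sum>n\<in>{0,1}. cinner y (S (C n) x))"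
    unfolding U by (rule sums_unique2)
  then show "cinner y (S (A \<union> B) x) = cinner y (S A x + S B x)"
    by (simp add: C_def cinner_add_right)
qed

text \<open>Additivity makes \<open>S A + S B\<close> a projection, hence a contraction. Applied to
  a vector fixed by \<open>S B\<close>, it leaves no room for a component in the range of
  \<open>S A\<close>.\<close>

lemma S_disjoint:
  assumes "A \<in> sets borel" "B \<in> sets borel" "A \<inter> B = {}"
  shows "S A (S B x) = 0"
proof -
  let ?y = "S B x"
  have AB: "A \<union> B \<in> sets borel" using assms by auto
  have y: "S B ?y = ?y" by (rule orth_projectionD(2)[OF S_proj[OF assms(2)]])
  have R: "S (A \<union> B) ?y = S A ?y + ?y" using S_Un[OF assms, of ?y] y by simp
  have "cinner ?y (S (A \<union> B) ?y) = cinner (S (A \<union> B) ?y) (S (A \<union> B) ?y)"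
    by (simp add: orth_projectionD(4)[OF S_proj[OF AB]])
  then have "Re (cinner ?y (S (A \<union> B) ?y)) = (norm (S (A \<union> B) ?y))\<^sup>2" by (simp add: norm_sq_cinner)
  also have "\<dots> \<le> (norm ?y)\<^sup>2" by (intro power_mono orth_projectionD(5)[OF S_proj[OF AB]]) auto
  finally have "Re (cinner ?y (S A ?y)) + Re (cinner ?y ?y) \<le> (norm ?y)\<^sup>2" by (simp add: R cinner_add_right)
  then have "Re (cinner ?y (S A ?y)) \<le> 0" by (simp add: norm_sq_cinner)
  moreover have "cinner ?y (S A ?y) = cinner (S A ?y) (S A ?y)"
    by (simp add: orth_projectionD(4)[OF S_proj[OF assms(1)]])
  ultimately have "(norm (S A ?y))\<^sup>2 \<le> 0" by (simp add: norm_sq_cinner)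
  then show ?thesis by simp
qed

lemma S_subset:
  assumes "A \<in> sets borel" "B \<in> sets borel" "A \<subseteq> B"
  shows "S B (S A x) = S A x" "S A (S B x) = S A x"
proof -
  have B: "B = A \<union> (B - A)" using assms by auto
  have d: "S A (S (B - A) x) = 0" "S (B - A) (S A x) = 0" using assms by (auto intro!: S_disjoint)
  have e: "S B y = S A y + S (B - A) y" for y
    by (subst B, rule S_Un) (use assms in auto)
  show "S B (S A x) = S A x" using d by (simp add: e orth_projectionD(2)[OF S_proj[OF assms(1)]])
  show "S A (S B x) = S A x"
    using d by (simp add: e bounded_clinear_add[OF bopsD[OF S_bops[OF assms(1)]]] orth_projectionD(2)[OF S_proj[OF assms(1)]])
qed

lemma S_additive: "interval_additive b (\<lambda>A. S A x)"
  unfolding interval_additive_def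
proof (intro allI impI)
  fix a c d :: ennreal assume "a \<le> c" "c \<le> d"
  then have "{a<..d} = {a<..c} \<union> {c<..d}" by auto
  then show "S {a<..d} x = S {a<..c} x + S {c<..d} x" using S_Un[of "{a<..c}" "{c<..d}" x] by auto
qed

lemma S_norm_additive: "interval_additive b (\<lambda>A. r * (norm (S A x))\<^sup>2)"
  unfolding interval_additive_def
proof (intro allI impI)
  fix a c d :: ennreal assume "a \<le> c" "c \<le> d" "d \<le> b"
  then have e: "S {a<..d} x = S {a<..c} x + S {c<..d} x"
    using S_additive[of b x] unfolding interval_additive_def by blast
  have "cinner (S {a<..c} x) (S {c<..d} x) = cinner x (S {a<..c} (S {c<..d} x))"
    by (rule orth_projectionD(3)[OF S_proj]) simp
  also have "\<dots> = 0" by (subst S_disjoint) auto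
  finally show "r * (norm (S {a<..d} x))\<^sup>2 = r * (norm (S {a<..c} x))\<^sup>2 + r * (norm (S {c<..d} x))\<^sup>2"
    by (simp add: e norm_add_sq distrib_left)
qed

lemma norm_S: "A \<in> sets borel \<Longrightarrow> norm (S A x) \<le> norm x"
  by (rule orth_projectionD(5)[OF S_proj])

lemma S_atMost_diff:
  assumes "a \<le> c" shows "S {a<..c} x = S {..c} x - S {..a} x"
proof -
  have "{..c} = {..a} \<union> {a<..c}" using assms by auto
  moreover have "{..a} \<inter> {a<..c} = {}" by auto
  ultimately have "S {..c} x = S {..a} x + S {a<..c} x" using S_Un[of "{..a}" "{a<..c}" x] by simp
  then show ?thesis by simp
qed

lemma S_atMost_0: "S {..0} x = 0"
proof -
  have "{..0::ennreal} = {0}" by auto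
  then show ?thesis by (simp add: S_0)
qed

lemma S_from_0: "S {0<..c} x = S {..c} x"
  using S_atMost_diff[of 0 c x] by (simp add: S_atMost_0)

lemma S_to_infinity: "S {0<..\<infinity>} x = x"
proof -
  have "{..\<infinity>::ennreal} = UNIV" by auto
  then show ?thesis by (simp add: S_from_0 S_UNIV)
qed

lemma S_scalar_at:
  assumes "t \<ge> 0" shows "scalar_at t (S {..ennreal t})"
proof (cases "t = 0")
  case True
  have "S {..ennreal t} = (\<lambda>_. 0)" using True by (simp add: fun_eq_iff S_atMost_0)
  then show ?thesis by (auto simp: scalar_at_def intro!: exI[of _ 0])
next
  case False
  then have t: "t > 0" using assms by simp
  then obtain X where "X \<in> bops_on (fock_on ex {0..<t})"
    "S {..ennreal t} = fock_optensor ex t X (ident_on (fock_on ex {t..}))"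
    using stop unfolding finite_quantum_stop_time_def by blast
  then show ?thesis using scalar_at_fock_optensor[of X t] assms by simp
qed

lemma S_cell_scalar_at:
  assumes "a \<le> c" "c < \<infinity>"
  shows "scalar_at (enn2real c) (S {a<..c})"
proof -
  have a: "a < \<infinity>" using assms by (rule le_less_trans)
  have "scalar_at (enn2real c) (\<lambda>x. S {..c} x - S {..a} x)"
  proof (rule scalar_at_diff)
    show "scalar_at (enn2real c) (S {..c})"
      using S_scalar_at[of "enn2real c"] ennreal_cases_lt_top[OF assms(2)] by simp
    have "scalar_at (enn2real a) (S {..a})"
      using S_scalar_at[of "enn2real a"] ennreal_cases_lt_top[OF a] by simp
    then show "scalar_at (enn2real c) (S {..a})"
      by (rule scalar_at_mono) (use assms in \<open>auto intro: enn2real_mono\<close>)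
  qed simp
  moreover have "(\<lambda>x. S {..c} x - S {..a} x) = S {a<..c}" by (rule ext) (rule S_atMost_diff[OF assms(1), symmetric])
  ultimately show ?thesis by simp
qed

text \<open>Weak countable additivity gives convergence of the quadratic form along the integers,
  and for projections this is convergence in norm. Nothing is lost in the limit because neither 0
  nor \<open>\<infinity>\<close> carries mass.\<close>

lemma S_tendsto: "((\<lambda>T. S {0<..ennreal T} x) \<longlongrightarrow> x) at_top"
proof -
  \<comment> \<open>Index 0 collects the two null points, so that the partial sum through index
    \<open>n\<close> is the projection of \<open>(0,n]\<close>.\<close>
  define A where "A n = (if n = (0::nat) then {0, \<infinity>} else {ennreal (real (n - 1))<..ennreal (real n)})" for n
  have disj: "disjoint_family A"
    unfolding disjoint_family_on_def
  proof (intro ballI impI)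
    have *: "A m \<inter> A n = {}" if "m < n" for m n
    proof (cases "m = 0")
      case True
      show ?thesis using True that by (auto simp: A_def top_unique)
    next
      case False
      have "ennreal (real m) \<le> ennreal (real (n - 1))" using that by (intro ennreal_leI) auto
      then show ?thesis using False that by (auto simp: A_def)
    qed
    fix m n :: nat assume "m \<noteq> n"
    then show "A m \<inter> A n = {}" using *[of m n] *[of n m] by (cases "m < n") auto
  qed
  have U: "(\<Union>n. A n) = UNIV"
  proof -
    have "u \<in> (\<Union>n. A n)" for u
    proof (cases "u = 0 \<or> u = \<infinity>")
      case True
      then have "u \<in> A 0" by (auto simp: A_def)
      then show ?thesis by blast
    next
      case False
      define r where "r = enn2real u"
      have u: "u = ennreal r" "r > 0" using False by (auto simp: r_def ennreal_enn2real less_top enn2real_positive_iff zero_less_iff_neq_zero)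
      define n where "n = nat \<lceil>r\<rceil>"
      have n: "r \<le> real n" "real n < r + 1" "n > 0" using u(2) unfolding n_def by linarith+
      have "real (n - 1) < r" using n by linarith
      then have "u \<in> A n" using n u by (auto simp: A_def ennreal_less_iff intro: ennreal_leI)
      then show ?thesis by blast
    qed
    then show ?thesis by blast
  qed
  have meas: "range A \<subseteq> sets borel" by (auto simp: A_def)
  have "S {0, \<infinity>} y = 0" for y
    using S_Un[of "{0}" "{\<infinity>}" y] by (simp add: S_0 S_inf S_inf[unfolded infinity_ennreal_def] insert_commute)
  then have A0: "S (A 0) y = 0" for y by (simp add: A_def)
  have part: "(\<Sum>k<Suc n. S (A k) x) = S {0<..ennreal (real n)} x" for n
  proof (induction n)
    case 0
    then show ?case by (simp add: A0 S_empty)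
  next
    case (Suc n)
    have "S {0<..ennreal (real (Suc n))} x = S {0<..ennreal (real n)} x + S {ennreal (real n)<..ennreal (real (Suc n))} x"
      using S_additive[of "\<infinity>" x] unfolding interval_additive_def by (auto intro!: ennreal_leI simp del: of_nat_Suc)
    then show ?case using Suc by (simp add: A_def del: of_nat_Suc)
  qed
  have "(\<lambda>n. cinner x (S (A n) x)) sums cinner x x"
    using S_sums[OF meas disj, of x x] by (simp add: U S_UNIV)
  then have "(\<lambda>n. \<Sum>k<Suc n. cinner x (S (A k) x)) \<longlonglongrightarrow> cinner x x"
    unfolding sums_def by (rule LIMSEQ_Suc)
  then have lim: "(\<lambda>n. cinner x (S {0<..ennreal (real n)} x)) \<longlonglongrightarrow> cinner x x"
    by (simp only: cinner_sum_right[symmetric] part)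
  have nrm: "(norm (x - S {0<..c} x))\<^sup>2 = Re (cinner x x) - Re (cinner x (S {0<..c} x))" for c
  proof -
    have "(norm (S {0<..c} x))\<^sup>2 = Re (cinner x (S {0<..c} x))"
      using orth_projectionD(4)[OF S_proj[of "{0<..c}"], of x x] by (simp add: norm_sq_cinner)
    then show ?thesis unfolding norm_diff_sq norm_sq_cinner[of x] by linarith
  qed
  have "(\<lambda>n. Re (cinner x x) - Re (cinner x (S {0<..ennreal (real n)} x))) \<longlonglongrightarrow> Re (cinner x x) - Re (cinner x x)"
    by (rule tendsto_diff[OF tendsto_const tendsto_Re[OF lim]])
  then have lim0: "(\<lambda>n. (norm (x - S {0<..ennreal (real n)} x))\<^sup>2) \<longlonglongrightarrow> 0" by (simp only: nrm diff_self)
  show ?thesis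
  proof (rule tendstoI)
    fix e :: real assume e: "0 < e"
    have "\<forall>\<^sub>F n in sequentially. (norm (x - S {0<..ennreal (real n)} x))\<^sup>2 < e\<^sup>2"
      by (rule order_tendstoD(2)[OF lim0]) (use e in simp)
    then obtain n where n: "(norm (x - S {0<..ennreal (real n)} x))\<^sup>2 < e\<^sup>2" using eventually_happens by force
    show "\<forall>\<^sub>F T in at_top. dist (S {0<..ennreal T} x) x < e"
      using eventually_ge_at_top[of "real n"]
    proof (rule eventually_mono)
      fix T :: real assume "real n \<le> T"
      then have "ennreal (real n) \<le> ennreal T" by (rule ennreal_leI)
      then have sub: "{0<..ennreal (real n)} \<subseteq> {0<..ennreal T}" by (auto intro: order_trans)
      let ?A = "{0<..ennreal (real n)}" and ?B = "{0<..ennreal T}"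
      \<comment> \<open>Passage from an integer to all larger times: the remainder beyond
        \<open>T\<close> is the image of the remainder beyond \<open>n\<close> under a complementary
        projection.\<close>
      have "x - S ?B x = (x - S ?A x) - S ?B (x - S ?A x)"
        using S_subset(1)[OF _ _ sub, of x] by (simp add: bounded_clinear_diff[OF bopsD[OF S_bops]])
      moreover have "norm (y - S ?B y) \<le> norm y" for y
      proof -
        have "cinner (S ?B y) (y - S ?B y) = 0"
          by (simp add: orth_projectionD(3)[OF S_proj] cinner_diff_right bounded_clinear_diff[OF bopsD[OF S_bops]]
              orth_projectionD(2)[OF S_proj])
        then have "(norm (S ?B y + (y - S ?B y)))\<^sup>2 = (norm (S ?B y))\<^sup>2 + (norm (y - S ?B y))\<^sup>2"
          by (simp only: norm_add_sq) simp
        then have "(norm (y - S ?B y))\<^sup>2 \<le> (norm y)\<^sup>2" by simp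
        then show ?thesis by (rule power2_le_imp_le) simp
      qed
      ultimately have "norm (x - S ?B x) \<le> norm (x - S ?A x)" by metis
      also have "\<dots> < e" using n e by (rule_tac power2_less_imp_less) auto
      finally show "dist (S ?B x) x < e" by (simp add: dist_norm norm_minus_commute)
    qed
  qed
qed

text \<open>The scalar is read off at the vacuum, where it is visibly a squared norm. Evaluating it
  again at \<open>ex (left_shift ?t g)\<close>, which \<open>j\<close> maps to \<open>ex g\<close>,
  bounds it by the content of the cell, because exponential vectors have norm at least 1.\<close>

lemma cell_scalar:
  assumes ac: "a \<le> c" "c < \<infinity>" and g: "g \<in> L2 {0..}"
  obtains \<alpha> :: real where "0 \<le> \<alpha>" "\<alpha> \<le> (norm (S {a<..c} (ex g)))\<^sup>2"
    "\<And>u v. cinner (j (enn2real c) g u) (S {a<..c} (j (enn2real c) g v)) = complex_of_real \<alpha> * cinner u v"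
proof -
  let ?t = "enn2real c" and ?P = "S {a<..c}"
  note P = orth_projectionD[OF S_proj, of "{a<..c}"]
  have t: "?t \<ge> 0" by simp
  obtain a' where a': "\<And>u v. cinner (j ?t g u) (?P (j ?t g v)) = a' * cinner u v"
    using scalar_atE[OF S_cell_scalar_at[OF ac] g g] by blast
  define \<alpha> where "\<alpha> = (norm (?P (j ?t g vac)))\<^sup>2"
  have "complex_of_real \<alpha> = cinner (?P (j ?t g vac)) (?P (j ?t g vac))" by (simp only: \<alpha>_def cinner_same)
  also have "\<dots> = a' * cinner vac vac" by (simp add: P(4) a')
  finally have \<alpha>: "a' = complex_of_real \<alpha>" by (simp add: vac_inner L2_zero)
  have ls: "left_shift ?t g \<in> L2 {0..}" by (rule left_shift_L2[OF g])
  have "cinner (ex g) (?P (ex g)) = complex_of_real \<alpha> * cinner (ex (left_shift ?t g)) (ex (left_shift ?t g))"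
    using a'[of "ex (left_shift ?t g)" "ex (left_shift ?t g)"] j_left_shift[OF g t] \<alpha> by simp
  moreover have "cinner (?P (ex g)) (?P (ex g)) = cinner (ex g) (?P (ex g))" by (simp add: P(4))
  ultimately have e: "(norm (?P (ex g)))\<^sup>2 = \<alpha> * (norm (ex (left_shift ?t g)))\<^sup>2"
    by (simp add: norm_sq_cinner)
  have "(norm (ex (left_shift ?t g)))\<^sup>2 = exp (LINT r|lborel. (norm (left_shift ?t g r))\<^sup>2)"
    using ls by (simp add: norm_sq_cinner ex_inner L2_inner_same exp_of_real)
  also have "\<dots> \<ge> 1" by (simp add: integral_nonneg_AE)
  finally have "1 \<le> (norm (ex (left_shift ?t g)))\<^sup>2" .
  then have "\<alpha> \<le> (norm (?P (ex g)))\<^sup>2"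
    unfolding e using mult_left_mono[of 1 _ \<alpha>] by (simp add: \<alpha>_def)
  then show ?thesis using that[of \<alpha>] a' \<alpha> by (simp add: \<alpha>_def)
qed

text \<open>The basic estimate: an arbitrary future vector \<open>u\<close> is controlled by the
  additive content \<open>(norm (S A (ex g)))\<^sup>2\<close> of the cell, and these contents sum to
  at most \<open>(norm (ex g))\<^sup>2\<close> over a partition.\<close>

lemma cell_bound:
  assumes "a \<le> c" "c < \<infinity>" and g: "g \<in> L2 {0..}"
  shows "(norm (S {a<..c} (j (enn2real c) g u)))\<^sup>2 \<le> (norm (S {a<..c} (ex g)))\<^sup>2 * (norm u)\<^sup>2"
proof -
  obtain \<alpha> :: real where \<alpha>: "0 \<le> \<alpha>" "\<alpha> \<le> (norm (S {a<..c} (ex g)))\<^sup>2"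
    "\<And>u v. cinner (j (enn2real c) g u) (S {a<..c} (j (enn2real c) g v)) = complex_of_real \<alpha> * cinner u v"
    using cell_scalar[OF assms] by blast
  have "(norm (S {a<..c} (j (enn2real c) g u)))\<^sup>2 = \<alpha> * (norm u)\<^sup>2"
    by (simp add: norm_sq_cinner orth_projectionD(4)[OF S_proj] \<alpha>(3))
  also have "\<dots> \<le> (norm (S {a<..c} (ex g)))\<^sup>2 * (norm u)\<^sup>2" by (intro mult_right_mono \<alpha>) auto
  finally show ?thesis .
qed

section \<open>Embeddings along a stop time: partition sums, their limits and totality\<close>

definition jsum :: "(real \<Rightarrow> 'k) \<Rightarrow> ennreal \<Rightarrow> ennreal set \<Rightarrow> 'f \<Rightarrow> 'f" where
  "jsum g b Q y = part_sum (\<lambda>q A. S A (j (enn2real q) g y)) b Q"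

lemma jsum_bops:
  assumes "g \<in> L2 {0..}" shows "jsum g b Q \<in> bops"
proof -
  have "(\<lambda>y. S A (j (enn2real q) g y)) \<in> bops" if "A \<in> sets borel" for A q
    using bops_comp[OF S_bops[OF that] j_bops[OF assms, of "enn2real q"]] by (simp add: o_def)
  then have "(\<lambda>y. part_sum (\<lambda>q A. S A (j (enn2real q) g y)) b Q) \<in> bops"
    unfolding part_sum_def by (intro bops_sum) auto
  then show ?thesis by (simp add: jsum_def[abs_def])
qed

lemma S_cells_orthogonal:
  assumes "c \<le> a'" shows "cinner (S {a<..c} x) (S {a'<..c'} y) = 0"
proof -
  have "cinner (S {a<..c} x) (S {a'<..c'} y) = cinner x (S {a<..c} (S {a'<..c'} y))"
    by (rule orth_projectionD(3)[OF S_proj]) simp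
  also have "\<dots> = 0" using assms by (subst S_disjoint) auto
  finally show ?thesis .
qed

lemma norm_jsum:
  assumes g: "g \<in> L2 {0..}" and b: "0 < b" "b < \<infinity>" and Q: "finite Q" "Q \<subseteq> {0<..<b}"
  shows "norm (jsum g b Q u) \<le> norm (ex g) * norm u"
proof -
  have "(norm (jsum g b Q u))\<^sup>2 = part_sum (\<lambda>q A. (norm (S A (j (enn2real q) g u)))\<^sup>2) b Q"
    unfolding jsum_def by (rule part_sum_orthogonal[OF Q b(1)]) (rule S_cells_orthogonal)
  also have "\<dots> \<le> part_sum (\<lambda>q A. (norm u)\<^sup>2 * (norm (S A (ex g)))\<^sup>2) b Q"
    unfolding part_sum_def
  proof (rule sum_mono)
    fix q assume q: "q \<in> insert b Q"
    have q': "0 < q" "q < \<infinity>" using partition_point[OF Q(2) b(1) q] b(2) by (auto intro: le_less_trans)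
    show "(norm (S {pred_point Q q<..q} (j (enn2real q) g u)))\<^sup>2 \<le> (norm u)\<^sup>2 * (norm (S {pred_point Q q<..q} (ex g)))\<^sup>2"
      using cell_bound[OF less_imp_le[OF pred_point(2)[OF Q(1) q'(1)]] q'(2) g, of u] by (simp add: mult.commute)
  qed
  also have "\<dots> = (norm u)\<^sup>2 * (norm (S {0<..b} (ex g)))\<^sup>2"
    by (rule interval_additive_part_sum[OF Q b(1) S_norm_additive])
  also have "\<dots> \<le> (norm u)\<^sup>2 * (norm (ex g))\<^sup>2"
    by (intro mult_left_mono power_mono norm_S) auto
  finally have "(norm (jsum g b Q u))\<^sup>2 \<le> (norm (ex g) * norm u)\<^sup>2" by (simp add: power_mult_distrib mult.commute)
  then show ?thesis by (rule power2_le_imp_le) simp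
qed

text \<open>On one fine cell, moving the attached time from \<open>f\<close> to \<open>c\<close>
  changes the term by \<open>j\<close> applied to an increment
  \<open>j h (left_shift s g) y - y\<close>. The increment is small uniformly in \<open>s\<close>,
  and \<open>cell_bound\<close> weighs it by the content of the cell.\<close>

lemma jsum_converges:
  assumes g: "g \<in> L2 {0..}" and b: "0 < b" "b < \<infinity>"
  shows "\<exists>l. ((\<lambda>Q. jsum g b Q y) \<longlongrightarrow> l) (finite_subsets_at_top {0<..<b})"
  unfolding jsum_def
proof (rule part_sum_converges[OF b(1) S_additive])
  show "cinner (S {a<..c} (j (enn2real q) g y)) (S {a'<..c'} (j (enn2real q') g y)) = 0" if "c \<le> a'" for q q' a c a' c'
    by (rule S_cells_orthogonal[OF that])
  fix e :: real assume e: "e > 0"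
  \<comment> \<open>Chosen so that \<open>r\<^sup>2\<close> times the total content is at most
    \<open>e\<close>; the summand 1 excludes division by zero.\<close>
  define r where "r = sqrt e / (norm (ex g) + 1)"
  have n1: "norm (ex g) + 1 > 0" by (simp add: add_nonneg_pos)
  have r: "r > 0" using e n1 by (simp add: r_def)
  have re: "r\<^sup>2 * (norm (ex g))\<^sup>2 \<le> e"
  proof -
    have "r * norm (ex g) \<le> r * (norm (ex g) + 1)" using r by simp
    also have "\<dots> = sqrt e" using n1 by (simp add: r_def)
    finally have "(r * norm (ex g))\<^sup>2 \<le> (sqrt e)\<^sup>2" using r by (intro power_mono) auto
    then show ?thesis using e by (simp add: power_mult_distrib)
  qed
  obtain d where d: "d > 0" "\<forall>s\<ge>0. \<forall>h\<ge>0. h < d \<longrightarrow> norm (j h (left_shift s g) y - y) < r"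
    using j_left_shift_near_id[OF g r, of y] by (elim exE conjE) (rule that, assumption+)
  obtain Q0 where Q0: "finite Q0" "Q0 \<subseteq> {0<..<b}"
    "\<forall>f c. 0 < f \<longrightarrow> f \<le> c \<longrightarrow> c \<le> b \<longrightarrow> (\<forall>u\<in>Q0. \<not> (f \<le> u \<and> u < c)) \<longrightarrow> enn2real c - enn2real f < d"
    by (rule mesh_exists[OF d(1) b]) (rule that, assumption+)
  have "(norm (S {a<..f} (j (enn2real c) g y) - S {a<..f} (j (enn2real f) g y)))\<^sup>2 \<le> r\<^sup>2 * (norm (S {a<..f} (ex g)))\<^sup>2"
    if f: "a < f" "f \<le> c" "c \<le> b" and no: "\<forall>u\<in>Q0. \<not> (f \<le> u \<and> u < c)" for a f c
  proof -
    have fin: "c < \<infinity>" "f < \<infinity>" using f b by (auto intro: le_less_trans)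
    have f0: "0 < f" using f(1) by (rule le_less_trans[rotated]) simp
    define h where "h = enn2real c - enn2real f"
    have h: "h \<ge> 0" "h < d" using Q0(3)[rule_format, OF f0 f(2,3) no[rule_format]] enn2real_mono[OF f(2) ] fin by (auto simp: h_def)
    have c: "enn2real c = enn2real f + h" by (simp add: h_def)
    let ?w = "j h (left_shift (enn2real f) g) y - y"
    have "S {a<..f} (j (enn2real c) g y) - S {a<..f} (j (enn2real f) g y) = S {a<..f} (j (enn2real f) g ?w)"
      using g h by (simp add: c j_comp bounded_clinear_diff[OF bopsD[OF j_bops]] bounded_clinear_diff[OF bopsD[OF S_bops]])
    then have "(norm (S {a<..f} (j (enn2real c) g y) - S {a<..f} (j (enn2real f) g y)))\<^sup>2 \<le>
        (norm (S {a<..f} (ex g)))\<^sup>2 * (norm ?w)\<^sup>2"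
      using cell_bound[OF less_imp_le[OF f(1)] fin(2) g, of ?w] by simp
    also have "\<dots> \<le> (norm (S {a<..f} (ex g)))\<^sup>2 * r\<^sup>2"
      using d(2)[rule_format, of "enn2real f" h] h by (intro mult_left_mono power_mono) (auto intro: less_imp_le)
    finally show ?thesis by (simp add: mult.commute)
  qed
  moreover have "r\<^sup>2 * (norm (S {0<..b} (ex g)))\<^sup>2 \<le> e"
  proof (rule order_trans[OF _ re])
    show "r\<^sup>2 * (norm (S {0<..b} (ex g)))\<^sup>2 \<le> r\<^sup>2 * (norm (ex g))\<^sup>2"
      by (intro mult_left_mono power_mono norm_S) auto
  qed
  ultimately show "\<exists>Q0 n. finite Q0 \<and> Q0 \<subseteq> {0<..<b} \<and> interval_additive b n \<and> n {0<..b} \<le> e \<and>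
      (\<forall>a f c. a < f \<longrightarrow> f \<le> c \<longrightarrow> c \<le> b \<longrightarrow> (\<forall>u\<in>Q0. \<not> (f \<le> u \<and> u < c)) \<longrightarrow>
        (norm (S {a<..f} (j (enn2real c) g y) - S {a<..f} (j (enn2real f) g y)))\<^sup>2 \<le> n {a<..f})"
    using Q0(1,2) S_norm_additive[of b "r\<^sup>2" "ex g"]
    by (intro exI[of _ Q0] exI[of _ "\<lambda>A. r\<^sup>2 * (norm (S A (ex g)))\<^sup>2"]) auto
qed

definition jS :: "(real \<Rightarrow> 'k) \<Rightarrow> ennreal \<Rightarrow> 'f \<Rightarrow> 'f" where
  "jS g b y = Lim (finite_subsets_at_top {0<..<b}) (\<lambda>Q. jsum g b Q y)"

lemma jS_tendsto:
  assumes "g \<in> L2 {0..}" "0 < b" "b < \<infinity>"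
  shows "((\<lambda>Q. jsum g b Q y) \<longlongrightarrow> jS g b y) (finite_subsets_at_top {0<..<b})"
proof -
  obtain l where l: "((\<lambda>Q. jsum g b Q y) \<longlongrightarrow> l) (finite_subsets_at_top {0<..<b})"
    using jsum_converges[OF assms] by blast
  then show ?thesis unfolding jS_def by (simp add: tendsto_Lim)
qed

lemma eventually_norm_jsum:
  assumes "g \<in> L2 {0..}" "0 < b" "b < \<infinity>"
  shows "\<forall>\<^sub>F Q in finite_subsets_at_top {0<..<b}. \<forall>u. norm (jsum g b Q u) \<le> norm (ex g) * norm u"
  using eventually_partition[of b] by (rule eventually_mono) (use norm_jsum[OF assms] in auto)

lemma jS_bops:
  assumes "g \<in> L2 {0..}" "0 < b" "b < \<infinity>"
  shows "jS g b \<in> bops"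
  by (rule bopsI, rule bounded_clinear_limit(1)[where T = "jsum g b", OF _ _ eventually_norm_jsum[OF assms] jS_tendsto[OF assms]])
    (auto intro: bopsD jsum_bops assms)

text \<open>Different cells are orthogonal, and each diagonal term is a scalar multiple of
  \<open>cinner u v\<close>; taking \<open>u = v = vac\<close> names the sum of these
  scalars.\<close>

lemma jsum_inner:
  assumes g: "g \<in> L2 {0..}" "g' \<in> L2 {0..}" and b: "0 < b" "b < \<infinity>" and Q: "finite Q" "Q \<subseteq> {0<..<b}"
  shows "cinner (jsum g b Q u) (jsum g' b Q v) = cinner (jsum g b Q vac) (jsum g' b Q vac) * cinner u v"
proof -
  have pt: "0 < q" "q < \<infinity>" "pred_point Q q < q" if "q \<in> insert b Q" for q
    using partition_point[OF Q(2) b(1) that] b(2) pred_point(2)[OF Q(1)] by (auto intro: le_less_trans)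
  have "\<forall>q\<in>insert b Q. \<exists>a. \<forall>u v. cinner (j (enn2real q) g u) (S {pred_point Q q<..q} (j (enn2real q) g' v)) = a * cinner u v"
  proof
    fix q assume q: "q \<in> insert b Q"
    show "\<exists>a. \<forall>u v. cinner (j (enn2real q) g u) (S {pred_point Q q<..q} (j (enn2real q) g' v)) = a * cinner u v"
      by (rule bspec[OF bspec[OF conjunct2[OF S_cell_scalar_at[OF less_imp_le[OF pt(3)[OF q]] pt(2)[OF q], unfolded scalar_at_def]] g(1)] g(2)])
  qed
  from bchoice[OF this] obtain a where
    a: "\<And>q u v. q \<in> insert b Q \<Longrightarrow> cinner (j (enn2real q) g u) (S {pred_point Q q<..q} (j (enn2real q) g' v)) = a q * cinner u v"
    by blast
  have off: "cinner (S {pred_point Q q<..q} x) (S {pred_point Q q'<..q'} y) = 0"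
    if q: "q \<in> insert b Q" "q' \<in> insert b Q" "q \<noteq> q'" for q q' x y
  proof -
    have "cinner (S {pred_point Q q<..q} x) (S {pred_point Q q'<..q'} y) =
        cinner x (S {pred_point Q q<..q} (S {pred_point Q q'<..q'} y))"
      by (rule orth_projectionD(3)[OF S_proj]) simp
    then show ?thesis using S_disjoint[OF _ _ cells_disjoint[OF Q b(1) q], of y] by simp
  qed
  have k: "cinner (jsum g b Q u) (jsum g' b Q v) = (\<Sum>q\<in>insert b Q. a q) * cinner u v" for u v
  proof -
    have "cinner (jsum g b Q u) (jsum g' b Q v) =
      (\<Sum>q\<in>insert b Q. \<Sum>q'\<in>insert b Q. cinner (S {pred_point Q q<..q} (j (enn2real q) g u)) (S {pred_point Q q'<..q'} (j (enn2real q') g' v)))"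
      unfolding jsum_def part_sum_def cinner_sum_left unfolding cinner_sum_right ..
    also have "\<dots> = (\<Sum>q\<in>insert b Q. \<Sum>q'\<in>insert b Q. if q' = q then a q * cinner u v else 0)"
    proof (intro sum.cong refl)
      fix q q' assume q: "q \<in> insert b Q" "q' \<in> insert b Q"
      show "cinner (S {pred_point Q q<..q} (j (enn2real q) g u)) (S {pred_point Q q'<..q'} (j (enn2real q') g' v)) =
          (if q' = q then a q * cinner u v else 0)"
        using off[OF q] a[OF q(1)] by (auto simp: orth_projectionD(4)[OF S_proj])
    qed
    also have "\<dots> = (\<Sum>q\<in>insert b Q. a q) * cinner u v"
      using Q by (simp add: sum_distrib_right)
    finally show ?thesis .
  qed
  show ?thesis by (simp only: k) (simp add: vac_inner L2_zero)
qed

lemma jsum_restrict: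
  assumes g: "g \<in> L2 {0..}" and b: "0 < b" "b \<le> b'" and Q: "finite Q" "Q \<subseteq> {0<..<b'}" "b \<in> insert b' Q"
  shows "S {0<..b} (jsum g b' Q y) = jsum g b (Q \<inter> {0<..<b}) y"
proof -
  have b': "0 < b'" using b by simp
  let ?v = "\<lambda>q A. S {0<..b} (S A (j (enn2real q) g y))"
  have "S {0<..b} (jsum g b' Q y) = part_sum ?v b' Q"
    unfolding jsum_def part_sum_def by (rule bounded_clinear_sum[OF bopsD[OF S_bops]]) simp
  also have "\<dots> = part_sum ?v b (Q \<inter> {0<..<b})"
  proof (rule part_sum_initial[OF Q(1,2,3) b'])
    fix q assume q: "q \<in> insert b' Q" "b < q"
    have "b \<le> pred_point Q q" by (rule le_pred_point[OF Q(1,2) b' Q(3) q])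
    then show "?v q {pred_point Q q<..q} = 0" by (intro S_disjoint) auto
  qed
  also have "\<dots> = jsum g b (Q \<inter> {0<..<b}) y"
    unfolding jsum_def part_sum_def
  proof (intro sum.cong refl S_subset(1))
    fix q assume "q \<in> insert b (Q \<inter> {0<..<b})"
    then have q: "q \<le> b" by auto
    show "{pred_point (Q \<inter> {0<..<b}) q<..q} \<subseteq> {0<..b}" by (rule cell_subset[OF q])
  qed auto
  finally show ?thesis .
qed

text \<open>Consistency in the end point: cutting at \<open>b\<close> discards the later cells and
  leaves the earlier ones as they are. Limits belonging to different end points are compared through
  this.\<close>

lemma jS_restrict:
  assumes g: "g \<in> L2 {0..}" and b: "0 < b" "b \<le> b'" "b' < \<infinity>"
  shows "S {0<..b} (jS g b' y) = jS g b y"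
proof (rule tendsto_unique)
  have b': "0 < b'" "b < \<infinity>" using b by (auto intro: le_less_trans less_le_trans)
  show "finite_subsets_at_top {0<..<b'} \<noteq> bot" by simp
  show "((\<lambda>Q. S {0<..b} (jsum g b' Q y)) \<longlongrightarrow> S {0<..b} (jS g b' y)) (finite_subsets_at_top {0<..<b'})"
    by (rule bounded_clinear_tendsto[OF bopsD[OF S_bops] jS_tendsto[OF g b'(1) b(3)]]) simp
  have "((\<lambda>Q. jsum g b (Q \<inter> {0<..<b}) y) \<longlongrightarrow> jS g b y) (finite_subsets_at_top {0<..<b'})"
    by (rule filterlim_compose[OF jS_tendsto[OF g b(1) b'(2)] filterlim_Int_partition[OF b(2)]])
  moreover have "\<forall>\<^sub>F Q in finite_subsets_at_top {0<..<b'}. jsum g b (Q \<inter> {0<..<b}) y = S {0<..b} (jsum g b' Q y)"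
    using eventually_partition_mem[OF b(1,2)] by (rule eventually_mono) (use jsum_restrict[OF g b(1,2)] in auto)
  ultimately show "((\<lambda>Q. S {0<..b} (jsum g b' Q y)) \<longlongrightarrow> jS g b y) (finite_subsets_at_top {0<..<b'})"
    by (rule Lim_transform_eventually)
qed

lemma jS_inner_same:
  assumes g: "g \<in> L2 {0..}" "g' \<in> L2 {0..}" and b: "0 < b" "b < \<infinity>"
  shows "cinner (jS g b u) (jS g' b v) = cinner (jS g b vac) (jS g' b vac) * cinner u v"
proof (rule tendsto_unique)
  show "finite_subsets_at_top {0<..<b} \<noteq> bot" by simp
  note t = jS_tendsto[OF g(1) b] jS_tendsto[OF g(2) b]
  show "((\<lambda>Q. cinner (jsum g b Q u) (jsum g' b Q v)) \<longlongrightarrow> cinner (jS g b u) (jS g' b v)) (finite_subsets_at_top {0<..<b})"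
    by (intro tendsto_cinner t)
  have "((\<lambda>Q. cinner (jsum g b Q vac) (jsum g' b Q vac) * cinner u v) \<longlongrightarrow> cinner (jS g b vac) (jS g' b vac) * cinner u v) (finite_subsets_at_top {0<..<b})"
    by (intro tendsto_mult_right tendsto_cinner t)
  moreover have "\<forall>\<^sub>F Q in finite_subsets_at_top {0<..<b}. cinner (jsum g b Q vac) (jsum g' b Q vac) * cinner u v = cinner (jsum g b Q u) (jsum g' b Q v)"
    using eventually_partition[of b] by (rule eventually_mono) (intro jsum_inner[OF g b, symmetric]; simp)
  ultimately show "((\<lambda>Q. cinner (jsum g b Q u) (jsum g' b Q v)) \<longlongrightarrow> cinner (jS g b vac) (jS g' b vac) * cinner u v) (finite_subsets_at_top {0<..<b})"
    by (rule Lim_transform_eventually)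
qed

text \<open>By consistency both vectors may be taken at the smaller of the two end points, where the
  limit of \<open>jsum_inner\<close> applies.\<close>

lemma jS_inner:
  assumes g: "g \<in> L2 {0..}" "g' \<in> L2 {0..}" and b: "0 < b" "b < \<infinity>" "0 < b'" "b' < \<infinity>"
  shows "cinner (jS g b u) (jS g' b' v) = cinner (jS g b vac) (jS g' b' vac) * cinner u v"
proof (cases "b \<le> b'")
  case True
  have k: "cinner (jS g b u) (jS g' b' v) = cinner (jS g b u) (jS g' b v)" for u v
  proof -
    have "cinner (jS g b u) (jS g' b' v) = cinner (S {0<..b} (jS g b u)) (jS g' b' v)"
      using jS_restrict[OF g(1) b(1) order_refl b(2)] by simp
    also have "\<dots> = cinner (jS g b u) (S {0<..b} (jS g' b' v))" by (rule orth_projectionD(3)[OF S_proj]) simp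
    finally show ?thesis using jS_restrict[OF g(2) b(1) True b(4)] by simp
  qed
  show ?thesis unfolding k[of u v] k[of vac vac] by (rule jS_inner_same[OF g b(1,2)])
next
  case False
  then have le: "b' \<le> b" by simp
  have k: "cinner (jS g b u) (jS g' b' v) = cinner (jS g b' u) (jS g' b' v)" for u v
  proof -
    have "cinner (jS g b u) (jS g' b' v) = cinner (jS g b u) (S {0<..b'} (jS g' b' v))"
      using jS_restrict[OF g(2) b(3) order_refl b(4)] by simp
    also have "\<dots> = cinner (S {0<..b'} (jS g b u)) (jS g' b' v)" by (rule orth_projectionD(3)[OF S_proj, symmetric]) simp
    finally show ?thesis using jS_restrict[OF g(1) b(3) le b(2)] by simp
  qed
  show ?thesis unfolding k[of u v] k[of vac vac] by (rule jS_inner_same[OF g b(3,4)])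
qed

text \<open>On a subcell ending at \<open>f\<close>, the vector \<open>ex g\<close> is
  \<open>j\<close> applied to the exponential of \<open>g\<close> shifted left by \<open>f\<close>.
  Replacing that moving argument by the fixed vector \<open>z\<close> costs at most \<open>d\<close>
  on each subcell, weighted by its content.\<close>

lemma jS_cell_error:
  assumes g: "g \<in> L2 {0..}" and q: "a < q" "q < \<infinity>" and d: "d \<ge> 0"
    and near: "\<And>f. a < f \<Longrightarrow> f \<le> q \<Longrightarrow> norm (ex (left_shift (enn2real f) g) - z) \<le> d"
  shows "norm (S {a<..q} (ex g) - S {a<..q} (jS g q z)) \<le> d * norm (S {a<..q} (ex g))"
proof (rule tendsto_upperbound)
  have q0: "0 < q" using q(1) by (rule le_less_trans[rotated]) simp
  show "finite_subsets_at_top {0<..<q} \<noteq> bot" by simp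
  show "((\<lambda>Q. norm (S {a<..q} (ex g) - S {a<..q} (jsum g q Q z))) \<longlongrightarrow> norm (S {a<..q} (ex g) - S {a<..q} (jS g q z)))
      (finite_subsets_at_top {0<..<q})"
    by (intro tendsto_norm tendsto_diff tendsto_const bounded_clinear_tendsto[OF bopsD[OF S_bops] jS_tendsto[OF g q0 q(2)]]) simp
  \<comment> \<open>The point \<open>a\<close> must belong to the partition, so that no cell
    straddles it.\<close>
  have "\<forall>\<^sub>F Q in finite_subsets_at_top {0<..<q}. finite Q \<and> Q \<subseteq> {0<..<q} \<and> a \<in> insert 0 Q"
  proof (cases "a = 0")
    case True
    then show ?thesis using eventually_partition[of q] by (auto elim: eventually_mono)
  next
    case False
    then have a0: "0 < a" by (simp add: zero_less_iff_neq_zero)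
    show ?thesis
      using eventually_partition_mem[OF a0 less_imp_le[OF q(1)]] by (rule eventually_mono) (use q in auto)
  qed
  then show "\<forall>\<^sub>F Q in finite_subsets_at_top {0<..<q}. norm (S {a<..q} (ex g) - S {a<..q} (jsum g q Q z)) \<le> d * norm (S {a<..q} (ex g))"
  proof (rule eventually_mono)
    fix Q assume Q: "finite Q \<and> Q \<subseteq> {0<..<q} \<and> a \<in> insert 0 Q"
    then have fQ: "finite Q" "Q \<subseteq> {0<..<q}" "a \<in> insert 0 Q" by auto
    let ?F = "{f \<in> insert q Q. a < f \<and> f \<le> q}"
    let ?D = "\<lambda>f. {pred_point Q f<..f}"
    have pt: "0 < f" "f \<le> q" "f < \<infinity>" "pred_point Q f < f" if "f \<in> insert q Q" for f
      using partition_point[OF fQ(2) q0 that] q(2) pred_point(2)[OF fQ(1)] by (auto intro: le_less_trans)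
    have pa: "a \<le> pred_point Q f" if "f \<in> ?F" for f
    proof (cases "a = 0")
      case False
      then show ?thesis using pred_point(3)[OF fQ(1) pt(1)] fQ(3) that by auto
    qed simp
    have 1: "S {a<..q} (ex g) = (\<Sum>f\<in>?F. S (?D f) (ex g))"
      by (rule interval_additive_sum_cell[OF fQ(1) S_additive _ order_refl fQ(3) q(1)]) simp
    have "S {a<..q} (jsum g q Q z) = (\<Sum>f\<in>insert q Q. S {a<..q} (S (?D f) (j (enn2real f) g z)))"
      unfolding jsum_def part_sum_def by (rule bounded_clinear_sum[OF bopsD[OF S_bops]]) simp
    also have "\<dots> = (\<Sum>f\<in>?F. S {a<..q} (S (?D f) (j (enn2real f) g z)))"
    proof (rule sum.mono_neutral_right)
      show "\<forall>f\<in>insert q Q - ?F. S {a<..q} (S (?D f) (j (enn2real f) g z)) = 0"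
      proof
        fix f assume f: "f \<in> insert q Q - ?F"
        then have "f \<le> a" using pt(2)[of f] by auto
        then show "S {a<..q} (S (?D f) (j (enn2real f) g z)) = 0" by (intro S_disjoint) auto
      qed
    qed (use fQ in auto)
    also have "\<dots> = (\<Sum>f\<in>?F. S (?D f) (j (enn2real f) g z))"
    proof (intro sum.cong refl S_subset(1))
      show "?D f \<subseteq> {a<..q}" if "f \<in> ?F" for f using pa[OF that] that by (auto intro: le_less_trans)
    qed auto
    finally have 2: "S {a<..q} (jsum g q Q z) = (\<Sum>f\<in>?F. S (?D f) (j (enn2real f) g z))" .
    let ?w = "\<lambda>f. ex (left_shift (enn2real f) g) - z"
    have 3: "S {a<..q} (ex g) - S {a<..q} (jsum g q Q z) = (\<Sum>f\<in>?F. S (?D f) (j (enn2real f) g (?w f)))"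
      unfolding 1 2 sum_subtractf[symmetric]
    proof (intro sum.cong refl)
      fix f
      have "j (enn2real f) g (?w f) = ex g - j (enn2real f) g z"
        using g by (simp add: bounded_clinear_diff[OF bopsD[OF j_bops]] j_left_shift)
      then show "S (?D f) (ex g) - S (?D f) (j (enn2real f) g z) = S (?D f) (j (enn2real f) g (?w f))"
        by (simp add: bounded_clinear_diff[OF bopsD[OF S_bops]])
    qed
    have "(norm (\<Sum>f\<in>?F. S (?D f) (j (enn2real f) g (?w f))))\<^sup>2 = (\<Sum>f\<in>?F. (norm (S (?D f) (j (enn2real f) g (?w f))))\<^sup>2)"
    proof (rule norm_sum_sq_orthogonal)
      show "finite ?F" using fQ by simp
      have *: "cinner (S (?D f) x) (S (?D f') y) = 0" if "f \<in> ?F" "f' \<in> ?F" "f < f'" for f f' x y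
      proof (rule S_cells_orthogonal)
        have "f \<in> Q" using that by auto
        then show "f \<le> pred_point Q f'" using pred_point(3)[OF fQ(1) pt(1)] that by auto
      qed
      show "cinner (S (?D f) (j (enn2real f) g (?w f))) (S (?D f') (j (enn2real f') g (?w f'))) = 0"
        if f: "f \<in> ?F" "f' \<in> ?F" "f \<noteq> f'" for f f'
      proof (cases "f < f'")
        case False
        then have "cinner (S (?D f') (j (enn2real f') g (?w f'))) (S (?D f) (j (enn2real f) g (?w f))) = 0"
          using *[OF f(2,1)] f(3) by auto
        then show ?thesis by (metis cinner_commute complex_cnj_zero)
      qed (use * f in blast)
    qed
    also have "\<dots> \<le> (\<Sum>f\<in>?F. d\<^sup>2 * (norm (S (?D f) (ex g)))\<^sup>2)"
    proof (rule sum_mono)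
      fix f assume f: "f \<in> ?F"
      have "(norm (S (?D f) (j (enn2real f) g (?w f))))\<^sup>2 \<le> (norm (S (?D f) (ex g)))\<^sup>2 * (norm (?w f))\<^sup>2"
        using cell_bound[OF less_imp_le[OF pt(4)] pt(3) g, of f] f by auto
      also have "\<dots> \<le> (norm (S (?D f) (ex g)))\<^sup>2 * d\<^sup>2"
        using near[of f] f by (intro mult_left_mono power_mono) auto
      finally show "(norm (S (?D f) (j (enn2real f) g (?w f))))\<^sup>2 \<le> d\<^sup>2 * (norm (S (?D f) (ex g)))\<^sup>2"
        by (simp add: mult.commute)
    qed
    also have "\<dots> = d\<^sup>2 * (norm (S {a<..q} (ex g)))\<^sup>2"
      by (rule interval_additive_sum_cell[OF fQ(1) S_norm_additive _ order_refl fQ(3) q(1), symmetric]) simp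
    also have "\<dots> = (d * norm (S {a<..q} (ex g)))\<^sup>2" by (simp add: power_mult_distrib)
    finally have "(norm (S {a<..q} (ex g) - S {a<..q} (jsum g q Q z)))\<^sup>2 \<le> (d * norm (S {a<..q} (ex g)))\<^sup>2"
      unfolding 3 .
    then show "norm (S {a<..q} (ex g) - S {a<..q} (jsum g q Q z)) \<le> d * norm (S {a<..q} (ex g))"
      by (rule power2_le_imp_le) (use d in simp)
  qed
qed

definition jS_index :: "((real \<Rightarrow> 'k) \<times> ennreal) set" where
  "jS_index = {(g, b). g \<in> L2 {0..} \<and> 0 < b \<and> b < \<infinity>}"

text \<open>The part of \<open>ex g\<close> before a finite time is approximated by a sum over cells
  of \<open>S A (jS g q z)\<close>, where \<open>z\<close> is the exponential of \<open>g\<close>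
  shifted left by the right end \<open>q\<close>. Uniform continuity of the orbit makes the error a
  small multiple of \<open>norm (ex g)\<close>, and \<open>S_tendsto\<close> removes the finite
  time.\<close>

lemma jS_total: "closure (cspan {jS (fst i) (snd i) y | i y. i \<in> jS_index}) = UNIV"
proof -
  let ?K = "closure (cspan {jS (fst i) (snd i) y | i y. i \<in> jS_index})"
  have K: "closed ?K" "csubspace ?K" by auto
  have mem: "jS g b y \<in> ?K" if "g \<in> L2 {0..}" "0 < b" "b < \<infinity>" for g b y
  proof (rule subsetD[OF subset_closure_cspan])
    have "(g, b) \<in> jS_index" using that by (simp add: jS_index_def)
    then show "jS g b y \<in> {jS (fst i) (snd i) y | i y. i \<in> jS_index}" by force
  qed
  \<comment> \<open>By consistency in the end point, the part of \<open>jS g q y\<close> in a cell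
    is a difference of two spanning vectors.\<close>
  have cell: "S {a<..q} (jS g q y) \<in> ?K" if g: "g \<in> L2 {0..}" and q: "a < q" "q < \<infinity>" for g a q y
  proof (cases "a = 0")
    case True
    then have q0: "0 < q" using q by simp
    show ?thesis unfolding True jS_restrict[OF g q0 order_refl q(2)] by (rule mem[OF g q0 q(2)])
  next
    case False
    then have a: "0 < a" "a < \<infinity>" using q by (auto simp: zero_less_iff_neq_zero)
    have q0: "0 < q" using a(1) q(1) by (rule less_trans)
    have "S {0<..q} (jS g q y) = S {0<..a} (jS g q y) + S {a<..q} (jS g q y)"
      by (rule S_additive[unfolded interval_additive_def, rule_format, where b = q]) (use q in auto)
    then have "S {a<..q} (jS g q y) = jS g q y - jS g a y"
      using jS_restrict[OF g q0 order_refl q(2), of y] jS_restrict[OF g a(1) less_imp_le[OF q(1)] q(2), of y] by (simp add: algebra_simps)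
    then show ?thesis using complex_hilbert.subspace_diff[OF K(2) mem[OF g q0 q(2)] mem[OF g a]] by simp
  qed
  have ex: "ex g \<in> ?K" if g: "g \<in> L2 {0..}" for g
  proof (rule mem_closed_csubspace_if[OF K])
    fix z assume z0: "\<And>u. u \<in> ?K \<Longrightarrow> cinner u z = 0"
    have z: "cinner z u = 0" if "u \<in> ?K" for u
      using cinner_commute[of z u] z0[OF that] by (simp only: complex_cnj_zero)
    have zero: "cinner z (S {0<..ennreal T} (ex g)) = 0" if T: "T > 0" for T
    proof -
      define b where "b = ennreal T"
      have b: "0 < b" "b < \<infinity>" using T by (auto simp: b_def)
      have small: "cmod (cinner z (S {0<..b} (ex g))) \<le> norm z * (e * norm (ex g))" if e: "e > 0" for e :: real
      proof -
        obtain d where d: "d > 0" "\<forall>s\<ge>0. \<forall>h\<ge>0. h < d \<longrightarrow> norm (ex (left_shift (s + h) g) - ex (left_shift s g)) < e"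
          using ex_left_shift_uniform[OF g e] by (elim exE conjE) (rule that, assumption+)
        obtain Q where Q: "finite Q" "Q \<subseteq> {0<..<b}"
          "\<forall>f c. 0 < f \<longrightarrow> f \<le> c \<longrightarrow> c \<le> b \<longrightarrow> (\<forall>u\<in>Q. \<not> (f \<le> u \<and> u < c)) \<longrightarrow> enn2real c - enn2real f < d"
          by (rule mesh_exists[OF d(1) b]) (rule that, assumption+)
        let ?D = "\<lambda>q. {pred_point Q q<..q}"
        let ?z = "\<lambda>q. ex (left_shift (enn2real q) g)"
        let ?v = "\<lambda>q A. S A (ex g) - S A (jS g q (?z q))"
        have pt: "0 < q" "q \<le> b" "q < \<infinity>" "pred_point Q q < q" if "q \<in> insert b Q" for q
          using partition_point[OF Q(2) b(1) that] b(2) pred_point(2)[OF Q(1)] by (auto intro: le_less_trans)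
        have err: "norm (?v q (?D q)) \<le> e * norm (S (?D q) (ex g))" if q: "q \<in> insert b Q" for q
        proof (rule jS_cell_error[OF g pt(4)[OF q] pt(3)[OF q] less_imp_le[OF e]])
          fix f assume f: "pred_point Q q < f" "f \<le> q"
          have f0: "0 < f" using f(1) by (rule le_less_trans[rotated]) simp
          have no: "\<forall>u\<in>Q. \<not> (f \<le> u \<and> u < q)"
            using pred_point(3)[OF Q(1) pt(1)[OF q]] f(1) by (meson leD less_le_trans)
          have "enn2real q - enn2real f < d" by (rule Q(3)[rule_format, OF f0 f(2) pt(2)[OF q] no[rule_format]])
          moreover have "enn2real f \<le> enn2real q" using f(2) pt(3)[OF q] by (intro enn2real_mono) auto
          ultimately have "norm (?z q - ?z f) < e" using d(2)[rule_format, of "enn2real f" "enn2real q - enn2real f"] by simp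
          then show "norm (?z f - ?z q) \<le> e" by (simp add: norm_minus_commute)
        qed
        have "(norm (part_sum ?v b Q))\<^sup>2 = part_sum (\<lambda>q A. (norm (?v q A))\<^sup>2) b Q"
        proof (rule part_sum_orthogonal[OF Q(1,2) b(1)])
          show "cinner (?v f {a<..f}) (?v f' {a'<..f'}) = 0" if "f \<le> a'" for f f' a a'
            using that by (simp add: cinner_diff_left cinner_diff_right S_cells_orthogonal)
        qed
        also have "\<dots> \<le> part_sum (\<lambda>q A. e\<^sup>2 * (norm (S A (ex g)))\<^sup>2) b Q"
          unfolding part_sum_def
        proof (rule sum_mono)
          show "(norm (?v q (?D q)))\<^sup>2 \<le> e\<^sup>2 * (norm (S (?D q) (ex g)))\<^sup>2" if "q \<in> insert b Q" for q
            using power_mono[OF err[OF that], of 2] by (simp add: power_mult_distrib)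
        qed
        also have "\<dots> = e\<^sup>2 * (norm (S {0<..b} (ex g)))\<^sup>2"
          by (rule interval_additive_part_sum[OF Q(1,2) b(1) S_norm_additive])
        also have "\<dots> \<le> e\<^sup>2 * (norm (ex g))\<^sup>2" by (intro mult_left_mono power_mono norm_S) auto
        also have "\<dots> = (e * norm (ex g))\<^sup>2" by (simp add: power_mult_distrib)
        finally have nv: "norm (part_sum ?v b Q) \<le> e * norm (ex g)" by (rule power2_le_imp_le) (use e in simp)
        have "S {0<..b} (ex g) = part_sum (\<lambda>q A. S A (ex g)) b Q"
          by (rule interval_additive_part_sum[OF Q(1,2) b(1) S_additive, symmetric])
        also have "\<dots> = part_sum ?v b Q + part_sum (\<lambda>q A. S A (jS g q (?z q))) b Q"
          by (simp add: part_sum_def sum_subtractf)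
        finally have "cinner z (S {0<..b} (ex g)) = cinner z (part_sum ?v b Q) + cinner z (part_sum (\<lambda>q A. S A (jS g q (?z q))) b Q)"
          by (simp add: cinner_add_right)
        also have "cinner z (part_sum (\<lambda>q A. S A (jS g q (?z q))) b Q) = 0"
          unfolding part_sum_def by (rule z[OF complex_hilbert.subspace_sum[OF K(2)]]) (rule cell[OF g pt(4,3)])
        finally have "cmod (cinner z (S {0<..b} (ex g))) \<le> norm z * norm (part_sum ?v b Q)"
          by (simp add: cinner_Cauchy_Schwarz)
        also have "\<dots> \<le> norm z * (e * norm (ex g))" by (intro mult_left_mono nv) auto
        finally show ?thesis .
      qed
      have "cmod (cinner z (S {0<..b} (ex g))) \<le> 0 + e" if e: "e > 0" for e :: real
      proof -
        define r where "r = norm z * norm (ex g) + 1"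
        have r: "r > 0" by (simp add: r_def add_nonneg_pos)
        have "cmod (cinner z (S {0<..b} (ex g))) \<le> norm z * ((e / r) * norm (ex g))" using e r by (intro small) auto
        also have "\<dots> = e * ((norm z * norm (ex g)) / r)" by simp
        also have "\<dots> \<le> e * 1" using e r by (intro mult_left_mono) (auto simp: r_def)
        finally show ?thesis by simp
      qed
      then have "cmod (cinner z (S {0<..b} (ex g))) \<le> 0" by (rule field_le_epsilon)
      then show ?thesis by (simp add: b_def)
    qed
    have "((\<lambda>T. cinner z (S {0<..ennreal T} (ex g))) \<longlongrightarrow> cinner z (ex g)) at_top"
      by (intro tendsto_cinner tendsto_const S_tendsto)
    moreover have "((\<lambda>T. cinner z (S {0<..ennreal T} (ex g))) \<longlongrightarrow> 0) at_top"
    proof (rule tendsto_eventually)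
      show "\<forall>\<^sub>F T in at_top. cinner z (S {0<..ennreal T} (ex g)) = 0"
        using eventually_gt_at_top[of 0] by (rule eventually_mono) (rule zero)
    qed
    ultimately show "cinner z (ex g) = 0" by (rule tendsto_unique[OF trivial_limit_at_top_linorder])
  qed
  then have "closure (cspan (ex ` L2 {0..})) \<subseteq> ?K" by (intro closure_cspan_subset K) auto
  then show ?thesis using ex_total by auto
qed

lemma jS_intertwiners: "intertwiners jS_index (\<lambda>i. jS (fst i) (snd i) vac) (\<lambda>i. jS (fst i) (snd i))"
  unfolding intertwiners_def
  by (intro conjI jS_total) (auto simp: jS_index_def intro: jS_bops jS_inner)

end

section \<open>Stopping the flow\<close>

locale stop_tensor = fock_tensor ex tn + stop_time ex S
  for ex :: "(real \<Rightarrow> 'k::complex_hilbert) \<Rightarrow> 'f::complex_hilbert"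
    and tn :: "'h::complex_hilbert \<Rightarrow> 'f \<Rightarrow> 'g::complex_hilbert"
    and S :: "ennreal set \<Rightarrow> 'f \<Rightarrow> 'f"
begin

abbreviation P :: "ennreal set \<Rightarrow> 'g \<Rightarrow> 'g" where "P A \<equiv> amp (S A)"

lemma P_proj: "A \<in> sets borel \<Longrightarrow> orth_projection (P A)"
  by (rule amp_orth_projection[OF S_proj])

lemma P_bops: "A \<in> sets borel \<Longrightarrow> P A \<in> bops"
  by (rule amp_bops[OF S_bops])

lemma amp_S_comp: "A \<in> sets borel \<Longrightarrow> X \<in> bops \<Longrightarrow> P A (amp X z) = amp (\<lambda>x. S A (X x)) z"
  using amp_comp[OF S_bops, of A X] by (simp add: o_def fun_eq_iff)

lemma P_disjoint:
  assumes "A \<in> sets borel" "B \<in> sets borel" "A \<inter> B = {}"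
  shows "P A (P B z) = 0"
  using amp_S_comp[OF assms(1) S_bops[OF assms(2)], of z] S_disjoint[OF assms] amp_zero by simp

lemma P_subset:
  assumes "A \<in> sets borel" "B \<in> sets borel" "A \<subseteq> B"
  shows "P B (P A z) = P A z" "P A (P B z) = P A z"
  using amp_S_comp[OF assms(2) S_bops[OF assms(1)], of z] amp_S_comp[OF assms(1) S_bops[OF assms(2)], of z]
    S_subset[OF assms] by simp_all

lemma P_additive: "interval_additive b (\<lambda>A. P A z)"
  unfolding interval_additive_def
proof (intro allI impI)
  fix a c d :: ennreal assume "a \<le> c" "c \<le> d"
  then have "S {a<..d} = (\<lambda>x. S {a<..c} x + S {c<..d} x)"
    by (intro ext S_additive[unfolded interval_additive_def, rule_format, where b = d]) auto
  then show "P {a<..d} z = P {a<..c} z + P {c<..d} z"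
    using amp_add[OF S_bops S_bops, of "{a<..c}" "{c<..d}"] by simp
qed

lemma P_cells_orthogonal:
  assumes "c \<le> a'" shows "cinner (P {a<..c} z) (P {a'<..c'} w) = 0"
proof -
  have "cinner (P {a<..c} z) (P {a'<..c'} w) = cinner z (P {a<..c} (P {a'<..c'} w))"
    by (rule orth_projectionD(3)[OF P_proj]) simp
  also have "\<dots> = 0" using assms by (subst P_disjoint) auto
  finally show ?thesis .
qed

lemma P_norm_additive: "interval_additive b (\<lambda>A. r * (norm (P A z))\<^sup>2)"
  unfolding interval_additive_def
proof (intro allI impI)
  fix a c d :: ennreal assume "a \<le> c" "c \<le> d"
  then have e: "P {a<..d} z = P {a<..c} z + P {c<..d} z"
    by (intro P_additive[unfolded interval_additive_def, rule_format, where b = d]) auto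
  show "r * (norm (P {a<..d} z))\<^sup>2 = r * (norm (P {a<..c} z))\<^sup>2 + r * (norm (P {c<..d} z))\<^sup>2"
    by (simp add: e norm_add_sq distrib_left P_cells_orthogonal)
qed

lemma norm_P: "A \<in> sets borel \<Longrightarrow> norm (P A z) \<le> norm z"
  by (rule orth_projectionD(5)[OF P_proj])

lemma P_to_infinity: "P {0<..\<infinity>} z = z"
proof -
  have "S {0<..\<infinity>} = id" by (rule ext) (simp only: S_to_infinity id_apply)
  then show ?thesis by (simp only: amp_id id_apply)
qed

lemma P_tendsto: "((\<lambda>T. P {0<..ennreal T} z) \<longlongrightarrow> z) at_top"
proof -
  have "((\<lambda>T. P {0<..ennreal T} z) \<longlongrightarrow> id z) at_top"
  proof (rule tendsto_on_total[OF _ _ bounded_clinear_id tn_total])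
    show "bounded_clinear (P {0<..ennreal T})" for T by (rule bopsD[OF P_bops]) simp
    show "\<forall>\<^sub>F T in at_top. \<forall>x. norm (P {0<..ennreal T} x) \<le> 1 * norm x" by (simp add: norm_P)
    fix b assume "b \<in> {tn x u | x u. True}"
    then obtain x u where b: "b = tn x u" by blast
    have "((\<lambda>T. tn x (S {0<..ennreal T} u)) \<longlongrightarrow> tn x u) at_top"
      by (rule bounded_clinear_tendsto[OF bounded_clinear_tn_right S_tendsto])
    then show "((\<lambda>T. P {0<..ennreal T} b) \<longlongrightarrow> id b) at_top" by (simp add: b amp_tn S_bops)
  qed
  then show ?thesis by simp
qed

lemma P_commute:
  assumes "a \<le> c" "c \<le> q" "q < \<infinity>" "T \<in> bops"
  shows "P {a<..c} (\<Phi> (enn2real q) T z) = \<Phi> (enn2real q) T (P {a<..c} z)"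
proof (rule amp_scalar_commute[OF scalar_at_mono[OF S_cell_scalar_at] _ assms(4)])
  show "c < \<infinity>" using assms by (auto intro: le_less_trans)
  show "enn2real c \<le> enn2real q" using assms by (intro enn2real_mono) auto
qed (use assms in auto)

section \<open>Partition sums of the ampliated flow and their limit\<close>

definition flow :: "('g \<Rightarrow> 'g) \<Rightarrow> ennreal \<Rightarrow> 'g \<Rightarrow> 'g" where
  "flow T q = (if q = \<infinity> then id else \<Phi> (enn2real q) T)"

definition flow_sum :: "('g \<Rightarrow> 'g) \<Rightarrow> ennreal \<Rightarrow> ennreal set \<Rightarrow> 'g \<Rightarrow> 'g" where
  "flow_sum T b Q z = part_sum (\<lambda>q A. flow T q (P A z)) b Q"

lemma flow_bops: "T \<in> bops \<Longrightarrow> flow T q \<in> bops"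
  by (simp add: flow_def \<Phi>_bops)

text \<open>The added 1 covers \<open>q = \<infinity>\<close>, where the flow is by convention the
  identity whatever \<open>T\<close> is.\<close>

lemma norm_flow:
  assumes "T \<in> bops" shows "norm (flow T q z) \<le> (onorm T + 1) * norm z"
proof -
  have o: "onorm T \<ge> 0" by (rule onorm_pos_le[OF bounded_clinear_bounded_linear[OF bopsD[OF assms]]])
  show ?thesis
  proof (cases "q = \<infinity>")
    case True
    then show ?thesis using o mult_right_mono[of 1 "onorm T + 1" "norm z"] by (simp add: flow_def)
  next
    case False
    then have "norm (flow T q z) \<le> onorm T * norm z" using norm_\<Phi>[OF assms] by (simp add: flow_def)
    then show ?thesis by (simp add: distrib_right add_increasing2)
  qed
qed

lemma P_flow:
  assumes "a \<le> c" "c \<le> q" "T \<in> bops"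
  shows "P {a<..c} (flow T q z) = flow T q (P {a<..c} z)"
proof (cases "q = \<infinity>")
  case False
  then show ?thesis using P_commute[OF assms(1,2) _ assms(3)] by (simp add: flow_def less_top)
qed (simp add: flow_def)

lemma flow_sum_bops:
  assumes "T \<in> bops" shows "flow_sum T b Q \<in> bops"
proof -
  have "(\<lambda>z. flow T q (P A z)) \<in> bops" if "A \<in> sets borel" for A q
    using bops_comp[OF flow_bops[OF assms] P_bops[OF that], of q] by (simp add: o_def)
  then have "(\<lambda>z. part_sum (\<lambda>q A. flow T q (P A z)) b Q) \<in> bops"
    unfolding part_sum_def by (intro bops_sum) auto
  then show ?thesis by (simp add: flow_sum_def[abs_def])
qed

text \<open>\<open>flow T q\<close> commutes with the projection of a cell ending at
  \<open>q\<close>, so the terms remain in mutually orthogonal ranges. The resulting bound is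
  uniform over partitions.\<close>

lemma norm_flow_sum:
  assumes T: "T \<in> bops" and b: "0 < b" and Q: "finite Q" "Q \<subseteq> {0<..<b}"
  shows "norm (flow_sum T b Q z) \<le> (onorm T + 1) * norm z"
proof -
  let ?C = "onorm T + 1"
  have C: "?C \<ge> 0" using onorm_pos_le[OF bounded_clinear_bounded_linear[OF bopsD[OF T]]] by simp
  have "(norm (flow_sum T b Q z))\<^sup>2 = part_sum (\<lambda>q A. (norm (flow T q (P A z)))\<^sup>2) b Q"
    unfolding flow_sum_def
  proof (rule part_sum_orthogonal[OF Q b])
    show "cinner (flow T f (P {a<..f} z)) (flow T f' (P {a'<..f'} z)) = 0"
      if "a \<le> f" "f \<le> a'" "a' \<le> f'" for f f' a a'
      using that P_flow[OF that(1) order_refl T, of z] P_flow[OF that(3) order_refl T, of z]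
      by (simp add: P_cells_orthogonal flip: P_flow[OF _ order_refl T])
  qed
  also have "\<dots> \<le> part_sum (\<lambda>q A. ?C\<^sup>2 * (norm (P A z))\<^sup>2) b Q"
    unfolding part_sum_def
  proof (rule sum_mono)
    fix q
    show "(norm (flow T q (P {pred_point Q q<..q} z)))\<^sup>2 \<le> ?C\<^sup>2 * (norm (P {pred_point Q q<..q} z))\<^sup>2"
      using power_mono[OF norm_flow[OF T, of q "P {pred_point Q q<..q} z"], of 2] by (simp add: power_mult_distrib)
  qed
  also have "\<dots> = ?C\<^sup>2 * (norm (P {0<..b} z))\<^sup>2"
    by (rule interval_additive_part_sum[OF Q b P_norm_additive])
  also have "\<dots> \<le> ?C\<^sup>2 * (norm z)\<^sup>2" by (intro mult_left_mono power_mono norm_P) auto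
  also have "\<dots> = (?C * norm z)\<^sup>2" by (simp only: power_mult_distrib)
  finally show ?thesis by (rule power2_le_imp_le) (use C in simp)
qed

lemma flow_sum_restrict:
  assumes b: "0 < b" and Q: "finite Q" "Q \<subseteq> {0<..<b}"
  shows "flow_sum T b Q (P {0<..b} z) = flow_sum T b Q z"
  unfolding flow_sum_def part_sum_def
proof (intro sum.cong refl arg_cong[where f = "flow T _"] P_subset(2))
  fix q assume q: "q \<in> insert b Q"
  show "{pred_point Q q<..q} \<subseteq> {0<..b}" by (rule cell_subset[OF partition_point(2)[OF Q(2) b q]])
qed auto

text \<open>The hypothesis on \<open>v\<close> says that each term already lies in the range of its
  own cell projection; disjointness of the cells then lets only the matching term survive.\<close>

lemma P_cell_part_sum:
  assumes b: "0 < b" and Q: "finite Q" "Q \<subseteq> {0<..<b}" and q: "q \<in> insert b Q"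
    and v: "\<And>q A. q \<in> insert b Q \<Longrightarrow> A = {pred_point Q q<..q} \<Longrightarrow> P A (v q A) = v q A"
  shows "P {pred_point Q q<..q} (part_sum v b Q) = v q {pred_point Q q<..q}"
proof -
  let ?D = "\<lambda>q. {pred_point Q q<..q}"
  have "P (?D q) (part_sum v b Q) = (\<Sum>q'\<in>insert b Q. P (?D q) (v q' (?D q')))"
    unfolding part_sum_def by (rule bounded_clinear_sum[OF bopsD[OF P_bops]]) simp
  also have "\<dots> = (\<Sum>q'\<in>insert b Q. if q' = q then v q (?D q) else 0)"
  proof (rule sum.cong[OF refl])
    fix q' assume q': "q' \<in> insert b Q"
    have "?D q \<inter> ?D q' = {}" if "q' \<noteq> q" using cells_disjoint[OF Q b q q'] that by blast
    then have "P (?D q) (P (?D q') (v q' (?D q'))) = (if q' = q then P (?D q) (v q (?D q)) else 0)"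
      by (auto simp: P_disjoint P_subset)
    then show "P (?D q) (v q' (?D q')) = (if q' = q then v q (?D q) else 0)"
      using v[OF q' refl] v[OF q refl] by simp
  qed
  also have "\<dots> = v q (?D q)" using Q q by simp
  finally show ?thesis .
qed

lemma amp_jsum:
  assumes g: "g \<in> L2 {0..}"
  shows "amp (jsum g b Q) z = part_sum (\<lambda>q A. P A (J (enn2real q) g z)) b Q"
proof -
  let ?X = "\<lambda>q y. S {pred_point Q q<..q} (j (enn2real q) g y)"
  have jb: "j (enn2real q) g \<in> bops" for q using j_bops[OF g] by simp
  have X: "?X q \<in> bops" for q
    using bops_comp[OF S_bops jb, of "{pred_point Q q<..q}" q] by (simp add: o_def)
  have "jsum g b Q = (\<lambda>y. \<Sum>q\<in>insert b Q. ?X q y)" by (simp add: jsum_def[abs_def] part_sum_def)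
  then have "amp (jsum g b Q) z = (\<Sum>q\<in>insert b Q. amp (?X q) z)" using amp_sum[of "insert b Q" ?X] X by simp
  also have "\<dots> = (\<Sum>q\<in>insert b Q. P {pred_point Q q<..q} (J (enn2real q) g z))"
    by (intro sum.cong refl amp_S_comp[symmetric] jb) simp
  finally show ?thesis by (simp add: part_sum_def)
qed

lemma amp_jsum_restrict:
  assumes g: "g \<in> L2 {0..}" and c: "0 < c" and Q: "finite Q" "Q \<subseteq> {0<..<c}"
  shows "P {0<..c} (amp (jsum g c Q) z) = amp (jsum g c Q) z"
proof -
  have i: "Q \<inter> {0<..<c} = Q" using Q by auto
  have "(\<lambda>x. S {0<..c} (jsum g c Q x)) = jsum g c Q"
    by (rule ext) (use jsum_restrict[OF g c order_refl Q] in \<open>simp only: i insertI1\<close>)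
  then show ?thesis using amp_S_comp[of "{0<..c}" "jsum g c Q" z] jsum_bops[OF g] by simp
qed

text \<open>On matching partitions the intertwining relation is exact before any limit: each cell of
  the flow sum meets only its own term of \<open>jsum\<close>, and there \<open>flow T q\<close>
  passes through \<open>J\<close>.\<close>

lemma flow_sum_jsum:
  assumes T: "T \<in> bops" and g: "g \<in> L2 {0..}" and c: "0 < c" "c < \<infinity>" and b: "0 < b"
    and Q: "finite Q" "Q \<subseteq> {0<..<b}" "c \<in> insert b Q"
  defines "R \<equiv> Q \<inter> {0<..<c}"
  shows "flow_sum T b Q (amp (jsum g c R) z) = amp (jsum g c R) (T z)"
proof -
  have R: "finite R" "R \<subseteq> {0<..<c}" using Q by (auto simp: R_def)
  let ?w = "amp (jsum g c R) z"
  have pt: "0 < q" "q \<le> c" "q < \<infinity>" "pred_point R q < q" if "q \<in> insert c R" for q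
    using partition_point[OF R(2) c(1) that] c(2) pred_point(2)[OF R(1)] by (auto intro: le_less_trans)
  have "flow_sum T b Q ?w = part_sum (\<lambda>q A. flow T q (P A ?w)) c R"
    unfolding flow_sum_def R_def
  proof (rule part_sum_initial[OF Q b])
    fix q assume q: "q \<in> insert b Q" "c < q"
    have "c \<le> pred_point Q q" by (rule le_pred_point[OF Q(1,2) b Q(3) q])
    then have "P {pred_point Q q<..q} (P {0<..c} ?w) = 0" by (intro P_disjoint) auto
    then have "P {pred_point Q q<..q} ?w = 0" by (simp only: amp_jsum_restrict[OF g c(1) R])
    then show "flow T q (P {pred_point Q q<..q} (amp (jsum g c (Q \<inter> {0<..<c})) z)) = 0"
      using bopsD[OF flow_bops[OF T]] by (simp add: R_def)
  qed
  also have "\<dots> = part_sum (\<lambda>q A. P A (J (enn2real q) g (T z))) c R"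
    unfolding part_sum_def
  proof (rule sum.cong[OF refl])
    let ?D = "\<lambda>q. {pred_point R q<..q}"
    fix q assume q: "q \<in> insert c R"
    have "P (?D q) ?w = P (?D q) (J (enn2real q) g z)"
      unfolding amp_jsum[OF g] by (rule P_cell_part_sum[OF c(1) R q]) (simp add: P_subset)
    then have "flow T q (P (?D q) ?w) = P (?D q) (flow T q (J (enn2real q) g z))"
      using P_flow[OF less_imp_le[OF pt(4)[OF q]] order_refl T] by simp
    also have "flow T q (J (enn2real q) g z) = J (enn2real q) g (T z)"
      using pt(3)[OF q] g T by (auto simp: flow_def \<Phi>_J)
    finally show "flow T q (P (?D q) ?w) = P (?D q) (J (enn2real q) g (T z))" .
  qed
  finally show ?thesis by (simp only: amp_jsum[OF g])
qed

lemma norm_amp_jsum: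
  assumes g: "g \<in> L2 {0..}" and b: "0 < b" "b < \<infinity>" and Q: "finite Q" "Q \<subseteq> {0<..<b}"
  shows "norm (amp (jsum g b Q) z) \<le> norm (ex g) * norm z"
proof -
  let ?k = "cinner (jsum g b Q vac) (jsum g b Q vac)"
  have "cinner (amp (jsum g b Q) z) (amp (jsum g b Q) z) = ?k * cinner z z"
    by (rule amp_inner[OF jsum_bops[OF g] jsum_bops[OF g] jsum_inner[OF g g b Q]])
  then have "complex_of_real ((norm (amp (jsum g b Q) z))\<^sup>2) = complex_of_real ((norm (jsum g b Q vac))\<^sup>2 * (norm z)\<^sup>2)"
    by (simp only: cinner_same of_real_mult)
  then have "(norm (amp (jsum g b Q) z))\<^sup>2 = (norm (jsum g b Q vac))\<^sup>2 * (norm z)\<^sup>2" by (simp only: of_real_eq_iff)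
  also have "\<dots> \<le> (norm (ex g))\<^sup>2 * (norm z)\<^sup>2"
  proof (intro mult_right_mono power_mono)
    have "(norm vac)\<^sup>2 = 1\<^sup>2" using norm_sq_cinner[of vac] vac_inner(1)[OF L2_zero] by simp
    then have "norm vac = 1" by (rule power2_eq_imp_eq) auto
    then show "norm (jsum g b Q vac) \<le> norm (ex g)" using norm_jsum[OF g b Q, of vac] by simp
  qed auto
  finally have "(norm (amp (jsum g b Q) z))\<^sup>2 \<le> (norm (ex g) * norm z)\<^sup>2" by (simp add: power_mult_distrib)
  then show ?thesis by (rule power2_le_imp_le) simp
qed

lemma amp_jsum_tendsto:
  assumes g: "g \<in> L2 {0..}" and b: "0 < b" "b < \<infinity>"
  shows "((\<lambda>Q. amp (jsum g b Q) z) \<longlongrightarrow> amp (jS g b) z) (finite_subsets_at_top {0<..<b})"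
proof (rule tendsto_on_total[where T = "\<lambda>Q. amp (jsum g b Q)" and U = "amp (jS g b)", OF _ _ _ tn_total])
  show "bounded_clinear (amp (jsum g b Q))" for Q by (rule bopsD[OF amp_bops[OF jsum_bops[OF g]]])
  show "bounded_clinear (amp (jS g b))" by (rule bopsD[OF amp_bops[OF jS_bops[OF g b]]])
  show "\<forall>\<^sub>F Q in finite_subsets_at_top {0<..<b}. \<forall>z. norm (amp (jsum g b Q) z) \<le> norm (ex g) * norm z"
    using eventually_partition[of b] by (rule eventually_mono) (use norm_amp_jsum[OF g b] in auto)
  fix y assume "y \<in> {tn x u | x u. True}"
  then obtain x u where y: "y = tn x u" by blast
  have "((\<lambda>Q. tn x (jsum g b Q u)) \<longlongrightarrow> tn x (jS g b u)) (finite_subsets_at_top {0<..<b})"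
    by (rule bounded_clinear_tendsto[OF bounded_clinear_tn_right jS_tendsto[OF g b]])
  then show "((\<lambda>Q. amp (jsum g b Q) y) \<longlongrightarrow> amp (jS g b) y) (finite_subsets_at_top {0<..<b})"
    by (simp add: y amp_tn jsum_bops[OF g] jS_bops[OF g b])
qed

lemma P_jS:
  assumes g: "g \<in> L2 {0..}" and b: "0 < b" "b \<le> c" "c < \<infinity>"
  shows "P {0<..b} (amp (jS g c) z) = amp (jS g b) z"
proof -
  have "0 < c" using b by (auto intro: less_le_trans)
  then have "P {0<..b} (amp (jS g c) z) = amp (\<lambda>x. S {0<..b} (jS g c x)) z"
    by (intro amp_S_comp jS_bops g b) auto
  also have "(\<lambda>x. S {0<..b} (jS g c x)) = jS g b" by (rule ext) (rule jS_restrict[OF g b])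
  finally show ?thesis .
qed

definition stopped_flow :: "('g \<Rightarrow> 'g) \<Rightarrow> 'g \<Rightarrow> 'g" where
  "stopped_flow = endo_of jS_index (\<lambda>i. amp (jS (fst i) (snd i)))"

lemmas amp_jS_intertwiners = amp_intertwiners[OF jS_intertwiners]

lemma stopped_flow_bops: "T \<in> bops \<Longrightarrow> stopped_flow T \<in> bops"
  unfolding stopped_flow_def by (rule endo_of_bops[OF amp_jS_intertwiners])

lemma stopped_flow_jS:
  assumes "T \<in> bops" "g \<in> L2 {0..}" "0 < b" "b < \<infinity>"
  shows "stopped_flow T (amp (jS g b) z) = amp (jS g b) (T z)"
proof -
  have "(g, b) \<in> jS_index" using assms by (simp add: jS_index_def)
  from endo_of_apply[OF amp_jS_intertwiners assms(1) this] show ?thesis by (simp add: stopped_flow_def)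
qed

text \<open>Replacing \<open>jS\<close> by \<open>jsum\<close> over the trace of the same partition
  makes the relation exact. Both replacement errors tend to zero, the one inside the flow sum thanks
  to the uniform bound \<open>?C\<close>.\<close>

lemma flow_sum_jS_tendsto:
  assumes T: "T \<in> bops" and g: "g \<in> L2 {0..}" and c: "0 < c" "c < \<infinity>" "c \<le> b"
  shows "((\<lambda>Q. flow_sum T b Q (amp (jS g c) z)) \<longlongrightarrow> amp (jS g c) (T z)) (finite_subsets_at_top {0<..<b})"
proof -
  let ?F = "finite_subsets_at_top {0<..<b}" and ?C = "onorm T + 1"
  let ?R = "\<lambda>Q. Q \<inter> {0<..<c}"
  have b: "0 < b" using c(1,3) by (rule less_le_trans)
  have t: "((\<lambda>Q. amp (jsum g c (?R Q)) w) \<longlongrightarrow> amp (jS g c) w) ?F" for w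
    by (rule filterlim_compose[OF amp_jsum_tendsto[OF g c(1,2)] filterlim_Int_partition[OF c(3)]])
  have "((\<lambda>Q. ?C * norm (amp (jS g c) z - amp (jsum g c (?R Q)) z)) \<longlongrightarrow> ?C * norm (amp (jS g c) z - amp (jS g c) z)) ?F"
    by (intro tendsto_mult_left tendsto_norm tendsto_diff tendsto_const t)
  then have 0: "((\<lambda>Q. ?C * norm (amp (jS g c) z - amp (jsum g c (?R Q)) z)) \<longlongrightarrow> 0) ?F" by simp
  have "((\<lambda>Q. flow_sum T b Q (amp (jS g c) z) - amp (jsum g c (?R Q)) (T z)) \<longlongrightarrow> 0) ?F"
  proof (rule Lim_null_comparison[OF _ 0])
    show "\<forall>\<^sub>F Q in ?F. norm (flow_sum T b Q (amp (jS g c) z) - amp (jsum g c (?R Q)) (T z)) \<le>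
        ?C * norm (amp (jS g c) z - amp (jsum g c (?R Q)) z)"
      using eventually_partition_mem[OF c(1,3)]
    proof (rule eventually_mono)
      fix Q assume "finite Q \<and> Q \<subseteq> {0<..<b} \<and> c \<in> insert b Q"
      then have Q: "finite Q" "Q \<subseteq> {0<..<b}" "c \<in> insert b Q" by auto
      have "flow_sum T b Q (amp (jS g c) z) - amp (jsum g c (?R Q)) (T z) =
          flow_sum T b Q (amp (jS g c) z - amp (jsum g c (?R Q)) z)"
        by (simp only: bounded_clinear_diff[OF bopsD[OF flow_sum_bops[OF T]]] flow_sum_jsum[OF T g c(1,2) b Q])
      then show "norm (flow_sum T b Q (amp (jS g c) z) - amp (jsum g c (?R Q)) (T z)) \<le>
          ?C * norm (amp (jS g c) z - amp (jsum g c (?R Q)) z)"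
        using norm_flow_sum[OF T b Q(1,2)] by simp
    qed
  qed
  from tendsto_add[OF this t[of "T z"]] show ?thesis by simp
qed

text \<open>By the uniform bound it suffices to treat the ranges of the \<open>jS\<close>. The
  projection of \<open>(0,b]\<close> appears because partitions of \<open>[0,b]\<close> do not see
  later times; an end point \<open>c\<close> beyond \<open>b\<close> is reduced to \<open>b\<close>
  by cutting.\<close>

lemma flow_sum_tendsto:
  assumes T: "T \<in> bops" and b: "0 < b"
  shows "((\<lambda>Q. flow_sum T b Q z) \<longlongrightarrow> stopped_flow T (P {0<..b} z)) (finite_subsets_at_top {0<..<b})"
proof -
  let ?F = "finite_subsets_at_top {0<..<b}"
  have "((\<lambda>Q. flow_sum T b Q z) \<longlongrightarrow> (stopped_flow T \<circ> P {0<..b}) z) ?F"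
  proof (rule tendsto_on_total[where T = "flow_sum T b" and U = "stopped_flow T \<circ> P {0<..b}", OF _ _ _ intertwinersD(3)[OF amp_jS_intertwiners]])
    show "bounded_clinear (flow_sum T b Q)" for Q by (rule bopsD[OF flow_sum_bops[OF T]])
    show "bounded_clinear (stopped_flow T \<circ> P {0<..b})"
      by (rule bopsD[OF bops_comp[OF stopped_flow_bops[OF T] P_bops]]) simp
    show "\<forall>\<^sub>F Q in ?F. \<forall>z. norm (flow_sum T b Q z) \<le> (onorm T + 1) * norm z"
      using eventually_partition[of b] by (rule eventually_mono) (use norm_flow_sum[OF T b] in auto)
    fix y assume "y \<in> {amp (jS (fst i) (snd i)) x | i x. i \<in> jS_index}"
    then obtain i x where i: "i \<in> jS_index" and y0: "y = amp (jS (fst i) (snd i)) x" by blast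
    define g c where "g = fst i" and "c = snd i"
    have g: "g \<in> L2 {0..}" and c: "0 < c" "c < \<infinity>" and y: "y = amp (jS g c) x"
      using i y0 by (auto simp: jS_index_def g_def c_def)
    show "((\<lambda>Q. flow_sum T b Q y) \<longlongrightarrow> (stopped_flow T \<circ> P {0<..b}) y) ?F"
    proof (cases "c \<le> b")
      case True
      have "P {0<..b} y = P {0<..b} (P {0<..c} y)" by (simp add: y P_jS[OF g c(1) order_refl c(2)])
      also have "\<dots> = P {0<..c} y" by (rule P_subset(1)) (use True in auto)
      also have "\<dots> = y" by (simp add: y P_jS[OF g c(1) order_refl c(2)])
      finally have "(stopped_flow T \<circ> P {0<..b}) y = amp (jS g c) (T x)"
        by (simp add: y stopped_flow_jS[OF T g c])
      then show ?thesis using flow_sum_jS_tendsto[OF T g c True, of x] by (simp only: y)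
    next
      case False
      then have le: "b \<le> c" and bt: "b < \<infinity>" using c(2) by (auto intro: less_trans)
      have Py: "P {0<..b} y = amp (jS g b) x" unfolding y by (rule P_jS[OF g b le c(2)])
      have "\<forall>\<^sub>F Q in ?F. flow_sum T b Q (amp (jS g b) x) = flow_sum T b Q y"
        using eventually_partition[of b]
      proof (rule eventually_mono)
        fix Q assume "finite Q \<and> Q \<subseteq> {0<..<b}"
        then show "flow_sum T b Q (amp (jS g b) x) = flow_sum T b Q y"
          using flow_sum_restrict[OF b, of Q T y] by (simp only: Py)
      qed
      from Lim_transform_eventually[OF flow_sum_jS_tendsto[OF T g b bt order_refl, of x] this]
      show ?thesis by (simp add: Py stopped_flow_jS[OF T g b bt])
    qed
  qed
  then show ?thesis by simp
qed

end

context stop_time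
begin

text \<open>The preceding limit with the complex numbers as initial space. At the end point
  \<open>\<infinity>\<close> the cut-off is the identity, because \<open>{0}\<close> carries no
  mass.\<close>

lemma
  assumes X: "X \<in> bops"
  shows stopped_ccr_flow_bops: "stopped_ccr_flow ex S X \<in> bops"
    and stopped_ccr_flow_jS: "i \<in> jS_index \<Longrightarrow> stopped_ccr_flow ex S X (jS (fst i) (snd i) u) = jS (fst i) (snd i) (X u)"
proof -
  interpret F: stop_tensor ex "scaleC :: complex \<Rightarrow> 'f \<Rightarrow> 'f" S
    by unfold_locales (rule hilbert_tensor_scaleC)
  have amp: "F.amp A = A" if "A \<in> bops" for A
    by (rule F.optensor_eqI[OF that]) (simp add: bounded_clinear_scaleC bopsD that)
  have \<Phi>: "F.\<Phi> t X = ccr_flow ex t X" if t: "t \<ge> 0" for t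
    unfolding ccr_flow_eq[OF X t]
  proof (rule F.\<Phi>_eqI[OF t endo_of_bops[OF j_intertwiners[OF t] X]])
    show "endo_of (L2 {0..}) (j t) X (F.J t f z) = F.J t f (X z)" if "f \<in> L2 {0..}" for f z
      using endo_of_apply[OF j_intertwiners[OF t] X that] j_bops[OF that t] by (simp add: amp)
  qed
  have "stop_sum (\<lambda>q. if q = \<infinity> then id else ccr_flow ex (enn2real q) X) S \<infinity> Q x = F.flow_sum X \<infinity> Q x" for Q x
    unfolding stop_sum_eq F.flow_sum_def part_sum_def
    by (intro sum.cong refl) (simp add: F.flow_def \<Phi> amp S_bops)
  then have "stopped_ccr_flow ex S X x = F.stopped_flow X x" for x
    unfolding stopped_ccr_flow_def stop_limit_def sot_Lim_def
    using tendsto_Lim[OF _ F.flow_sum_tendsto[OF X, of \<infinity> x]] F.P_to_infinity by simp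
  then have eq: "stopped_ccr_flow ex S X = F.stopped_flow X" by (rule ext)
  show "stopped_ccr_flow ex S X \<in> bops" unfolding eq by (rule F.stopped_flow_bops[OF X])
  show "stopped_ccr_flow ex S X (jS (fst i) (snd i) u) = jS (fst i) (snd i) (X u)" if "i \<in> jS_index"
    using that F.stopped_flow_jS[OF X, of "fst i" "snd i" u] by (auto simp: eq amp jS_bops jS_index_def)
qed

end

context stop_tensor
begin

lemma ampliation_stopped_ccr_flow:
  assumes "T \<in> bops" shows "ampliation tn (stopped_ccr_flow ex S) T = stopped_flow T"
  unfolding stopped_flow_def
  by (rule ampliation_eq_endo_of(2)[OF jS_intertwiners stopped_ccr_flow_bops stopped_ccr_flow_jS assms])

end

context stop_tensor
begin

text \<open>The scalar of a cell is unchanged by ampliation, so the bound carries over with the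
  content still computed on Fock space alone.\<close>

lemma P_cell_bound:
  assumes ac: "a \<le> c" "c < \<infinity>" and g: "g \<in> L2 {0..}"
  shows "(norm (P {a<..c} (J (enn2real c) g w)))\<^sup>2 \<le> (norm (S {a<..c} (ex g)))\<^sup>2 * (norm w)\<^sup>2"
proof -
  let ?j = "j (enn2real c) g" and ?A = "{a<..c}"
  obtain \<alpha> :: real where \<alpha>: "0 \<le> \<alpha>" "\<alpha> \<le> (norm (S ?A (ex g)))\<^sup>2"
    "\<And>u v. cinner (?j u) (S ?A (?j v)) = complex_of_real \<alpha> * cinner u v"
    using cell_scalar[OF ac g] by blast
  have jb: "?j \<in> bops" using j_bops[OF g] by simp
  have Sj: "(\<lambda>v. S ?A (?j v)) \<in> bops" using bops_comp[OF S_bops jb, of ?A] by (simp add: o_def)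
  have "cinner (amp ?j w) (P ?A (amp ?j w)) = complex_of_real \<alpha> * cinner w w"
    using amp_inner[OF jb Sj \<alpha>(3), of w w] amp_S_comp[OF _ jb, of ?A w] by simp
  then have "(norm (P ?A (amp ?j w)))\<^sup>2 = \<alpha> * (norm w)\<^sup>2"
    by (simp add: norm_sq_cinner orth_projectionD(4)[OF P_proj])
  also have "\<dots> \<le> (norm (S ?A (ex g)))\<^sup>2 * (norm w)\<^sup>2" by (intro mult_right_mono \<alpha>) auto
  finally show ?thesis .
qed

lemma P_cell_flow_sum:
  assumes T: "T \<in> bops" and b: "0 < b" and Q: "finite Q" "Q \<subseteq> {0<..<b}" and q: "q \<in> insert b Q"
  shows "P {pred_point Q q<..q} (flow_sum T b Q z) = flow T q (P {pred_point Q q<..q} z)"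
  unfolding flow_sum_def
proof (rule P_cell_part_sum[OF b Q q])
  fix q A assume q: "q \<in> insert b Q" and A: "A = {pred_point Q q<..q}"
  have "pred_point Q q \<le> q" by (rule less_imp_le[OF pred_point(2)[OF Q(1) partition_point(1)[OF Q(2) b q]]])
  then show "P A (flow T q (P A z)) = flow T q (P A z)"
    unfolding A by (simp add: P_flow[OF _ order_refl T] P_subset)
qed

end

section \<open>The stop time delayed by \<open>t\<close>\<close>

context stop_time
begin

text \<open>The image of \<open>S\<close> under \<open>s \<mapsto> s + t\<close> has the required
  properties, which gives the choice behind \<open>stop_time_plus\<close> something to choose. It is
  adapted at \<open>u\<close> because it only consults \<open>S\<close> up to
  \<open>u - t\<close>.\<close>

lemma stop_time_shift:
  assumes t: "t \<ge> 0"
  shows "\<exists>S'. finite_quantum_stop_time ex S' \<and>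
     (\<forall>u<ennreal t. S' {..u} = (\<lambda>_. 0)) \<and> (\<forall>u\<ge>ennreal t. S' {..u} = S {..u - ennreal t})"
proof -
  define h where "h s = s + ennreal t" for s
  define S' where "S' A = S (h -` A)" for A
  have meas: "h -` A \<in> sets borel" if "A \<in> sets borel" for A
  proof -
    have "h \<in> borel_measurable borel" unfolding h_def by measurable
    then show ?thesis using measurable_sets_borel[OF _ that] by blast
  qed
  have empty: "S {} = (\<lambda>_. 0)" by (rule ext) (rule S_empty)
  have low: "h -` {..u} = {}" if "u < ennreal t" for u
  proof -
    have "u < h s" for s using that by (rule less_le_trans) (simp add: h_def)
    then have "\<not> h s \<le> u" for s by (simp only: not_le)
    then show ?thesis by auto
  qed
  have high: "h -` {..u} = {..u - ennreal t}" if "ennreal t \<le> u" for u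
  proof -
    have "h s \<le> u \<longleftrightarrow> s \<le> u - ennreal t" for s
    proof
      assume "h s \<le> u"
      then have "h s - ennreal t \<le> u - ennreal t" by (rule ennreal_minus_mono) simp
      then show "s \<le> u - ennreal t" by (simp add: h_def)
    next
      assume "s \<le> u - ennreal t"
      then have "h s \<le> u - ennreal t + ennreal t" unfolding h_def by (rule add_right_mono)
      then show "h s \<le> u" using that by (simp add: diff_add_cancel_ennreal)
    qed
    then show ?thesis by auto
  qed
  have "finite_quantum_stop_time ex S'"
    unfolding finite_quantum_stop_time_def
  proof (intro conjI ballI allI impI)
    show "orth_projection (S' A)" if "A \<in> sets borel" for A
      unfolding S'_def by (rule S_proj[OF meas[OF that]])
    show "(\<lambda>n. cinner x (S' (A n) y)) sums cinner x (S' (\<Union>n. A n) y)"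
      if "range A \<subseteq> sets borel \<and> disjoint_family A" for x y and A :: "nat \<Rightarrow> ennreal set"
      unfolding S'_def vimage_UN
    proof (rule S_sums)
      show "range (\<lambda>n. h -` A n) \<subseteq> sets borel" using that meas by auto
      show "disjoint_family (\<lambda>n. h -` A n)" using that by (fastforce simp: disjoint_family_on_def)
    qed
    show "S' UNIV = id" by (simp add: S'_def S_UNIV)
    show "\<exists>X\<in>bops_on (fock_on ex {0..<u}). S' {..ennreal u} = fock_optensor ex u X (ident_on (fock_on ex {u..}))"
      if u: "0 < u" for u
    proof (rule fock_optensor_scalar_at)
      show "scalar_at u (S' {..ennreal u})"
      proof (cases "t \<le> u")
        case True
        then have "S' {..ennreal u} = S {..ennreal (u - t)}"
          using t u high[of "ennreal u"] by (simp add: S'_def ennreal_leI ennreal_minus)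
        then show ?thesis using scalar_at_mono[OF S_scalar_at[of "u - t"]] True t by simp
      next
        case False
        then have "S' {..ennreal u} = (\<lambda>_. 0)" using u low[of "ennreal u"] empty by (simp add: S'_def ennreal_lessI)
        then show ?thesis by (auto simp: scalar_at_def intro!: exI[of _ 0])
      qed
    qed (use u in simp)
    \<comment> \<open>The preimage is empty for positive \<open>t\<close> and \<open>{0}\<close> for
      \<open>t = 0\<close>; either way it is null.\<close>
    have "h -` {0} = {} \<or> h -` {0} = {0}" by (auto simp: h_def)
    then show "S' {0} = (\<lambda>_. 0)" using empty S_0 by (auto simp: S'_def)
    have "h -` {\<infinity>} = {\<infinity>}" by (auto simp: h_def)
    then show "S' {\<infinity>} = (\<lambda>_. 0)" by (simp only: S'_def S_inf)
  qed
  then show ?thesis using low high empty by (intro exI[of _ S']) (simp add: S'_def)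
qed

abbreviation S_plus :: "real \<Rightarrow> ennreal set \<Rightarrow> 'f \<Rightarrow> 'f" where "S_plus t \<equiv> stop_time_plus ex S t"

text \<open>The chosen stop time is prescribed on initial intervals; differences of these give its
  values on half-open cells, and partition sums involve nothing else.\<close>

lemma
  assumes t: "t \<ge> 0"
  shows S_plus_stop_time: "stop_time ex (S_plus t)"
    and S_plus_before: "c \<le> ennreal t \<Longrightarrow> a \<le> c \<Longrightarrow> S_plus t {a<..c} = (\<lambda>_. 0)"
    and S_plus_after: "a \<le> c \<Longrightarrow> S_plus t {ennreal t + a<..ennreal t + c} = S {a<..c}"
proof -
  have *: "finite_quantum_stop_time ex (S_plus t) \<and>
     (\<forall>u<ennreal t. S_plus t {..u} = (\<lambda>_. 0)) \<and> (\<forall>u\<ge>ennreal t. S_plus t {..u} = S {..u - ennreal t})"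
    unfolding stop_time_plus_def by (rule someI_ex[OF stop_time_shift[OF t]])
  show "stop_time ex (S_plus t)" by unfold_locales (use * in blast)
  then interpret S': stop_time ex "S_plus t" .
  \<comment> \<open>At \<open>u = ennreal t\<close> itself the second clause applies and yields
    \<open>S {..0}\<close>, which vanishes, so the point \<open>t\<close> can be counted with the
    vanishing part.\<close>
  have low: "S_plus t {..u} x = 0" if "u \<le> ennreal t" for u x
  proof (cases "u = ennreal t")
    case True
    then show ?thesis using * by (simp add: S_atMost_0)
  next
    case False
    then show ?thesis using * that by simp
  qed
  show "S_plus t {a<..c} = (\<lambda>_. 0)" if "c \<le> ennreal t" "a \<le> c"
    using low[OF that(1)] low[of a] that by (auto simp: S'.S_atMost_diff)
  show "S_plus t {ennreal t + a<..ennreal t + c} = S {a<..c}" if ac: "a \<le> c"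
  proof
    fix x
    have u: "S_plus t {..ennreal t + u} = S {..u}" for u
      using * by (simp add: ennreal_add_diff_cancel_left)
    have "S_plus t {ennreal t + a<..ennreal t + c} x = S {..c} x - S {..a} x"
      using S'.S_atMost_diff[of "ennreal t + a" "ennreal t + c" x] ac by (simp add: u add_left_mono)
    then show "S_plus t {ennreal t + a<..ennreal t + c} x = S {a<..c} x" by (simp add: S_atMost_diff[OF ac])
  qed
qed

end

section \<open>Stopping a cocycle\<close>

locale stopped_cocycle = isometric_cocycle ex tn M p V + stop_tensor ex tn S
  for ex :: "(real \<Rightarrow> 'k::complex_hilbert) \<Rightarrow> 'f::complex_hilbert"
    and tn :: "'h::complex_hilbert \<Rightarrow> 'f \<Rightarrow> 'g::complex_hilbert"
    and M :: "('h \<Rightarrow> 'h) set" and p :: "'k \<Rightarrow> 'k" and V :: "real \<Rightarrow> 'g \<Rightarrow> 'g"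
    and S :: "ennreal set \<Rightarrow> 'f \<Rightarrow> 'f"
begin

text \<open>The operator at the later time factors through the one at the earlier time, whose
  isometry cancels; what remains is a flow image of \<open>Vh h\<close>, which commutes with the
  projection of the cell. The times \<open>q\<close> and \<open>q'\<close> may exceed the ends of
  the cells, as happens when a coarse partition is compared with a finer one.\<close>

lemma Vh_cells_orthogonal:
  assumes o: "a \<le> c" "c \<le> a'" "a' \<le> c'" and q: "c \<le> q" "c' \<le> q'" "q < \<infinity>" "q' < \<infinity>"
  shows "cinner (Vh (enn2real q) (P {a<..c} z)) (Vh (enn2real q') (P {a'<..c'} w)) = 0"
proof (cases "q \<le> q'")
  case True
  define h where "h = enn2real q' - enn2real q"
  have h: "h \<ge> 0" "enn2real q' = enn2real q + h" using enn2real_mono[OF True] q by (auto simp: h_def)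
  let ?U = "\<Phi> (enn2real q) (Vh h)"
  have "cinner (Vh (enn2real q) (P {a<..c} z)) (Vh (enn2real q') (P {a'<..c'} w)) =
      cinner (P {a<..c} z) (?U (P {a'<..c'} w))"
    using h by (simp add: Vh_cocycle Vh_inner)
  also have "\<dots> = cinner z (P {a<..c} (?U (P {a'<..c'} w)))" by (rule orth_projectionD(3)[OF P_proj]) simp
  also have "\<dots> = cinner z (?U (P {a<..c} (P {a'<..c'} w)))"
    by (subst P_commute[OF o(1) q(1,3) Vh_bops[OF h(1)]]) simp
  also have "P {a<..c} (P {a'<..c'} w) = 0" using o by (intro P_disjoint) auto
  also have "?U 0 = 0" using bopsD[OF \<Phi>_bops[OF Vh_bops[OF h(1)]]] by simp
  finally show ?thesis by (rule trans) simp
next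
  case False
  then have le: "q' \<le> q" by simp
  define h where "h = enn2real q - enn2real q'"
  have h: "h \<ge> 0" "enn2real q = enn2real q' + h" using enn2real_mono[OF le] q by (auto simp: h_def)
  let ?U = "\<Phi> (enn2real q') (Vh h)"
  have cq: "c \<le> q'" using o q by (blast intro: order_trans)
  have "cinner (Vh (enn2real q) (P {a<..c} z)) (Vh (enn2real q') (P {a'<..c'} w)) =
      cinner (?U (P {a<..c} z)) (P {a'<..c'} w)"
    using h by (simp add: Vh_cocycle Vh_inner)
  also have "\<dots> = cinner (P {a<..c} (?U z)) (P {a'<..c'} w)"
    by (subst P_commute[OF o(1) cq q(4) Vh_bops[OF h(1)]]) simp
  finally show ?thesis by (simp add: P_cells_orthogonal o)
qed

section \<open>Partition sums of the identity-adapted cocycle and their convergence\<close>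

definition cocycle_sum :: "ennreal \<Rightarrow> ennreal set \<Rightarrow> 'g \<Rightarrow> 'g" where
  "cocycle_sum b Q z = part_sum (\<lambda>q A. Vh (enn2real q) (P A z)) b Q"

lemma cocycle_sum_bops: "cocycle_sum b Q \<in> bops"
proof -
  have "(\<lambda>z. Vh (enn2real q) (P A z)) \<in> bops" if "A \<in> sets borel" for A q
    using bops_comp[OF Vh_bops P_bops[OF that], of "enn2real q"] by (simp add: o_def)
  then have "(\<lambda>z. part_sum (\<lambda>q A. Vh (enn2real q) (P A z)) b Q) \<in> bops"
    unfolding part_sum_def by (intro bops_sum) auto
  then show ?thesis by (simp add: cocycle_sum_def[abs_def])
qed

lemma norm_cocycle_sum:
  assumes b: "0 < b" "b < \<infinity>" and Q: "finite Q" "Q \<subseteq> {0<..<b}"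
  shows "norm (cocycle_sum b Q z) \<le> norm z"
proof -
  have "(norm (cocycle_sum b Q z))\<^sup>2 = part_sum (\<lambda>q A. (norm (Vh (enn2real q) (P A z)))\<^sup>2) b Q"
    unfolding cocycle_sum_def
  proof (rule part_sum_orthogonal[OF Q b(1)])
    fix f f' a a' assume o: "a \<le> f" "f \<le> a'" "a' \<le> f'" "f' \<le> b"
    have "f' < \<infinity>" using o(4) b(2) by (rule le_less_trans)
    moreover from this have "f < \<infinity>" using o by (auto intro: le_less_trans)
    ultimately show "cinner (Vh (enn2real f) (P {a<..f} z)) (Vh (enn2real f') (P {a'<..f'} z)) = 0"
      using o by (intro Vh_cells_orthogonal) auto
  qed
  also have "\<dots> = part_sum (\<lambda>q A. 1 * (norm (P A z))\<^sup>2) b Q" by (simp add: norm_Vh)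
  also have "\<dots> = 1 * (norm (P {0<..b} z))\<^sup>2"
    by (rule interval_additive_part_sum[OF Q b(1) P_norm_additive])
  also have "\<dots> \<le> (norm z)\<^sup>2" using norm_P[of "{0<..b}" z] by (simp add: power_mono)
  finally show ?thesis by (rule power2_le_imp_le) simp
qed

text \<open>Strong convergence of \<open>Vh h\<close> to the identity holds vector by vector; a
  finite net for the orbit of \<open>ex g\<close>, together with isometry of \<open>Vh h\<close>,
  makes it uniform over the shifts \<open>s\<close>.\<close>

lemma Vh_near_id_ex:
  assumes g: "g \<in> L2 {0..}" and e: "e > 0"
  shows "\<exists>d>0. \<forall>s\<in>{0..b}. \<forall>h\<ge>0. h < d \<longrightarrow>
    norm (Vh h (tn x (ex (left_shift s g))) - tn x (ex (left_shift s g))) < e"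
proof -
  \<comment> \<open>Makes the distance to the net at most a third of \<open>e\<close> after
    tensoring with \<open>x\<close>. It is counted twice, once under the isometry
    \<open>Vh h\<close>, and the last third is for the net point itself.\<close>
  define e1 where "e1 = e / (3 * (norm x + 1))"
  have n1: "norm x + 1 > 0" by (simp add: add_nonneg_pos)
  have e1: "e1 > 0" using e n1 by (simp add: e1_def)
  have "norm x * e1 \<le> (norm x + 1) * e1" using e1 by (intro mult_right_mono) auto
  also have "\<dots> = e / 3" using n1 by (simp add: e1_def field_simps)
  finally have xe: "norm x * e1 \<le> e / 3" .
  have e3: "e / 3 > 0" using e by simp
  obtain N where N: "finite N" "\<forall>s\<in>{0..b}. \<exists>n\<in>N. norm (ex (left_shift s g) - n) < e1"
    using ex_left_shift_totally_bounded[OF g e1, of b] by (elim exE conjE) (rule that, assumption+)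
  obtain d where d: "d > 0" "\<forall>h\<ge>0. h < d \<longrightarrow> (\<forall>n\<in>tn x ` N. norm (Vh h n - n) < e / 3)"
    using Vh_near_id_uniform[OF finite_imageI[OF N(1)] e3, of "tn x"] by (elim exE conjE) (rule that, assumption+)
  have "norm (Vh h (tn x (ex (left_shift s g))) - tn x (ex (left_shift s g))) < e"
    if s: "s \<in> {0..b}" and h: "h \<ge> 0" "h < d" for s h
  proof -
    obtain n where n: "n \<in> N" "norm (ex (left_shift s g) - n) < e1" using N(2) s by blast
    define y m where "y = tn x (ex (left_shift s g))" and "m = tn x n"
    have "norm (y - m) = norm x * norm (ex (left_shift s g) - n)"
      by (simp only: y_def m_def bounded_clinear_diff[OF bounded_clinear_tn_right, symmetric] norm_tn)
    also have "\<dots> \<le> norm x * e1" using n(2) by (intro mult_left_mono) auto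
    finally have ym: "norm (y - m) \<le> e / 3" using xe by linarith
    have "norm (Vh h m - m) < e / 3" using d(2) h n(1) by (auto simp: m_def)
    moreover have "Vh h y - y = Vh h (y - m) + (Vh h m - m) - (y - m)"
      by (simp add: bounded_clinear_diff[OF bopsD[OF Vh_bops[OF h(1)]]])
    then have "norm (Vh h y - y) \<le> norm (Vh h (y - m)) + norm (Vh h m - m) + norm (y - m)"
      using norm_triangle_ineq4[of "Vh h (y - m) + (Vh h m - m)" "y - m"] norm_triangle_ineq[of "Vh h (y - m)" "Vh h m - m"]
      by simp
    ultimately show ?thesis using ym norm_Vh[OF h(1), of "y - m"] by (simp add: y_def)
  qed
  then show ?thesis using d(1) by (intro exI[of _ d]) auto
qed

text \<open>For vectors of the form \<open>tn x (ex g)\<close> the past up to any time can be split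
  off: the vector is \<open>J\<close> at that time applied to \<open>tn x\<close> of a left shift.
  The increment \<open>Vh h\<close> then acts on the inner vector alone, and
  \<open>P_cell_bound\<close> gives an error proportional to the content of the cell.\<close>

lemma cocycle_sum_converges_tn_ex:
  assumes g: "g \<in> L2 {0..}" and b: "0 < b" "b < \<infinity>"
  shows "\<exists>l. ((\<lambda>Q. cocycle_sum b Q (tn x (ex g))) \<longlongrightarrow> l) (finite_subsets_at_top {0<..<b})"
  unfolding cocycle_sum_def
proof (rule part_sum_converges[OF b(1)])
  let ?z = "tn x (ex g)"
  show "interval_additive q (\<lambda>A. Vh (enn2real q) (P A ?z))" for q
    unfolding interval_additive_def
  proof (intro allI impI)
    fix a c d :: ennreal assume "a \<le> c" "c \<le> d" "d \<le> q"
    then have "P {a<..d} ?z = P {a<..c} ?z + P {c<..d} ?z"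
      by (rule P_additive[unfolded interval_additive_def, rule_format, where b = q])
    then show "Vh (enn2real q) (P {a<..d} ?z) = Vh (enn2real q) (P {a<..c} ?z) + Vh (enn2real q) (P {c<..d} ?z)"
      by (simp add: bounded_clinear_add[OF bopsD[OF Vh_bops]])
  qed
  show "cinner (Vh (enn2real q) (P {a<..c} ?z)) (Vh (enn2real q') (P {a'<..c'} ?z)) = 0"
    if "a \<le> c" "c \<le> a'" "a' \<le> c'" "c \<le> q" "c' \<le> q'" "q \<le> b" "q' \<le> b" for q q' a c a' c'
    by (rule Vh_cells_orthogonal[OF that(1-5) le_less_trans[OF that(6) b(2)] le_less_trans[OF that(7) b(2)]])
  fix e :: real assume e: "e > 0"
  define r where "r = sqrt e / (norm (ex g) + 1)"
  have n1: "norm (ex g) + 1 > 0" by (simp add: add_nonneg_pos)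
  have r: "r > 0" using e n1 by (simp add: r_def)
  have re: "r\<^sup>2 * (norm (ex g))\<^sup>2 \<le> e"
  proof -
    have "r * norm (ex g) \<le> r * (norm (ex g) + 1)" using r by simp
    also have "\<dots> = sqrt e" using n1 by (simp add: r_def)
    finally have "(r * norm (ex g))\<^sup>2 \<le> (sqrt e)\<^sup>2" using r by (intro power_mono) auto
    then show ?thesis using e by (simp add: power_mult_distrib)
  qed
  obtain d where d: "d > 0" "\<forall>s\<in>{0..enn2real b}. \<forall>h\<ge>0. h < d \<longrightarrow>
      norm (Vh h (tn x (ex (left_shift s g))) - tn x (ex (left_shift s g))) < r"
    using Vh_near_id_ex[OF g r, of "enn2real b" x] by (elim exE conjE) (rule that, assumption+)
  obtain Q0 where Q0: "finite Q0" "Q0 \<subseteq> {0<..<b}"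
    "\<forall>f c. 0 < f \<longrightarrow> f \<le> c \<longrightarrow> c \<le> b \<longrightarrow> (\<forall>u\<in>Q0. \<not> (f \<le> u \<and> u < c)) \<longrightarrow> enn2real c - enn2real f < d"
    by (rule mesh_exists[OF d(1) b]) (rule that, assumption+)
  have "(norm (Vh (enn2real c) (P {a<..f} ?z) - Vh (enn2real f) (P {a<..f} ?z)))\<^sup>2 \<le> r\<^sup>2 * (norm (S {a<..f} (ex g)))\<^sup>2"
    if f: "a < f" "f \<le> c" "c \<le> b" and no: "\<forall>u\<in>Q0. \<not> (f \<le> u \<and> u < c)" for a f c
  proof -
    have fin: "c < \<infinity>" "f < \<infinity>" using f b by (auto intro: le_less_trans)
    have f0: "0 < f" using f(1) by (rule le_less_trans[rotated]) simp
    define h where "h = enn2real c - enn2real f"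
    have h: "h \<ge> 0" "h < d"
      using Q0(3)[rule_format, OF f0 f(2,3) no[rule_format]] enn2real_mono[OF f(2)] fin by (auto simp: h_def)
    have c: "enn2real c = enn2real f + h" by (simp add: h_def)
    have fb: "enn2real f \<in> {0..enn2real b}" using f b(2) by (auto intro: enn2real_mono)
    let ?y = "tn x (ex (left_shift (enn2real f) g))" and ?A = "{a<..f}" and ?s = "enn2real f"
    let ?w = "Vh h ?y - ?y"
    have Vb: "Vh h \<in> bops" by (rule Vh_bops[OF h(1)])
    have zy: "?z = J ?s g ?y" by (simp add: J_tn g j_left_shift)
    have "Vh (enn2real c) (P ?A ?z) = Vh ?s (\<Phi> ?s (Vh h) (P ?A ?z))" by (simp add: c Vh_cocycle h)
    also have "\<Phi> ?s (Vh h) (P ?A ?z) = P ?A (J ?s g (Vh h ?y))"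
      unfolding zy by (simp add: \<Phi>_J[OF Vb _ g] flip: P_commute[OF less_imp_le[OF f(1)] order_refl fin(2) Vb])
    finally have e1: "Vh (enn2real c) (P ?A ?z) = Vh ?s (P ?A (J ?s g (Vh h ?y)))" .
    have e2: "Vh ?s (P ?A (J ?s g ?w)) = Vh ?s (P ?A (J ?s g (Vh h ?y))) - Vh ?s (P ?A (J ?s g ?y))"
      by (simp add: bounded_clinear_diff[OF bopsD[OF Vh_bops]] bounded_clinear_diff[OF bopsD[OF P_bops]]
          bounded_clinear_diff[OF bopsD[OF J_bops[OF g]]])
    have "Vh (enn2real c) (P ?A ?z) - Vh ?s (P ?A ?z) = Vh ?s (P ?A (J ?s g ?w))"
      by (simp only: e1 e2) (simp only: zy)
    then have "(norm (Vh (enn2real c) (P ?A ?z) - Vh ?s (P ?A ?z)))\<^sup>2 = (norm (P ?A (J ?s g ?w)))\<^sup>2"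
      by (simp add: norm_Vh)
    also have "\<dots> \<le> (norm (S ?A (ex g)))\<^sup>2 * (norm ?w)\<^sup>2"
      by (rule P_cell_bound[OF less_imp_le[OF f(1)] fin(2) g])
    also have "\<dots> \<le> (norm (S ?A (ex g)))\<^sup>2 * r\<^sup>2"
      using d(2)[rule_format, OF fb h] by (intro mult_left_mono power_mono) auto
    finally show ?thesis by (simp add: mult.commute)
  qed
  moreover have "r\<^sup>2 * (norm (S {0<..b} (ex g)))\<^sup>2 \<le> e"
  proof (rule order_trans[OF _ re])
    show "r\<^sup>2 * (norm (S {0<..b} (ex g)))\<^sup>2 \<le> r\<^sup>2 * (norm (ex g))\<^sup>2"
      by (intro mult_left_mono power_mono norm_S) auto
  qed
  ultimately show "\<exists>Q0 n. finite Q0 \<and> Q0 \<subseteq> {0<..<b} \<and> interval_additive b n \<and> n {0<..b} \<le> e \<and>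
      (\<forall>a f c. a < f \<longrightarrow> f \<le> c \<longrightarrow> c \<le> b \<longrightarrow> (\<forall>u\<in>Q0. \<not> (f \<le> u \<and> u < c)) \<longrightarrow>
        (norm (Vh (enn2real c) (P {a<..f} ?z) - Vh (enn2real f) (P {a<..f} ?z)))\<^sup>2 \<le> n {a<..f})"
    using Q0(1,2) S_norm_additive[of b "r\<^sup>2" "ex g"]
    by (intro exI[of _ Q0] exI[of _ "\<lambda>A. r\<^sup>2 * (norm (S A (ex g)))\<^sup>2"]) auto
qed

section \<open>The stopped cocycle at finite end points and in the limit\<close>

definition stopped :: "ennreal \<Rightarrow> 'g \<Rightarrow> 'g" where
  "stopped b z = Lim (finite_subsets_at_top {0<..<b}) (\<lambda>Q. cocycle_sum b Q z)"

lemma eventually_norm_cocycle_sum: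
  assumes "0 < b" "b < \<infinity>"
  shows "\<forall>\<^sub>F Q in finite_subsets_at_top {0<..<b}. \<forall>z. norm (cocycle_sum b Q z) \<le> 1 * norm z"
  using eventually_partition[of b] by (rule eventually_mono) (use norm_cocycle_sum[OF assms] in auto)

lemma cocycle_sum_tendsto:
  assumes b: "0 < b" "b < \<infinity>"
  shows "((\<lambda>Q. cocycle_sum b Q z) \<longlongrightarrow> stopped b z) (finite_subsets_at_top {0<..<b})"
proof -
  have "\<exists>l. ((\<lambda>Q. cocycle_sum b Q z) \<longlongrightarrow> l) (finite_subsets_at_top {0<..<b})"
  proof (rule limit_exists_on_total[where T = "cocycle_sum b", OF _ _ eventually_norm_cocycle_sum[OF b] tn_ex_total])
    show "bounded_clinear (cocycle_sum b Q)" for Q by (rule bopsD[OF cocycle_sum_bops])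
    fix y assume "y \<in> {tn x (ex f) | x f. f \<in> L2 {0..}}"
    then obtain x f where y: "y = tn x (ex f)" "f \<in> L2 {0..}" by blast
    show "\<exists>l. ((\<lambda>Q. cocycle_sum b Q y) \<longlongrightarrow> l) (finite_subsets_at_top {0<..<b})"
      unfolding y(1) by (rule cocycle_sum_converges_tn_ex[OF y(2) b])
  qed simp
  then obtain l where l: "((\<lambda>Q. cocycle_sum b Q z) \<longlongrightarrow> l) (finite_subsets_at_top {0<..<b})" by blast
  then show ?thesis unfolding stopped_def by (simp add: tendsto_Lim)
qed

lemma
  assumes b: "0 < b" "b < \<infinity>"
  shows stopped_bops: "stopped b \<in> bops" and norm_stopped: "norm (stopped b z) \<le> norm z"
proof -
  note l = bounded_clinear_limit[where T = "cocycle_sum b", OF _ bopsD[OF cocycle_sum_bops]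
      eventually_norm_cocycle_sum[OF b] cocycle_sum_tendsto[OF b]]
  show "stopped b \<in> bops" by (rule bopsI, rule l(1)) simp
  have "norm (stopped b z) \<le> 1 * norm z" by (rule l(2)) simp
  then show "norm (stopped b z) \<le> norm z" by simp
qed

lemma stopped_restrict:
  assumes b: "0 < b" "b \<le> b'" "b' < \<infinity>"
  shows "stopped b' (P {0<..b} z) = stopped b z"
proof (rule tendsto_unique)
  let ?F = "finite_subsets_at_top {0<..<b'}"
  have b': "0 < b'" "b < \<infinity>" using b by (auto intro: le_less_trans less_le_trans)
  show "?F \<noteq> bot" by simp
  show "((\<lambda>Q. cocycle_sum b' Q (P {0<..b} z)) \<longlongrightarrow> stopped b' (P {0<..b} z)) ?F"
    by (rule cocycle_sum_tendsto[OF b'(1) b(3)])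
  have "((\<lambda>Q. cocycle_sum b (Q \<inter> {0<..<b}) z) \<longlongrightarrow> stopped b z) ?F"
    by (rule filterlim_compose[OF cocycle_sum_tendsto[OF b(1) b'(2)] filterlim_Int_partition[OF b(2)]])
  moreover have "\<forall>\<^sub>F Q in ?F. cocycle_sum b (Q \<inter> {0<..<b}) z = cocycle_sum b' Q (P {0<..b} z)"
    using eventually_partition_mem[OF b(1,2)]
  proof (rule eventually_mono)
    fix Q assume "finite Q \<and> Q \<subseteq> {0<..<b'} \<and> b \<in> insert b' Q"
    then have Q: "finite Q" "Q \<subseteq> {0<..<b'}" "b \<in> insert b' Q" by auto
    let ?v = "\<lambda>q A. Vh (enn2real q) (P A (P {0<..b} z))"
    have "cocycle_sum b' Q (P {0<..b} z) = part_sum ?v b (Q \<inter> {0<..<b})"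
      unfolding cocycle_sum_def
    proof (rule part_sum_initial[OF Q b'(1)])
      fix q assume q: "q \<in> insert b' Q" "b < q"
      have "b \<le> pred_point Q q" by (rule le_pred_point[OF Q(1,2) b'(1) Q(3) q])
      then have "P {pred_point Q q<..q} (P {0<..b} z) = 0" by (intro P_disjoint) auto
      then show "?v q {pred_point Q q<..q} = 0" using bopsD[OF Vh_bops] by simp
    qed
    also have "\<dots> = cocycle_sum b (Q \<inter> {0<..<b}) z"
      unfolding cocycle_sum_def part_sum_def
    proof (intro sum.cong refl arg_cong[where f = "Vh _"] P_subset(2))
      fix q assume "q \<in> insert b (Q \<inter> {0<..<b})"
      then have q: "q \<le> b" by auto
      show "{pred_point (Q \<inter> {0<..<b}) q<..q} \<subseteq> {0<..b}" by (rule cell_subset[OF q])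
    qed auto
    finally show "cocycle_sum b (Q \<inter> {0<..<b}) z = cocycle_sum b' Q (P {0<..b} z)" by simp
  qed
  ultimately show "((\<lambda>Q. cocycle_sum b' Q (P {0<..b} z)) \<longlongrightarrow> stopped b z) ?F"
    by (rule Lim_transform_eventually)
qed

lemma stopped_upto_Vh: "stopped_upto tn Vh S T = stopped (ennreal T)"
  by (rule ext) (simp add: stopped_upto_def stop_limit_def sot_Lim_def stop_sum_eq stopped_def cocycle_sum_def)

text \<open>By consistency in the end point, lengthening the interval beyond \<open>T0\<close> only
  affects the part of \<open>z\<close> left over by \<open>P {0<..ennreal T0}\<close>. That part is
  small, and the operators \<open>stopped b\<close> are contractions.\<close>

lemma stopped_tendsto: "((\<lambda>T. stopped (ennreal T) z) \<longlongrightarrow> stopped_process tn Vh S z) at_top"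
proof -
  have "\<exists>l. ((\<lambda>T. stopped (ennreal T) z) \<longlongrightarrow> l) at_top"
  proof (rule complete_convergence_criterion)
    fix e :: real assume e: "e > 0"
    have "\<forall>\<^sub>F T in at_top. dist (P {0<..ennreal T} z) z < e \<and> T > 0"
      by (intro eventually_conj tendstoD[OF P_tendsto e] eventually_gt_at_top)
    then obtain T0 where T0: "dist (P {0<..ennreal T0} z) z < e" "T0 > 0"
      using eventually_happens[of _ "at_top :: real filter"] by force
    have "\<forall>\<^sub>F T in at_top. dist (stopped (ennreal T) z) (stopped (ennreal T0) z) \<le> e"
      using eventually_ge_at_top[of T0]
    proof (rule eventually_mono)
      fix T assume T: "T0 \<le> T"
      have f: "0 < ennreal T0" "ennreal T0 \<le> ennreal T" "ennreal T < \<infinity>" "0 < ennreal T"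
        using T T0 by (auto simp: ennreal_leI)
      have "dist (stopped (ennreal T) z) (stopped (ennreal T0) z) = norm (stopped (ennreal T) (z - P {0<..ennreal T0} z))"
        by (simp only: dist_norm stopped_restrict[OF f(1-3), symmetric] bounded_clinear_diff[OF bopsD[OF stopped_bops[OF f(4,3)]]])
      also have "\<dots> \<le> norm (z - P {0<..ennreal T0} z)" by (rule norm_stopped[OF f(4,3)])
      finally show "dist (stopped (ennreal T) z) (stopped (ennreal T0) z) \<le> e"
        using T0(1) by (simp add: dist_norm norm_minus_commute)
    qed
    then show "\<exists>l. \<forall>\<^sub>F T in at_top. dist (stopped (ennreal T) z) l \<le> e" by blast
  qed simp
  then obtain l where "((\<lambda>T. stopped (ennreal T) z) \<longlongrightarrow> l) at_top" by blast
  then show ?thesis by (simp add: stopped_process_def sot_Lim_def stopped_upto_Vh tendsto_Lim)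
qed

text \<open>\<open>Q\<close> consists of the points of \<open>R\<close> after \<open>t\<close>,
  moved back by \<open>t\<close>. Cells ending at or before \<open>t\<close> carry no mass of the
  delayed stop time, and no cell straddles \<open>t\<close> because it is a partition point;
  \<open>insert 0\<close> admits the case \<open>t = 0\<close>. Each surviving term is then a term
  of the outer sum, since \<open>P_cell_flow_sum\<close> extracts it from the inner one.\<close>

lemma shifted_cocycle_sum:
  assumes t: "t \<ge> 0" and b: "0 < b" "b < \<infinity>"
    and R: "finite R" "R \<subseteq> {0<..<ennreal t + b}" "ennreal t \<in> insert 0 R"
  defines "Q \<equiv> {q \<in> {0<..<b}. ennreal t + q \<in> R}"
  shows "part_sum (\<lambda>q A. V (enn2real q) (amp (S_plus t A) z)) (ennreal t + b) R =
    cocycle_sum b Q (flow_sum (V t) b Q z)"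
proof -
  let ?t = "ennreal t"
  have sh: "?t + q < ?t + q' \<longleftrightarrow> q < q'" "?t + q \<le> ?t + q' \<longleftrightarrow> q \<le> q'" "?t + q = ?t + q' \<longleftrightarrow> q = q'" for q q'
    by (simp_all add: ennreal_add_left_cancel_less ennreal_add_left_cancel_le)
  have inj: "inj_on (\<lambda>q. ?t + q) A" for A by (rule inj_onI) (simp add: sh)
  have "finite ((\<lambda>q. ?t + q) ` Q)" by (rule finite_subset[OF _ R(1)]) (auto simp: Q_def)
  then have Q: "finite Q" "Q \<subseteq> {0<..<b}" by (auto simp: Q_def intro: finite_imageD[OF _ inj])
  have split: "\<exists>q>0. r = ?t + q" if "?t < r" for r
  proof (intro exI[of _ "r - ?t"] conjI)
    show "0 < r - ?t" using that by (simp add: diff_gr0_ennreal)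
    show "r = ?t + (r - ?t)" using that by (simp add: add_diff_inverse_ennreal)
  qed
  have b': "0 < ?t + b" using b by (simp add: add_pos_nonneg add_nonneg_pos)
  have img: "(\<lambda>q. ?t + q) ` insert b Q = {r \<in> insert (?t + b) R. ?t < r}"
  proof
    show "(\<lambda>q. ?t + q) ` insert b Q \<subseteq> {r \<in> insert (?t + b) R. ?t < r}"
      using b sh(1)[of 0] by (auto simp: Q_def)
    show "{r \<in> insert (?t + b) R. ?t < r} \<subseteq> (\<lambda>q. ?t + q) ` insert b Q"
    proof
      fix r assume r: "r \<in> {r \<in> insert (?t + b) R. ?t < r}"
      then obtain q where q: "q > 0" "r = ?t + q" using split by blast
      have "q \<in> insert b Q"
      proof (cases "q = b")
        case False
        then have "r \<in> R" using r by (simp add: q(2) sh)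
        moreover from this have "q < b" using R(2) sh(1)[of q b] by (auto simp: q(2))
        ultimately show ?thesis using q by (simp add: Q_def)
      qed simp
      then show "r \<in> (\<lambda>q. ?t + q) ` insert b Q" using q by blast
    qed
  qed
  have pred: "pred_point R (?t + q) = ?t + pred_point Q q" if q: "q \<in> insert b Q" for q
  proof (rule pred_point_eqI[OF R(1)])
    note pq = pred_point[OF Q(1) partition_point(1)[OF Q(2) b(1) q]]
    show "?t + pred_point Q q \<in> insert 0 R"
    proof (cases "pred_point Q q = 0")
      case True
      then show ?thesis using R(3) by simp
    next
      case False
      then have "pred_point Q q \<in> Q" using pq(1) by blast
      then show ?thesis by (simp add: Q_def)
    qed
    show "?t + pred_point Q q < ?t + q" using pq(2) by (simp add: sh)
    show "s \<le> ?t + pred_point Q q" if s: "s \<in> R" "s < ?t + q" for s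
    proof (cases "?t < s")
      case True
      then obtain q' where q': "q' > 0" "s = ?t + q'" using split by blast
      have "q' < q" using s(2) by (simp add: q'(2) sh)
      moreover from this have "q' < b" using partition_point(2)[OF Q(2) b(1) q] by (auto intro: less_le_trans)
      ultimately show ?thesis using pq(3)[of q'] q' s(1) by (simp add: Q_def sh)
    next
      case False
      then have "s \<le> ?t + 0" by simp
      also have "\<dots> \<le> ?t + pred_point Q q" by (rule add_left_mono) simp
      finally show ?thesis .
    qed
  qed
  let ?f = "\<lambda>r. V (enn2real r) (amp (S_plus t {pred_point R r<..r}) z)"
  have "part_sum (\<lambda>q A. V (enn2real q) (amp (S_plus t A) z)) (?t + b) R = (\<Sum>r\<in>insert (?t + b) R. ?f r)"
    by (simp only: part_sum_def)
  also have "\<dots> = (\<Sum>r\<in>{r \<in> insert (?t + b) R. ?t < r}. ?f r)"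
  proof (rule sum.mono_neutral_right)
    show "\<forall>r\<in>insert (?t + b) R - {r \<in> insert (?t + b) R. ?t < r}. ?f r = 0"
    proof
      fix r assume r: "r \<in> insert (?t + b) R - {r \<in> insert (?t + b) R. ?t < r}"
      then have rt: "r \<le> ?t" and rR: "r \<in> insert (?t + b) R" by auto
      have "pred_point R r \<le> r"
        by (rule less_imp_le[OF pred_point(2)[OF R(1) partition_point(1)[OF R(2) b' rR]]])
      then have "S_plus t {pred_point R r<..r} = (\<lambda>_. 0)" by (rule S_plus_before[OF t rt])
      then show "?f r = 0" using bopsD[OF V_bops] by (simp add: amp_zero)
    qed
  qed (use R in auto)
  also have "\<dots> = (\<Sum>q\<in>insert b Q. ?f (?t + q))"
    unfolding img[symmetric] by (rule sum.reindex[OF inj, unfolded o_def])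
  also have "\<dots> = (\<Sum>q\<in>insert b Q. Vh (enn2real q) (P {pred_point Q q<..q} (flow_sum (V t) b Q z)))"
  proof (rule sum.cong[OF refl])
    fix q assume q: "q \<in> insert b Q"
    note pt = partition_point[OF Q(2) b(1) q]
    have fin: "q < \<infinity>" using pt(2) b(2) by (rule le_less_trans)
    have "pred_point Q q \<le> q" by (rule less_imp_le[OF pred_point(2)[OF Q(1) pt(1)]])
    then have "S_plus t {pred_point R (?t + q)<..?t + q} = S {pred_point Q q<..q}"
      by (simp only: pred[OF q] S_plus_after[OF t])
    \<comment> \<open>In this order of the summands the cocycle law puts the flow by the partition
      time outside and leaves the fixed operator \<open>V t\<close> inside.\<close>
    moreover have "enn2real (?t + q) = enn2real q + t"
      using fin t by (simp add: enn2real_plus less_top)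
    ultimately have "?f (?t + q) = Vh (enn2real q) (\<Phi> (enn2real q) (V t) (P {pred_point Q q<..q} z))"
      using t by (simp add: V_cocycle)
    also have "\<Phi> (enn2real q) (V t) = flow (V t) q" using fin by (auto simp: flow_def)
    finally show "?f (?t + q) = Vh (enn2real q) (P {pred_point Q q<..q} (flow_sum (V t) b Q z))"
      by (simp only: P_cell_flow_sum[OF V_bops[OF t] b(1) Q q])
  qed
  finally show ?thesis by (simp add: cocycle_sum_def part_sum_def)
qed

text \<open>Every sufficiently fine partition of the long interval contains the shifted points of
  any prescribed partition of \<open>[0,b]\<close>, so limits over the latter may be taken along the
  former.\<close>

lemma filterlim_shift_partition:
  "filterlim (\<lambda>R. {q \<in> {0<..<b}. ennreal t + q \<in> R}) (finite_subsets_at_top {0<..<b})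
    (finite_subsets_at_top {0<..<ennreal t + b})"
  unfolding filterlim_def le_filter_def eventually_filtermap
proof (intro allI impI)
  let ?t = "ennreal t"
  fix Pr assume "eventually Pr (finite_subsets_at_top {0<..<b})"
  then obtain X where X: "finite X" "X \<subseteq> {0<..<b}" "\<forall>Y. finite Y \<and> X \<subseteq> Y \<and> Y \<subseteq> {0<..<b} \<longrightarrow> Pr Y"
    unfolding eventually_finite_subsets_at_top by (elim exE conjE) (rule that, assumption+)
  have sh: "?t + q < ?t + q' \<longleftrightarrow> q < q'" for q q' by (simp add: ennreal_add_left_cancel_less)
  show "\<forall>\<^sub>F R in finite_subsets_at_top {0<..<?t + b}. Pr {q \<in> {0<..<b}. ?t + q \<in> R}"
    unfolding eventually_finite_subsets_at_top
  proof (intro exI[of _ "(\<lambda>q. ?t + q) ` X"] conjI allI impI)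
    show "finite ((\<lambda>q. ?t + q) ` X)" using X by simp
    show "(\<lambda>q. ?t + q) ` X \<subseteq> {0<..<?t + b}"
    proof
      fix r assume "r \<in> (\<lambda>q. ?t + q) ` X"
      then obtain q where q: "q \<in> X" "r = ?t + q" by blast
      have qb: "0 < q" "q < b" using X(2) q(1) by auto
      have "0 < r" unfolding q(2) by (rule add_nonneg_pos[OF _ qb(1)]) simp
      then show "r \<in> {0<..<?t + b}" using qb(2) by (simp add: q(2) sh)
    qed
    fix Y assume Y: "finite Y \<and> (\<lambda>q. ?t + q) ` X \<subseteq> Y \<and> Y \<subseteq> {0<..<?t + b}"
    let ?Z = "{q \<in> {0<..<b}. ?t + q \<in> Y}"
    have "finite ((\<lambda>q. ?t + q) ` ?Z)" by (rule finite_subset[of _ Y]) (use Y in auto)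
    then have "finite ?Z" by (rule finite_imageD) (auto intro: inj_onI)
    moreover have "X \<subseteq> ?Z" using X(2) Y by auto
    ultimately show "Pr ?Z" using X(3) by auto
  qed
qed

text \<open>The end point \<open>t + b\<close> makes the shifted cells run exactly up to
  \<open>b\<close>. The cut-off inside the stopped flow remains at this stage, because the inner sum
  stops at \<open>b\<close> as well.\<close>

lemma stopped_upto_S_plus:
  assumes t: "t \<ge> 0" and b: "b > 0"
  shows "stopped_upto tn V (S_plus t) (t + b) z = stopped (ennreal b) (stopped_flow (V t) (P {0<..ennreal b} z))"
proof -
  let ?t = "ennreal t" and ?b = "ennreal b"
  have bb: "0 < ?b" "?b < \<infinity>" using b by auto
  let ?F = "finite_subsets_at_top {0<..<?b}" and ?F' = "finite_subsets_at_top {0<..<?t + ?b}"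
  let ?w = "stopped_flow (V t) (P {0<..?b} z)"
  let ?u = "\<lambda>Q. flow_sum (V t) ?b Q z"
  have u: "(?u \<longlongrightarrow> ?w) ?F" by (rule flow_sum_tendsto[OF V_bops[OF t] bb(1)])
  have "((\<lambda>Q. cocycle_sum ?b Q (?u Q) - cocycle_sum ?b Q ?w) \<longlongrightarrow> 0) ?F"
  proof (rule Lim_null_comparison)
    have "((\<lambda>Q. norm (?u Q - ?w)) \<longlongrightarrow> norm (?w - ?w)) ?F" by (intro tendsto_norm tendsto_diff u tendsto_const)
    then show "((\<lambda>Q. norm (?u Q - ?w)) \<longlongrightarrow> 0) ?F" by simp
    show "\<forall>\<^sub>F Q in ?F. norm (cocycle_sum ?b Q (?u Q) - cocycle_sum ?b Q ?w) \<le> norm (?u Q - ?w)"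
      using eventually_norm_cocycle_sum[OF bb]
    proof (rule eventually_mono)
      fix Q assume "\<forall>z. norm (cocycle_sum ?b Q z) \<le> 1 * norm z"
      then have "norm (cocycle_sum ?b Q (?u Q - ?w)) \<le> norm (?u Q - ?w)" by (metis mult_1)
      then show "norm (cocycle_sum ?b Q (?u Q) - cocycle_sum ?b Q ?w) \<le> norm (?u Q - ?w)"
        by (simp only: bounded_clinear_diff[OF bopsD[OF cocycle_sum_bops]])
    qed
  qed
  from tendsto_add[OF this cocycle_sum_tendsto[OF bb, of ?w]]
  have "((\<lambda>Q. cocycle_sum ?b Q (?u Q)) \<longlongrightarrow> stopped ?b ?w) ?F" by simp
  from filterlim_compose[OF this filterlim_shift_partition[of ?b t]]
  have lim: "((\<lambda>R. cocycle_sum ?b {q \<in> {0<..<?b}. ?t + q \<in> R} (?u {q \<in> {0<..<?b}. ?t + q \<in> R})) \<longlongrightarrow> stopped ?b ?w) ?F'" .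
  have "\<forall>\<^sub>F R in ?F'. finite R \<and> R \<subseteq> {0<..<?t + ?b} \<and> ?t \<in> insert 0 R"
  proof (cases "t = 0")
    case True
    then show ?thesis using eventually_partition[of "?t + ?b"] by (auto elim: eventually_mono)
  next
    case False
    have "?t + 0 < ?t + ?b" using b by (subst ennreal_add_left_cancel_less) auto
    then have tb: "?t < ?t + ?b" by simp
    have t0: "0 < ?t" using False t by simp
    show ?thesis
      using eventually_partition_mem[OF t0 less_imp_le[OF tb]] by (rule eventually_mono) (use tb in auto)
  qed
  then have "\<forall>\<^sub>F R in ?F'. cocycle_sum ?b {q \<in> {0<..<?b}. ?t + q \<in> R} (?u {q \<in> {0<..<?b}. ?t + q \<in> R}) =
      part_sum (\<lambda>q A. V (enn2real q) (amp (S_plus t A) z)) (?t + ?b) R"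
    by (rule eventually_mono) (intro shifted_cocycle_sum[OF t bb, symmetric]; simp)
  from Lim_transform_eventually[OF lim this]
  have "((\<lambda>R. part_sum (\<lambda>q A. V (enn2real q) (amp (S_plus t A) z)) (?t + ?b) R) \<longlongrightarrow> stopped ?b ?w) ?F'" .
  then have "Lim ?F' (\<lambda>R. part_sum (\<lambda>q A. V (enn2real q) (amp (S_plus t A) z)) (?t + ?b) R) = stopped ?b ?w"
    by (intro tendsto_Lim) simp
  moreover have "ennreal (t + b) = ?t + ?b" using t b by simp
  ultimately show ?thesis
    by (simp only: stopped_upto_def stop_limit_def sot_Lim_def stop_sum_eq)
qed

text \<open>Letting \<open>b\<close> grow removes the cut-off inside the flow by
  \<open>P_tendsto\<close>; the outer operators are contractions for every \<open>b\<close>, so both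
  limits can be taken together.\<close>

lemma stopped_process_S_plus:
  assumes t: "t \<ge> 0"
  shows "stopped_process tn V (S_plus t) z = stopped_process tn Vh S (stopped_flow (V t) z)"
proof -
  let ?w = "stopped_flow (V t) z"
  let ?w' = "\<lambda>b. stopped_flow (V t) (P {0<..ennreal b} z)"
  have \<Psi>: "bounded_clinear (stopped_flow (V t))" by (rule bopsD[OF stopped_flow_bops[OF V_bops[OF t]]])
  have "((\<lambda>b. stopped (ennreal b) (?w' b) - stopped (ennreal b) ?w) \<longlongrightarrow> 0) at_top"
  proof (rule Lim_null_comparison)
    have "((\<lambda>b. norm (?w' b - ?w)) \<longlongrightarrow> norm (?w - ?w)) at_top"
      by (intro tendsto_norm tendsto_diff bounded_clinear_tendsto[OF \<Psi> P_tendsto] tendsto_const)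
    then show "((\<lambda>b. norm (?w' b - ?w)) \<longlongrightarrow> 0) at_top" by simp
    show "\<forall>\<^sub>F b in at_top. norm (stopped (ennreal b) (?w' b) - stopped (ennreal b) ?w) \<le> norm (?w' b - ?w)"
      using eventually_gt_at_top[of 0]
    proof (rule eventually_mono)
      fix b :: real assume b: "0 < b"
      have bb: "0 < ennreal b" "ennreal b < \<infinity>" using b by auto
      show "norm (stopped (ennreal b) (?w' b) - stopped (ennreal b) ?w) \<le> norm (?w' b - ?w)"
        using norm_stopped[OF bb, of "?w' b - ?w"] by (simp only: bounded_clinear_diff[OF bopsD[OF stopped_bops[OF bb]]])
    qed
  qed
  from tendsto_add[OF this stopped_tendsto[of ?w]]
  have "((\<lambda>b. stopped (ennreal b) (?w' b)) \<longlongrightarrow> stopped_process tn Vh S ?w) at_top" by simp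
  \<comment> \<open>The stopped process is indexed by its end point \<open>s = t + b\<close>, so the
    limit in \<open>b\<close> is reparametrised; end points up to \<open>t\<close> play no part in
    the limit.\<close>
  from filterlim_compose[OF this filterlim_tendsto_add_at_top[OF tendsto_const filterlim_ident, of "- t"]]
  have lim: "((\<lambda>s. stopped (ennreal (- t + s)) (?w' (- t + s))) \<longlongrightarrow> stopped_process tn Vh S ?w) at_top" .
  have "((\<lambda>s. stopped_upto tn V (S_plus t) s z) \<longlongrightarrow> stopped_process tn Vh S ?w) at_top"
  proof (rule Lim_transform_eventually[OF lim])
    show "\<forall>\<^sub>F s in at_top. stopped (ennreal (- t + s)) (?w' (- t + s)) = stopped_upto tn V (S_plus t) s z"
      using eventually_gt_at_top[of t]
    proof (rule eventually_mono)
      fix s assume "t < s"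
      then show "stopped (ennreal (- t + s)) (?w' (- t + s)) = stopped_upto tn V (S_plus t) s z"
        using stopped_upto_S_plus[OF t, of "- t + s" z] by simp
    qed
  qed
  then show ?thesis by (simp add: stopped_process_def sot_Lim_def tendsto_Lim)
qed

end

theorem theorem7p2:
  fixes ex :: "(real \<Rightarrow> 'k::complex_hilbert) \<Rightarrow> 'f::complex_hilbert"
    and tn :: "'h::complex_hilbert \<Rightarrow> 'f \<Rightarrow> 'g::complex_hilbert"
    and M :: "('h \<Rightarrow> 'h) set"
    and p :: "'k \<Rightarrow> 'k"
    and S :: "ennreal set \<Rightarrow> 'f \<Rightarrow> 'f"
    and V :: "real \<Rightarrow> 'g \<Rightarrow> 'g"
  assumes "boson_fock ex"
    and "hilbert_tensor tn"
    and "von_neumann_algebra M"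
    and "orth_projection p"
    and "finite_quantum_stop_time ex S"
    and "adapted_cocycle tn ex M p V"
    and "isometric_process tn ex p V"
    and "strongly_continuous_process V"
  shows "\<forall>t\<ge>0. stopped_process tn V (stop_time_plus ex S t) =
     stopped_process tn (identity_adapted tn ex p V) S \<circ>
     ampliation tn (stopped_ccr_flow ex S) (V t)"
proof (intro allI impI ext)
  interpret stopped_cocycle ex tn M p V S
    by unfold_locales (fact assms)+
  fix t :: real and z assume t: "t \<ge> 0"
  have "Vh = identity_adapted tn ex p V" by (rule ext) (rule Vh_def)
  then show "stopped_process tn V (stop_time_plus ex S t) z =
      (stopped_process tn (identity_adapted tn ex p V) S \<circ> ampliation tn (stopped_ccr_flow ex S) (V t)) z"
    using stopped_process_S_plus[OF t, of z] ampliation_stopped_ccr_flow[OF V_bops[OF t]] by simp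
qed

end
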